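(* Consider the randomized cutting-plane algorithm which, in every round $t$, forms a discretization $D_t=\{p_0,\dots,p_k\}$ of the curvature path of the current knowledge set $K_t$ into $k=\Theta(d^4)$ pieces, and queries a point chosen uniformly at random from $D_t$. For every $T$, every hidden point $w^*\in\mathsf{B}$ and every weak separation oracle, the expected regret of this algorithm is $O(d^5\log^2 d)$.
   Context: $\mathsf{B}=\{w\in\mathbb{R}^d:\|w\|_2\le1\}$, $+$ denotes Minkowski sum, $\mathsf{cg}(L)=\big(\int_L x\,dx\big)/\big(\int_L 1\,dx\big)$ is the center of gravity. Cutting-plane problem with a weak separation oracle: there is a hidden $w^*\in\mathsf{B}$. In each round $t=1,\dots,T$, the oracle first fixes (adversarially, based on the history but not on the current query) a unit vector $u_t$; then the learner queries a point $p_t$, and the oracle returns $v_t=u_t$ if $\langle w^*-p_t,u_t\rangle\ge0$ and $v_t=-u_t$ otherwise. The regret is $\sum_{t=1}^T\langle w^*-p_t,v_t\rangle$ and the expected regret is its expectation over the learner's randomness. The knowledge set is $K_1=\mathsf{B}$, $K_{t+1}=K_t\cap\{w:\langle w-p_t,v_t\rangle\ge0\}$. The curvature path of a convex set $K$ is $\rho_K(r)=\mathsf{cg}(K+r\mathsf{B})$, $r\in[0,\infty]$ (with $\rho_K(\infty)=\lim_{r\to\infty}\rho_K(r)$). The discretization of the curvature path of $K$ into $k$ pieces is defined as follows: take an invertible linear map $A$ and a point $q$ with $q+\mathsf{B}\subseteq A(K)\subseteq q+d\mathsf{B}$, divide the path $\{A\rho_K(r):r\in[0,\infty]\}$ into $k$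 pieces of equal length, and let $p_0,\dots,p_k$ be the points whose images $Ap_0,\dots,Ap_k$ are the endpoints of these pieces. *)

theory Defs
  imports "HOL-Analysis.Analysis" "HOL-Library.Function_Algebras"
begin

text \<open>Points of R^d are represented as functions nat => real vanishing from index d on,
  so that the dimension d is an ordinary natural-number parameter (needed because the
  constant in O(d^5 log^2 d) must be uniform in d).\<close>

type_synonym vec = "nat \<Rightarrow> real"

definition Rd :: "nat \<Rightarrow> vec set" where
  "Rd d = {x. \<forall>i\<ge>d. x i = 0}"

definition ip :: "nat \<Rightarrow> vec \<Rightarrow> vec \<Rightarrow> real" where
  "ip d x y = (\<Sum>i<d. x i * y i)"

definition nrm :: "nat \<Rightarrow> vec \<Rightarrow> real" where
  "nrm d x = sqrt (ip d x x)"

definition smul :: "real \<Rightarrow> vec \<Rightarrow> vec" where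
  "smul c x = (\<lambda>i. c * x i)"

definition ballR :: "nat \<Rightarrow> real \<Rightarrow> vec set" where
  "ballR d r = {x \<in> Rd d. nrm d x \<le> r}"

definition msum :: "vec set \<Rightarrow> vec set \<Rightarrow> vec set" where
  "msum A B = {a + b | a b. a \<in> A \<and> b \<in> B}"

definition emb :: "nat \<Rightarrow> vec \<Rightarrow> vec" where
  "emb d x = (\<lambda>i. if i < d then x i else 0)"

definition leb :: "nat \<Rightarrow> vec measure" where
  "leb d = PiM {..<d} (\<lambda>_. lborel)"

definition vol :: "nat \<Rightarrow> vec set \<Rightarrow> real" where
  "vol d L = measure (leb d) {x \<in> space (leb d). emb d x \<in> L}"

definition cg :: "nat \<Rightarrow> vec set \<Rightarrow> vec" where
  "cg d L = (\<lambda>i. if i < d then (LINT x|leb d. indicator L (emb d x) * x i) / vol d L else 0)"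

definition rho :: "nat \<Rightarrow> vec set \<Rightarrow> ereal \<Rightarrow> vec" where
  "rho d K r = (if r = \<infinity> then Lim at_top (\<lambda>s::real. cg d (msum K (smul s ` ballR d 1)))
                else cg d (msum K (smul (real_of_ereal r) ` ballR d 1)))"

definition plen :: "nat \<Rightarrow> (ereal \<Rightarrow> vec) \<Rightarrow> ereal \<Rightarrow> ereal \<Rightarrow> ereal" where
  "plen d \<gamma> a b = (SUP ts \<in> {ts. sorted ts \<and> set ts \<subseteq> {a..b}}.
      ereal (\<Sum>j < length ts - 1. nrm d (\<gamma> (ts ! Suc j) - \<gamma> (ts ! j))))"

definition matapp :: "nat \<Rightarrow> (nat \<Rightarrow> nat \<Rightarrow> real) \<Rightarrow> vec \<Rightarrow> vec" where
  "matapp d A x = (\<lambda>i. if i < d then (\<Sum>j<d. A i j * x j) else 0)"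

definition invertible_d :: "nat \<Rightarrow> (nat \<Rightarrow> nat \<Rightarrow> real) \<Rightarrow> bool" where
  "invertible_d d A = (\<exists>M. \<forall>x \<in> Rd d. matapp d M (matapp d A x) = x \<and> matapp d A (matapp d M x) = x)"

definition is_discretization :: "nat \<Rightarrow> nat \<Rightarrow> vec set \<Rightarrow> vec list \<Rightarrow> bool" where
  "is_discretization d k K ps =
    (length ps = Suc k \<and> set ps \<subseteq> Rd d \<and>
     (\<exists>A q (r :: nat \<Rightarrow> ereal).
        invertible_d d A \<and> q \<in> Rd d \<and>
        (\<lambda>b. q + b) ` ballR d 1 \<subseteq> matapp d A ` K \<and>
        matapp d A ` K \<subseteq> (\<lambda>b. q + b) ` ballR d (real d) \<and>
        r 0 = 0 \<and> r k = \<infinity> \<and> (\<forall>j<k. r j \<le> r (Suc j)) \<and>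
        (\<forall>j<k. plen d (matapp d A \<circ> rho d K) (r j) (r (Suc j))
               = plen d (matapp d A \<circ> rho d K) 0 \<infinity> / ereal (real k)) \<and>
        (\<forall>j\<le>k. matapp d A (ps ! j) = matapp d A (rho d K (r j)))))"

definition knowledge :: "nat \<Rightarrow> (vec \<times> vec) list \<Rightarrow> vec set" where
  "knowledge d h = ballR d 1 \<inter> {w. \<forall>(p, v) \<in> set h. ip d (w - p) v \<ge> 0}"

text \<open>Expected regret of the remaining n rounds from history h, for the algorithm that queries
  a uniformly random point of the set D_t = set (disc K_t); the oracle orc chooses u_t from the
  history; the hidden point is w.\<close>
fun exp_regret :: "nat \<Rightarrow> (vec set \<Rightarrow> vec list) \<Rightarrow> ((vec \<times> vec) list \<Rightarrow> vec) \<Rightarrow> vec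
      \<Rightarrow> nat \<Rightarrow> (vec \<times> vec) list \<Rightarrow> real" where
  "exp_regret d disc orc w 0 h = 0"
| "exp_regret d disc orc w (Suc n) h =
     (\<Sum>p \<in> set (disc (knowledge d h)).
        (let u = orc h; v = (if ip d (w - p) u \<ge> 0 then u else - u)
         in ip d (w - p) v + exp_regret d disc orc w n (h @ [(p, v)])))
     / real (card (set (disc (knowledge d h))))"

end

theory Submission
  imports Defs "HOL-Probability.Probability" "Jordan_Normal_Form.Determinant"
begin

text \<open>By a Steiner-type formula for zonotopes, a fixed linear functional of the curvature path of $K$ takes each
  value at most $d + 1$ times. In John position the path therefore has length at most $2d^2(d+1)$, and one of
  the $k = 120 d^4$ pieces of the discretization comes close enough, in the direction asked by the oracle,
  to the center of gravity of $K + zB$, where $z$ is a small multiple of the width of $K$ divided by $d$.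
  Querying that point removes a fifth of the volume of $K + zB$ by a robust version of Gruenbaum's inequality, whatever
  the answer is. Hence the potential, the sum over $i$ of $2^{-i}$ times the logarithm of the ratio of the volumes of
  $K + z_i B$ and $z_i B$ with $z_i = 2^{-i} / (80d)$, pays in expectation for the regret of each round up to the factor $10(k+1)$,
  and initially it is $O(d \log d)$.\<close>

hide_type (open) Matrix.vec
hide_const (open) Matrix.vec

section \<open>Vectors and Lebesgue measure\<close>

text \<open>The regret of a round is bounded by the width of \<open>K\<close> in the direction of
  the oracle, and a body of tiny volume can be wide; so the volume of \<open>K\<close> alone is no
  measure of progress. Fattening by a ball of radius proportional to width over d bounds the volume
  from below by that of the ball, and the fattened remainder of a cut passes only slightly beyond
  the centroid. The right radius depends on a unit vector that the learner does not see: hence a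
  whole path of centroids, and a random point of it, which is the right one with probability at
  least 1/(k+1). John position makes lengths along the path comparable with widths: a displacement
  of length s in the image changes a functional by at most s/2 times the width of \<open>K\<close>.
  Zonotopes enter because moments are affine in the length of an added segment, which yields
  polynomials without mixed volumes; the ball is reached by approximation. That discretizations
  exist at all (finite length, continuity, a limit at infinity, nonempty interior after each cut) is
  part of the argument. The weights 2^(-i) bound the potential independently of the number of
  scales, which is taken equal to the number of rounds.\<close>

lemma smul_apply [simp]: "smul c x i = c * x i"
  by (simp add: smul_def)

lemma Rd_add: "x \<in> Rd d \<Longrightarrow> y \<in> Rd d \<Longrightarrow> x + y \<in> Rd d"
  and Rd_diff: "x \<in> Rd d \<Longrightarrow> y \<in> Rd d \<Longrightarrow> x - y \<in> Rd d"
  and Rd_smul: "x \<in> Rd d \<Longrightarrow> smul c x \<in> Rd d"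
  and Rd_uminus: "x \<in> Rd d \<Longrightarrow> - x \<in> Rd d"
  and Rd_0: "0 \<in> Rd d"
  and Rd_emb: "emb d x \<in> Rd d"
  by (auto simp: Rd_def emb_def)

lemmas Rd_intros = Rd_add Rd_diff Rd_smul Rd_uminus Rd_0 Rd_emb

lemma ip_add_left: "ip d (x + y) z = ip d x z + ip d y z"
  and ip_add_right: "ip d z (x + y) = ip d z x + ip d z y"
  and ip_diff_left: "ip d (x - y) z = ip d x z - ip d y z"
  and ip_diff_right: "ip d z (x - y) = ip d z x - ip d z y"
  and ip_smul_left: "ip d (smul c x) z = c * ip d x z"
  and ip_smul_right: "ip d z (smul c x) = c * ip d z x"
  and ip_minus_left: "ip d (- x) z = - ip d x z"
  and ip_minus_right: "ip d z (- x) = - ip d z x"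
  and ip_0_left: "ip d 0 x = 0" and ip_0_right: "ip d x 0 = 0"
proof -
  show "ip d (x + y) z = ip d x z + ip d y z" "ip d z (x + y) = ip d z x + ip d z y"
    "ip d (x - y) z = ip d x z - ip d y z" "ip d z (x - y) = ip d z x - ip d z y"
    by (simp_all add: ip_def sum.distrib sum_subtractf distrib_left distrib_right left_diff_distrib right_diff_distrib)
  show "ip d (smul c x) z = c * ip d x z" "ip d z (smul c x) = c * ip d z x"
    by (simp_all add: ip_def sum_distrib_left mult.assoc mult.left_commute)
qed (simp_all add: ip_def sum_negf)

lemmas ip_simps = ip_add_left ip_add_right ip_diff_left ip_diff_right ip_smul_left ip_smul_right
  ip_minus_left ip_minus_right ip_0_left ip_0_right

lemma ip_commute: "ip d x y = ip d y x"
  by (simp add: ip_def mult.commute)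

lemma ip_self_nonneg: "0 \<le> ip d x x"
  by (simp add: ip_def sum_nonneg)

lemma nrm_L2: "nrm d x = L2_set x {..<d}"
  by (simp add: nrm_def ip_def L2_set_def power2_eq_square)

lemma nrm_nonneg [simp]: "0 \<le> nrm d x"
  by (simp add: nrm_def ip_self_nonneg)

lemma nrm_sq: "(nrm d x)\<^sup>2 = ip d x x"
  by (simp add: nrm_def ip_self_nonneg)

lemma nrm_triangle: "nrm d (x + y) \<le> nrm d x + nrm d y"
  using L2_set_triangle_ineq[of x y "{..<d}"] by (simp add: nrm_L2 plus_fun_def)

lemma nrm_smul: "nrm d (smul c x) = \<bar>c\<bar> * nrm d x"
  by (simp add: nrm_def ip_simps real_sqrt_mult flip: mult.assoc)

lemma nrm_minus [simp]: "nrm d (- x) = nrm d x"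
  by (simp add: nrm_def ip_simps)

lemma nrm_diff_commute: "nrm d (x - y) = nrm d (y - x)"
  by (metis minus_diff_eq nrm_minus)

lemma nrm_0 [simp]: "nrm d 0 = 0"
  by (simp add: nrm_def ip_simps)

lemma ip_le_nrm: "\<bar>ip d x y\<bar> \<le> nrm d x * nrm d y"
proof -
  have "(ip d x y)\<^sup>2 \<le> (nrm d x * nrm d y)\<^sup>2"
    using Cauchy_Schwarz_ineq_sum[of x y "{..<d}"]
    by (simp add: power_mult_distrib nrm_sq) (simp add: ip_def power2_eq_square)
  then show ?thesis by (simp add: power2_le_iff_abs_le)
qed

lemma nrm_le_sum: "nrm d x \<le> (\<Sum>i<d. \<bar>x i\<bar>)"
  by (simp add: nrm_L2 L2_set_le_sum_abs)

lemma coord_le_nrm: "i < d \<Longrightarrow> \<bar>x i\<bar> \<le> nrm d x"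
  unfolding nrm_L2 using member_le_L2_set[of "{..<d}" i "\<lambda>i. \<bar>x i\<bar>"]
  by (simp add: L2_set_def)

lemma nrm_eq_0: "x \<in> Rd d \<Longrightarrow> nrm d x = 0 \<Longrightarrow> x = 0"
proof (rule ext)
  fix i assume "x \<in> Rd d" "nrm d x = 0"
  then show "x i = 0 i"
    using coord_le_nrm[of i d x] by (cases "i < d") (auto simp: Rd_def)
qed

lemma ballR_iff: "x \<in> ballR d r \<longleftrightarrow> x \<in> Rd d \<and> nrm d x \<le> r"
  by (simp add: ballR_def)

lemma smul_ballR: assumes r: "0 \<le> r" shows "smul r ` ballR d 1 = ballR d r"
proof (rule equalityI; rule subsetI)
  fix x assume "x \<in> smul r ` ballR d 1"
  then show "x \<in> ballR d r"
    using r by (auto simp: ballR_iff Rd_smul nrm_smul mult_left_le)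
next
  fix x assume x: "x \<in> ballR d r"
  show "x \<in> smul r ` ballR d 1"
  proof (cases "r = 0")
    case True
    with x nrm_eq_0[of x d] have "x = smul r 0"
      by (auto simp: ballR_iff fun_eq_iff order_antisym)
    then show ?thesis by (auto intro!: imageI simp: ballR_iff Rd_0)
  next
    case False
    then have "x = smul r (smul (1/r) x)" by (auto simp: fun_eq_iff)
    moreover have "smul (1/r) x \<in> ballR d 1"
      using x r False by (auto simp: ballR_iff Rd_smul nrm_smul divide_simps)
    ultimately show ?thesis by blast
  qed
qed

lemma continuous_on_coord:
  fixes f :: "'a::topological_space \<Rightarrow> vec"
  shows "continuous_on S f \<Longrightarrow> continuous_on S (\<lambda>x. f x i)"
  by (rule continuous_on_product_then_coordinatewise)

lemma continuous_on_vecI: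
  fixes f :: "'a::topological_space \<Rightarrow> vec"
  shows "(\<And>i. continuous_on S (\<lambda>x. f x i)) \<Longrightarrow> continuous_on S f"
  by (rule continuous_on_coordinatewise_then_product)

lemma continuous_on_vec_add [continuous_intros]:
  fixes f g :: "'a::topological_space \<Rightarrow> vec"
  assumes "continuous_on S f" "continuous_on S g"
  shows "continuous_on S (\<lambda>x. f x + g x)"
  by (rule continuous_on_vecI)
    (simp add: continuous_on_add[OF continuous_on_coord[OF assms(1)] continuous_on_coord[OF assms(2)]])

lemma continuous_on_vec_diff [continuous_intros]:
  fixes f g :: "'a::topological_space \<Rightarrow> vec"
  assumes "continuous_on S f" "continuous_on S g"
  shows "continuous_on S (\<lambda>x. f x - g x)"
  by (rule continuous_on_vecI)
    (simp add: continuous_on_diff[OF continuous_on_coord[OF assms(1)] continuous_on_coord[OF assms(2)]])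

lemma continuous_on_smul [continuous_intros]:
  fixes f :: "'a::topological_space \<Rightarrow> vec"
  assumes "continuous_on S c" "continuous_on S f"
  shows "continuous_on S (\<lambda>x. smul (c x) (f x))"
  by (rule continuous_on_vecI)
    (simp add: continuous_on_mult[OF assms(1) continuous_on_coord[OF assms(2)]])

lemma continuous_on_ip [continuous_intros]:
  fixes f g :: "'a::topological_space \<Rightarrow> vec"
  assumes "continuous_on S f" "continuous_on S g"
  shows "continuous_on S (\<lambda>x. ip d (f x) (g x))"
  unfolding ip_def
  by (intro continuous_on_sum continuous_on_mult continuous_on_coord assms)

lemma continuous_on_nrm [continuous_intros]:
  fixes f :: "'a::topological_space \<Rightarrow> vec"
  assumes "continuous_on S f"
  shows "continuous_on S (\<lambda>x. nrm d (f x))"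
  unfolding nrm_def by (intro continuous_on_real_sqrt continuous_on_ip assms)

lemma continuous_on_matapp [continuous_intros]:
  fixes f :: "'a::topological_space \<Rightarrow> vec"
  assumes "continuous_on S f"
  shows "continuous_on S (\<lambda>x. matapp d A (f x))"
proof (rule continuous_on_vecI)
  fix i show "continuous_on S (\<lambda>x. matapp d A (f x) i)"
    by (cases "i < d")
      (simp_all add: matapp_def, intro continuous_on_sum continuous_on_mult_left continuous_on_coord assms)
qed

section \<open>Closed and compact sets in the product topology\<close>

lemma closed_Rd: "closed (Rd d)"
proof -
  have "Rd d = (\<Inter>i\<in>{d..}. {x. x i = 0})" by (auto simp: Rd_def)
  moreover have "closed {x::vec. x i = 0}" for i
    by (intro closed_Collect_eq continuous_on_const continuous_on_coord continuous_on_id)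
  ultimately show ?thesis by auto
qed

lemma closed_ballR: "closed (ballR d r)"
proof -
  have "ballR d r = Rd d \<inter> {x. nrm d x \<le> r}" by (auto simp: ballR_def)
  moreover have "closed {x. nrm d x \<le> r}"
    by (intro closed_Collect_le continuous_on_const continuous_on_nrm continuous_on_id)
  ultimately show ?thesis using closed_Rd by auto
qed

text \<open>Tychonoff's theorem. The index type stays general because the boxes occur twice: around
  balls of vectors and around encoded affine maps, which are functions on pairs of indices.\<close>

lemma compact_box_fun: "compact (PiE UNIV (\<lambda>i. {a i..b i}) :: ('a \<Rightarrow> real) set)"
proof -
  have "compactin (product_topology (\<lambda>_. euclideanreal) UNIV) (PiE UNIV (\<lambda>i::'a. {a i..b i}))"
    by (simp add: compactin_PiE)
  then show ?thesis by (simp add: euclidean_product_topology)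
qed

lemma compact_ballR: "compact (ballR d r)"
proof -
  \<comment> \<open>Coordinates below d are bounded by the norm, the others vanish; so the ball lies
    in a cube over all indices.\<close>
  have le: "\<bar>x i\<bar> \<le> \<bar>r\<bar>" if "x \<in> ballR d r" for x i
    using that coord_le_nrm[of i d x] by (cases "i < d") (auto simp: ballR_iff Rd_def)
  have "ballR d r \<subseteq> PiE UNIV (\<lambda>i. {-\<bar>r\<bar>..\<bar>r\<bar>})"
  proof
    fix x assume "x \<in> ballR d r"
    from le[OF this] show "x \<in> PiE UNIV (\<lambda>i. {-\<bar>r\<bar>..\<bar>r\<bar>})"
      by (simp add: PiE_def Pi_def abs_le_iff) (metis minus_le_iff)
  qed
  then have "ballR d r \<inter> PiE UNIV (\<lambda>i. {-\<bar>r\<bar>..\<bar>r\<bar>}) = ballR d r" by (rule Int_absorb2)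
  then show ?thesis
    using closed_Int_compact[OF closed_ballR[of d r] compact_box_fun[of "\<lambda>_. -\<bar>r\<bar>" "\<lambda>_. \<bar>r\<bar>"]] by simp
qed

lemma compact_msum: "compact A \<Longrightarrow> compact B \<Longrightarrow> compact (msum A B)"
proof -
  assume "compact A" "compact B"
  then have "compact ((\<lambda>z. fst z + snd z) ` (A \<times> B))"
    by (intro compact_continuous_image compact_Times) (intro continuous_on_vec_add continuous_on_fst continuous_on_snd continuous_on_id)
  moreover have "msum A B = (\<lambda>z. fst z + snd z) ` (A \<times> B)" by (force simp: msum_def)
  ultimately show ?thesis by simp
qed

text \<open>The measure \<open>leb d\<close> carried to a Borel measure on all of \<open>vec\<close>
  that is concentrated on \<open>Rd d\<close>. All dimensions then share one measurable space, so
  that arguments by induction on the dimension can be stated.\<close>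

definition rdm :: "nat \<Rightarrow> vec measure" where
  "rdm d = distr (leb d) borel (emb d)"

lemma borel_measurable_coord [measurable]: "(\<lambda>x::vec. x i) \<in> borel_measurable borel"
  by (intro borel_measurable_continuous_onI continuous_on_coord continuous_on_id)

lemma borel_measurable_ip [measurable]:
  "f \<in> borel_measurable M \<Longrightarrow> g \<in> borel_measurable M \<Longrightarrow> (\<lambda>x. ip d (f x) (g x)) \<in> borel_measurable M"
  unfolding ip_def
  by (intro borel_measurable_sum borel_measurable_times measurable_compose[OF _ borel_measurable_coord])

lemma borel_measurable_vecI: "(\<And>i. (\<lambda>x. f x i) \<in> borel_measurable M) \<Longrightarrow> (f::_\<Rightarrow>vec) \<in> borel_measurable M"
  by (rule measurable_coordinatewise_then_product)

lemma space_leb: "space (leb d) = extensional {..<d}"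
  by (simp add: leb_def space_PiM PiE_def)

lemma emb_measurable [measurable]: "emb d \<in> measurable (leb d) borel"
proof (rule borel_measurable_vecI)
  fix i show "(\<lambda>x. emb d x i) \<in> borel_measurable (leb d)"
  proof (cases "i < d")
    case True
    then have "(\<lambda>x. x i) \<in> measurable (leb d) lborel"
      unfolding leb_def by (intro measurable_component_singleton) auto
    then show ?thesis using True by (simp add: emb_def)
  qed (simp add: emb_def)
qed

lemma sets_rdm [measurable_cong, simp]: "sets (rdm d) = sets borel"
  by (simp add: rdm_def)

lemma space_rdm [simp]: "space (rdm d) = UNIV"
  by (simp add: rdm_def)

lemma vol_rdm: "L \<in> sets borel \<Longrightarrow> vol d L = measure (rdm d) L"
  unfolding vol_def rdm_def
  by (subst measure_distr) (auto intro!: arg_cong[where f="measure (leb d)"])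

lemma cg_rdm: "L \<in> sets borel \<Longrightarrow> i < d \<Longrightarrow>
    cg d L i = (\<integral>x. indicator L x * x i \<partial>rdm d) / measure (rdm d) L"
proof -
  assume L: "L \<in> sets borel" "i < d"
  have "(\<integral>x. indicator L x * x i \<partial>rdm d) = (\<integral>x. indicator L (emb d x) * emb d x i \<partial>leb d)"
    unfolding rdm_def using L by (subst integral_distr) auto
  then show ?thesis using L by (simp add: cg_def vol_rdm emb_def)
qed

lemma AE_rdm_Rd: "AE x in rdm d. x \<in> Rd d"
  unfolding rdm_def by (subst AE_distr_iff) (auto simp: Rd_emb closed_Rd borel_closed pred_def)

lemma product_sigma_finite_lborel: "product_sigma_finite (\<lambda>_. lborel::real measure)"
  by (simp add: product_sigma_finite_def sigma_finite_lborel)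

text \<open>Every invertible linear map is a composition of maps that replace one coordinate by an affine
  function of itself and of the others; for those the Jacobian comes from Fubini.\<close>

lemma nn_integral_rdm_coord:
  assumes i: "i < d" and c: "c \<noteq> 0" and f [measurable]: "f \<in> borel_measurable borel"
    and b [measurable]: "b \<in> borel_measurable borel" and bi: "\<And>x t. b (x(i := t)) = b x"
  shows "(\<integral>\<^sup>+x. f (x(i := c * x i + b x)) \<partial>rdm d) = ennreal (1 / \<bar>c\<bar>) * (\<integral>\<^sup>+x. f x \<partial>rdm d)"
proof -
  interpret product_sigma_finite "\<lambda>_. lborel::real measure" by (rule product_sigma_finite_lborel)
  let ?I = "{..<d} - {i}"
  have ins: "insert i ?I = {..<d}" using i by auto
  have upd: "(\<lambda>x::vec. x(i := h x)) \<in> borel_measurable borel" if [measurable]: "h \<in> borel_measurable borel" for h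
    by (rule borel_measurable_vecI) (auto simp: fun_upd_def)
  have meas[measurable]: "(\<lambda>x. f (x(i := c * x i + b x))) \<in> borel_measurable borel"
    by (rule measurable_compose[OF upd f]) measurable
  have emb_upd: "emb d (x(i := t)) = (emb d x)(i := t)" for x t
    using i by (auto simp: emb_def)
  have leb: "leb d = Pi\<^sub>M (insert i ?I) (\<lambda>_. lborel)" by (simp only: leb_def ins)
  have fub: "(\<integral>\<^sup>+x. g x \<partial>rdm d) = (\<integral>\<^sup>+x. \<integral>\<^sup>+t. g ((emb d x)(i := t)) \<partial>lborel \<partial>Pi\<^sub>M ?I (\<lambda>_. lborel))"
    if [measurable]: "g \<in> borel_measurable borel" for g
  proof -
    have "(\<integral>\<^sup>+x. g x \<partial>rdm d) = (\<integral>\<^sup>+x. g (emb d x) \<partial>Pi\<^sub>M (insert i ?I) (\<lambda>_. lborel))"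
      unfolding rdm_def by (subst nn_integral_distr) (use that in \<open>simp_all del: insert_Diff_single add: leb[symmetric]\<close>)
    also have "\<dots> = (\<integral>\<^sup>+x. \<integral>\<^sup>+t. g (emb d (x(i := t))) \<partial>lborel \<partial>Pi\<^sub>M ?I (\<lambda>_. lborel))"
    proof (rule product_nn_integral_insert)
      show "(\<lambda>x. g (emb d x)) \<in> borel_measurable (Pi\<^sub>M (insert i ?I) (\<lambda>_. lborel))"
        unfolding ins leb_def[symmetric] by measurable
    qed auto
    finally show ?thesis by (simp add: emb_upd)
  qed
  have inner: "(\<integral>\<^sup>+t. f (y(i := c * t + b y)) \<partial>lborel) = ennreal (1/\<bar>c\<bar>) * (\<integral>\<^sup>+t. f (y(i := t)) \<partial>lborel)" for y
  proof -
    have [measurable]: "(\<lambda>t::real. y(i := t)) \<in> borel_measurable borel"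
      by (rule borel_measurable_vecI) (auto simp: fun_upd_def)
    have "(\<integral>\<^sup>+t. f (y(i := t)) \<partial>lborel) = ennreal \<bar>c\<bar> * (\<integral>\<^sup>+t. f (y(i := b y + c * t)) \<partial>lborel)"
      by (rule nn_integral_real_affine) (use c in auto)
    then have "ennreal (1/\<bar>c\<bar>) * (\<integral>\<^sup>+t. f (y(i := t)) \<partial>lborel) = ennreal (1/\<bar>c\<bar> * \<bar>c\<bar>) * (\<integral>\<^sup>+t. f (y(i := b y + c * t)) \<partial>lborel)"
      by (simp only: ennreal_mult' abs_ge_zero mult.assoc zero_le_divide_1_iff)
    then show ?thesis using c by (simp add: add.commute)
  qed
  have "(\<integral>\<^sup>+x. f (x(i := c * x i + b x)) \<partial>rdm d)
     = (\<integral>\<^sup>+x. ennreal (1/\<bar>c\<bar>) * (\<integral>\<^sup>+t. f ((emb d x)(i := t)) \<partial>lborel) \<partial>Pi\<^sub>M ?I (\<lambda>_. lborel))"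
    by (subst fub) (auto simp: bi inner)
  also have "\<dots> = ennreal (1/\<bar>c\<bar>) * (\<integral>\<^sup>+x. (\<integral>\<^sup>+t. f ((emb d x)(i := t)) \<partial>lborel) \<partial>Pi\<^sub>M ?I (\<lambda>_. lborel))"
  proof (rule nn_integral_cmult)
    have "(\<lambda>(x,t). (emb d x)(i := t)) \<in> borel_measurable (Pi\<^sub>M ?I (\<lambda>_. lborel) \<Otimes>\<^sub>M lborel)"
    proof (rule borel_measurable_vecI)
      fix j show "(\<lambda>p. (case p of (x, t) \<Rightarrow> (emb d x)(i := t)) j) \<in> borel_measurable (Pi\<^sub>M ?I (\<lambda>_. lborel) \<Otimes>\<^sub>M lborel)"
      proof (cases "j \<in> ?I")
        case True
        then have "(\<lambda>x. x j) \<in> measurable (Pi\<^sub>M ?I (\<lambda>_. lborel)) (lborel::real measure)"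
          by (intro measurable_component_singleton) auto
        then show ?thesis using True
          by (auto simp: case_prod_beta emb_def intro: measurable_compose[OF measurable_fst])
      next
        case False
        then show ?thesis by (cases "j = i") (auto simp: case_prod_beta emb_def)
      qed
    qed
    from measurable_compose[OF this f]
    show "(\<lambda>x. \<integral>\<^sup>+t. f ((emb d x)(i := t)) \<partial>lborel) \<in> borel_measurable (Pi\<^sub>M ?I (\<lambda>_. lborel))"
      by (intro lborel.borel_measurable_nn_integral) (auto simp: case_prod_beta')
  qed
  also have "\<dots> = ennreal (1/\<bar>c\<bar>) * (\<integral>\<^sup>+x. f x \<partial>rdm d)"
    by (subst fub) auto
  finally show ?thesis .
qed

text \<open>The \<open>b j\<close> read only coordinates outside S. Updating S one coordinate at a
  time therefore agrees with the simultaneous update, and each coordinate contributes the factor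
  1/|c|.\<close>

lemma nn_integral_rdm_block:
  assumes "finite S" "S \<subseteq> {..<d}" and c: "c \<noteq> 0" and f: "f \<in> borel_measurable borel"
    and b: "\<And>j. j \<in> S \<Longrightarrow> b j \<in> borel_measurable borel"
    and "\<And>j x y. j \<in> S \<Longrightarrow> (\<And>i. i \<notin> S \<Longrightarrow> x i = y i) \<Longrightarrow> b j x = b j y"
  shows "(\<integral>\<^sup>+x. f (\<lambda>j. if j \<in> S then c * x j + b j x else x j) \<partial>rdm d)
      = ennreal ((1 / \<bar>c\<bar>) ^ card S) * (\<integral>\<^sup>+x. f x \<partial>rdm d)"
  using assms
proof (induction S rule: finite_induct)
  case empty show ?case by simp
next
  case (insert i S)
  define T where "T = (\<lambda>x j. if j \<in> S then c * x j + b j x else (x::vec) j)"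
  have bm: "b j \<in> borel_measurable borel" if "j \<in> insert i S" for j using insert.prems(4) that .
  have Tm: "T \<in> borel_measurable borel"
  proof (rule borel_measurable_vecI)
    fix j show "(\<lambda>x. T x j) \<in> borel_measurable borel"
    proof (cases "j \<in> S")
      case True
      then have [measurable]: "b j \<in> borel_measurable borel" by (intro bm) simp
      show ?thesis unfolding T_def using True by simp
    next
      case False
      then show ?thesis by (simp add: T_def)
    qed
  qed
  have dep: "b j x = b j y" if "j \<in> insert i S" "\<And>k. k \<notin> insert i S \<Longrightarrow> x k = y k" for j x y
    by (rule insert.prems(5)[OF that])
  have eq: "(\<lambda>j. if j \<in> insert i S then c * x j + b j x else x j) = T (x(i := c * x i + b i x))" for x
  proof (rule ext)
    fix j
    have "b j (x(i := c * x i + b i x)) = b j x" if "j \<in> S" by (rule dep) (use that in simp_all)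
    then show "(if j \<in> insert i S then c * x j + b j x else x j) = T (x(i := c * x i + b i x)) j"
      using insert.hyps by (auto simp: T_def)
  qed
  have "(\<integral>\<^sup>+x. f (\<lambda>j. if j \<in> insert i S then c * x j + b j x else x j) \<partial>rdm d)
     = (\<integral>\<^sup>+x. (f \<circ> T) (x(i := c * x i + b i x)) \<partial>rdm d)"
    by (simp only: eq o_def)
  also have "\<dots> = ennreal (1 / \<bar>c\<bar>) * (\<integral>\<^sup>+x. (f \<circ> T) x \<partial>rdm d)"
  proof (rule nn_integral_rdm_coord)
    show "f \<circ> T \<in> borel_measurable borel" using insert.prems(3) Tm by (rule measurable_comp[rotated])
    show "b i (x(i := t)) = b i x" for x t by (rule dep) auto
  qed (use insert.prems(1,2) bm[of i] in simp_all)
  also have "(\<integral>\<^sup>+x. (f \<circ> T) x \<partial>rdm d) = ennreal ((1 / \<bar>c\<bar>) ^ card S) * (\<integral>\<^sup>+x. f x \<partial>rdm d)"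
    unfolding T_def o_def
  proof (rule insert.IH)
    show "b j x = b j y" if "j \<in> S" "\<And>i. i \<notin> S \<Longrightarrow> x i = y i" for j x y
      by (rule dep) (use that in auto)
      show "b j \<in> borel_measurable borel" if "j \<in> S" for j by (rule bm) (use that in simp)
  qed (use insert.prems(1,2,3) in simp_all)
  also have "ennreal (1 / \<bar>c\<bar>) * (ennreal ((1 / \<bar>c\<bar>) ^ card S) * (\<integral>\<^sup>+x. f x \<partial>rdm d))
      = ennreal ((1 / \<bar>c\<bar>) ^ card (insert i S)) * (\<integral>\<^sup>+x. f x \<partial>rdm d)"
    proof -
    have "ennreal a * (ennreal (a ^ n) * X) = ennreal (a ^ Suc n) * X" if "0 \<le> a" for a n X
      using that by (simp add: ennreal_mult' mult.assoc)
    from this[of "1 / \<bar>c\<bar>" "card S" "\<integral>\<^sup>+x. f x \<partial>rdm d"] show ?thesis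
      using insert.hyps by simp
  qed
  finally show ?case .
qed

lemma nn_integral_rdm_affine:
  assumes c: "c \<noteq> 0" and f: "f \<in> borel_measurable borel" and a: "a \<in> Rd d"
  shows "(\<integral>\<^sup>+x. f (smul c x + a) \<partial>rdm d) = ennreal ((1 / \<bar>c\<bar>) ^ d) * (\<integral>\<^sup>+x. f x \<partial>rdm d)"
proof -
  have "(\<integral>\<^sup>+x. f (smul c x + a) \<partial>rdm d) = (\<integral>\<^sup>+x. f (\<lambda>j. if j \<in> {..<d} then c * x j + a j else x j) \<partial>rdm d)"
  proof (rule nn_integral_cong_AE)
    \<comment> \<open>The two arguments of f agree on \<open>Rd d\<close> but not elsewhere: the
      left one also scales the coordinates from d on.\<close>
    show "AE x in rdm d. f (smul c x + a) = f (\<lambda>j. if j \<in> {..<d} then c * x j + a j else x j)"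
      using AE_rdm_Rd[of d]
    proof eventually_elim
      case (elim x)
      then have "smul c x + a = (\<lambda>j. if j \<in> {..<d} then c * x j + a j else x j)"
        using a by (intro ext) (simp add: Rd_def)
      then show ?case by (rule arg_cong)
    qed
  qed
  also have "\<dots> = ennreal ((1 / \<bar>c\<bar>) ^ card {..<d}) * (\<integral>\<^sup>+x. f x \<partial>rdm d)"
    by (rule nn_integral_rdm_block[where b="\<lambda>j _. a j"]) (use c f in simp_all)
  finally show ?thesis by (simp only: card_lessThan)
qed

section \<open>Convex bodies and their moments\<close>

lemma nrm_le_ip: "nrm d x \<le> r \<longleftrightarrow> 0 \<le> r \<and> ip d x x \<le> r\<^sup>2"
  unfolding nrm_sq[symmetric] using nrm_nonneg[of d x]
  by (metis abs_le_square_iff abs_of_nonneg order_trans)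

lemma emeasure_rdm_box:
  assumes "0 \<le> r"
  shows "emeasure (rdm d) {x. \<forall>i<d. \<bar>x i\<bar> \<le> r} = ennreal ((2 * r) ^ d)"
proof -
  interpret product_sigma_finite "\<lambda>_. lborel::real measure" by (rule product_sigma_finite_lborel)
  have cl: "{x::vec. \<forall>i<d. \<bar>x i\<bar> \<le> r} \<in> sets borel"
  proof -
    have "{x::vec. \<forall>i<d. \<bar>x i\<bar> \<le> r} = (\<Inter>i\<in>{..<d}. {x. \<bar>x i\<bar> \<le> r})" by auto
    also have "closed \<dots>"
      by (intro closed_INT ballI closed_Collect_le continuous_on_rabs continuous_on_coord continuous_on_id continuous_on_const)
    finally show ?thesis by (rule borel_closed)
  qed
  have "emeasure (rdm d) {x. \<forall>i<d. \<bar>x i\<bar> \<le> r} = emeasure (leb d) (emb d -` {x. \<forall>i<d. \<bar>x i\<bar> \<le> r} \<inter> space (leb d))"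
    unfolding rdm_def by (rule emeasure_distr[OF emb_measurable cl])
  also have "emb d -` {x. \<forall>i<d. \<bar>x i\<bar> \<le> r} \<inter> space (leb d) = PiE {..<d} (\<lambda>_. {-r..r})"
    by (auto simp: space_leb emb_def PiE_def Pi_def abs_le_iff minus_le_iff)
  also have "emeasure (leb d) \<dots> = (\<Prod>i<d. emeasure lborel {-r..r})"
    unfolding leb_def by (rule emeasure_PiM) auto
  also have "\<dots> = ennreal ((2 * r) ^ d)"
    using assms by (simp add: ennreal_power)
  finally show ?thesis .
qed

lemma ballR_borel [measurable, simp]: "ballR d r \<in> sets borel"
  by (simp add: borel_closed closed_ballR)

lemma compact_borel: "compact (A::vec set) \<Longrightarrow> A \<in> sets borel"
  by (simp add: borel_closed compact_imp_closed)

lemma emeasure_ballR_finite: "emeasure (rdm d) (ballR d r) < \<infinity>"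
proof -
  have cl: "{x::vec. \<forall>i<d. \<bar>x i\<bar> \<le> \<bar>r\<bar>} \<in> sets borel"
  proof -
    have "{x::vec. \<forall>i<d. \<bar>x i\<bar> \<le> \<bar>r\<bar>} = (\<Inter>i\<in>{..<d}. {x. \<bar>x i\<bar> \<le> \<bar>r\<bar>})" by auto
    also have "closed \<dots>"
      by (intro closed_INT ballI closed_Collect_le continuous_on_rabs continuous_on_coord continuous_on_id continuous_on_const)
    finally show ?thesis by (rule borel_closed)
  qed
  have "emeasure (rdm d) (ballR d r) \<le> emeasure (rdm d) {x. \<forall>i<d. \<bar>x i\<bar> \<le> \<bar>r\<bar>}"
  proof (rule emeasure_mono)
    show "ballR d r \<subseteq> {x. \<forall>i<d. \<bar>x i\<bar> \<le> \<bar>r\<bar>}"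
      using coord_le_nrm[of _ d] by (auto simp: ballR_iff) (meson abs_ge_self order_trans)
  qed (use cl in simp)
  also have "\<dots> < \<infinity>" by (simp add: emeasure_rdm_box)
  finally show ?thesis .
qed

lemma bounded_emeasure_finite: "A \<subseteq> ballR d r \<Longrightarrow> emeasure (rdm d) A < \<infinity>"
  using emeasure_mono[of A "ballR d r" "rdm d"] emeasure_ballR_finite[of d r] by (simp add: order_le_less_trans)

lemma measure_ballR_pos: "0 < r \<Longrightarrow> 0 < measure (rdm d) (ballR d r)"
proof -
  assume r: "0 < r"
  \<comment> \<open>A cube of this half side has sum norm at most d e <= r, so it fits into the
    ball; d + 1 avoids a division by 0 in dimension 0.\<close>
  define e where "e = r / real (Suc d)"
  have e: "0 < e" using r by (simp add: e_def)
  have ae: "AE x in rdm d. x \<in> {x. \<forall>i<d. \<bar>x i\<bar> \<le> e} \<longrightarrow> x \<in> ballR d r"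
    using AE_rdm_Rd[of d]
  proof eventually_elim
    case (elim x)
    show ?case
    proof
      assume x: "x \<in> {x. \<forall>i<d. \<bar>x i\<bar> \<le> e}"
      have "nrm d x \<le> (\<Sum>i<d. \<bar>x i\<bar>)" by (rule nrm_le_sum)
      also have "\<dots> \<le> (\<Sum>i<d. e)" by (rule sum_mono) (use x in auto)
      also have "\<dots> \<le> r" using r by (simp add: e_def divide_simps mult_right_mono)
      finally show "x \<in> ballR d r" using elim by (simp add: ballR_iff)
    qed
  qed
  have "0 < ennreal ((2 * e) ^ d)" using e by simp
  also have "\<dots> \<le> emeasure (rdm d) (ballR d r)"
    unfolding emeasure_rdm_box[OF less_imp_le[OF e], symmetric]
    by (rule emeasure_mono_AE[OF ae]) simp
  finally show ?thesis
    using emeasure_ballR_finite[of d r]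
    by (simp add: measure_def enn2real_positive_iff)
qed

text \<open>Volumes are moments of the constant 1, and the coordinates of a center of gravity are
  quotients of moments. Continuity in the body is proved once, for all of them.\<close>

definition mom :: "nat \<Rightarrow> (vec \<Rightarrow> real) \<Rightarrow> vec set \<Rightarrow> real" where
  "mom d \<phi> A = (\<integral>x. indicator A x * \<phi> x \<partial>rdm d)"

definition dil :: "vec \<Rightarrow> real \<Rightarrow> vec set \<Rightarrow> vec set" where
  "dil c t A = (\<lambda>x. c + smul t (x - c)) ` A"

lemma dil_iff: "t \<noteq> 0 \<Longrightarrow> y \<in> dil c t A \<longleftrightarrow> c + smul (1/t) (y - c) \<in> A"
proof
  assume t: "t \<noteq> 0" and "y \<in> dil c t A"
  then obtain x where x: "x \<in> A" "y = c + smul t (x - c)" by (auto simp: dil_def)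
  have "c + smul (1/t) (y - c) = x" using t by (auto simp: x fun_eq_iff)
  then show "c + smul (1/t) (y - c) \<in> A" using x by simp
next
  assume t: "t \<noteq> 0" and A: "c + smul (1/t) (y - c) \<in> A"
  have "y = c + smul t (c + smul (1/t) (y - c) - c)" using t by (auto simp: fun_eq_iff)
  then show "y \<in> dil c t A" unfolding dil_def using A by blast
qed

lemma compact_dil: "compact A \<Longrightarrow> compact (dil c t A)"
  unfolding dil_def
  by (rule compact_continuous_image)
    (intro continuous_on_vec_add continuous_on_smul continuous_on_vec_diff continuous_on_const continuous_on_id)

lemma dil_borel:
  assumes "A \<in> sets borel" "t \<noteq> 0" shows "dil c t A \<in> sets borel"
proof -
  have "(\<lambda>x. c + smul (1/t) (x - c)) \<in> borel_measurable borel"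
    by (intro borel_measurable_continuous_onI continuous_on_vec_add continuous_on_smul continuous_on_vec_diff continuous_on_const continuous_on_id)
  from measurable_sets[OF this assms(1)] show ?thesis
    using assms(2) by (simp add: vimage_def dil_iff[symmetric])
qed

lemma emeasure_dil:
  assumes A: "A \<in> sets borel" and c: "c \<in> Rd d" and t: "0 < t"
  shows "emeasure (rdm d) (dil c t A) = ennreal (t ^ d) * emeasure (rdm d) A"
proof -
  have "emeasure (rdm d) (dil c t A) = (\<integral>\<^sup>+x. indicator A (smul (1/t) x + (c - smul (1/t) c)) \<partial>rdm d)"
  proof -
    have "emeasure (rdm d) (dil c t A) = (\<integral>\<^sup>+x. indicator (dil c t A) x \<partial>rdm d)"
      using A t by (simp add: dil_borel)
    also have "\<dots> = (\<integral>\<^sup>+x. indicator A (smul (1/t) x + (c - smul (1/t) c)) \<partial>rdm d)"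
    proof (rule nn_integral_cong)
      fix x
      have *: "c + smul (1/t) (x - c) = smul (1/t) x + (c - smul (1/t) c)"
        by (auto simp: fun_eq_iff algebra_simps)
      have t0: "t \<noteq> 0" using t by simp
      have "x \<in> dil c t A \<longleftrightarrow> smul (1/t) x + (c - smul (1/t) c) \<in> A"
        by (simp only: dil_iff[OF t0] *)
      then show "indicator (dil c t A) x = (indicator A (smul (1/t) x + (c - smul (1/t) c)) :: ennreal)"
        by (simp only: indicator_def)
    qed
    finally show ?thesis .
  qed
  also have "\<dots> = ennreal ((1 / \<bar>1/t\<bar>) ^ d) * (\<integral>\<^sup>+x. indicator A x \<partial>rdm d)"
  proof (rule nn_integral_rdm_affine)
    show "c - smul (1/t) c \<in> Rd d" by (intro Rd_intros c)
  qed (use A t in auto)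
  finally show ?thesis using A t by simp
qed

lemma measure_dil:
  assumes A: "A \<in> sets borel" and c: "c \<in> Rd d" and t: "0 < t"
  shows "measure (rdm d) (dil c t A) = t ^ d * measure (rdm d) A"
  using emeasure_dil[OF assms] t by (simp add: measure_def enn2real_mult)

section \<open>Convex bodies, parallel bodies and inner balls\<close>

definition cvx :: "vec set \<Rightarrow> bool" where
  "cvx A \<longleftrightarrow> (\<forall>x\<in>A. \<forall>y\<in>A. \<forall>t\<in>{0..1}. smul (1 - t) x + smul t y \<in> A)"

definition body :: "nat \<Rightarrow> vec set \<Rightarrow> bool" where
  "body d K \<longleftrightarrow> K \<subseteq> Rd d \<and> compact K \<and> cvx K"

text \<open>An inner ball with explicit center and radius. The condition is monotone in the set, so
  one inner ball serves all parallel bodies and all approximations by zonotopes, which makes their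
  comparison uniform.\<close>

definition core :: "nat \<Rightarrow> vec set \<Rightarrow> vec \<Rightarrow> real \<Rightarrow> bool" where
  "core d K c \<delta> \<longleftrightarrow> 0 < \<delta> \<and> c \<in> Rd d \<and> (\<forall>b\<in>ballR d \<delta>. c + b \<in> K)"

definition par :: "nat \<Rightarrow> vec set \<Rightarrow> real \<Rightarrow> vec set" where
  "par d K r = msum K (ballR d r)"

lemma cvxD: "cvx A \<Longrightarrow> x \<in> A \<Longrightarrow> y \<in> A \<Longrightarrow> 0 \<le> t \<Longrightarrow> t \<le> 1 \<Longrightarrow> smul (1 - t) x + smul t y \<in> A"
  by (simp add: cvx_def)

lemma bodyD: assumes "body d K" shows "K \<subseteq> Rd d" "compact K" "cvx K" "K \<in> sets borel" "closed K"
  using assms compact_borel[of K] by (auto simp: body_def compact_imp_closed)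

lemma cvx_ballR: "cvx (ballR d r)"
  unfolding cvx_def
proof (intro ballI)
  fix x y and t :: real assume x: "x \<in> ballR d r" "y \<in> ballR d r" "t \<in> {0..1}"
  have "nrm d (smul (1 - t) x + smul t y) \<le> (1 - t) * nrm d x + t * nrm d y"
    using nrm_triangle[of d "smul (1 - t) x" "smul t y"] x by (simp add: nrm_smul)
  also have "\<dots> \<le> (1 - t) * r + t * r" using x by (intro add_mono mult_left_mono) (auto simp: ballR_iff)
  finally show "smul (1 - t) x + smul t y \<in> ballR d r" using x
    by (auto simp: ballR_iff algebra_simps intro: Rd_intros)
qed

lemma body_ballR: "body d (ballR d r)"
  by (auto simp: body_def cvx_ballR compact_ballR ballR_iff)

lemma msumI: "a \<in> A \<Longrightarrow> b \<in> B \<Longrightarrow> a + b \<in> msum A B"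
  by (auto simp: msum_def)

lemma msumE: assumes "x \<in> msum A B" obtains a b where "a \<in> A" "b \<in> B" "x = a + b"
  using assms by (auto simp: msum_def)

lemma msum_mono: "A \<subseteq> A' \<Longrightarrow> B \<subseteq> B' \<Longrightarrow> msum A B \<subseteq> msum A' B'"
  by (auto simp: msum_def)

lemma cvx_msum: assumes "cvx A" "cvx B" shows "cvx (msum A B)"
  unfolding cvx_def
proof (intro ballI)
  fix x y and t :: real assume "x \<in> msum A B" "y \<in> msum A B" and t: "t \<in> {0..1}"
  then obtain a b a' b' where *: "a \<in> A" "b \<in> B" "x = a + b" "a' \<in> A" "b' \<in> B" "y = a' + b'"
    by (auto elim!: msumE)
  have "smul (1 - t) x + smul t y = (smul (1 - t) a + smul t a') + (smul (1 - t) b + smul t b')"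
    by (auto simp: * fun_eq_iff algebra_simps)
  also have "\<dots> \<in> msum A B" using * t assms by (intro msumI cvxD) auto
  finally show "smul (1 - t) x + smul t y \<in> msum A B" .
qed

lemma body_msum: "body d A \<Longrightarrow> body d B \<Longrightarrow> body d (msum A B)"
  by (auto simp: body_def cvx_msum compact_msum elim!: msumE intro!: Rd_add)

lemma body_par: "body d K \<Longrightarrow> body d (par d K r)"
  by (simp add: par_def body_msum body_ballR)

lemma par_mono: "A \<subseteq> B \<Longrightarrow> r \<le> s \<Longrightarrow> par d A r \<subseteq> par d B s"
  unfolding par_def by (intro msum_mono) (auto simp: ballR_iff)

lemma subset_par: "0 \<le> r \<Longrightarrow> A \<subseteq> par d A r"
proof
  fix x assume "0 \<le> r" "x \<in> A"
  then have "x + 0 \<in> par d A r" unfolding par_def by (intro msumI) (auto simp: ballR_iff Rd_0)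
  then show "x \<in> par d A r" by simp
qed

text \<open>A vector of length at most r + s is split in the proportion r : s.\<close>

lemma par_par_ge: assumes "0 \<le> r" "0 \<le> s" shows "par d A (r + s) \<subseteq> par d (par d A r) s"
proof (cases "r + s = 0")
  case True with assms have [simp]: "r = 0" "s = 0" by auto
  show ?thesis using subset_par[of 0 "par d A 0" d] by simp
next
  case False
  show ?thesis
  proof
    fix x assume "x \<in> par d A (r + s)"
    then obtain a b where *: "a \<in> A" "b \<in> ballR d (r + s)" "x = a + b"
      unfolding par_def by (auto elim!: msumE)
    have "x = (a + smul (r / (r + s)) b) + smul (s / (r + s)) b"
    proof (rule ext)
      fix i
      have "r / (r + s) * b i + s / (r + s) * b i = (r + s) / (r + s) * b i"
        unfolding distrib_right[symmetric] add_divide_distrib[symmetric] ..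
      then show "x i = ((a + smul (r / (r + s)) b) + smul (s / (r + s)) b) i" using False by (simp add: *)
    qed
    moreover have "smul (t / (r + s)) b \<in> ballR d t" if "0 \<le> t" for t
    proof -
      have "t / (r + s) * nrm d b \<le> t / (r + s) * (r + s)"
        using * that assms by (intro mult_left_mono) (auto simp: ballR_iff)
      also have "\<dots> = t" using False by simp
      finally show ?thesis using * that assms False by (auto simp: ballR_iff Rd_smul nrm_smul simp del: times_divide_eq_left)
    qed
    ultimately show "x \<in> par d (par d A r) s"
      unfolding par_def using msumI[OF msumI[OF *(1)]] assms by metis
  qed
qed

lemma core_mono: "core d A c \<delta> \<Longrightarrow> A \<subseteq> B \<Longrightarrow> core d B c \<delta>"
  by (auto simp: core_def)

lemma core_center: "core d A c \<delta> \<Longrightarrow> c \<in> A"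
proof -
  assume A: "core d A c \<delta>"
  then have "0 \<in> ballR d \<delta>" by (simp add: ballR_iff Rd_0 core_def)
  with A have "c + 0 \<in> A" unfolding core_def by blast
  then show ?thesis by simp
qed

text \<open>The translated inner ball has the measure of the ball, by the affine change of variables
  with factor 1. Boundedness of A enters because \<open>measure\<close> is 0 on sets of infinite
  measure.\<close>

lemma core_pos:
  assumes "body d A" "core d A c \<delta>" shows "0 < measure (rdm d) A"
proof -
  have c: "c \<in> Rd d" and \<delta>: "0 < \<delta>" using assms by (auto simp: core_def)
  have eq: "(\<lambda>b. c + b) ` ballR d \<delta> = {x. x + (- c) \<in> ballR d \<delta>}"
  proof (rule equalityI; rule subsetI)
    fix x assume "x \<in> {x. x + (- c) \<in> ballR d \<delta>}"
    moreover have "x = c + (x + (- c))" by simp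
    ultimately show "x \<in> (\<lambda>b. c + b) ` ballR d \<delta>" by blast
  qed auto
  have bm: "{x. x + (- c) \<in> ballR d \<delta>} \<in> sets borel"
  proof -
    have "(\<lambda>x. x + (- c)) \<in> borel_measurable borel"
      by (intro borel_measurable_continuous_onI continuous_on_vec_add continuous_on_const continuous_on_id)
    from measurable_sets[OF this ballR_borel[of d \<delta>]] show ?thesis by (simp add: vimage_def)
  qed
  have "emeasure (rdm d) (ballR d \<delta>) = (\<integral>\<^sup>+x. indicator (ballR d \<delta>) x \<partial>rdm d)"
    by simp
  also have "\<dots> = (\<integral>\<^sup>+x. indicator (ballR d \<delta>) (smul 1 x + (- c)) \<partial>rdm d)"
    using nn_integral_rdm_affine[of 1 "indicator (ballR d \<delta>)" "- c" d] c by (simp add: Rd_uminus)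
  also have "\<dots> = (\<integral>\<^sup>+x. indicator {x. x + (- c) \<in> ballR d \<delta>} x \<partial>rdm d)"
    by (intro nn_integral_cong) (simp add: indicator_def smul_def)
  also have "\<dots> = emeasure (rdm d) {x. x + (- c) \<in> ballR d \<delta>}" using bm by simp
  also have "\<dots> \<le> emeasure (rdm d) A"
    unfolding eq[symmetric] using assms bodyD(4)[OF assms(1)] by (intro emeasure_mono) (auto simp: core_def)
  finally have le: "emeasure (rdm d) (ballR d \<delta>) \<le> emeasure (rdm d) A" .
  have "0 < emeasure (rdm d) (ballR d \<delta>)"
    using measure_ballR_pos[OF \<delta>, of d] by (simp add: measure_def enn2real_positive_iff)
  moreover obtain R where "A \<subseteq> ballR d R"
  proof -
    have "compact (nrm d ` A)" using bodyD[OF assms(1)]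
      by (intro compact_continuous_image continuous_on_nrm continuous_on_id) auto
    then have "bounded (nrm d ` A)" by (rule compact_imp_bounded)
    then obtain R where "\<forall>x\<in>A. \<bar>nrm d x\<bar> \<le> R" by (auto simp: bounded_iff)
    then have "A \<subseteq> ballR d R" using bodyD(1)[OF assms(1)] by (auto simp: ballR_iff)
    then show ?thesis by (rule that)
  qed
  ultimately show ?thesis
    using le bounded_emeasure_finite[of A d R] by (auto simp: measure_def enn2real_positive_iff)
qed

lemma body_bounded: assumes "body d A" obtains R where "0 < R" "A \<subseteq> ballR d R"
proof -
  have "compact (nrm d ` A)" using bodyD[OF assms(1)]
    by (intro compact_continuous_image continuous_on_nrm continuous_on_id) auto
  then have "bounded (nrm d ` A)" by (rule compact_imp_bounded)
  then obtain R where "\<forall>x\<in>A. \<bar>nrm d x\<bar> \<le> R" by (auto simp: bounded_iff)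
  then have "A \<subseteq> ballR d (max R 1)" using bodyD(1)[OF assms(1)] by (force simp: ballR_iff)
  then show ?thesis by (intro that[of "max R 1"]) auto
qed

lemma body_emeasure_finite: "body d A \<Longrightarrow> emeasure (rdm d) A < \<infinity>"
  using body_bounded bounded_emeasure_finite by metis

lemma body_fmeasurable: "body d A \<Longrightarrow> A \<in> fmeasurable (rdm d)"
  using body_emeasure_finite bodyD(4) by (auto simp: fmeasurable_def)

lemma integrable_compact:
  assumes A: "compact A" "A \<subseteq> Rd d" and \<phi>: "continuous_on UNIV \<phi>"
  shows "integrable (rdm d) (\<lambda>x. indicator A x * \<phi> x :: real)"
proof -
  have "compact (\<phi> ` A)" using A(1) \<phi> by (intro compact_continuous_image) (auto intro: continuous_on_subset)
  then have "bounded (\<phi> ` A)" by (rule compact_imp_bounded)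
  then obtain M where M: "\<forall>x\<in>A. \<bar>\<phi> x\<bar> \<le> M" by (auto simp: bounded_iff)
  have "compact (nrm d ` A)" using A
    by (intro compact_continuous_image continuous_on_nrm continuous_on_id) auto
  then have "bounded (nrm d ` A)" by (rule compact_imp_bounded)
  then obtain R where "\<forall>x\<in>A. \<bar>nrm d x\<bar> \<le> R" by (auto simp: bounded_iff)
  then have R: "A \<subseteq> ballR d R" using A by (auto simp: ballR_iff)
  have [measurable]: "A \<in> sets borel" "\<phi> \<in> borel_measurable borel"
    using A compact_borel borel_measurable_continuous_onI[OF \<phi>] by auto
  have "integrable (rdm d) (\<lambda>x. indicator A x * M)"
    using bounded_emeasure_finite[OF R] by (intro integrable_mult_left integrable_real_indicator) auto
  moreover have M': "\<bar>\<phi> x\<bar> \<le> \<bar>M\<bar>" if "x \<in> A" for x using M that abs_ge_self order_trans by blast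
  ultimately show ?thesis
  proof (rule_tac Bochner_Integration.integrable_bound)
    show "AE x in rdm d. norm (indicator A x * \<phi> x) \<le> norm (indicator A x * M)"
      by (rule AE_I2) (simp add: indicator_def M')
  qed auto
qed

section \<open>Continuity of moments under Hausdorff convergence\<close>

lemma dil_sub:
  assumes A: "cvx A" "c \<in> A" "0 \<le> t" "t \<le> 1" shows "dil c t A \<subseteq> A"
proof
  fix y assume "y \<in> dil c t A"
  then obtain x where x: "x \<in> A" "y = c + smul t (x - c)" by (auto simp: dil_def)
  have "y = smul (1 - t) c + smul t x" by (auto simp: x fun_eq_iff algebra_simps)
  then show "y \<in> A" using cvxD[OF A(1,2) x(1)] A by simp
qed

lemma dil_dil: "dil c s (dil c t A) = dil c (s * t) A"
  by (auto simp: dil_def image_image fun_eq_iff algebra_simps intro!: image_cong)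

lemma dil_1 [simp]: "dil c 1 A = A"
proof -
  have "(\<lambda>x. c + smul 1 (x - c)) = (\<lambda>x. x)" by (auto simp: fun_eq_iff)
  then show ?thesis by (simp only: dil_def image_ident)
qed

lemma dil_mono: "A \<subseteq> B \<Longrightarrow> dil c t A \<subseteq> dil c t B"
  by (auto simp: dil_def)

text \<open>With s = \<epsilon>/\<delta>, the ball of radius \<epsilon> is s times the inner ball.
  Contracting a + s b' towards c by 1/(1 + s) gives a convex combination of a and c + b', both in A.
  Thus additive fattening is replaced by a dilation, whose effect on volume is an exact
  power.\<close>

lemma par_sub_dil:
  assumes A: "cvx A" "core d A c \<delta>" "0 \<le> \<epsilon>"
  shows "par d A \<epsilon> \<subseteq> dil c (1 + \<epsilon> / \<delta>) A"
proof
  have \<delta>: "0 < \<delta>" "c \<in> Rd d" using A by (auto simp: core_def)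
  define s where "s = \<epsilon> / \<delta>"
  have s: "0 \<le> s" using A \<delta> by (simp add: s_def)
  fix y assume "y \<in> par d A \<epsilon>"
  then obtain a b where ab: "a \<in> A" "b \<in> ballR d \<epsilon>" "y = a + b" by (auto simp: par_def elim!: msumE)
  obtain b' where b': "b' \<in> ballR d \<delta>" "b = smul s b'"
  proof (cases "\<epsilon> = 0")
    case True
    with ab have "b \<in> Rd d" "nrm d b = 0" by (auto simp: ballR_iff order_antisym)
    then have "b = smul s 0" using nrm_eq_0[of b d] by (auto simp: fun_eq_iff)
    then show ?thesis using \<delta> by (intro that[of 0]) (auto simp: ballR_iff Rd_0)
  next
    case False
    then have s0: "0 < s" using A \<delta> by (simp add: s_def)
    have "(1/s) * nrm d b \<le> \<delta>" using ab s0 A \<delta> False by (simp add: ballR_iff s_def divide_simps)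
    then have "smul (1/s) b \<in> ballR d \<delta>" using ab s0 by (auto simp: ballR_iff Rd_smul nrm_smul)
    moreover have "b = smul s (smul (1/s) b)" using s0 by (auto simp: fun_eq_iff)
    ultimately show ?thesis by (rule that)
  qed
  define u where "u = 1 / (1 + s)"
  have u: "s / (1 + s) = 1 - u" "s * u = 1 - u" "0 \<le> u" "u \<le> 1" using s by (auto simp: u_def field_simps)
  have "c + smul u (y - c) = smul (1 - (1 - u)) a + smul (1 - u) (c + b')"
  proof (rule ext)
    fix i
    have "u * (s * b' i) = (1 - u) * b' i" using u(2) by (metis mult.assoc mult.commute)
    then show "(c + smul u (y - c)) i = (smul (1 - (1 - u)) a + smul (1 - u) (c + b')) i"
      by (simp add: ab b' algebra_simps)
  qed
  also have "\<dots> \<in> A" using A ab b' u by (intro cvxD) (auto simp: core_def)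
  finally show "y \<in> dil c (1 + \<epsilon> / \<delta>) A" using dil_iff[of "1+s" y c A] s by (simp add: s_def[symmetric] u_def)
qed

text \<open>Both A and B lie between the dilates of A by 1/(1+s) and 1+s, where s =
  \<epsilon>/\<delta>, so the two integrands differ only on the shell between these dilates.\<close>

lemma mom_close:
  assumes A: "body d A" "core d A c \<delta>" and B: "body d B" "core d B c \<delta>" and e: "0 \<le> \<epsilon>"
    and AB: "A \<subseteq> par d B \<epsilon>" "B \<subseteq> par d A \<epsilon>"
    and \<phi>: "continuous_on UNIV \<phi>" and M: "\<And>x. x \<in> dil c (1 + \<epsilon> / \<delta>) A \<Longrightarrow> \<bar>\<phi> x\<bar> \<le> M"
  shows "\<bar>mom d \<phi> B - mom d \<phi> A\<bar> \<le> M * (measure (rdm d) A * ((1 + \<epsilon>/\<delta>) ^ d - (1 / (1 + \<epsilon>/\<delta>)) ^ d))"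
proof -
  define s where "s = \<epsilon> / \<delta>"
  have \<delta>: "0 < \<delta>" "c \<in> Rd d" using A by (auto simp: core_def)
  have s: "0 \<le> s" using e \<delta> by (simp add: s_def)
  let ?U = "dil c (1 + s) A" and ?D = "dil c (1/(1+s)) A"
  have bo: "A \<in> sets borel" "B \<in> sets borel" "?U \<in> sets borel" "?D \<in> sets borel"
    using bodyD[OF A(1)] bodyD[OF B(1)] s by (auto intro!: dil_borel)
  have cA: "c \<in> A" using core_center A by blast
  have "A \<subseteq> dil c (1 + s) B" using AB(1) par_sub_dil[OF bodyD(3)[OF B(1)] B(2) e] by (auto simp: s_def)
  then have "?D \<subseteq> dil c (1/(1+s)) (dil c (1 + s) B)" by (rule dil_mono)
  also have "\<dots> = B" using s by (simp add: dil_dil)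
  finally have DB: "?D \<subseteq> B" .
  have DA: "?D \<subseteq> A" using s bodyD[OF A(1)] by (intro dil_sub cA) auto
  have BU: "B \<subseteq> ?U" using AB(2) par_sub_dil[OF bodyD(3)[OF A(1)] A(2) e] by (auto simp: s_def)
  have "A = dil c (1+s) ?D" using s by (simp add: dil_dil)
  then have AU: "A \<subseteq> ?U" using dil_mono[OF DA, of c "1+s"] by simp
  have fin: "emeasure (rdm d) ?U < \<infinity>"
    using s \<delta> bodyD[OF A(1)] body_emeasure_finite[OF A(1)] by (simp add: emeasure_dil ennreal_mult_less_top)
  have i1: "integrable (rdm d) (\<lambda>x. indicator A x * \<phi> x)" "integrable (rdm d) (\<lambda>x. indicator B x * \<phi> x)"
    using bodyD[OF A(1)] bodyD[OF B(1)] \<phi> by (auto intro: integrable_compact)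
  have finD: "emeasure (rdm d) ?D < \<infinity>" using emeasure_mono[of ?D ?U "rdm d"] DA AU bo fin by (auto intro: order_le_less_trans)
  have i2: "integrable (rdm d) (\<lambda>x. M * (indicator ?U x - indicator ?D x))"
    using fin finD bo by (intro integrable_mult_right Bochner_Integration.integrable_diff integrable_real_indicator) auto
  have "\<bar>mom d \<phi> B - mom d \<phi> A\<bar> = \<bar>\<integral>x. indicator B x * \<phi> x - indicator A x * \<phi> x \<partial>rdm d\<bar>"
    using i1 by (simp add: mom_def)
  also have "\<dots> \<le> (\<integral>x. \<bar>indicator B x * \<phi> x - indicator A x * \<phi> x\<bar> \<partial>rdm d)"
    by (rule integral_abs_bound)
  also have "\<dots> \<le> (\<integral>x. M * (indicator ?U x - indicator ?D x) \<partial>rdm d)"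
  proof (rule integral_mono[OF _ i2])
    show "integrable (rdm d) (\<lambda>x. \<bar>indicator B x * \<phi> x - indicator A x * \<phi> x\<bar>)" using i1 by auto
    fix x
    show "\<bar>indicator B x * \<phi> x - indicator A x * \<phi> x\<bar> \<le> M * (indicator ?U x - indicator ?D x)"
      using M[of x] DA DB AU BU by (auto simp: indicator_def s_def[symmetric])
  qed
  also have "\<dots> = M * (measure (rdm d) ?U - measure (rdm d) ?D)"
    using fin finD bo by simp
  also have "\<dots> = M * (measure (rdm d) A * ((1 + s) ^ d - (1 / (1 + s)) ^ d))"
    using s \<delta> bo by (simp add: measure_dil algebra_simps)
  finally show ?thesis by (simp add: s_def)
qed

text \<open>The two inclusions express Hausdorff convergence; the common inner ball turns it into
  the quantitative bound of \<open>mom_close\<close>, whose right side tends to 0.\<close>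

lemma mom_tendsto:
  assumes A: "body d A" "core d A c \<delta>" and \<phi>: "continuous_on UNIV \<phi>"
    and \<epsilon>: "(\<epsilon> \<longlongrightarrow> 0) F"
    and ev: "eventually (\<lambda>n. body d (X n) \<and> core d (X n) c \<delta> \<and> 0 \<le> \<epsilon> n \<and> A \<subseteq> par d (X n) (\<epsilon> n) \<and> X n \<subseteq> par d A (\<epsilon> n)) F"
  shows "((\<lambda>n. mom d \<phi> (X n)) \<longlongrightarrow> mom d \<phi> A) F"
proof -
  have \<delta>: "0 < \<delta>" "c \<in> Rd d" using A by (auto simp: core_def)
  \<comment> \<open>Eventually \<epsilon> < \<delta>, so that all outer dilates lie in this one
    compact set and \<phi> has a common bound.\<close>
  have "compact (\<phi> ` dil c 2 A)" using bodyD[OF A(1)] \<phi>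
    by (intro compact_continuous_image compact_dil) (auto intro: continuous_on_subset)
  then have "bounded (\<phi> ` dil c 2 A)" by (rule compact_imp_bounded)
  then obtain M where M: "\<forall>x\<in>dil c 2 A. \<bar>\<phi> x\<bar> \<le> M" by (auto simp: bounded_iff)
  have lim: "((\<lambda>n. M * (measure (rdm d) A * ((1 + \<epsilon> n/\<delta>) ^ d - (1 / (1 + \<epsilon> n/\<delta>)) ^ d))) \<longlongrightarrow> M * (measure (rdm d) A * ((1 + 0/\<delta>) ^ d - (1 / (1 + 0/\<delta>)) ^ d))) F"
    using \<delta> by (intro tendsto_intros \<epsilon>) auto
  have "eventually (\<lambda>n. \<epsilon> n < \<delta>) F" by (rule order_tendstoD(2)[OF \<epsilon> \<delta>(1)])
  with ev have "eventually (\<lambda>n. \<bar>mom d \<phi> (X n) - mom d \<phi> A\<bar> \<le> M * (measure (rdm d) A * ((1 + \<epsilon> n/\<delta>) ^ d - (1 / (1 + \<epsilon> n/\<delta>)) ^ d))) F"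
  proof eventually_elim
    case (elim n)
    then have en: "0 \<le> \<epsilon> n / \<delta>" "\<epsilon> n / \<delta> \<le> 1" using \<delta> by auto
    have "dil c (1 + \<epsilon> n / \<delta>) A = dil c 2 (dil c ((1 + \<epsilon> n / \<delta>) / 2) A)"
      unfolding dil_dil by (rule arg_cong[where f="\<lambda>t. dil c t A"]) simp
    also have "\<dots> \<subseteq> dil c 2 A"
      using en bodyD[OF A(1)] core_center[OF A(2)] by (intro dil_mono dil_sub) auto
    finally have sub: "dil c (1 + \<epsilon> n / \<delta>) A \<subseteq> dil c 2 A" .
    show ?case
      by (rule mom_close[OF A _ _ _ _ _ \<phi>]) (use elim M sub in auto)
  qed
  then have "eventually (\<lambda>n. norm (mom d \<phi> (X n) - mom d \<phi> A) \<le> M * (measure (rdm d) A * ((1 + \<epsilon> n/\<delta>) ^ d - (1 / (1 + \<epsilon> n/\<delta>)) ^ d))) F"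
    by (simp only: real_norm_def)
  moreover have "((\<lambda>n. M * (measure (rdm d) A * ((1 + \<epsilon> n/\<delta>) ^ d - (1 / (1 + \<epsilon> n/\<delta>)) ^ d))) \<longlongrightarrow> 0) F"
    using lim by simp
  ultimately have "((\<lambda>n. mom d \<phi> (X n) - mom d \<phi> A) \<longlongrightarrow> 0) F"
    by (rule Lim_null_comparison)
  then show ?thesis by (rule LIM_zero_cancel)
qed

lemma mom_const: "A \<in> sets borel \<Longrightarrow> mom d (\<lambda>_. 1) A = measure (rdm d) A"
  by (simp add: mom_def)

section \<open>The Prekopa-Leindler inequality\<close>

lemma upd_measurable:
  assumes g: "g \<in> borel_measurable borel"
  shows "(\<lambda>(x, t). g ((x::vec)(i := t))) \<in> borel_measurable (borel \<Otimes>\<^sub>M lborel)"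
proof -
  have "(\<lambda>p. (fst p :: vec)(i := snd p)) \<in> borel_measurable (borel \<Otimes>\<^sub>M lborel)"
  proof (rule borel_measurable_vecI)
    fix j :: nat
    have "(\<lambda>p. (fst p :: vec) j) \<in> borel_measurable (borel \<Otimes>\<^sub>M (lborel::real measure))"
      by (rule measurable_compose[OF measurable_fst borel_measurable_coord])
    then show "(\<lambda>p. ((fst p :: vec)(i := snd p)) j) \<in> borel_measurable (borel \<Otimes>\<^sub>M lborel)"
      by (cases "j = i") auto
  qed
  from measurable_compose[OF this g] show ?thesis by (simp only: case_prod_beta')
qed

text \<open>Fubini for the last coordinate: almost every point of \<open>rdm n\<close> vanishes at
  n, and x(n := t) runs through the space of one dimension more. This carries the induction in
  \<open>prekopa_marginal\<close>.\<close>

lemma nn_integral_rdm_Suc: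
  assumes g [measurable]: "g \<in> borel_measurable borel"
  shows "(\<integral>\<^sup>+x. g x \<partial>rdm (Suc n)) = (\<integral>\<^sup>+x. \<integral>\<^sup>+t. g (x(n := t)) \<partial>lborel \<partial>rdm n)"
proof -
  interpret product_sigma_finite "\<lambda>_. lborel::real measure" by (rule product_sigma_finite_lborel)
  have leb: "leb (Suc n) = Pi\<^sub>M (insert n {..<n}) (\<lambda>_. lborel)" by (simp only: leb_def lessThan_Suc)
  have emb_upd: "emb (Suc n) (x(n := t)) = (emb n x)(n := t)" for x t
    by (auto simp: emb_def)
  have "(\<integral>\<^sup>+x. g x \<partial>rdm (Suc n)) = (\<integral>\<^sup>+x. g (emb (Suc n) x) \<partial>leb (Suc n))"
    unfolding rdm_def by (rule nn_integral_distr) simp_all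
  also have "\<dots> = (\<integral>\<^sup>+x. \<integral>\<^sup>+t. g (emb (Suc n) (x(n := t))) \<partial>lborel \<partial>leb n)"
    unfolding leb leb_def[of n]
  proof (rule product_nn_integral_insert)
    show "(\<lambda>x. g (emb (Suc n) x)) \<in> borel_measurable (Pi\<^sub>M (insert n {..<n}) (\<lambda>_. lborel))"
      unfolding leb[symmetric] by measurable
  qed auto
  also have "\<dots> = (\<integral>\<^sup>+x. \<integral>\<^sup>+t. g ((emb n x)(n := t)) \<partial>lborel \<partial>leb n)" by (simp only: emb_upd)
  also have "\<dots> = (\<integral>\<^sup>+x. \<integral>\<^sup>+t. g (x(n := t)) \<partial>lborel \<partial>rdm n)"
  proof -
    have "(\<lambda>x. \<integral>\<^sup>+t. g (x(n := t)) \<partial>lborel) \<in> borel_measurable borel"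
      by (intro lborel.borel_measurable_nn_integral upd_measurable g)
    then show ?thesis unfolding rdm_def by (subst nn_integral_distr) simp_all
  qed
  finally show ?thesis .
qed

lemma nn_integral_rdm_0:
  assumes g: "g \<in> borel_measurable borel"
  shows "(\<integral>\<^sup>+x. g x \<partial>rdm 0) = g 0"
proof -
  have "leb 0 = count_space {\<lambda>_. undefined}" by (simp add: leb_def PiM_empty)
  moreover have "emb 0 x = 0" for x by (auto simp: emb_def)
  ultimately show ?thesis
    unfolding rdm_def using g by (subst nn_integral_distr) (auto simp: nn_integral_count_space_finite)
qed

text \<open>Fubini on the region 0 < c < u x. Negative values of u contribute nothing on either
  side, because \<open>ennreal\<close> cuts them off.\<close>

lemma layer_cake:
  assumes "sigma_finite_measure M" and u [measurable]: "u \<in> borel_measurable M"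
  shows "(\<integral>\<^sup>+x. ennreal (u x) \<partial>M) = (\<integral>\<^sup>+c. indicator {0<..} c * emeasure M {x\<in>space M. c < u x} \<partial>lborel)"
proof -
  interpret sigma_finite_measure M by fact
  interpret pair_sigma_finite M lborel by unfold_locales
  have "(\<integral>\<^sup>+x. ennreal (u x) \<partial>M) = (\<integral>\<^sup>+x. \<integral>\<^sup>+c. indicator {c. 0 < c \<and> c < u x} c \<partial>lborel \<partial>M)"
  proof (rule nn_integral_cong)
    fix x
    have "{c. 0 < c \<and> c < u x} = {0<..<u x}" by auto
    then show "ennreal (u x) = (\<integral>\<^sup>+c. indicator {c. 0 < c \<and> c < u x} c \<partial>lborel)"
      by (cases "0 \<le> u x") (auto simp: ennreal_neg)
  qed
  also have "\<dots> = (\<integral>\<^sup>+x. \<integral>\<^sup>+c. indicator {0<..} c * indicator {x\<in>space M. c < u x} x \<partial>lborel \<partial>M)"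
    by (intro nn_integral_cong) (auto simp: indicator_def)
  also have "\<dots> = (\<integral>\<^sup>+c. \<integral>\<^sup>+x. indicator {0<..} c * indicator {x\<in>space M. c < u x} x \<partial>M \<partial>lborel)"
  proof (rule Fubini'[symmetric])
    have "(\<lambda>(x, c). indicator {0<..} c * indicator {z. snd z < u (fst z)} (x, c) :: ennreal) \<in> borel_measurable (M \<Otimes>\<^sub>M lborel)"
      by (simp add: case_prod_beta') measurable
    also have "?this \<longleftrightarrow> (\<lambda>(x, c). indicator {0<..} c * indicator {x \<in> space M. c < u x} x :: ennreal) \<in> borel_measurable (M \<Otimes>\<^sub>M lborel)"
      by (intro measurable_cong) (auto simp: indicator_def space_pair_measure)
    finally show "(\<lambda>(x, c). indicator {0<..} c * indicator {x \<in> space M. c < u x} x :: ennreal) \<in> borel_measurable (M \<Otimes>\<^sub>M lborel)" .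
  qed
  also have "\<dots> = (\<integral>\<^sup>+c. indicator {0<..} c * emeasure M {x\<in>space M. c < u x} \<partial>lborel)"
    by (intro nn_integral_cong) (simp add: nn_integral_cmult)
  finally show ?thesis .
qed

lemma weighted_am_gm:
  fixes a b t :: real
  assumes "0 \<le> a" "0 \<le> b" "0 < t" "t < 1"
  shows "a powr (1 - t) * b powr t \<le> (1 - t) * a + t * b"
proof (cases "a = 0 \<or> b = 0")
  case True then show ?thesis using assms by auto
next
  case False
  then have ab: "0 < a" "0 < b" using assms by auto
  have "(1 - t) * ln a + t * ln b \<le> ln ((1 - t) * a + t * b)"
    using concave_onD[OF ln_concave, of t a b] ab assms by simp
  then have "exp ((1 - t) * ln a + t * ln b) \<le> (1 - t) * a + t * b"
    using ab assms by (metis add_pos_pos diff_gt_0_iff_gt exp_le_cancel_iff exp_ln mult_pos_pos)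
  then show ?thesis using ab by (simp add: powr_def exp_add)
qed

lemma ennreal_combination:
  "0 \<le> a \<Longrightarrow> 0 \<le> b \<Longrightarrow> 0 < t \<Longrightarrow> t < 1 \<Longrightarrow> ennreal (1 - t) * ennreal a + ennreal t * ennreal b = ennreal ((1 - t) * a + t * b)"
  by (simp add: ennreal_mult')

text \<open>Lengths are differences of extrema, and every point strictly between the combined
  extrema is the combination of points at equal relative position \<theta> in A and B.\<close>

lemma interval_combination:
  fixes A B C :: "real set"
  assumes A: "is_interval A" "A \<noteq> {}" "bounded A" and B: "is_interval B" "B \<noteq> {}" "bounded B"
    and C: "C \<in> sets borel" and t: "0 < t" "t < 1"
    and sub: "\<And>a b. a \<in> A \<Longrightarrow> b \<in> B \<Longrightarrow> (1 - t) * a + t * b \<in> C"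
  shows "ennreal (1 - t) * emeasure lborel A + ennreal t * emeasure lborel B \<le> emeasure lborel C"
proof -
  have *: "A \<subseteq> {Inf A..Sup A} \<and> {Inf A<..<Sup A} \<subseteq> A \<and> Inf A \<le> Sup A \<and> (Inf A = Sup A \<longrightarrow> Inf A \<in> A)"
    if A: "is_interval A" "A \<noteq> {}" "bounded A" for A :: "real set"
  proof -
    have bd: "bdd_above A" "bdd_below A" using A by (auto simp: bounded_imp_bdd_above bounded_imp_bdd_below)
    have 1: "A \<subseteq> {Inf A..Sup A}" using bd by (auto intro: cInf_lower cSup_upper)
    have 2: "{Inf A<..<Sup A} \<subseteq> A"
    proof
      fix z assume z: "z \<in> {Inf A<..<Sup A}"
      then obtain p q where "p \<in> A" "p < z" "q \<in> A" "z < q"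
        using A bd by (meson cInf_lessD greaterThanLessThan_iff less_cSupD)
      then show "z \<in> A" using A(1) by (meson is_interval_1 less_imp_le)
    qed
    obtain p where "p \<in> A" using A by blast
    then show ?thesis using 1 2 by force
  qed
  note a = *[OF A] and b = *[OF B]
  let ?lo = "(1 - t) * Inf A + t * Inf B" and ?hi = "(1 - t) * Sup A + t * Sup B"
  have lohi: "?lo \<le> ?hi" using a b t by (intro add_mono mult_left_mono) auto
  have "{?lo<..<?hi} \<subseteq> C"
  proof
    fix z assume z: "z \<in> {?lo<..<?hi}"
    define \<theta> where "\<theta> = (z - ?lo) / (?hi - ?lo)"
    have \<theta>: "0 < \<theta>" "\<theta> < 1" "z = (1 - \<theta>) * ?lo + \<theta> * ?hi"
      using z by (auto simp: \<theta>_def divide_simps) (auto simp: field_simps)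
    \<comment> \<open>For a degenerate interval the point is its infimum, which belongs to it;
      otherwise 0 < \<theta> < 1 keeps the point off the endpoints, which may be missing.\<close>
    have mem: "(1 - \<theta>) * Inf A + \<theta> * Sup A \<in> A" if A: "is_interval A" "A \<noteq> {}" "bounded A" for A
    proof (cases "Inf A = Sup A")
      case True
      then have "(1 - \<theta>) * Inf A + \<theta> * Sup A = Inf A" by (simp add: algebra_simps)
      then show ?thesis using *[OF A] True by metis
    next
      case False
      with *[OF A] have "Inf A < Sup A" by auto
      then have "\<theta> * Inf A < \<theta> * Sup A" "(1 - \<theta>) * Inf A < (1 - \<theta>) * Sup A" using \<theta> by auto
      then have "(1 - \<theta>) * Inf A + \<theta> * Sup A \<in> {Inf A<..<Sup A}" by (auto simp: algebra_simps)
      then show ?thesis using *[OF A] by blast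
    qed
    have "z = (1 - t) * ((1 - \<theta>) * Inf A + \<theta> * Sup A) + t * ((1 - \<theta>) * Inf B + \<theta> * Sup B)"
      unfolding \<theta>(3) by (simp add: algebra_simps)
    then show "z \<in> C" using sub[OF mem[OF A] mem[OF B]] by simp
  qed
  then have "emeasure lborel {?lo<..<?hi} \<le> emeasure lborel C" using C by (intro emeasure_mono) auto
  then have "ennreal (?hi - ?lo) \<le> emeasure lborel C" using lohi by simp
  moreover have mA: "emeasure lborel A \<le> ennreal (Sup A - Inf A)"
    using emeasure_mono[of A "{Inf A..Sup A}" lborel] a by simp
  moreover have mB: "emeasure lborel B \<le> ennreal (Sup B - Inf B)"
    using emeasure_mono[of B "{Inf B..Sup B}" lborel] b by simp
  moreover have "ennreal (1 - t) * ennreal (Sup A - Inf A) + ennreal t * ennreal (Sup B - Inf B) = ennreal (?hi - ?lo)"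
  proof -
    have "(1 - t) * (Sup A - Inf A) + t * (Sup B - Inf B) = ?hi - ?lo" by (simp add: algebra_simps)
    then show ?thesis using a b t by (subst ennreal_combination) auto
  qed
  moreover have "ennreal (1 - t) * emeasure lborel A + ennreal t * emeasure lborel B
      \<le> ennreal (1 - t) * ennreal (Sup A - Inf A) + ennreal t * ennreal (Sup B - Inf B)"
    by (intro add_mono mult_left_mono mA mB zero_le)
  ultimately show ?thesis by simp
qed

text \<open>The one-dimensional Prekopa-Leindler inequality; superlevel sets are assumed to be intervals, which
  reduces the Brunn-Minkowski step to a triviality.\<close>

lemma prekopa_leindler_1:
  fixes f g h :: "real \<Rightarrow> real"
  assumes meas [measurable]: "f \<in> borel_measurable borel" "g \<in> borel_measurable borel" "h \<in> borel_measurable borel"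
    and nn: "\<And>x. 0 \<le> f x" "\<And>x. 0 \<le> g x" "\<And>x. 0 \<le> h x"
    and bd: "\<And>x. f x \<le> M" "\<And>x. g x \<le> M" "\<And>x. h x \<le> M"
    and supp: "\<And>x. R < \<bar>x\<bar> \<Longrightarrow> f x = 0" "\<And>x. R < \<bar>x\<bar> \<Longrightarrow> g x = 0" "\<And>x. R < \<bar>x\<bar> \<Longrightarrow> h x = 0"
    and lev: "\<And>c. 0 \<le> c \<Longrightarrow> is_interval {x. c < f x}" "\<And>c. 0 \<le> c \<Longrightarrow> is_interval {x. c < g x}"
    and t: "0 < t" "t < 1"
    and fgh: "\<And>x y. f x powr (1 - t) * g y powr t \<le> h ((1 - t) * x + t * y)"
  shows "(\<integral>x. f x \<partial>lborel) powr (1 - t) * (\<integral>x. g x \<partial>lborel) powr t \<le> (\<integral>x. h x \<partial>lborel)"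
proof -
  have int: "integrable lborel u" if [measurable]: "u \<in> borel_measurable borel" and u: "\<And>x. 0 \<le> u x" "\<And>x. u x \<le> M" "\<And>x. R < \<bar>x\<bar> \<Longrightarrow> u x = 0" for u :: "real \<Rightarrow> real"
  proof (rule Bochner_Integration.integrable_bound)
    show "integrable lborel (\<lambda>x. M * indicator {-\<bar>R\<bar>..\<bar>R\<bar>} x)"
      by (intro integrable_mult_right integrable_real_indicator) auto
    have *: "norm (u x) \<le> norm (M * indicator {-\<bar>R\<bar>..\<bar>R\<bar>} x)" for x
      using u(1,2)[of x] u(3)[of x] by (auto simp: indicator_def abs_le_iff not_le)
    show "AE x in lborel. norm (u x) \<le> norm (M * indicator {-\<bar>R\<bar>..\<bar>R\<bar>} x)"
      by (rule AE_I2) (rule *)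
  qed auto
  note ints = int[OF meas(1) nn(1) bd(1) supp(1)] int[OF meas(2) nn(2) bd(2) supp(2)] int[OF meas(3) nn(3) bd(3) supp(3)]
  have nnint: "0 \<le> (\<integral>x. f x \<partial>lborel)" "0 \<le> (\<integral>x. g x \<partial>lborel)" "0 \<le> (\<integral>x. h x \<partial>lborel)" using nn by simp_all
  show ?thesis
  proof (cases "(\<integral>x. f x \<partial>lborel) = 0 \<or> (\<integral>x. g x \<partial>lborel) = 0")
    case True then show ?thesis using nnint by auto
  next
    case False
    \<comment> \<open>Division by the suprema makes the superlevel sets of f and g nonempty for the
      same levels, those in (0,1); the combination of sets has to be applied to nonempty
      ones.\<close>
    define F where "F = (SUP x. f x)"
    define G where "G = (SUP x. g x)"
    have bdd: "bdd_above (range f)" "bdd_above (range g)" using bd by (auto intro!: bdd_aboveI)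
    have le: "f x \<le> F" "g x \<le> G" for x unfolding F_def G_def using bdd by (auto intro: cSUP_upper)
    have "\<exists>x. 0 < f x" using False nn(1) by (metis (no_types, lifting) integral_zero less_le Bochner_Integration.integral_cong)
    then have F: "0 < F" using le(1) order_less_le_trans by blast
    have "\<exists>x. 0 < g x" using False nn(2) by (metis (no_types, lifting) integral_zero less_le Bochner_Integration.integral_cong)
    then have G: "0 < G" using le(2) order_less_le_trans by blast
    define H where "H = F powr (1 - t) * G powr t"
    have H: "0 < H" using F G by (simp add: H_def)
    have lc: "(\<integral>\<^sup>+x. ennreal (u x / U) \<partial>lborel) = (\<integral>\<^sup>+c. indicator {0<..} c * emeasure lborel {x. c < u x / U} \<partial>lborel)"
      if [measurable]: "u \<in> borel_measurable borel" for u :: "real \<Rightarrow> real" and U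
      using layer_cake[OF sigma_finite_lborel, of "\<lambda>x. u x / U"] by simp
    have key: "ennreal (1 - t) * (indicator {0<..} c * emeasure lborel {x. c < f x / F}) + ennreal t * (indicator {0<..} c * emeasure lborel {x. c < g x / G})
        \<le> indicator {0<..} c * emeasure lborel {x. c < h x / H}" for c
    proof (cases "0 < c \<and> c < 1")
      case False
      have "f x / F \<le> 1" "g x / G \<le> 1" for x using le F G by auto
      then have "0 < c \<Longrightarrow> \<not> c < f x / F" "0 < c \<Longrightarrow> \<not> c < g x / G" for x
        using False by (meson le_less_trans not_less order_trans)+
      then show ?thesis by (auto simp: indicator_def)
    next
      case True
      have bdd': "bounded {x. c < u x / U}" if "\<And>x. R < \<bar>x\<bar> \<Longrightarrow> u x = 0" for u :: "real \<Rightarrow> real" and U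
        using that True by (intro boundedI[of _ R]) (force simp: not_less[symmetric])
      have eq: "{x. c < f x / F} = {x. c * F < f x}" "{x. c < g x / G} = {x. c * G < g x}"
        using F G by (auto simp: field_simps)
      have cF: "c * F < F" "c * G < G" using True F G by auto
      have ne: "{x. c * F < f x} \<noteq> {}" "{x. c * G < g x} \<noteq> {}"
        using less_cSUP_iff[OF _ bdd(1), of "c * F"] less_cSUP_iff[OF _ bdd(2), of "c * G"] cF by (auto simp: F_def[symmetric] G_def[symmetric])
      have "ennreal (1 - t) * emeasure lborel {x. c < f x / F} + ennreal t * emeasure lborel {x. c < g x / G} \<le> emeasure lborel {x. c < h x / H}"
      proof (rule interval_combination[OF _ _ _ _ _ _ _ t])
        show "is_interval {x. c < f x / F}" "is_interval {x. c < g x / G}" unfolding eq using lev True F G by auto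
        show "{x. c < f x / F} \<noteq> {}" "{x. c < g x / G} \<noteq> {}" unfolding eq by (fact ne)+
        show "bounded {x. c < f x / F}" "bounded {x. c < g x / G}" using bdd' supp by auto
        show "{x. c < h x / H} \<in> sets borel" by measurable
        fix x y assume xy: "x \<in> {x. c < f x / F}" "y \<in> {x. c < g x / G}"
        have "c = c powr (1 - t) * c powr t" using True by (simp add: powr_add[symmetric])
        then have "c * H = (c * F) powr (1 - t) * (c * G) powr t"
          using True F G by (simp add: H_def powr_mult mult_ac)
        also have "\<dots> < f x powr (1 - t) * g y powr t"
        proof (rule mult_strict_mono)
          have "0 < c * F" "0 < c * G" using True F G by auto
          then show "(c * F) powr (1 - t) < f x powr (1 - t)" "(c * G) powr t < g y powr t" "0 < f x powr (1 - t)"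
            using xy t unfolding eq by (auto intro!: powr_less_mono2)
        qed simp
        also have "\<dots> \<le> h ((1 - t) * x + t * y)" by (rule fgh)
        finally show "(1 - t) * x + t * y \<in> {x. c < h x / H}" using H by (simp add: field_simps)
      qed
      then show ?thesis using True by simp
    qed
    have "ennreal (1 - t) * (\<integral>\<^sup>+x. ennreal (f x / F) \<partial>lborel) + ennreal t * (\<integral>\<^sup>+x. ennreal (g x / G) \<partial>lborel)
        = (\<integral>\<^sup>+c. ennreal (1 - t) * (indicator {0<..} c * emeasure lborel {x. c < f x / F}) + ennreal t * (indicator {0<..} c * emeasure lborel {x. c < g x / G}) \<partial>lborel)"
      unfolding lc[OF meas(1)] lc[OF meas(2)]
      by (subst nn_integral_add) (auto simp: nn_integral_cmult)
    also have "\<dots> \<le> (\<integral>\<^sup>+x. ennreal (h x / H) \<partial>lborel)"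
      unfolding lc[OF meas(3)] by (intro nn_integral_mono key)
    finally have le: "ennreal (1 - t) * (\<integral>\<^sup>+x. ennreal (f x / F) \<partial>lborel) + ennreal t * (\<integral>\<^sup>+x. ennreal (g x / G) \<partial>lborel) \<le> (\<integral>\<^sup>+x. ennreal (h x / H) \<partial>lborel)" .
    have nni: "(\<integral>\<^sup>+x. ennreal (u x / U) \<partial>lborel) = ennreal ((\<integral>x. u x \<partial>lborel) / U)"
      if "integrable lborel u" "\<And>x. 0 \<le> u x" "0 < U" for u :: "real \<Rightarrow> real" and U
      using that by (subst nn_integral_eq_integral) auto
    let ?f = "\<integral>x. f x \<partial>lborel" and ?g = "\<integral>x. g x \<partial>lborel" and ?h = "\<integral>x. h x \<partial>lborel"
    have "(1 - t) * (?f / F) + t * (?g / G) \<le> ?h / H"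
    proof -
      have "ennreal (1 - t) * ennreal (?f / F) + ennreal t * ennreal (?g / G) \<le> ennreal (?h / H)"
      proof -
        have e1: "(\<integral>\<^sup>+x. ennreal (f x / F) \<partial>lborel) = ennreal (?f / F)" by (rule nni[OF ints(1) nn(1) F])
        have e2: "(\<integral>\<^sup>+x. ennreal (g x / G) \<partial>lborel) = ennreal (?g / G)" by (rule nni[OF ints(2) nn(2) G])
        have e3: "(\<integral>\<^sup>+x. ennreal (h x / H) \<partial>lborel) = ennreal (?h / H)" by (rule nni[OF ints(3) nn(3) H])
        show ?thesis using le by (simp only: e1 e2 e3)
      qed
      moreover have "ennreal (1 - t) * ennreal (?f / F) + ennreal t * ennreal (?g / G) = ennreal ((1 - t) * (?f / F) + t * (?g / G))"
        by (rule ennreal_combination) (use t nnint F G in auto)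
      moreover have "0 \<le> ?h / H" using nnint H by simp
      ultimately show ?thesis by (metis ennreal_le_iff)
    qed
    \<comment> \<open>Integration over the levels gives an arithmetic mean of the normalized
      integrals; the arithmetic-geometric inequality weakens it to the geometric mean, from which
      the normalization H cancels.\<close>
    moreover have "(?f / F) powr (1 - t) * (?g / G) powr t \<le> (1 - t) * (?f / F) + t * (?g / G)"
      using nnint F G t by (intro weighted_am_gm) auto
    moreover have "(?f / F) powr (1 - t) * (?g / G) powr t = (?f powr (1 - t) * ?g powr t) / H"
      using nnint F G by (simp add: H_def powr_divide)
    ultimately have "(?f powr (1 - t) * ?g powr t) / H \<le> ?h / H" by linarith
    then show ?thesis using H by (simp add: divide_le_cancel)
  qed
qed

text \<open>One family \<phi> that is log-concave jointly in the parameter and the point, instead of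
  three functions: integrating out the last coordinate gives a family of the same kind, so the
  induction closes. The bound M grows by the factor 2|R| in each step and is therefore
  generalized.\<close>

theorem prekopa_marginal:
  fixes \<phi> :: "real \<Rightarrow> vec \<Rightarrow> real"
  assumes "\<And>s. \<phi> s \<in> borel_measurable borel" "\<And>s x. 0 \<le> \<phi> s x" "\<And>s x. \<phi> s x \<le> M"
    "\<And>s x i. i < n \<Longrightarrow> R < \<bar>x i\<bar> \<Longrightarrow> \<phi> s x = 0"
    and t: "0 < t" "t < 1"
    and "\<And>s s' x x' t. 0 < t \<Longrightarrow> t < 1 \<Longrightarrow>
        \<phi> s x powr (1 - t) * \<phi> s' x' powr t \<le> \<phi> ((1 - t) * s + t * s') (smul (1 - t) x + smul t x')"
  shows "(\<integral>x. \<phi> s x \<partial>rdm n) powr (1 - t) * (\<integral>x. \<phi> s' x \<partial>rdm n) powr t \<le> (\<integral>x. \<phi> ((1 - t) * s + t * s') x \<partial>rdm n)"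
  using assms(1-4,7)
proof (induction n arbitrary: \<phi> M)
  case 0
  have "(\<integral>x. \<phi> s x \<partial>rdm 0) = \<phi> s 0" for s
    using 0(1,2) by (simp add: integral_eq_nn_integral nn_integral_rdm_0)
  moreover have "smul (1 - t) 0 + smul t 0 = 0" by (auto simp: fun_eq_iff)
  ultimately show ?case using 0(5)[OF t, of s 0 s' 0] by (simp only:)
next
  case (Suc n)
  note meas [measurable] = Suc.prems(1)
  note nn = Suc.prems(2) and bd = Suc.prems(3) and supp = Suc.prems(4) and lc = Suc.prems(5)
  define \<psi> where "\<psi> = (\<lambda>s x. \<integral>y. \<phi> s (x(n := y)) \<partial>lborel)"
  have upd: "(\<lambda>y::real. (x::vec)(n := y)) \<in> borel_measurable borel" for x
    by (rule borel_measurable_vecI) (auto simp: fun_upd_def)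
  have m1 [measurable]: "(\<lambda>y. \<phi> s (x(n := y))) \<in> borel_measurable borel" for s x
    by (rule measurable_compose[OF upd meas])
  have i1: "integrable lborel (\<lambda>y. \<phi> s (x(n := y)))" for s x
  proof (rule Bochner_Integration.integrable_bound)
    show "integrable lborel (\<lambda>x. M * indicator {-\<bar>R\<bar>..\<bar>R\<bar>} x)"
      by (intro integrable_mult_right integrable_real_indicator) auto
    have ab: "norm v \<le> norm (M * indicator {-\<bar>R\<bar>..\<bar>R\<bar>} y)" if "0 \<le> v" "v \<le> M" "R < \<bar>y\<bar> \<Longrightarrow> v = 0" for v y :: real
      using that by (auto simp: indicator_def not_le)
    have *: "norm (\<phi> s (x(n := y))) \<le> norm (M * indicator {-\<bar>R\<bar>..\<bar>R\<bar>} y)" for y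
      by (intro ab nn bd supp[of n]) simp_all
    show "AE y in lborel. norm (\<phi> s (x(n := y))) \<le> norm (M * indicator {-\<bar>R\<bar>..\<bar>R\<bar>} y)"
      by (rule AE_I2) (rule *)
  qed auto
  have \<psi>m [measurable]: "\<psi> s \<in> borel_measurable borel" for s
    unfolding \<psi>_def by (intro lborel.borel_measurable_lebesgue_integral upd_measurable meas)
  have \<psi>0: "0 \<le> \<psi> s x" for s x using nn by (simp add: \<psi>_def)
  have \<psi>M: "\<psi> s x \<le> M * (2 * \<bar>R\<bar>)" for s x
  proof -
    have "\<psi> s x \<le> (\<integral>y. M * indicator {-\<bar>R\<bar>..\<bar>R\<bar>} y \<partial>lborel)"
      unfolding \<psi>_def
    proof (rule integral_mono[OF i1])
      show "integrable lborel (\<lambda>x. M * indicator {-\<bar>R\<bar>..\<bar>R\<bar>} x)"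
        by (intro integrable_mult_right integrable_real_indicator) auto
      have ab: "v \<le> M * indicator {-\<bar>R\<bar>..\<bar>R\<bar>} y" if "0 \<le> v" "v \<le> M" "R < \<bar>y\<bar> \<Longrightarrow> v = 0" for v y :: real
        using that by (auto simp: indicator_def not_le)
      show "\<phi> s (x(n := y)) \<le> M * indicator {-\<bar>R\<bar>..\<bar>R\<bar>} y" for y
        by (intro ab nn bd supp[of n]) simp_all
    qed
    then show ?thesis by simp
  qed
  have \<psi>s: "\<psi> s x = 0" if "i < n" "R < \<bar>x i\<bar>" for s x i
  proof -
    have "\<phi> s (x(n := y)) = 0" for y using that by (intro supp[of i]) auto
    then show ?thesis by (simp add: \<psi>_def)
  qed
  have upd_comb: "smul (1 - t) (x(n := y)) + smul t (x'(n := y')) = (smul (1 - t) x + smul t x')(n := (1 - t) * y + t * y')"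
    for t x x' y y' by (auto simp: fun_eq_iff)
  have \<psi>lc: "\<psi> s x powr (1 - t) * \<psi> s' x' powr t \<le> \<psi> ((1 - t) * s + t * s') (smul (1 - t) x + smul t x')"
    if t: "0 < t" "t < 1" for s s' x x' t
    unfolding \<psi>_def
  proof (rule prekopa_leindler_1[OF m1 m1 m1 nn nn nn bd bd bd _ _ _ _ _ t])
    \<comment> \<open>Along a line the superlevel sets of a log-concave function are convex, which
      supplies the interval condition of the one-dimensional inequality.\<close>
    have lev: "is_interval {y. c < \<phi> s (x(n := y))}" if c: "0 \<le> c" for c s x
    proof -
      have "convex {y. c < \<phi> s (x(n := y))}"
        unfolding convex_alt
      proof (intro ballI allI impI)
        fix y y' u :: real assume y: "y \<in> {y. c < \<phi> s (x(n := y))}" "y' \<in> {y. c < \<phi> s (x(n := y))}" and u: "0 \<le> u \<and> u \<le> 1"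
        show "(1 - u) *\<^sub>R y + u *\<^sub>R y' \<in> {y. c < \<phi> s (x(n := y))}"
        proof (cases "u = 0 \<or> u = 1")
          case True then show ?thesis using y by auto
        next
          case False
          then have u: "0 < u" "u < 1" using u by auto
          have "c = c powr (1 - u) * c powr u" using c by (simp add: powr_add[symmetric])
          also have "\<dots> < \<phi> s (x(n := y)) powr (1 - u) * \<phi> s (x(n := y')) powr u"
            using y c u by (intro mult_strict_mono' powr_less_mono2) auto
          also have "\<dots> \<le> \<phi> ((1 - u) * s + u * s) (smul (1 - u) (x(n := y)) + smul u (x(n := y')))"
            by (rule lc[OF u])
          also have "smul (1 - u) (x(n := y)) + smul u (x(n := y')) = x(n := (1 - u) * y + u * y')"
            by (auto simp: fun_eq_iff algebra_simps)
          also have "(1 - u) * s + u * s = s" by (simp add: algebra_simps)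
          finally show ?thesis by (simp only: mem_Collect_eq real_scaleR_def)
        qed
      qed
      then show ?thesis by (simp add: is_interval_convex_1)
    qed
    show "is_interval {y. c < \<phi> s (x(n := y))}" "is_interval {y. c < \<phi> s' (x'(n := y))}" if "0 \<le> c" for c
      using lev that by auto
    show "\<phi> s (x(n := y)) powr (1 - t) * \<phi> s' (x'(n := y')) powr t
        \<le> \<phi> ((1 - t) * s + t * s') ((smul (1 - t) x + smul t x')(n := (1 - t) * y + t * y'))" for y y'
      using lc[OF t, of s "x(n := y)" s' "x'(n := y')"] by (simp only: upd_comb)
    show "\<phi> s (x(n := y)) = 0" "\<phi> s' (x'(n := y)) = 0"
      "\<phi> ((1 - t) * s + t * s') ((smul (1 - t) x + smul t x')(n := y)) = 0" if "R < \<bar>y\<bar>" for y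
      by (rule supp[of n]; use that in simp)+
  qed
  have eq: "(\<integral>x. \<phi> s x \<partial>rdm (Suc n)) = (\<integral>x. \<psi> s x \<partial>rdm n)" for s
  proof -
    have "(\<integral>\<^sup>+x. ennreal (\<phi> s x) \<partial>rdm (Suc n)) = (\<integral>\<^sup>+x. \<integral>\<^sup>+y. ennreal (\<phi> s (x(n := y))) \<partial>lborel \<partial>rdm n)"
      by (rule nn_integral_rdm_Suc) measurable
    also have "\<dots> = (\<integral>\<^sup>+x. ennreal (\<psi> s x) \<partial>rdm n)"
      unfolding \<psi>_def by (intro nn_integral_cong nn_integral_eq_integral i1) (auto simp: nn)
    finally show ?thesis
      using nn \<psi>0 by (simp add: integral_eq_nn_integral)
  qed
  show ?case
    unfolding eq by (rule Suc.IH[OF \<psi>m \<psi>0 \<psi>M \<psi>s \<psi>lc])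
qed

section \<open>Gruenbaum's inequality\<close>

text \<open>The unnormalized distribution function of \<open>ip d x v\<close> under the uniform
  measure on L.\<close>

definition lower :: "nat \<Rightarrow> vec \<Rightarrow> vec set \<Rightarrow> real \<Rightarrow> real" where
  "lower d v L s = measure (rdm d) (L \<inter> {x. ip d x v \<le> s})"

lemma closed_halfspace: "closed {x. ip d x v \<le> s}" "closed {x. s \<le> ip d x v}"
  by (intro closed_Collect_le continuous_on_ip continuous_on_id continuous_on_const)+

lemma halfspace_borel [measurable, simp]: "{x. ip d x v \<le> s} \<in> sets borel" "{x. s \<le> ip d x v} \<in> sets borel"
    "{x. ip d x v < s} \<in> sets borel" "{x. s < ip d x v} \<in> sets borel"
  by measurable

lemma body_halfspace: "body d L \<Longrightarrow> body d (L \<inter> {x. ip d x v \<le> s})"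
proof -
  assume L: "body d L"
  have "cvx (L \<inter> {x. ip d x v \<le> s})"
    unfolding cvx_def
  proof (intro ballI)
    fix x y and t :: real assume *: "x \<in> L \<inter> {x. ip d x v \<le> s}" "y \<in> L \<inter> {x. ip d x v \<le> s}" "t \<in> {0..1}"
    then have "smul (1 - t) x + smul t y \<in> L" using bodyD[OF L] by (intro cvxD) auto
    moreover have "(1 - t) * ip d x v + t * ip d y v \<le> (1 - t) * s + t * s"
      using * by (intro add_mono mult_left_mono) auto
    ultimately show "smul (1 - t) x + smul t y \<in> L \<inter> {x. ip d x v \<le> s}" by (simp add: ip_simps algebra_simps)
  qed
  then show ?thesis using L compact_Int_closed[OF bodyD(2)[OF L] closed_halfspace(1)]
    by (auto simp: body_def)
qed

text \<open>The set of pairs (s, x) with x in L and \<open>ip d x v\<close> at most s is convex, so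
  its indicator is jointly log-concave and the marginal theorem applies.\<close>

lemma lower_logconcave:
  assumes L: "body d L" and t: "0 < t" "t < 1"
  shows "lower d v L s powr (1 - t) * lower d v L s' powr t \<le> lower d v L ((1 - t) * s + t * s')"
proof -
  obtain R where R: "0 < R" "L \<subseteq> ballR d R" using body_bounded[OF L] .
  have [measurable]: "L \<in> sets borel" using bodyD[OF L] by simp
  define \<phi> where "\<phi> = (\<lambda>s x. indicator (L \<inter> {x. ip d x v \<le> s}) x :: real)"
  have eq: "(\<integral>x. \<phi> s x \<partial>rdm d) = lower d v L s" for s by (simp add: \<phi>_def lower_def)
  show ?thesis
    unfolding eq[symmetric]
  proof (rule prekopa_marginal[where M=1 and R=R, OF _ _ _ _ t])
    show "\<phi> s \<in> borel_measurable borel" for s unfolding \<phi>_def by measurable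
    show "\<phi> s x = 0" if "i < d" "R < \<bar>x i\<bar>" for s x i
      using that R coord_le_nrm[of i d x] by (auto simp: \<phi>_def indicator_def ballR_iff)
    show "\<phi> s x powr (1 - t) * \<phi> s' x' powr t \<le> \<phi> ((1 - t) * s + t * s') (smul (1 - t) x + smul t x')"
      if t: "0 < t" "t < 1" for s s' x x' t
    proof (cases "x \<in> L \<inter> {x. ip d x v \<le> s} \<and> x' \<in> L \<inter> {x. ip d x v \<le> s'}")
      case True
      have "(1 - t) * ip d x v + t * ip d x' v \<le> (1 - t) * s + t * s'"
        using True t by (intro add_mono mult_left_mono) auto
      moreover have "smul (1 - t) x + smul t x' \<in> L" using True t bodyD[OF L] by (intro cvxD) auto
      ultimately show ?thesis using True by (simp add: \<phi>_def ip_simps)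
    next
      case False
      then have "\<phi> s x = 0 \<or> \<phi> s' x' = 0" by (auto simp: \<phi>_def)
      moreover have "0 \<le> \<phi> ((1 - t) * s + t * s') (smul (1 - t) x + smul t x')" by (simp add: \<phi>_def)
      ultimately show ?thesis by auto
    qed
  qed (simp_all add: \<phi>_def)
qed

text \<open>The dilation with center a and factor t maps the part of L up to height u above a into
  the part up to height t u. It exchanges a shift of the level for a factor t^d; with -v in place of
  v it also serves the parts above a level.\<close>

lemma lower_dil:
  assumes L: "body d L" and a: "a \<in> L" and lam: "0 < t" "t \<le> 1"
  shows "t ^ d * lower d v L (ip d a v + u) \<le> lower d v L (ip d a v + t * u)"
proof -
  have aR: "a \<in> Rd d" using bodyD(1)[OF L] a by auto
  let ?S = "\<lambda>u. L \<inter> {x. ip d x v \<le> ip d a v + u}"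
  have "t ^ d * lower d v L (ip d a v + u) = measure (rdm d) (dil a t (?S u))"
    unfolding lower_def using bodyD(4)[OF L] lam aR by (subst measure_dil) auto
  also have "\<dots> \<le> measure (rdm d) (?S (t * u))"
  proof (rule measure_mono_fmeasurable)
    show "dil a t (?S u) \<subseteq> ?S (t * u)"
    proof
      fix y assume "y \<in> dil a t (?S u)"
      then obtain x where x: "x \<in> L" "ip d x v \<le> ip d a v + u" "y = a + smul t (x - a)" by (auto simp: dil_def)
      have "y = smul (1 - t) a + smul t x" by (auto simp: x fun_eq_iff algebra_simps)
      then have "y \<in> L" using x a bodyD[OF L] lam by (simp add: cvxD)
      moreover have "ip d y v = ip d a v + t * (ip d x v - ip d a v)" by (simp add: x ip_simps)
      moreover have "t * (ip d x v - ip d a v) \<le> t * u" using x lam by (intro mult_left_mono) auto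
      ultimately show "y \<in> ?S (t * u)" by simp
    qed
    show "dil a t (?S u) \<in> sets (rdm d)" using bodyD(4)[OF L] lam by (auto intro!: dil_borel)
  qed (rule body_fmeasurable[OF body_halfspace[OF L]])
  finally show ?thesis by (simp add: lower_def)
qed

lemma body_ip_extrema:
  assumes L: "body d L" and c: "core d L c \<delta>" and v: "v \<in> Rd d" "nrm d v = 1"
  obtains a b where "a \<in> L" "b \<in> L" "\<And>x. x \<in> L \<Longrightarrow> ip d a v \<le> ip d x v" "\<And>x. x \<in> L \<Longrightarrow> ip d x v \<le> ip d b v"
    "ip d a v + 2 * \<delta> \<le> ip d b v"
proof -
  have ne: "L \<noteq> {}" using core_center[OF c] by auto
  have cont: "continuous_on L (\<lambda>x. ip d x v)" by (intro continuous_on_ip continuous_on_id continuous_on_const)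
  obtain a where a: "a \<in> L" "\<And>x. x \<in> L \<Longrightarrow> ip d a v \<le> ip d x v"
    using continuous_attains_inf[OF bodyD(2)[OF L] ne cont] by auto
  obtain b where b: "b \<in> L" "\<And>x. x \<in> L \<Longrightarrow> ip d x v \<le> ip d b v"
    using continuous_attains_sup[OF bodyD(2)[OF L] ne cont] by auto
  have "c + smul r v \<in> L" if "\<bar>r\<bar> = \<delta>" for r
    using c v that by (auto simp: core_def ballR_iff Rd_smul nrm_smul)
  then have "c + smul \<delta> v \<in> L" "c + smul (- \<delta>) v \<in> L" using c by (auto simp: core_def)
  moreover have "ip d v v = 1" using v nrm_sq[of d v] by simp
  ultimately have "ip d c v + \<delta> \<le> ip d b v" "ip d a v \<le> ip d c v - \<delta>"
    using a(2)[of "c + smul (- \<delta>) v"] b(2)[of "c + smul \<delta> v"] by (auto simp: ip_simps)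
  then show ?thesis using a b by (intro that[of a b]) auto
qed

lemma exp_integral: "0 < \<beta> \<Longrightarrow> (\<integral>\<^sup>+c. indicator {0<..} c * ennreal (V * exp (- \<beta> * c)) \<partial>lborel) = ennreal (V / \<beta>)" if "0 \<le> V" for V \<beta> :: real
proof -
  assume \<beta>: "0 < \<beta>"
  have "(\<integral>\<^sup>+c. ennreal (V * exp (- \<beta> * c)) * indicator {0..} c \<partial>lborel) = ennreal (0 - (- V / \<beta> * exp (- \<beta> * 0)))"
  proof (rule nn_integral_FTC_atLeast)
    show "((\<lambda>c. - V / \<beta> * exp (- \<beta> * c)) has_real_derivative V * exp (- \<beta> * c)) (at c)" for c
      using \<beta> by (auto intro!: derivative_eq_intros)
    have "((\<lambda>c. exp (- \<beta> * c)) \<longlongrightarrow> 0) at_top"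
      using \<beta> by (intro filterlim_compose[OF exp_at_bot] filterlim_tendsto_neg_mult_at_bot[OF tendsto_const] filterlim_ident) auto
    then show "((\<lambda>c. - V / \<beta> * exp (- \<beta> * c)) \<longlongrightarrow> 0) at_top"
      using tendsto_mult_right_zero by blast
  qed (use that in auto)
  moreover have "(\<integral>\<^sup>+c. indicator {0<..} c * ennreal (V * exp (- \<beta> * c)) \<partial>lborel) = (\<integral>\<^sup>+c. ennreal (V * exp (- \<beta> * c)) * indicator {0..} c \<partial>lborel)"
    using AE_lborel_singleton[of 0] by (intro nn_integral_cong_AE) (auto simp: indicator_def)
  ultimately show ?thesis by simp
qed

text \<open>Gruenbaum's inequality. A supporting exponential of the log-concave distribution function at the
  mean dominates it everywhere, and the exponential distribution is extremal.\<close>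

theorem gruenbaum:
  assumes L: "body d L" and c: "core d L c \<delta>" and v: "v \<in> Rd d" "nrm d v = 1"
    and m: "mom d (\<lambda>x. ip d x v) L = m * measure (rdm d) L"
  shows "exp (- 1) * measure (rdm d) L \<le> lower d v L m"
proof -
  let ?V = "measure (rdm d) L" and ?F = "lower d v L"
  have V: "0 < ?V" by (rule core_pos[OF L c])
  obtain a b where a: "a \<in> L" "\<And>x. x \<in> L \<Longrightarrow> ip d a v \<le> ip d x v"
    and b: "b \<in> L" "\<And>x. x \<in> L \<Longrightarrow> ip d x v \<le> ip d b v" and ab: "ip d a v + 2 * \<delta> \<le> ip d b v"
    using body_ip_extrema[OF L c v] by metis
  have \<delta>: "0 < \<delta>" using c by (simp add: core_def)
  have Lb [measurable]: "L \<in> sets borel" using bodyD[OF L] by simp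
  define \<alpha> where "\<alpha> = ip d a v"
  define W where "W = ip d b v - \<alpha>"
  have W: "0 < W" using ab \<delta> by (simp add: W_def \<alpha>_def)
  have Ftop: "?F s = ?V" if "\<alpha> + W \<le> s" for s
    using that b(2) by (auto simp: lower_def W_def \<alpha>_def intro!: arg_cong[where f="measure (rdm d)"]) force
  have Fpos: "0 < ?F s" if "\<alpha> < s" for s
  proof (cases "\<alpha> + W \<le> s")
    case True then show ?thesis using Ftop V by simp
  next
    case False
    define t where "t = (s - \<alpha>) / W"
    have t: "0 < t" "t \<le> 1" "t * W = s - \<alpha>" using that False W by (auto simp: t_def field_simps)
    have "0 < t ^ d * ?F (ip d a v + W)" using Ftop[of "\<alpha> + W"] V t by (simp add: \<alpha>_def)
    also have "\<dots> \<le> ?F (ip d a v + t * W)" by (rule lower_dil[OF L a(1) t(1,2)])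
    finally show ?thesis using t by (simp add: \<alpha>_def)
  qed
  have intX: "integrable (rdm d) (\<lambda>x. indicator L x * (k + j * ip d x v))" for k j
    using bodyD[OF L] by (intro integrable_compact continuous_on_add continuous_on_mult continuous_on_const continuous_on_ip continuous_on_id) auto
  have lin: "(\<integral>x. indicator L x * (k + j * ip d x v) \<partial>rdm d) = (k + j * m) * ?V" for k j
  proof -
    have i: "integrable (rdm d) (\<lambda>x. indicator L x * k)" "integrable (rdm d) (\<lambda>x. j * (indicator L x * ip d x v))"
      using intX[of k 0] intX[of 0 1] by auto
    have "(\<integral>x. indicator L x * (k + j * ip d x v) \<partial>rdm d) = (\<integral>x. indicator L x * k + j * (indicator L x * ip d x v) \<partial>rdm d)"
      by (intro Bochner_Integration.integral_cong) (auto simp: algebra_simps)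
    also have "\<dots> = k * ?V + j * mom d (\<lambda>x. ip d x v) L"
      unfolding Bochner_Integration.integral_add[OF i] by (simp add: mom_def)
    finally show ?thesis by (simp add: m algebra_simps)
  qed
  have ma: "\<alpha> < m"
  proof -
    \<comment> \<open>Shrinking L by one half towards its highest point leaves a set of positive
      measure at height at least W/2 over \<alpha>; it pulls the mean strictly above
      \<alpha>.\<close>
    have "(1/2) ^ d * lower d (- v) L (ip d b (- v) + W) \<le> lower d (- v) L (ip d b (- v) + (1/2) * W)"
      by (rule lower_dil[OF L b(1)]) auto
    moreover have "lower d (- v) L (ip d b (- v) + W) = ?V"
      using a(2) by (auto simp: lower_def ip_simps W_def \<alpha>_def intro!: arg_cong[where f="measure (rdm d)"])
    ultimately have pos: "0 < lower d (- v) L (ip d b (- v) + (1/2) * W)"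
      using V by (smt (verit) half_gt_zero_iff mult_pos_pos zero_less_power zero_less_one)
    let ?S = "L \<inter> {x. ip d x (- v) \<le> ip d b (- v) + (1/2) * W}"
    have "0 < (W/2) * measure (rdm d) ?S" using pos W by (simp add: lower_def)
    also have "\<dots> = (\<integral>x. (W/2) * indicator ?S x \<partial>rdm d)" by simp
    also have "\<dots> \<le> (\<integral>x. indicator L x * (- \<alpha> + 1 * ip d x v) \<partial>rdm d)"
    proof (rule integral_mono[OF _ intX])
      show "integrable (rdm d) (\<lambda>x. (W/2) * indicator ?S x)"
        using body_emeasure_finite[OF body_halfspace[OF L]] by (intro integrable_mult_right integrable_real_indicator) auto
      show "(W/2) * indicator ?S x \<le> indicator L x * (- \<alpha> + 1 * ip d x v)" for x
        using a(2)[of x] by (auto simp: indicator_def \<alpha>_def W_def ip_simps field_simps)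
    qed
    also have "\<dots> = (- \<alpha> + 1 * m) * ?V" by (rule lin)
    finally show ?thesis using V by (simp add: zero_less_mult_iff)
  qed
  have conv: "convex_on {\<alpha><..} (\<lambda>s. - ln (?F s))"
  proof (rule convex_onI)
    fix t x y :: real assume *: "0 < t" "t < 1" "x \<in> {\<alpha><..}" "y \<in> {\<alpha><..}"
    have p: "0 < ?F x" "0 < ?F y" using * Fpos by auto
    have "ln (?F x powr (1 - t) * ?F y powr t) \<le> ln (?F ((1 - t) * x + t * y))"
      using lower_logconcave[OF L *(1,2), of v x y] p by (intro ln_mono) (auto intro: order_less_le_trans mult_pos_pos)
    then show "- ln (?F ((1 - t) *\<^sub>R x + t *\<^sub>R y)) \<le> (1 - t) * (- ln (?F x)) + t * (- ln (?F y))"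
      using p by (simp add: ln_mult ln_powr)
  qed simp
  \<comment> \<open>The infimum of the slopes to the right is the right derivative of the convex
    function -ln F at m, so \<beta> is a supporting slope of ln F there.\<close>
  define \<beta> where "\<beta> = - (INF t\<in>{m<..} \<inter> {\<alpha><..}. ((- ln (?F m)) - (- ln (?F t))) / (m - t))"
  have Fle: "?F s \<le> ?F m * exp (\<beta> * (s - m))" if "\<alpha> < s" for s
  proof -
    have "- ln (?F m) + (INF t\<in>{m<..} \<inter> {\<alpha><..}. ((- ln (?F m)) - (- ln (?F t))) / (m - t)) * (s - m) \<le> - ln (?F s)"
      by (rule convex_le_Inf_differential[OF conv]) (use ma that in \<open>auto simp: interior_open\<close>)
    then have "ln (?F s) \<le> ln (?F m) + \<beta> * (s - m)" by (simp add: \<beta>_def)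
    then have "exp (ln (?F s)) \<le> exp (ln (?F m) + \<beta> * (s - m))" by simp
    then show ?thesis using Fpos[OF that] Fpos[OF ma] by (simp add: exp_add)
  qed
  have Fm: "0 < ?F m" by (rule Fpos[OF ma])
  show ?thesis
  proof (cases "0 < \<beta>")
    case False
    \<comment> \<open>With a nonpositive slope the exponential bound does not exceed F m to the
      right of m, so F m is already the full volume.\<close>
    have "?V = ?F (max m (\<alpha> + W))" using Ftop by simp
    also have "\<dots> \<le> ?F m * exp (\<beta> * (max m (\<alpha> + W) - m))" using ma by (intro Fle) auto
    also have "\<dots> \<le> ?F m * 1" using False Fm by (intro mult_left_mono) (auto simp: mult_nonpos_nonneg)
    finally have "?V \<le> ?F m" by simp
    moreover have "exp (- 1) * ?V \<le> 1 * ?V" using V by (intro mult_right_mono) auto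
    ultimately show ?thesis by simp
  next
    case \<beta>: True
    \<comment> \<open>The level at which the dominating exponential reaches the full volume.\<close>
    define T where "T = m + ln (?V / ?F m) / \<beta>"
    have FT: "?F m * exp (\<beta> * (T - m)) = ?V" using Fm V \<beta> by (simp add: T_def)
    have sf: "sigma_finite_measure (rdm d)"
    proof
      show "\<exists>A. countable A \<and> A \<subseteq> sets (rdm d) \<and> \<Union> A = space (rdm d) \<and> (\<forall>a\<in>A. emeasure (rdm d) a \<noteq> \<infinity>)"
      proof (intro exI[of _ "insert (- Rd d) (range (\<lambda>n::nat. ballR d n))"] conjI ballI)
        show "\<Union> (insert (- Rd d) (range (\<lambda>n::nat. ballR d n))) = space (rdm d)"
        proof -
          have "\<exists>n. nrm d x \<le> real n" for x by (rule real_arch_simple)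
          then show ?thesis by (auto simp: ballR_iff)
        qed
        fix a assume "a \<in> insert (- Rd d) (range (\<lambda>n::nat. ballR d n))"
        moreover have "emeasure (rdm d) (- Rd d) = 0"
          using AE_rdm_Rd[of d] by (subst (asm) AE_iff_measurable[of "- Rd d"]) (auto simp: borel_closed closed_Rd)
        moreover have "emeasure (rdm d) (ballR d r) \<noteq> \<infinity>" for r using emeasure_ballR_finite[of d r] by auto
        ultimately show "emeasure (rdm d) a \<noteq> \<infinity>" by auto
      qed (auto simp: borel_closed closed_Rd)
    qed
    \<comment> \<open>The mean of T - \<open>ip d x v\<close> is computed from its tails. The tail
      beyond s is at most V exp(-\<beta> s), hence T - m <= 1/\<beta>, and by the choice of T this
      says V <= e F m.\<close>
    have "ennreal (\<integral>x. indicator L x * (T + (- 1) * ip d x v) \<partial>rdm d) \<le> (\<integral>\<^sup>+x. ennreal (indicator L x * (T + (- 1) * ip d x v)) \<partial>rdm d)"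
    proof -
      let ?u = "\<lambda>x. indicator L x * (T + (- 1) * ip d x v) :: real"
      have i: "integrable (rdm d) ?u" "integrable (rdm d) (\<lambda>x. max 0 (?u x))" using intX[of T "- 1"] by auto
      have "ennreal (\<integral>x. ?u x \<partial>rdm d) \<le> ennreal (\<integral>x. max 0 (?u x) \<partial>rdm d)"
        by (intro ennreal_leI integral_mono i) auto
      also have "\<dots> = (\<integral>\<^sup>+x. ennreal (max 0 (?u x)) \<partial>rdm d)" by (rule nn_integral_eq_integral[symmetric]) (use i in auto)
      also have "\<dots> = (\<integral>\<^sup>+x. ennreal (?u x) \<partial>rdm d)" by (intro nn_integral_cong) (simp add: max_def ennreal_neg)
      finally show ?thesis .
    qed
    also have "\<dots> = (\<integral>\<^sup>+c. indicator {0<..} c * emeasure (rdm d) {x \<in> space (rdm d). c < indicator L x * (T + (- 1) * ip d x v)} \<partial>lborel)"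
      by (rule layer_cake[OF sf]) measurable
    also have "\<dots> \<le> (\<integral>\<^sup>+c. indicator {0<..} c * ennreal (?V * exp (- \<beta> * c)) \<partial>lborel)"
    proof (rule nn_integral_mono)
      fix s :: real
      show "indicator {0<..} s * emeasure (rdm d) {x \<in> space (rdm d). s < indicator L x * (T + (- 1) * ip d x v)} \<le> indicator {0<..} s * ennreal (?V * exp (- \<beta> * s))"
      proof (cases "0 < s")
        case True
        let ?S = "{x \<in> space (rdm d). s < indicator L x * (T + (- 1) * ip d x v)}"
        have "emeasure (rdm d) ?S \<le> ennreal (?V * exp (- \<beta> * s))"
        proof (cases "\<alpha> < T - s")
          case False
          then have "?S = {}" using a(2) True by (force simp: indicator_def \<alpha>_def)
          then show ?thesis by simp
        next
          case inn: True
          have "emeasure (rdm d) ?S \<le> emeasure (rdm d) (L \<inter> {x. ip d x v \<le> T - s})"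
            using True by (intro emeasure_mono) (auto simp: indicator_def split: if_splits)
          also have "\<dots> = ennreal (?F (T - s))"
            unfolding lower_def using body_emeasure_finite[OF body_halfspace[OF L], of v "T - s"] by (intro emeasure_eq_ennreal_measure) auto
          also have "\<dots> \<le> ennreal (?F m * exp (\<beta> * (T - s - m)))" using Fle[OF inn] by (rule ennreal_leI)
          also have "?F m * exp (\<beta> * (T - s - m)) = ?F m * exp (\<beta> * (T - m)) * exp (- \<beta> * s)"
            by (simp add: exp_add[symmetric] mult.assoc algebra_simps)
          finally show ?thesis by (simp add: FT)
        qed
        then show ?thesis using True by simp
      qed simp
    qed
    also have "\<dots> = ennreal (?V / \<beta>)" by (rule exp_integral[OF _ \<beta>]) (use V in simp)
    finally have "(\<integral>x. indicator L x * (T + (- 1) * ip d x v) \<partial>rdm d) \<le> ?V / \<beta>" using V \<beta> by (simp add: ennreal_le_iff)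
    then have "(T - m) * ?V \<le> ?V / \<beta>" unfolding lin by simp
    then have "(T - m) * ?V \<le> (1 / \<beta>) * ?V" by simp
    then have "T - m \<le> 1 / \<beta>" using V by (rule mult_right_le_imp_le)
    then have "ln (?V / ?F m) / \<beta> \<le> 1 / \<beta>" by (simp add: T_def)
    then have "ln (?V / ?F m) \<le> 1" using \<beta> by (simp add: divide_le_cancel)
    then have "?V / ?F m \<le> exp 1" using V Fm by (metis divide_pos_pos exp_le_cancel_iff exp_ln)
    then show ?thesis using Fm by (simp add: field_simps exp_minus)
  qed
qed

text \<open>Gruenbaum's inequality with a margin: moving the hyperplane by \<eta> W costs a factor
  of at least (1 - 4\<eta>)^d >= 9/10. The dilation is centered at the extremal point at least W/2
  away from the centroid, so that the move is a small fraction of the distance to the center. The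
  numbers fit because e < 2.72 gives 1/e >= 9/25, while 9/10 * 9/25 >= 1/5 and (16/25) / (9/10) <=
  4/5.\<close>

lemma shifted_cut:
  assumes L: "body d L" and c: "core d L c \<delta>" and v: "v \<in> Rd d" "nrm d v = 1"
    and m: "mom d (\<lambda>x. ip d x v) L = m * measure (rdm d) L"
    and W: "\<And>x y. x \<in> L \<Longrightarrow> y \<in> L \<Longrightarrow> \<bar>ip d x v - ip d y v\<bar> \<le> W" "\<exists>x\<in>L. \<exists>y\<in>L. ip d y v - ip d x v = W"
    and \<eta>: "0 < \<eta>" "\<eta> * real d \<le> 1 / 40" and d: "0 < d"
  shows "measure (rdm d) (L \<inter> {x. m - \<eta> * W \<le> ip d x v}) \<le> 4 / 5 * measure (rdm d) L"
proof -
  let ?V = "measure (rdm d) L" and ?F = "lower d v L"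
  have V: "0 < ?V" by (rule core_pos[OF L c])
  obtain a b where a: "a \<in> L" "\<And>x. x \<in> L \<Longrightarrow> ip d a v \<le> ip d x v"
    and b: "b \<in> L" "\<And>x. x \<in> L \<Longrightarrow> ip d x v \<le> ip d b v" and ab: "ip d a v + 2 * \<delta> \<le> ip d b v"
    using body_ip_extrema[OF L c v] by metis
  have \<delta>: "0 < \<delta>" using c by (simp add: core_def)
  have Lb [measurable]: "L \<in> sets borel" using bodyD[OF L] by simp
  have Wab: "W = ip d b v - ip d a v"
    using W(1)[OF b(1) a(1)] W(2) a(2) b(2) by (smt (verit))
  have Wp: "0 < W" using ab \<delta> Wab by simp
  have fm: "L \<inter> {x. k \<le> ip d x v} \<in> fmeasurable (rdm d)" "L \<inter> {x. ip d x v \<le> k} \<in> fmeasurable (rdm d)" for k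
    using fmeasurable_Int_fmeasurable[OF body_fmeasurable[OF L]] by auto
  have disj: "measure (rdm d) (L \<inter> {x. k \<le> ip d x v}) + ?F k' \<le> ?V" if "k' < k" for k k'
  proof -
    have "measure (rdm d) (L \<inter> {x. k \<le> ip d x v}) + ?F k' = measure (rdm d) (L \<inter> {x. k \<le> ip d x v} \<union> L \<inter> {x. ip d x v \<le> k'})"
      unfolding lower_def using that fm by (intro measure_Un_AE[symmetric] AE_I2) auto
    also have "\<dots> \<le> ?V" using body_fmeasurable[OF L] by (intro measure_mono_fmeasurable) auto
    finally show ?thesis .
  qed
  have G: "exp (- 1) * ?V \<le> ?F m" by (rule gruenbaum[OF L c v m])
  have e: "9/25 \<le> exp (- 1 :: real)" using e_less_272 by (simp add: exp_minus field_simps)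
  have d1: "1 \<le> real d" using d by simp
  have "\<eta> * 1 \<le> \<eta> * real d" using \<eta> d1 by (intro mult_left_mono) auto
  then have \<eta>1: "\<eta> \<le> 1/40" using \<eta> by linarith
  show ?thesis
  proof (cases "W / 2 \<le> m - ip d a v")
    case True
    define u where "u = m - ip d a v"
    have u: "W / 2 \<le> u" "0 < u" using True Wp by (auto simp: u_def)
    \<comment> \<open>Contracts level m to m - 2 \<eta> W. The shift is twice the required one, so
      that the lower part is disjoint from the closed halfspace at m - \<eta> W.\<close>
    define t where "t = 1 - 2 * \<eta> * W / u"
    have q: "2 * \<eta> * W / u \<le> 4 * \<eta>"
    proof -
      have "2 * \<eta> * W \<le> 2 * \<eta> * (2 * u)" using u \<eta> by (intro mult_left_mono) auto
      then show ?thesis using u by (simp add: divide_le_eq)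
    qed
    have q0: "0 < 2 * \<eta> * W / u" using \<eta> Wp u by simp
    have t: "1 - 4 * \<eta> \<le> t" "0 < t" "t \<le> 1" using q q0 \<eta>1 by (auto simp: t_def)
    have tu: "t * u = u - 2 * \<eta> * W" using u by (simp add: t_def field_simps)
    have "1 - real d * (4 * \<eta>) \<le> (1 - 4 * \<eta>) ^ d"
      using Bernoulli_inequality[of "- (4 * \<eta>)" d] \<eta>1 by simp
    also have "\<dots> \<le> t ^ d" using t \<eta>1 by (intro power_mono) auto
    finally have "1 - real d * (4 * \<eta>) \<le> t ^ d" .
    moreover have "real d * (4 * \<eta>) \<le> 1/10" using \<eta>(2) by (simp add: algebra_simps)
    ultimately have td: "9/10 \<le> t ^ d" by linarith
    have "9/10 * (9/25 * ?V) \<le> t ^ d * ?F m"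
    proof (rule mult_mono)
      have "9/25 * ?V \<le> exp (- 1) * ?V" using e V by (intro mult_right_mono) auto
      then show "9/25 * ?V \<le> ?F m" using G by linarith
    qed (use td V in auto)
    also have "t ^ d * ?F m = t ^ d * ?F (ip d a v + u)" by (simp add: u_def)
    also have "\<dots> \<le> ?F (ip d a v + t * u)" by (rule lower_dil[OF L a(1) t(2,3)])
    also have "ip d a v + t * u = m - 2 * \<eta> * W" unfolding tu by (simp add: u_def)
    finally have "1/5 * ?V \<le> ?F (m - 2 * \<eta> * W)" using V by simp
    moreover have "m - 2 * \<eta> * W < m - \<eta> * W" using \<eta> Wp by simp
    ultimately show ?thesis using disj[of "m - 2 * \<eta> * W" "m - \<eta> * W"] by simp
  next
    case False
    define u where "u = ip d b v - m"
    have u: "W / 2 < u" "0 < u" using False Wp by (auto simp: u_def Wab)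
    \<comment> \<open>Seen from the highest point, this factor carries the part above m - \<eta> W
      into the part above m + \<eta> W, which misses the lower part at m and is bounded by
      Gruenbaum's inequality.\<close>
    define t where "t = (u - \<eta> * W) / (u + \<eta> * W)"
    have "\<eta> * W \<le> \<eta> * (2 * u)" using u \<eta> by (intro mult_left_mono) auto
    also have "\<dots> \<le> (1/40) * (2 * u)" using u \<eta>1 by (intro mult_right_mono) auto
    finally have \<eta>W: "\<eta> * W \<le> 2 * \<eta> * u" "\<eta> * W \<le> u / 20" "0 < \<eta> * W"
      using \<open>\<eta> * W \<le> \<eta> * (2 * u)\<close> \<eta> Wp by auto
    have t: "0 < t" "t \<le> 1" using \<eta>W u by (auto simp: t_def)
    have tu: "t * (u + \<eta> * W) = u - \<eta> * W" using \<eta>W u by (simp add: t_def)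
    have lw: "lower d (- v) L (ip d b (- v) + w) = measure (rdm d) (L \<inter> {x. ip d b v - w \<le> ip d x v})" for w
      unfolding lower_def by (rule arg_cong[where f="measure (rdm d)"]) (auto simp: ip_simps)
    have 1: "t ^ d * measure (rdm d) (L \<inter> {x. m - \<eta> * W \<le> ip d x v}) \<le> measure (rdm d) (L \<inter> {x. m + \<eta> * W \<le> ip d x v})"
      using lower_dil[OF L b(1) t, of "- v" "u + \<eta> * W"] unfolding tu lw by (simp add: u_def algebra_simps)
    have 2: "measure (rdm d) (L \<inter> {x. m + \<eta> * W \<le> ip d x v}) \<le> (16/25) * ?V"
    proof -
      have "9/25 * ?V \<le> exp (- 1) * ?V" using e V by (intro mult_right_mono) auto
      then show ?thesis using disj[of m "m + \<eta> * W"] G \<eta>W by simp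
    qed
    have "1 - 4 * \<eta> \<le> t"
    proof -
      have "(1 - 4 * \<eta>) * (u + \<eta> * W) \<le> u - \<eta> * W"
      proof -
        have "2 * (\<eta> * W) \<le> 4 * \<eta> * u" using \<eta>W(1) by linarith
        moreover have "0 \<le> 4 * \<eta> * (\<eta> * W)" using \<eta> \<eta>W by simp
        moreover have "(1 - 4 * \<eta>) * (u + \<eta> * W) = u + \<eta> * W - 4 * \<eta> * u - 4 * \<eta> * (\<eta> * W)"
          by (simp add: algebra_simps)
        ultimately show ?thesis by linarith
      qed
      then show ?thesis using u \<eta>W by (simp add: t_def le_divide_eq)
    qed
    have "1 - real d * (4 * \<eta>) \<le> (1 - 4 * \<eta>) ^ d"
      using Bernoulli_inequality[of "- (4 * \<eta>)" d] \<eta>1 by simp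
    also have "\<dots> \<le> t ^ d" using \<open>1 - 4 * \<eta> \<le> t\<close> \<eta>1 by (intro power_mono) auto
    finally have "1 - real d * (4 * \<eta>) \<le> t ^ d" .
    moreover have "real d * (4 * \<eta>) \<le> 1/10" using \<eta>(2) by (simp add: algebra_simps)
    ultimately have td: "9/10 \<le> t ^ d" by linarith
    have "9/10 * measure (rdm d) (L \<inter> {x. m - \<eta> * W \<le> ip d x v}) \<le> t ^ d * measure (rdm d) (L \<inter> {x. m - \<eta> * W \<le> ip d x v})"
      using td by (intro mult_right_mono) auto
    with 1 2 have "9/10 * measure (rdm d) (L \<inter> {x. m - \<eta> * W \<le> ip d x v}) \<le> (16/25) * ?V" by linarith
    then show ?thesis using V by simp
  qed
qed

section \<open>Centers of gravity of parallel bodies\<close>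

definition refl_hp :: "nat \<Rightarrow> vec \<Rightarrow> real \<Rightarrow> vec \<Rightarrow> vec" where
  "refl_hp d n h x = x - smul (2 * (ip d x n - h)) n"

lemma continuous_on_refl_hp: "continuous_on S (refl_hp d n h)"
  unfolding refl_hp_def
  by (intro continuous_on_vec_diff continuous_on_smul continuous_on_mult continuous_on_diff continuous_on_ip continuous_on_id continuous_on_const)

lemma refl_hp_measurable: "refl_hp d n h \<in> borel_measurable borel"
  by (rule borel_measurable_continuous_onI[OF continuous_on_refl_hp])

text \<open>The reflection is factored into coordinate replacements around an index k with
  \<open>n k\<close> nonzero: A makes s = \<open>ip d x n\<close> the coordinate k, B adds (2h - 2s)
  n to the other coordinates, C replaces s by 2h - s, and D solves for the coordinate k again. The
  factors for A and D are inverse to each other, those for B and C are 1.\<close>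

lemma nn_integral_refl_hp:
  assumes n: "n \<in> Rd d" "nrm d n = 1" and f: "f \<in> borel_measurable borel"
  shows "(\<integral>\<^sup>+x. f (refl_hp d n h x) \<partial>rdm d) = (\<integral>\<^sup>+x. f x \<partial>rdm d)"
proof -
  have nn: "ip d n n = 1" using n nrm_sq[of d n] by simp
  have "\<exists>i<d. n i \<noteq> 0"
  proof (rule ccontr)
    assume "\<not> ?thesis"
    then have "ip d n n = 0" by (simp add: ip_def)
    with nn show False by simp
  qed
  then obtain k where k: "k < d" "n k \<noteq> 0" by blast
  let ?J = "{..<d} - {k}"
  define b where "b = (\<lambda>x::vec. \<Sum>j\<in>?J. n j * x j)"
  define A where "A = (\<lambda>x::vec. x(k := n k * x k + b x))"
  define B where "B = (\<lambda>x::vec. \<lambda>j. if j \<in> ?J then 1 * x j + (2 * h - 2 * x k) * n j else x j)"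
  define C where "C = (\<lambda>x::vec. x(k := (- 1) * x k + 2 * h))"
  define D where "D = (\<lambda>x::vec. x(k := (1 / n k) * x k + (- (b x / n k))))"
  have bm [measurable]: "b \<in> borel_measurable borel" unfolding b_def by measurable
  have bk: "b (x(k := t)) = b x" for x t unfolding b_def by (intro sum.cong) auto
  have um: "(\<lambda>x. x(k := u x)) \<in> borel_measurable borel" if [measurable]: "u \<in> borel_measurable borel" for u :: "vec \<Rightarrow> real"
    by (rule borel_measurable_vecI) (auto simp: fun_upd_def)
  have Dm: "D \<in> borel_measurable borel" unfolding D_def by (rule um) measurable
  have Cm: "C \<in> borel_measurable borel" unfolding C_def by (rule um) measurable
  have Bm: "B \<in> borel_measurable borel"
  proof (rule borel_measurable_vecI)
    fix j show "(\<lambda>x. B x j) \<in> borel_measurable borel"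
      unfolding B_def by (cases "j \<in> ?J") (simp_all, measurable)
  qed
  have ipb: "ip d x n = n k * x k + b x" for x
    unfolding ip_def b_def using k by (subst sum.remove[of _ k]) (auto simp: mult.commute)
  have comp: "D (C (B (A x))) = refl_hp d n h x" for x
  proof (rule ext)
    fix j
    let ?s = "ip d x n"
    have s1: "b (C (B (A x))) = b x - 2 * (?s - h) * (1 - n k * n k)"
    proof -
      define q where "q = 2 * h - 2 * ?s"
      have "b (C (B (A x))) = (\<Sum>j\<in>?J. n j * x j + q * (n j * n j))"
        unfolding b_def by (intro sum.cong) (auto simp: C_def B_def A_def ipb q_def algebra_simps)
      also have "\<dots> = b x + q * (\<Sum>j\<in>?J. n j * n j)"
        by (simp only: b_def sum.distrib sum_distrib_left)
      also have "(\<Sum>j\<in>?J. n j * n j) = 1 - n k * n k"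
        using nn k by (simp add: ip_def sum_diff1)
      finally show ?thesis by (simp add: q_def algebra_simps)
    qed
    show "D (C (B (A x))) j = refl_hp d n h x j"
    proof (cases "j = k")
      case True
      have "D (C (B (A x))) k = (2 * h - ?s - b (C (B (A x)))) / n k"
        using k by (simp add: D_def C_def B_def A_def ipb diff_divide_distrib add_divide_distrib)
      also have "\<dots> = x k - 2 * (?s - h) * n k"
        unfolding s1 using k by (simp add: ipb field_simps)
      finally show ?thesis using True by (simp add: refl_hp_def)
    next
      case False
      then show ?thesis using n by (auto simp: D_def C_def B_def A_def refl_hp_def ipb Rd_def algebra_simps)
    qed
  qed
  have "(\<integral>\<^sup>+x. f (refl_hp d n h x) \<partial>rdm d) = (\<integral>\<^sup>+x. (f \<circ> D \<circ> C \<circ> B) (A x) \<partial>rdm d)"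
    by (simp only: comp[symmetric] o_apply)
  also have "\<dots> = ennreal (1 / \<bar>n k\<bar>) * (\<integral>\<^sup>+x. (f \<circ> D \<circ> C \<circ> B) x \<partial>rdm d)"
    unfolding A_def
    by (rule nn_integral_rdm_coord[OF k(1,2) measurable_comp[OF Bm measurable_comp[OF Cm measurable_comp[OF Dm f]]] bm bk, unfolded o_assoc])
  also have "(\<integral>\<^sup>+x. (f \<circ> D \<circ> C \<circ> B) x \<partial>rdm d) = (\<integral>\<^sup>+x. (f \<circ> D \<circ> C) (B x) \<partial>rdm d)" by simp
  also have "\<dots> = ennreal ((1 / \<bar>1::real\<bar>) ^ card ?J) * (\<integral>\<^sup>+x. (f \<circ> D \<circ> C) x \<partial>rdm d)"
    unfolding B_def
  proof (rule nn_integral_rdm_block[where b="\<lambda>j x. (2 * h - 2 * x k) * n j"])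
    show "f \<circ> D \<circ> C \<in> borel_measurable borel" using measurable_comp[OF Cm measurable_comp[OF Dm f]] by (simp only: o_assoc)
    show "(2 * h - 2 * x k) * n j = (2 * h - 2 * y k) * n j" if "\<And>i. i \<notin> ?J \<Longrightarrow> x i = y i" for j x y
      using that[of k] by simp
  qed auto
  also have "\<dots> = (\<integral>\<^sup>+x. (f \<circ> D) (C x) \<partial>rdm d)" by simp
  also have "\<dots> = ennreal (1 / \<bar>- 1::real\<bar>) * (\<integral>\<^sup>+x. (f \<circ> D) x \<partial>rdm d)"
    unfolding C_def by (rule nn_integral_rdm_coord[OF k(1) _ measurable_comp[OF Dm f]]) simp_all
  also have "\<dots> = (\<integral>\<^sup>+x. f (D x) \<partial>rdm d)" by simp
  also have "\<dots> = ennreal (1 / \<bar>1 / n k\<bar>) * (\<integral>\<^sup>+x. f x \<partial>rdm d)"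
    unfolding D_def
  proof (rule nn_integral_rdm_coord[OF k(1) _ f])
    show "- (b (x(k := t)) / n k) = - (b x / n k)" for x t by (simp only: bk)
  qed (use k in auto)
  also have "ennreal (1 / \<bar>n k\<bar>) * (ennreal (1 / \<bar>1 / n k\<bar>) * (\<integral>\<^sup>+x. f x \<partial>rdm d)) = ennreal (1 / \<bar>n k\<bar> * (1 / \<bar>1 / n k\<bar>)) * (\<integral>\<^sup>+x. f x \<partial>rdm d)"
  proof -
    have "ennreal p * (ennreal q * X) = ennreal (p * q) * X" if "0 \<le> p" "0 \<le> q" for p q X
      using that by (simp add: ennreal_mult mult.assoc)
    then show ?thesis by simp
  qed
  also have "1 / \<bar>n k\<bar> * (1 / \<bar>1 / n k\<bar>) = 1" using k by simp
  finally show ?thesis by simp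
qed

lemma integral_refl_hp:
  fixes u :: "vec \<Rightarrow> real"
  assumes n: "n \<in> Rd d" "nrm d n = 1" and u: "u \<in> borel_measurable borel"
  shows "(\<integral>x. u (refl_hp d n h x) \<partial>rdm d) = (\<integral>x. u x \<partial>rdm d)"
    and "integrable (rdm d) u \<Longrightarrow> integrable (rdm d) (\<lambda>x. u (refl_hp d n h x))"
proof -
  have rm: "refl_hp d n h \<in> measurable (rdm d) borel" using refl_hp_measurable by simp
  have eq: "distr (rdm d) borel (refl_hp d n h) = rdm d"
  proof (rule measure_eqI)
    fix X assume "X \<in> sets (distr (rdm d) borel (refl_hp d n h))"
    then have X: "X \<in> sets borel" by simp
    have "emeasure (distr (rdm d) borel (refl_hp d n h)) X = (\<integral>\<^sup>+x. indicator X x \<partial>distr (rdm d) borel (refl_hp d n h))"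
      using X by simp
    also have "\<dots> = (\<integral>\<^sup>+x. indicator X (refl_hp d n h x) \<partial>rdm d)"
      by (rule nn_integral_distr[OF rm]) (use X in simp)
    also have "\<dots> = (\<integral>\<^sup>+x. indicator X x \<partial>rdm d)" by (rule nn_integral_refl_hp[OF n]) (use X in simp)
    finally show "emeasure (distr (rdm d) borel (refl_hp d n h)) X = emeasure (rdm d) X" using X by simp
  qed simp
  show "(\<integral>x. u (refl_hp d n h x) \<partial>rdm d) = (\<integral>x. u x \<partial>rdm d)"
    using integral_distr[OF rm u] by (simp add: eq)
  show "integrable (rdm d) u \<Longrightarrow> integrable (rdm d) (\<lambda>x. u (refl_hp d n h x))"
    using integrable_distr_eq[OF rm u] by (simp add: eq)
qed

lemma measure_ballR: "0 < t \<Longrightarrow> measure (rdm d) (ballR d t) = t ^ d * measure (rdm d) (ballR d 1)"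
proof -
  assume t: "0 < t"
  have "ballR d t = dil 0 t (ballR d 1)" using smul_ballR[of t d] t by (simp add: dil_def)
  then show ?thesis using t by (simp only: measure_dil[OF ballR_borel Rd_0])
qed

lemma cg_Rd: "cg d A \<in> Rd d"
  by (simp add: cg_def Rd_def)

lemma ip_cg:
  assumes "body d A"
  shows "ip d (cg d A) v = mom d (\<lambda>x. ip d x v) A / measure (rdm d) A"
proof -
  have A: "A \<in> sets borel" using bodyD[OF assms] by simp
  have i: "integrable (rdm d) (\<lambda>x. indicator A x * x i)" for i
    using bodyD[OF assms] by (intro integrable_compact continuous_on_coord continuous_on_id) auto
  have "ip d (cg d A) v = (\<Sum>i<d. (\<integral>x. indicator A x * x i \<partial>rdm d) * v i) / measure (rdm d) A"
    using A by (simp add: ip_def cg_rdm sum_divide_distrib)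
  also have "(\<Sum>i<d. (\<integral>x. indicator A x * x i \<partial>rdm d) * v i) = (\<integral>x. (\<Sum>i<d. (indicator A x * x i) * v i) \<partial>rdm d)"
    using i by (subst Bochner_Integration.integral_sum) auto
  also have "\<dots> = mom d (\<lambda>x. ip d x v) A"
    by (simp add: mom_def ip_def sum_distrib_left mult.assoc)
  finally show ?thesis .
qed

text \<open>The far side of the hyperplane is folded onto the near side. The integrand changes sign
  under the reflection, so what remains is a positive weight times the difference between A and its
  mirror image.\<close>

lemma reflected_moment:
  fixes h :: real
  assumes n: "n \<in> Rd d" "nrm d n = 1" and A: "body d A"
  defines "\<sigma> \<equiv> refl_hp d n h"
  shows "mom d (\<lambda>x. h - ip d x n) A
      = (\<integral>x. indicator {x. ip d x n < h} x * (h - ip d x n) * (indicator A x - indicator A (\<sigma> x)) \<partial>rdm d)"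
    and "integrable (rdm d) (\<lambda>x. indicator {x. ip d x n < h} x * (h - ip d x n) * (indicator A x - indicator A (\<sigma> x)))"
proof -
  have nn: "ip d n n = 1" using n nrm_sq[of d n] by simp
  have [measurable]: "A \<in> sets borel" using bodyD[OF A] by simp
  have ip\<sigma>: "ip d (\<sigma> x) n = 2 * h - ip d x n" for x by (simp add: \<sigma>_def refl_hp_def ip_simps nn)
  define u where "u = (\<lambda>x. indicator A x * (h - ip d x n))"
  have iu: "integrable (rdm d) u"
    unfolding u_def using bodyD[OF A] by (intro integrable_compact continuous_on_diff continuous_on_const continuous_on_ip continuous_on_id) auto
  define u1 where "u1 = (\<lambda>x. indicator {x. ip d x n < h} x * u x)"
  define u2 where "u2 = (\<lambda>x. indicator {x. h < ip d x n} x * u x)"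
  have i1: "integrable (rdm d) u1" "integrable (rdm d) u2"
    unfolding u1_def u2_def using iu by (auto intro!: integrable_real_mult_indicator simp: mult.commute)
  have [measurable]: "u2 \<in> borel_measurable borel" unfolding u2_def u_def by measurable
  have i2: "integrable (rdm d) (\<lambda>x. u2 (\<sigma> x))" unfolding \<sigma>_def by (rule integral_refl_hp(2)[OF n]) (use i1 in auto)
  have sum: "u1 x + u2 (\<sigma> x) = indicator {x. ip d x n < h} x * (h - ip d x n) * (indicator A x - indicator A (\<sigma> x))" for x
    by (auto simp: u1_def u2_def u_def ip\<sigma> indicator_def)
  have "mom d (\<lambda>x. h - ip d x n) A = (\<integral>x. u1 x + u2 x \<partial>rdm d)"
    unfolding mom_def by (intro Bochner_Integration.integral_cong) (auto simp: u1_def u2_def u_def indicator_def)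
  also have "\<dots> = (\<integral>x. u1 x \<partial>rdm d) + (\<integral>x. u2 (\<sigma> x) \<partial>rdm d)"
    unfolding \<sigma>_def using i1 by (simp add: integral_refl_hp(1)[OF n])
  also have "\<dots> = (\<integral>x. u1 x + u2 (\<sigma> x) \<partial>rdm d)" using i1 i2 by simp
  finally show "mom d (\<lambda>x. h - ip d x n) A = (\<integral>x. indicator {x. ip d x n < h} x * (h - ip d x n) * (indicator A x - indicator A (\<sigma> x)) \<partial>rdm d)"
    by (simp only: sum)
  show "integrable (rdm d) (\<lambda>x. indicator {x. ip d x n < h} x * (h - ip d x n) * (indicator A x - indicator A (\<sigma> x)))"
    using Bochner_Integration.integrable_add[OF i1(1) i2] by (simp only: sum)
qed

text \<open>The extra term is the product of the signed distances to the hyperplane: reflecting x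
  away from the side of y increases its distance to y.\<close>

lemma refl_hp_dist:
  assumes n: "n \<in> Rd d" "nrm d n = 1"
  shows "(nrm d (refl_hp d n h x - y))\<^sup>2 = (nrm d (x - y))\<^sup>2 + 4 * (h - ip d x n) * (h - ip d y n)"
proof -
  have nn: "ip d n n = 1" using n nrm_sq[of d n] by simp
  show ?thesis
    unfolding nrm_sq refl_hp_def by (simp add: ip_simps nn ip_commute[of d n x] ip_commute[of d n y] ip_commute[of d y x] algebra_simps)
qed

lemma par_iff: "x \<in> Rd d \<Longrightarrow> K \<subseteq> Rd d \<Longrightarrow> x \<in> par d K r \<longleftrightarrow> (\<exists>y\<in>K. nrm d (x - y) \<le> r)"
proof
  assume "x \<in> Rd d" "K \<subseteq> Rd d" "\<exists>y\<in>K. nrm d (x - y) \<le> r"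
  then obtain y where y: "y \<in> K" "nrm d (x - y) \<le> r" by blast
  then have "x - y \<in> ballR d r" using \<open>x \<in> Rd d\<close> \<open>K \<subseteq> Rd d\<close> Rd_diff[of x d y] by (auto simp: ballR_iff)
  from msumI[OF y(1) this] have "y + (x - y) \<in> par d K r" by (simp only: par_def)
  then show "x \<in> par d K r" by simp
next
  assume "x \<in> par d K r"
  then obtain a b where "a \<in> K" "b \<in> ballR d r" "x = a + b" by (auto simp: par_def elim!: msumE)
  then show "\<exists>y\<in>K. nrm d (x - y) \<le> r" by (intro bexI[of _ a]) (auto simp: ballR_iff)
qed

text \<open>K lies on the near side, so a point of the near side is at least as close to K as its
  mirror image. Hence the integrand in \<open>reflected_moment\<close> is nonnegative.\<close>

lemma reflect_into_par:
  assumes n: "n \<in> Rd d" "nrm d n = 1" and K: "K \<subseteq> Rd d" "\<And>y. y \<in> K \<Longrightarrow> ip d y n \<le> h"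
    and x: "x \<in> Rd d" "ip d x n \<le> h" "refl_hp d n h x \<in> par d K r"
  shows "x \<in> par d K r"
proof -
  have "refl_hp d n h x \<in> Rd d" using x n by (simp add: refl_hp_def Rd_intros)
  then obtain y where y: "y \<in> K" "nrm d (refl_hp d n h x - y) \<le> r" using par_iff[OF _ K(1)] x by blast
  have "(nrm d (x - y))\<^sup>2 \<le> (nrm d (refl_hp d n h x - y))\<^sup>2"
    using refl_hp_dist[OF n, of h x y] K(2)[OF y(1)] x(2) by simp
  then have "nrm d (x - y) \<le> nrm d (refl_hp d n h x - y)" by (rule power2_le_imp_le) simp
  then show ?thesis using par_iff[OF x(1) K(1)] y by (meson order_trans)
qed

text \<open>The parts of a parallel body on the two sides of a supporting hyperplane of the body are compared by
  reflection. An annular cone pointing away from the hyperplane has no mirror image in the parallel body;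
  its volume is of order $r^{d-1}$, which keeps the limit $r \to \infty$ strictly inside, too.\<close>

lemma moment_gap:
  assumes n: "n \<in> Rd d" "nrm d n = 1" and K: "body d K" "core d K c \<delta>" "\<And>y. y \<in> K \<Longrightarrow> ip d y n \<le> h"
  obtains s where "0 < s" "\<And>r. 0 \<le> r \<Longrightarrow>
      max r (\<delta>/2) / 2 * (((r + \<delta>) ^ d - (max r (\<delta>/2)) ^ d) * s) \<le> mom d (\<lambda>x. h - ip d x n) (par d K r)"
proof -
  have nn: "ip d n n = 1" using n nrm_sq[of d n] by simp
  have \<delta>: "0 < \<delta>" and c: "c \<in> Rd d" using K by (auto simp: core_def)
  have KR: "K \<subseteq> Rd d" using bodyD K by blast
  have "c + smul \<delta> n \<in> K" using K(2) n \<delta> by (auto simp: core_def ballR_iff Rd_smul nrm_smul)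
  from K(3)[OF this] have hc: "\<delta> \<le> h - ip d c n" by (simp add: ip_simps nn)
  obtain R where R: "\<delta> \<le> R" "\<And>y. y \<in> K \<Longrightarrow> nrm d (c - y) \<le> R"
  proof -
    obtain R' where R': "0 < R'" "K \<subseteq> ballR d R'" using body_bounded[OF K(1)] .
    have "nrm d (c - y) \<le> max \<delta> (nrm d c + R')" if "y \<in> K" for y
    proof -
      have "nrm d (c - y) \<le> nrm d c + nrm d y" using nrm_triangle[of d c "- y"] by simp
      moreover have "nrm d y \<le> R'" using R' that by (auto simp: ballR_iff)
      ultimately show ?thesis by simp
    qed
    then show ?thesis by (intro that[of "max \<delta> (nrm d c + R')"]) auto
  qed
  have R0: "0 < R" using R \<delta> by simp
  \<comment> \<open>R bounds the distance from c to points y of K. For w in this cone the tangential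
    part changes \<open>ip d w (c - y)\<close> by at most \<delta>/2 times the depth of w, which the
    reflection across a hyperplane at distance at least \<delta> from c outweighs.\<close>
  define cone where "cone = (\<lambda>w. nrm d (w - smul (ip d w n) n) * R \<le> \<delta> / 2 * (- ip d w n))"
  define S where "S = (\<lambda>t. {x. x \<in> Rd d \<and> nrm d (x - c) \<le> t \<and> cone (x - c)})"
  have coneS: "cone (smul t w) \<longleftrightarrow> cone w" if "0 < t" for t w
  proof -
    have e: "smul t w - smul (ip d (smul t w) n) n = smul t (w - smul (ip d w n) n)"
      by (auto simp: fun_eq_iff ip_simps algebra_simps)
    have "nrm d (smul t w - smul (ip d (smul t w) n) n) * R = t * (nrm d (w - smul (ip d w n) n) * R)"
      unfolding e nrm_smul using that by simp
    moreover have "\<delta> / 2 * (- ip d (smul t w) n) = t * (\<delta> / 2 * (- ip d w n))" by (simp add: ip_simps)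
    ultimately show ?thesis unfolding cone_def using that by (simp only: mult_le_cancel_left_pos)
  qed
  have clS: "closed (S t)" for t
  proof -
    have "S t = Rd d \<inter> {x. nrm d (x - c) \<le> t} \<inter> {x. nrm d (x - c - smul (ip d (x - c) n) n) * R \<le> \<delta> / 2 * (- ip d (x - c) n)}"
      by (auto simp: S_def cone_def)
    also have "closed \<dots>"
      by (intro closed_Int closed_Rd closed_Collect_le continuous_on_nrm continuous_on_vec_diff continuous_on_smul
          continuous_on_mult continuous_on_ip continuous_on_id continuous_on_const continuous_on_minus)
    finally show ?thesis .
  qed
  have Sb [measurable]: "S t \<in> sets borel" for t by (rule borel_closed[OF clS])
  have Sdil: "S t = dil c t (S 1)" if t: "0 < t" for t
  proof (rule Set.set_eqI)
    fix x
    have "c + smul (1/t) (x - c) - c = smul (1/t) (x - c)" by simp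
    moreover have "c + smul (1/t) (x - c) \<in> Rd d \<longleftrightarrow> x \<in> Rd d"
    proof
      assume as: "c + smul (1/t) (x - c) \<in> Rd d"
      have "c + smul t ((c + smul (1/t) (x - c)) - c) \<in> Rd d" by (rule Rd_add[OF c Rd_smul[OF Rd_diff[OF as c]]])
      moreover have "c + smul t ((c + smul (1/t) (x - c)) - c) = x" using t by (auto simp: fun_eq_iff)
      ultimately show "x \<in> Rd d" by simp
    qed (use c in \<open>intro Rd_intros\<close>)
    moreover have "nrm d (smul (1/t) (x - c)) \<le> 1 \<longleftrightarrow> nrm d (x - c) \<le> t" using t by (simp add: nrm_smul field_simps)
    ultimately show "x \<in> S t \<longleftrightarrow> x \<in> dil c t (S 1)"
      using t coneS[of "1/t" "x - c"] by (simp add: dil_iff S_def)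
  qed
  have Sm: "measure (rdm d) (S t) = t ^ d * measure (rdm d) (S 1)" if "0 < t" for t
    using that Sdil[OF that] measure_dil[OF Sb c that, of 1] by simp
  have Sfin: "S t \<in> fmeasurable (rdm d)" for t
  proof -
    have "S t \<subseteq> ballR d (nrm d c + t)"
      using nrm_triangle[of d c] by (auto simp: S_def ballR_iff) (smt (verit) add_diff_cancel_left' diff_add_cancel add.commute)
    then show ?thesis using bounded_emeasure_finite Sb by (auto simp: fmeasurable_def)
  qed
  have S1: "0 < measure (rdm d) (S 1)"
  proof -
    define \<epsilon> where "\<epsilon> = \<delta> / (16 * R)"
    have \<epsilon>: "0 < \<epsilon>" "\<epsilon> \<le> 1/16" "\<epsilon> * R = \<delta> / 16" using R \<delta> R0 by (auto simp: \<epsilon>_def field_simps)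
    \<comment> \<open>Half a unit from c along the axis of the cone: a small ball around this point
      stays inside the cone and the unit ball.\<close>
    define p where "p = c - smul (1/2) n"
    have pR: "p \<in> Rd d" unfolding p_def using c n by (intro Rd_intros)
    have "body d {p}" using pR by (auto simp: body_def cvx_def fun_eq_iff algebra_simps)
    then have B: "body d (par d {p} \<epsilon>)" by (rule body_par)
    have "core d (par d {p} \<epsilon>) p \<epsilon>" using \<epsilon> pR by (auto simp: core_def par_def intro: msumI)
    then have "0 < measure (rdm d) (par d {p} \<epsilon>)" by (rule core_pos[OF B])
    also have "\<dots> \<le> measure (rdm d) (S 1)"
    proof (rule measure_mono_fmeasurable[OF _ _ Sfin])
      show "par d {p} \<epsilon> \<subseteq> S 1"
      proof
        fix x assume "x \<in> par d {p} \<epsilon>"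
        then obtain b where b: "b \<in> Rd d" "nrm d b \<le> \<epsilon>" "x = p + b" by (auto simp: par_def ballR_iff elim!: msumE)
        have w: "x - c = b - smul (1/2) n" by (simp add: b p_def)
        have bn: "\<bar>ip d b n\<bar> \<le> \<epsilon>" using ip_le_nrm[of d b n] b n by simp
        have "nrm d (b - smul (1/2) n) \<le> nrm d b + 1/2" using nrm_triangle[of d b "- smul (1/2) n"] n by (simp add: nrm_smul)
        moreover have "nrm d (b - smul (1/2) n - smul (ip d (b - smul (1/2) n) n) n) \<le> 2 * \<epsilon>"
        proof -
          have "b - smul (1/2) n - smul (ip d (b - smul (1/2) n) n) n = b + smul (- ip d b n) n"
            by (auto simp: fun_eq_iff ip_simps nn algebra_simps)
          moreover have "nrm d (b + smul (- ip d b n) n) \<le> nrm d b + \<bar>ip d b n\<bar>"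
            using nrm_triangle[of d b "smul (- ip d b n) n"] n by (simp add: nrm_smul)
          ultimately have "nrm d (b - smul (1/2) n - smul (ip d (b - smul (1/2) n) n) n) \<le> nrm d b + \<bar>ip d b n\<bar>"
            by (simp only:)
          then show ?thesis using bn b by simp
        qed
        then have "nrm d (b - smul (1/2) n - smul (ip d (b - smul (1/2) n) n) n) * R \<le> 2 * \<epsilon> * R"
          using R0 by (intro mult_right_mono) auto
        moreover have "2 * \<epsilon> * R \<le> \<delta> / 2 * (1/2 - \<epsilon>)"
        proof -
          have "\<delta> / 2 * (7/16) \<le> \<delta> / 2 * (1/2 - \<epsilon>)" using \<epsilon> \<delta> by (intro mult_left_mono) auto
          moreover have "2 * \<epsilon> * R = \<delta> / 8" "\<delta> / 8 \<le> \<delta> / 2 * (7/16)" using \<epsilon>(3) \<delta> by auto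
          ultimately show ?thesis by linarith
        qed
        moreover have "\<delta> / 2 * (1/2 - \<epsilon>) \<le> \<delta> / 2 * (- ip d (b - smul (1/2) n) n)"
          using bn \<delta> by (intro mult_left_mono) (auto simp: ip_simps nn)
        ultimately have "nrm d (b - smul (1/2) n) \<le> 1" "cone (b - smul (1/2) n)"
          unfolding cone_def using b(2) \<epsilon> by linarith+
        moreover have "x \<in> Rd d" unfolding b(3) by (rule Rd_add[OF pR b(1)])
        ultimately show "x \<in> S 1" unfolding S_def by (simp add: w)
      qed
      show "par d {p} \<epsilon> \<in> sets (rdm d)" using bodyD[OF B] by simp
    qed
    finally show ?thesis .
  qed
  show thesis
  proof (rule that[OF S1])
    fix r :: real assume r: "0 \<le> r"
    \<comment> \<open>The inner radius is at least r so that mirror images are farther than r from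
      K; the bound \<delta>/2 keeps it positive when r = 0.\<close>
    define r' where "r' = max r (\<delta>/2)"
    have r': "0 < r'" "r \<le> r'" "r' < r + \<delta>" using \<delta> r by (auto simp: r'_def)
    let ?A = "par d K r" and ?D = "S (r + \<delta>) - S r'"
    have A: "body d ?A" by (rule body_par[OF K(1)])
    have D: "0 \<le> h - ip d x n \<and> r' / 2 \<le> h - ip d x n \<and> x \<in> ?A \<and> refl_hp d n h x \<notin> ?A" if x: "x \<in> ?D" for x
    proof -
      define w where "w = x - c"
      define \<mu> where "\<mu> = - ip d w n"
      define \<tau> where "\<tau> = w - smul (ip d w n) n"
      have xR: "x \<in> Rd d" and w: "nrm d w \<le> r + \<delta>" "r' < nrm d w" and cw: "nrm d \<tau> * R \<le> \<delta> / 2 * \<mu>"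
        using x by (auto simp: S_def cone_def w_def \<mu>_def \<tau>_def)
      have wR: "w \<in> Rd d" using xR c by (simp add: w_def Rd_diff)
      have "0 \<le> \<delta> / 2 * \<mu>" using cw R0 by (meson mult_nonneg_nonneg nrm_nonneg less_imp_le order_trans)
      then have \<mu>0: "0 \<le> \<mu>" using \<delta> by (simp add: zero_le_mult_iff)
      have "nrm d \<tau> * R \<le> R / 2 * \<mu>" using cw R(1) \<mu>0 mult_right_mono[of "\<delta>/2" "R/2" \<mu>] by simp
      then have \<tau>: "nrm d \<tau> \<le> \<mu> / 2" using R0 by (simp add: field_simps)
      have "w = \<tau> + smul (- \<mu>) n" by (auto simp: \<tau>_def \<mu>_def fun_eq_iff)
      then have "nrm d w \<le> nrm d \<tau> + \<mu>" using nrm_triangle[of d \<tau> "smul (- \<mu>) n"] n \<mu>0 by (simp add: nrm_smul)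
      then have \<mu>: "r' / 2 \<le> \<mu>" "0 < \<mu>" using \<tau> w r' by auto
      have ipx: "h - ip d x n = (h - ip d c n) + \<mu>" by (simp add: \<mu>_def w_def ip_simps)
      have p1: "r' / 2 \<le> h - ip d x n" using ipx hc \<mu> \<delta> by simp
      have inA: "x \<in> ?A"
      proof -
        have "c + smul (\<delta> / (r + \<delta>)) w \<in> K"
        proof -
          have "\<delta> / (r + \<delta>) * nrm d w \<le> \<delta> / (r + \<delta>) * (r + \<delta>)" using w r \<delta> by (intro mult_left_mono) auto
          then have "smul (\<delta> / (r + \<delta>)) w \<in> ballR d \<delta>" using wR r \<delta> by (simp add: ballR_iff Rd_smul nrm_smul)
          then show ?thesis using K(2) by (simp add: core_def)
        qed
        moreover have "nrm d (x - (c + smul (\<delta> / (r + \<delta>)) w)) \<le> r"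
        proof -
          have "x - (c + smul (\<delta> / (r + \<delta>)) w) = smul (r / (r + \<delta>)) w"
          proof (rule ext)
            fix i
            have "w i = (r / (r + \<delta>) + \<delta> / (r + \<delta>)) * w i" using r \<delta> by (simp add: add_divide_distrib[symmetric])
            then show "(x - (c + smul (\<delta> / (r + \<delta>)) w)) i = smul (r / (r + \<delta>)) w i" by (simp add: w_def algebra_simps)
          qed
          moreover have "r / (r + \<delta>) * nrm d w \<le> r / (r + \<delta>) * (r + \<delta>)" using w r \<delta> by (intro mult_left_mono) auto
          ultimately show ?thesis using r \<delta> by (simp add: nrm_smul)
        qed
        ultimately show ?thesis using par_iff[OF xR KR] by blast
      qed
      have notA: "refl_hp d n h x \<notin> ?A"
      proof
        assume "refl_hp d n h x \<in> ?A"
        moreover have "refl_hp d n h x \<in> Rd d" using xR n by (simp add: refl_hp_def Rd_intros)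
        ultimately obtain y where y: "y \<in> K" "nrm d (refl_hp d n h x - y) \<le> r" using par_iff[OF _ KR] by blast
        have yh: "0 \<le> h - ip d y n" using K(3)[OF y(1)] by simp
        have ip_w\<tau>: "ip d w (c - y) = ip d \<tau> (c - y) - \<mu> * (ip d c n - ip d y n)"
          unfolding \<tau>_def \<mu>_def by (simp add: ip_simps ip_commute[of d n c] ip_commute[of d n y] algebra_simps)
        have "\<bar>ip d \<tau> (c - y)\<bar> \<le> nrm d \<tau> * nrm d (c - y)" by (rule ip_le_nrm)
        also have "\<dots> \<le> nrm d \<tau> * R" using R(2)[OF y(1)] by (intro mult_left_mono) auto
        finally have tb: "- (\<delta> / 2 * \<mu>) \<le> ip d \<tau> (c - y)" using cw by linarith
        have xy: "x - y = w + (c - y)" by (simp add: w_def)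
        have "(nrm d (x - y))\<^sup>2 = (nrm d w)\<^sup>2 + 2 * ip d w (c - y) + (nrm d (c - y))\<^sup>2"
          unfolding nrm_sq xy by (simp add: ip_add_left ip_add_right ip_commute[of d "c - y" w])
        then have "(nrm d (refl_hp d n h x - y))\<^sup>2 = (nrm d w)\<^sup>2 + 2 * ip d \<tau> (c - y) + (nrm d (c - y))\<^sup>2
            + 2 * \<mu> * (h - ip d c n) + 2 * \<mu> * (h - ip d y n) + 4 * (h - ip d c n) * (h - ip d y n)"
          unfolding refl_hp_dist[OF n] ipx ip_w\<tau> by (simp add: algebra_simps)
        moreover have "2 * \<mu> * \<delta> \<le> 2 * \<mu> * (h - ip d c n)" using hc \<mu> by (intro mult_left_mono) auto
        moreover have "0 \<le> 2 * \<mu> * (h - ip d y n)" "0 \<le> 4 * (h - ip d c n) * (h - ip d y n)" using \<mu> yh hc \<delta> by auto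
        moreover have "0 < \<mu> * \<delta>" using \<mu> \<delta> by simp
        moreover have "- (\<mu> * \<delta>) \<le> 2 * ip d \<tau> (c - y)" using tb by (simp add: mult.commute)
        moreover have "2 * \<mu> * \<delta> = \<mu> * \<delta> + \<mu> * \<delta>" by simp
        \<comment> \<open>The terms of order \<mu> \<delta> dominate the tangential one, so the
          mirror image is farther from y than x is from c, which is already more than r.\<close>
        ultimately have "(nrm d w)\<^sup>2 < (nrm d (refl_hp d n h x - y))\<^sup>2"
          using zero_le_power2[of "nrm d (c - y)"] by linarith
        then have "nrm d w < nrm d (refl_hp d n h x - y)" by (rule power_less_imp_less_base) simp
        then show False using y w r' by simp
      qed
      show ?thesis using p1 inA notA r' by auto
    qed
    have Dm: "?D \<in> fmeasurable (rdm d)" by (intro fmeasurable.Diff Sfin)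
    have "(r' / 2) * (((r + \<delta>) ^ d - r' ^ d) * measure (rdm d) (S 1)) = (r' / 2) * measure (rdm d) ?D"
    proof -
      have "S r' \<subseteq> S (r + \<delta>)" using r' by (auto simp: S_def)
      then have "measure (rdm d) ?D = measure (rdm d) (S (r + \<delta>)) - measure (rdm d) (S r')"
        by (intro measurable_measure_Diff Sfin) (auto intro: fmeasurableD Sfin)
      also have "\<dots> = ((r + \<delta>) ^ d - r' ^ d) * measure (rdm d) (S 1)"
        using Sm[of "r + \<delta>"] Sm[OF r'(1)] r \<delta> by (simp add: algebra_simps)
      finally show ?thesis by simp
    qed
    also have "\<dots> = (\<integral>x. (r' / 2) * indicator ?D x \<partial>rdm d)" by simp
    also have "\<dots> \<le> (\<integral>x. indicator {x. ip d x n < h} x * (h - ip d x n) * (indicator ?A x - indicator ?A (refl_hp d n h x)) \<partial>rdm d)"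
    proof (rule integral_mono_AE)
      show "integrable (rdm d) (\<lambda>x. (r' / 2) * indicator ?D x)"
        using Dm by (intro integrable_mult_right integrable_real_indicator) (auto simp: fmeasurable_def)
      show "integrable (rdm d) (\<lambda>x. indicator {x. ip d x n < h} x * (h - ip d x n) * (indicator ?A x - indicator ?A (refl_hp d n h x)))"
        by (rule reflected_moment(2)[OF n A])
      show "AE x in rdm d. (r' / 2) * indicator ?D x \<le> indicator {x. ip d x n < h} x * (h - ip d x n) * (indicator ?A x - indicator ?A (refl_hp d n h x))"
        using AE_rdm_Rd[of d]
      proof eventually_elim
        case (elim x)
        show ?case
        proof (cases "x \<in> ?D")
          case True
          then show ?thesis using D[OF True] r' by (auto simp: indicator_def)
        next
          case False
          have "ip d x n < h \<Longrightarrow> refl_hp d n h x \<in> ?A \<Longrightarrow> x \<in> ?A"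
            using reflect_into_par[OF n KR K(3) elim] by auto
          then show ?thesis using False by (auto simp: indicator_def)
        qed
      qed
    qed
    also have "\<dots> = mom d (\<lambda>x. h - ip d x n) ?A" by (rule reflected_moment(1)[OF n A, symmetric])
    finally show "max r (\<delta>/2) / 2 * (((r + \<delta>) ^ d - (max r (\<delta>/2)) ^ d) * measure (rdm d) (S 1)) \<le> mom d (\<lambda>x. h - ip d x n) (par d K r)"
      by (simp add: r'_def)
  qed
qed

lemma mom_diff_const:
  assumes "body d A" shows "mom d (\<lambda>x. h - ip d x n) A = h * measure (rdm d) A - mom d (\<lambda>x. ip d x n) A"
proof -
  have A: "A \<in> sets borel" using bodyD[OF assms] by simp
  have i: "integrable (rdm d) (\<lambda>x. indicator A x * h)" "integrable (rdm d) (\<lambda>x. indicator A x * ip d x n)"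
    by (intro integrable_compact bodyD(1,2)[OF assms] continuous_on_const continuous_on_ip continuous_on_id)+
  have "mom d (\<lambda>x. h - ip d x n) A = (\<integral>x. indicator A x * h - indicator A x * ip d x n \<partial>rdm d)"
    unfolding mom_def by (intro Bochner_Integration.integral_cong) (auto simp: algebra_simps)
  also have "\<dots> = h * measure (rdm d) A - mom d (\<lambda>x. ip d x n) A"
    unfolding Bochner_Integration.integral_diff[OF i] using A by (simp add: mom_def)
  finally show ?thesis .
qed

lemma par_pos: "body d K \<Longrightarrow> core d K c \<delta> \<Longrightarrow> 0 \<le> r \<Longrightarrow> 0 < measure (rdm d) (par d K r)"
  by (rule core_pos[OF body_par core_mono[OF _ subset_par]])

text \<open>The second claim is uniform in r: the moment in \<open>moment_gap\<close> has order r^d,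
  depth r/2 times annulus volume of order r^(d-1), and the volume of the parallel body is at most
  (2r)^d times that of the unit ball for large r. The quotient stays away from 0, so the limit of
  the path stays strictly inside as well.\<close>

lemma cg_strict:
  assumes n: "n \<in> Rd d" "nrm d n = 1" and K: "body d K" "core d K c \<delta>" "\<And>y. y \<in> K \<Longrightarrow> ip d y n \<le> h"
    and d: "0 < d"
  shows "0 \<le> r \<Longrightarrow> ip d (cg d (par d K r)) n < h"
    and "\<exists>\<eta>>0. \<exists>R. \<forall>r\<ge>R. ip d (cg d (par d K r)) n \<le> h - \<eta>"
proof -
  have \<delta>: "0 < \<delta>" using K by (auto simp: core_def)
  obtain s where s: "0 < s" "\<And>r. 0 \<le> r \<Longrightarrow>
      max r (\<delta>/2) / 2 * (((r + \<delta>) ^ d - (max r (\<delta>/2)) ^ d) * s) \<le> mom d (\<lambda>x. h - ip d x n) (par d K r)"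
    using moment_gap[OF n K] by blast
  have eq: "h - ip d (cg d (par d K r)) n = mom d (\<lambda>x. h - ip d x n) (par d K r) / measure (rdm d) (par d K r)" if "0 \<le> r" for r
    using par_pos[OF K(1,2) that] by (simp add: ip_cg body_par K mom_diff_const field_simps)
  show "ip d (cg d (par d K r)) n < h" if r: "0 \<le> r" for r
  proof -
    have "max r (\<delta>/2) ^ d < (r + \<delta>) ^ d" using r \<delta> d by (intro power_strict_mono) auto
    then have "0 < max r (\<delta>/2) / 2 * (((r + \<delta>) ^ d - (max r (\<delta>/2)) ^ d) * s)" using s \<delta> by simp
    then have "0 < mom d (\<lambda>x. h - ip d x n) (par d K r)" using s(2)[OF r] by linarith
    then have "0 < h - ip d (cg d (par d K r)) n" using eq[OF r] par_pos[OF K(1,2) r] by simp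
    then show ?thesis by simp
  qed
  obtain R where R: "0 < R" "K \<subseteq> ballR d R" using body_bounded[OF K(1)] .
  let ?V = "measure (rdm d) (ballR d 1)"
  have V: "0 < ?V" by (rule measure_ballR_pos) simp
  have gap: "\<delta> * s / (2 * 2 ^ d * ?V) \<le> h - ip d (cg d (par d K r)) n" if r: "max R \<delta> \<le> r" for r
  proof -
    have r0: "0 < r" "R \<le> r" "\<delta> \<le> r" using r R by auto
    have "par d K r \<subseteq> ballR d (R + r)"
    proof
      fix x assume "x \<in> par d K r"
      then obtain a b where "a \<in> K" "b \<in> ballR d r" "x = a + b" by (auto simp: par_def elim!: msumE)
      then show "x \<in> ballR d (R + r)" using R(2) nrm_triangle[of d a b] by (force simp: ballR_iff Rd_add)
    qed
    then have "measure (rdm d) (par d K r) \<le> measure (rdm d) (ballR d (R + r))"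
      using bodyD[OF body_par[OF K(1)]] by (intro measure_mono_fmeasurable body_fmeasurable body_ballR) auto
    also have "\<dots> = (R + r) ^ d * ?V" using R r0 by (intro measure_ballR) auto
    also have "\<dots> \<le> (2 * r) ^ d * ?V" using R r0 V by (intro mult_right_mono power_mono) auto
    finally have up: "measure (rdm d) (par d K r) \<le> (2 * r) ^ d * ?V" .
    have mx: "max r (\<delta>/2) = r" using r0 \<delta> by simp
    have "r ^ d + \<delta> * r ^ (d - 1) \<le> (r + \<delta>) ^ d"
    proof -
      obtain e where e: "d = Suc e" using d gr0_conv_Suc by blast
      have "r ^ e * (r + \<delta>) \<le> (r + \<delta>) ^ e * (r + \<delta>)" using r0 \<delta> by (intro mult_right_mono power_mono) auto
      then show ?thesis by (simp add: e algebra_simps)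
    qed
    then have "r / 2 * ((\<delta> * r ^ (d - 1)) * s) \<le> r / 2 * (((r + \<delta>) ^ d - r ^ d) * s)"
      using r0 s by (intro mult_left_mono mult_right_mono) auto
    also have "\<dots> \<le> mom d (\<lambda>x. h - ip d x n) (par d K r)" using s(2)[of r] r0 by (simp add: mx)
    finally have lo': "r / 2 * ((\<delta> * r ^ (d - 1)) * s) \<le> mom d (\<lambda>x. h - ip d x n) (par d K r)" .
    have lo: "r ^ d * (\<delta> * s / 2) \<le> mom d (\<lambda>x. h - ip d x n) (par d K r)"
    proof -
      obtain e where e: "d = Suc e" using d gr0_conv_Suc by blast
      have "r ^ d = r * r ^ (d - 1)" by (simp add: e)
      then have "r ^ d * (\<delta> * s / 2) = r / 2 * ((\<delta> * r ^ (d - 1)) * s)" by (simp only:) simp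
      with lo' show ?thesis by (simp only:)
    qed
    have "\<delta> * s / (2 * 2 ^ d * ?V) = r ^ d * (\<delta> * s / 2) / ((2 * r) ^ d * ?V)"
      using r0 V by (simp add: power_mult_distrib field_simps)
    also have "\<dots> \<le> mom d (\<lambda>x. h - ip d x n) (par d K r) / measure (rdm d) (par d K r)"
    proof (rule frac_le[OF _ lo _ up])
      have "0 \<le> r ^ d * (\<delta> * s / 2)" using r0 \<delta> s by simp
      then show "0 \<le> mom d (\<lambda>x. h - ip d x n) (par d K r)" using lo by linarith
    qed (use r0 par_pos[OF K(1,2), of r] in auto)
    also have "\<dots> = h - ip d (cg d (par d K r)) n" using eq[of r] r0 by simp
    finally show ?thesis .
  qed
  have pos: "0 < \<delta> * s / (2 * 2 ^ d * ?V)" using V \<delta> s by simp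
  have "\<forall>r\<ge>max R \<delta>. ip d (cg d (par d K r)) n \<le> h - \<delta> * s / (2 * 2 ^ d * ?V)"
  proof (intro allI impI)
    fix r assume "max R \<delta> \<le> r"
    from gap[OF this] show "ip d (cg d (par d K r)) n \<le> h - \<delta> * s / (2 * 2 ^ d * ?V)" by linarith
  qed
  with pos show "\<exists>\<eta>>0. \<exists>R. \<forall>r\<ge>R. ip d (cg d (par d K r)) n \<le> h - \<eta>" by blast
qed

section \<open>Zonotopes\<close>

lemma msum_commute: "msum A B = msum B A"
  by (auto simp: msum_def) (metis add.commute)+

lemma msum_assoc: "msum (msum A B) C = msum A (msum B C)"
  by (auto simp: msum_def) (metis add.assoc)+

lemma msum_0: "msum A {0} = A"
  by (auto simp: msum_def)

definition seg :: "vec \<Rightarrow> real \<Rightarrow> vec set" where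
  "seg a s = (\<lambda>t. smul t a) ` {- s..s}"

text \<open>The zonotope generated by the segments from -r a to r a. The common parameter r plays
  the role of the radius of the ball.\<close>

fun zon :: "vec list \<Rightarrow> real \<Rightarrow> vec set" where
  "zon [] r = {0}"
| "zon (a # as) r = msum (seg a r) (zon as r)"

lemma body_seg: "a \<in> Rd d \<Longrightarrow> body d (seg a s)"
proof -
  assume a: "a \<in> Rd d"
  have "compact (seg a s)" unfolding seg_def
    by (intro compact_continuous_image continuous_on_smul continuous_on_id continuous_on_const compact_Icc)
  moreover have "cvx (seg a s)"
    unfolding cvx_def
  proof (intro ballI)
    fix x y and t :: real assume "x \<in> seg a s" "y \<in> seg a s" and t: "t \<in> {0..1}"
    then obtain p q where pq: "- s \<le> p" "p \<le> s" "- s \<le> q" "q \<le> s" "x = smul p a" "y = smul q a" by (auto simp: seg_def)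
    have "(1 - t) * (- s) + t * (- s) \<le> (1 - t) * p + t * q" "(1 - t) * p + t * q \<le> (1 - t) * s + t * s"
      using t pq by (intro add_mono mult_left_mono; simp)+
    then have "(1 - t) * p + t * q \<in> {- s..s}" by (simp add: algebra_simps)
    moreover have "smul (1 - t) x + smul t y = smul ((1 - t) * p + t * q) a" by (auto simp: pq fun_eq_iff algebra_simps)
    ultimately show "smul (1 - t) x + smul t y \<in> seg a s" by (auto simp: seg_def)
  qed
  ultimately show ?thesis using a by (auto simp: body_def seg_def Rd_smul)
qed

lemma body_singleton: "p \<in> Rd d \<Longrightarrow> body d {p}"
  by (auto simp: body_def cvx_def fun_eq_iff algebra_simps)

lemma body_zon: "set as \<subseteq> Rd d \<Longrightarrow> body d (zon as r)"
  by (induction as) (auto intro!: body_msum body_seg body_singleton Rd_0)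

lemma zero_seg: "0 \<le> s \<Longrightarrow> 0 \<in> seg a s"
  unfolding seg_def by (rule image_eqI[of _ _ 0]) (auto simp: fun_eq_iff)

lemma zero_zon: "0 \<le> r \<Longrightarrow> 0 \<in> zon as r"
proof (induction as)
  case (Cons a as)
  from msumI[OF zero_seg[OF Cons.prems] Cons.IH[OF Cons.prems]] show ?case by (simp only: zon.simps add_0)
qed (simp only: zon.simps singletonI)

lemma subset_msum: "0 \<in> B \<Longrightarrow> A \<subseteq> msum A B"
proof
  fix x assume "0 \<in> B" "x \<in> A"
  then have "x + 0 \<in> msum A B" by (intro msumI)
  then show "x \<in> msum A B" by simp
qed

text \<open>With a constant term, the event that a centroid lies on a given hyperplane is the
  vanishing of a single moment, see \<open>mom_aff_cg\<close>.\<close>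

definition aff :: "nat \<Rightarrow> real \<Rightarrow> vec \<Rightarrow> vec \<Rightarrow> real" where
  "aff d \<alpha> v x = \<alpha> + ip d x v"

lemma continuous_on_aff: "continuous_on S (aff d \<alpha> v)"
  unfolding aff_def by (intro continuous_on_add continuous_on_const continuous_on_ip continuous_on_id)

lemma integrable_aff: "body d A \<Longrightarrow> integrable (rdm d) (\<lambda>x. indicator A x * aff d \<alpha> v x)"
  by (intro integrable_compact bodyD continuous_on_aff)

lemma mom_aff:
  assumes A: "body d A" shows "mom d (aff d \<alpha> v) A = \<alpha> * measure (rdm d) A + mom d (\<lambda>x. ip d x v) A"
proof -
  have Ab: "A \<in> sets borel" using bodyD[OF A] by simp
  have i: "integrable (rdm d) (\<lambda>x. indicator A x * \<alpha>)" "integrable (rdm d) (\<lambda>x. indicator A x * ip d x v)"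
    by (intro integrable_compact bodyD(1,2)[OF A] continuous_on_const continuous_on_ip continuous_on_id)+
  have "mom d (aff d \<alpha> v) A = (\<integral>x. indicator A x * \<alpha> + indicator A x * ip d x v \<partial>rdm d)"
    unfolding mom_def aff_def by (intro Bochner_Integration.integral_cong) (auto simp: algebra_simps)
  also have "\<dots> = \<alpha> * measure (rdm d) A + mom d (\<lambda>x. ip d x v) A"
    unfolding Bochner_Integration.integral_add[OF i] using Ab by (simp add: mom_def)
  finally show ?thesis .
qed

definition shift :: "vec \<Rightarrow> vec set \<Rightarrow> vec set" where
  "shift c A = (\<lambda>x. x + c) ` A"

lemma body_shift: "c \<in> Rd d \<Longrightarrow> body d A \<Longrightarrow> body d (shift c A)"
proof -
  assume c: "c \<in> Rd d" and A: "body d A"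
  have "shift c A = msum A {c}" by (auto simp: shift_def msum_def)
  then show ?thesis using body_msum[OF A body_singleton[OF c]] by simp
qed

lemma mom_shift:
  assumes A: "body d A" and c: "c \<in> Rd d"
  shows "mom d (aff d \<alpha> v) (shift c A) = mom d (aff d \<alpha> v) A + ip d c v * measure (rdm d) A"
proof -
  have mem: "x + c \<in> shift c A \<longleftrightarrow> x \<in> A" for x by (auto simp: shift_def)
  have bs: "shift c A \<in> sets borel" "A \<in> sets borel" using bodyD body_shift[OF c A] A by auto
  define u where "u = (\<lambda>x. indicator (shift c A) x * aff d \<alpha> v x)"
  have um [measurable]: "u \<in> borel_measurable borel"
    unfolding u_def using bs borel_measurable_continuous_onI[OF continuous_on_aff[of UNIV d \<alpha> v]] by measurable
  have tm: "(\<lambda>x. x + c) \<in> measurable (rdm d) borel"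
    using borel_measurable_continuous_onI[OF continuous_on_vec_add[OF continuous_on_id continuous_on_const], of c] by simp
  have "distr (rdm d) borel (\<lambda>x. x + c) = rdm d"
  proof (rule measure_eqI)
    fix X assume "X \<in> sets (distr (rdm d) borel (\<lambda>x. x + c))"
    then have X: "X \<in> sets borel" by simp
    have "emeasure (distr (rdm d) borel (\<lambda>x. x + c)) X = (\<integral>\<^sup>+x. indicator X x \<partial>distr (rdm d) borel (\<lambda>x. x + c))"
      using X by simp
    also have "\<dots> = (\<integral>\<^sup>+x. indicator X (x + c) \<partial>rdm d)"
      by (rule nn_integral_distr[OF tm]) (use X in simp)
    also have "\<dots> = (\<integral>\<^sup>+x. indicator X (smul 1 x + c) \<partial>rdm d)"
      by (intro nn_integral_cong arg_cong[where f="indicator X"]) (auto simp: fun_eq_iff)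
    also have "\<dots> = ennreal ((1 / \<bar>1::real\<bar>) ^ d) * (\<integral>\<^sup>+x. indicator X x \<partial>rdm d)"
      by (rule nn_integral_rdm_affine) (use X c in auto)
    finally show "emeasure (distr (rdm d) borel (\<lambda>x. x + c)) X = emeasure (rdm d) X" using X by simp
  qed simp
  then have "mom d (aff d \<alpha> v) (shift c A) = (\<integral>x. u (x + c) \<partial>rdm d)"
    unfolding mom_def using integral_distr[OF tm um] by (simp add: u_def)
  also have "\<dots> = (\<integral>x. indicator A x * aff d (\<alpha> + ip d c v) v x \<partial>rdm d)"
    by (intro Bochner_Integration.integral_cong) (auto simp: u_def mem indicator_def aff_def ip_add_left)
  also have "\<dots> = mom d (aff d (\<alpha> + ip d c v) v) A" by (simp add: mom_def)
  finally show ?thesis by (simp add: mom_aff[OF A] algebra_simps)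
qed

lemma mom_Un_Int:
  assumes A: "body d A" and B: "body d B"
  shows "mom d (aff d \<alpha> v) (A \<union> B) + mom d (aff d \<alpha> v) (A \<inter> B) = mom d (aff d \<alpha> v) A + mom d (aff d \<alpha> v) B"
proof -
  have AB: "compact (A \<inter> B)" "A \<inter> B \<subseteq> Rd d" "compact (A \<union> B)" "A \<union> B \<subseteq> Rd d"
    using bodyD[OF A] bodyD[OF B] by (auto intro: compact_Int)
  note i = integrable_compact[OF AB(1,2) continuous_on_aff[of UNIV d \<alpha> v]] integrable_compact[OF AB(3,4) continuous_on_aff[of UNIV d \<alpha> v]]
    integrable_aff[OF A, of \<alpha> v] integrable_aff[OF B, of \<alpha> v]
  have "mom d (aff d \<alpha> v) (A \<union> B) + mom d (aff d \<alpha> v) (A \<inter> B)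
      = (\<integral>x. indicator (A \<union> B) x * aff d \<alpha> v x + indicator (A \<inter> B) x * aff d \<alpha> v x \<partial>rdm d)"
    unfolding mom_def using i by simp
  also have "\<dots> = (\<integral>x. indicator A x * aff d \<alpha> v x + indicator B x * aff d \<alpha> v x \<partial>rdm d)"
    by (intro Bochner_Integration.integral_cong) (auto simp: indicator_def)
  also have "\<dots> = mom d (aff d \<alpha> v) A + mom d (aff d \<alpha> v) B"
    unfolding mom_def using i by simp
  finally show ?thesis .
qed

text \<open>Boundedness replaces continuity in Jensen's equation: the deviation k from the chord
  over [0,S] satisfies the equation and vanishes at both ends, and therefore any bound on |k| can be
  halved, again and again.\<close>

lemma jensen_bounded_affine:
  fixes g :: "real \<Rightarrow> real"
  assumes J: "\<And>s t. 0 \<le> t \<Longrightarrow> t \<le> s \<Longrightarrow> g (s + t) + g (s - t) = 2 * g s"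
    and bd: "\<And>S. \<exists>M. \<forall>s. 0 \<le> s \<longrightarrow> s \<le> S \<longrightarrow> \<bar>g s\<bar> \<le> M" and s: "0 \<le> s"
  shows "g s = (1 - s) * g 0 + s * g 1"
proof -
  have aff: "g x = g 0 + x / S * (g S - g 0)" if S: "0 < S" and x: "0 \<le> x" "x \<le> S" for x S
  proof -
    define k where "k = (\<lambda>x. g x - g 0 - x / S * (g S - g 0))"
    have kJ: "k (s + t) + k (s - t) = 2 * k s" if "0 \<le> t" "t \<le> s" for s t
    proof -
      have "(s + t) / S * D + (s - t) / S * D = 2 * (s / S * D)" for D
        by (simp add: add_divide_distrib diff_divide_distrib algebra_simps)
      moreover have "p + q = 2 * c \<Longrightarrow> G1 + G2 = 2 * G \<Longrightarrow> G1 - g0 - p + (G2 - g0 - q) = 2 * (G - g0 - c)"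
        for p :: real and q c G1 G2 G g0 by (simp add: algebra_simps)
      ultimately show ?thesis using J[OF that] unfolding k_def by blast
    qed
    obtain M where M: "\<And>s. 0 \<le> s \<Longrightarrow> s \<le> S \<Longrightarrow> \<bar>g s\<bar> \<le> M" using bd by blast
    have kM: "\<bar>k s\<bar> \<le> M + M + 1 * (M + M)" if "0 \<le> s" "s \<le> S" for s
    proof -
      have "\<bar>s / S * (g S - g 0)\<bar> \<le> 1 * (M + M)"
        unfolding abs_mult using M[of S] M[of 0] that S by (intro mult_mono) auto
      then show ?thesis using M[of s] M[of 0] that S unfolding k_def by linarith
    qed
    have k0: "k 0 = 0" "k S = 0" using S by (auto simp: k_def)
    \<comment> \<open>A point of the left half is the midpoint of 0 and 2s, one of the right half
      the midpoint of 2s - S and S; at the ends k is 0.\<close>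
    have half: "\<bar>k s\<bar> \<le> B / 2" if B: "\<And>s. 0 \<le> s \<Longrightarrow> s \<le> S \<Longrightarrow> \<bar>k s\<bar> \<le> B" and s: "0 \<le> s" "s \<le> S" for B s
    proof (cases "s \<le> S / 2")
      case True
      have "k (2 * s) = 2 * k s" using kJ[of s s] s k0 by (simp add: mult.commute)
      then show ?thesis using B[of "2 * s"] s True by auto
    next
      case False
      have "k S + k (2 * s - S) = 2 * k s" using kJ[of "S - s" s] s False by (simp add: algebra_simps)
      then have "k (2 * s - S) = 2 * k s" using k0 by simp
      then show ?thesis using B[of "2 * s - S"] s False by auto
    qed
    have "\<bar>k s\<bar> \<le> (4 * M) / 2 ^ n" if "0 \<le> s" "s \<le> S" for s n
      using that
    proof (induction n arbitrary: s)
      case 0 then show ?case using kM[of s] by simp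
    next
      case (Suc n)
      then show ?case using half[of "(4 * M) / 2 ^ n" s] by (simp add: field_simps)
    qed
    from this[OF x] have le: "\<bar>k x\<bar> \<le> (4 * M) / 2 ^ n" for n .
    have "(\<lambda>n. (4 * M) / 2 ^ n) \<longlonglongrightarrow> 0" by real_asymp
    then have "\<bar>k x\<bar> \<le> 0" by (rule LIMSEQ_le_const) (use le in auto)
    then show ?thesis by (simp add: k_def)
  qed
  \<comment> \<open>The chord is taken over [0,1] or over [0,s], whichever contains both 1 and
    s.\<close>
  show ?thesis
  proof (cases "s \<le> 1")
    case True
    then show ?thesis using aff[of 1 s] s by (simp add: algebra_simps)
  next
    case False
    then have "g 1 = g 0 + 1 / s * (g s - g 0)" using aff[of s 1] by simp
    then have "s * g 1 = s * g 0 + (g s - g 0)" using False by (simp add: field_simps)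
    then show ?thesis by (simp add: algebra_simps)
  qed
qed

text \<open>Adding a symmetric segment: inclusion-exclusion for the two translates of $K + [-s,s]a$ by $\pm ta$ makes
  moments of affine functions satisfy Jensen's equation, because the contributions of the translations cancel.\<close>

lemma mom_segment_affine:
  assumes K: "body d K" and a: "a \<in> Rd d" and s: "0 \<le> s"
  shows "mom d (aff d \<alpha> v) (msum K (seg a s)) = (1 - s) * mom d (aff d \<alpha> v) K + s * mom d (aff d \<alpha> v) (msum K (seg a 1))"
proof -
  define L where "L = (\<lambda>s. msum K (seg a s))"
  have bL: "body d (L s)" for s unfolding L_def by (intro body_msum K body_seg a)
  have Lmem: "x \<in> L s \<longleftrightarrow> (\<exists>k\<in>K. \<exists>t. - s \<le> t \<and> t \<le> s \<and> x = k + smul t a)" for x s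
    unfolding L_def msum_def seg_def by (simp add: image_def Bex_def) blast
  have mono: "L s \<subseteq> L s'" if "s \<le> s'" for s s' using that unfolding L_def by (intro msum_mono) (auto simp: seg_def)
  have shiftmem: "x \<in> shift (smul t a) (L s) \<longleftrightarrow> (\<exists>k\<in>K. \<exists>q. - s \<le> q - t \<and> q - t \<le> s \<and> x = k + smul q a)" for x s t
  proof
    assume "x \<in> shift (smul t a) (L s)"
    then obtain k q where kq: "k \<in> K" "- s \<le> q" "q \<le> s" "x = k + smul q a + smul t a" by (auto simp: shift_def Lmem)
    have "x = k + smul (q + t) a" by (auto simp: kq fun_eq_iff algebra_simps)
    then show "\<exists>k\<in>K. \<exists>q. - s \<le> q - t \<and> q - t \<le> s \<and> x = k + smul q a"
      using kq by (intro bexI[of _ k] exI[of _ "q + t"]) auto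
  next
    assume "\<exists>k\<in>K. \<exists>q. - s \<le> q - t \<and> q - t \<le> s \<and> x = k + smul q a"
    then obtain k q where kq: "k \<in> K" "- s \<le> q - t" "q - t \<le> s" "x = k + smul q a" by blast
    have "x = (k + smul (q - t) a) + smul t a" by (auto simp: kq fun_eq_iff algebra_simps)
    moreover have "k + smul (q - t) a \<in> L s" using kq Lmem by blast
    ultimately show "x \<in> shift (smul t a) (L s)" unfolding shift_def by blast
  qed
  have J: "mom d (aff d \<alpha> v) (L (s + t)) + mom d (aff d \<alpha> v) (L (s - t)) = 2 * mom d (aff d \<alpha> v) (L s)" if t: "0 \<le> t" "t \<le> s" for s t
  proof -
    let ?P = "shift (smul t a) (L s)" and ?M = "shift (smul (- t) a) (L s)"
    have un: "?P \<union> ?M = L (s + t)"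
    proof (rule equalityI; rule subsetI)
      fix x assume "x \<in> ?P \<union> ?M"
      then obtain k q where "k \<in> K" "x = k + smul q a" "(- s \<le> q - t \<and> q - t \<le> s) \<or> (- s \<le> q - (- t) \<and> q - (- t) \<le> s)"
        unfolding Un_iff shiftmem by blast
      then have "k \<in> K" "- (s + t) \<le> q" "q \<le> s + t" "x = k + smul q a" using t by linarith+
      then show "x \<in> L (s + t)" unfolding Lmem by blast
    next
      fix x assume "x \<in> L (s + t)"
      then obtain k q where kq: "k \<in> K" "- (s + t) \<le> q" "q \<le> s + t" "x = k + smul q a" unfolding Lmem by blast
      have "(- s \<le> q - t \<and> q - t \<le> s) \<or> (- s \<le> q - (- t) \<and> q - (- t) \<le> s)" using kq t by linarith
      then show "x \<in> ?P \<union> ?M" unfolding Un_iff shiftmem using kq by blast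
    qed
    have int: "?P \<inter> ?M = L (s - t)"
    proof (rule equalityI; rule subsetI)
      fix x assume "x \<in> ?P \<inter> ?M"
      then obtain k q k' q' where kq: "k \<in> K" "- s \<le> q - t" "q - t \<le> s" "x = k + smul q a"
          "k' \<in> K" "- s \<le> q' - (- t)" "q' - (- t) \<le> s" "x = k' + smul q' a"
        unfolding Int_iff shiftmem by blast
      show "x \<in> L (s - t)"
      proof (cases "q \<le> s - t \<or> - (s - t) \<le> q'")
        case True
        then show ?thesis
        proof
          assume "q \<le> s - t" then show ?thesis unfolding Lmem using kq by (intro bexI[of _ k] exI[of _ q]) auto
        next
          assume "- (s - t) \<le> q'" then show ?thesis unfolding Lmem using kq by (intro bexI[of _ k'] exI[of _ q']) auto
        qed
      next
        case False
        then have q: "0 < q" "q' < 0" using t by auto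
        \<comment> \<open>The two representations of x have parameters of opposite sign. The
          combination with weight l has parameter 0, and convexity puts its base point into
          K.\<close>
        define l where "l = q / (q - q')"
        have l: "0 \<le> l" "l \<le> 1" "(1 - l) * q + l * q' = 0" using q by (auto simp: l_def field_simps)
        have "smul (1 - l) k + smul l k' \<in> K" using kq l bodyD[OF K] by (intro cvxD) auto
        moreover have "x = smul (1 - l) k + smul l k' + smul 0 a"
        proof (rule ext)
          fix i
          have "x i = (1 - l) * x i + l * x i" by (simp add: algebra_simps)
          also have "\<dots> = (1 - l) * (k i + q * a i) + l * (k' i + q' * a i)"
          proof -
            have "k i + q * a i = x i" unfolding kq(4) by simp
            moreover have "k' i + q' * a i = x i" unfolding kq(8) by simp
            ultimately show ?thesis by (simp only:)
          qed
          also have "\<dots> = (1 - l) * k i + l * k' i + ((1 - l) * q + l * q') * a i" by (simp add: algebra_simps)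
          finally show "x i = (smul (1 - l) k + smul l k' + smul 0 a) i" by (simp add: l(3))
        qed
        ultimately show ?thesis unfolding Lmem using t by (intro bexI[of _ "smul (1 - l) k + smul l k'"] exI[of _ 0]) auto
      qed
    next
      fix x assume "x \<in> L (s - t)"
      then obtain k q where kq: "k \<in> K" "- (s - t) \<le> q" "q \<le> s - t" "x = k + smul q a" unfolding Lmem by blast
      then have "- s \<le> q - t \<and> q - t \<le> s" "- s \<le> q - (- t) \<and> q - (- t) \<le> s" using t by auto
      then show "x \<in> ?P \<inter> ?M" unfolding Int_iff shiftmem using kq by blast
    qed
    have "mom d (aff d \<alpha> v) (?P \<union> ?M) + mom d (aff d \<alpha> v) (?P \<inter> ?M) = mom d (aff d \<alpha> v) ?P + mom d (aff d \<alpha> v) ?M"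
      by (intro mom_Un_Int body_shift Rd_smul a bL)
    then show ?thesis
      unfolding un int mom_shift[OF bL Rd_smul[OF a]] by (simp add: ip_simps)
  qed
  have bd: "\<exists>M. \<forall>s. 0 \<le> s \<longrightarrow> s \<le> S \<longrightarrow> \<bar>mom d (aff d \<alpha> v) (L s)\<bar> \<le> M" for S
  proof (intro exI allI impI)
    fix s assume "0 \<le> s" "s \<le> S"
    have i: "integrable (rdm d) (\<lambda>x. indicator (L s) x * aff d \<alpha> v x)" "integrable (rdm d) (\<lambda>x. indicator (L S) x * aff d \<alpha> v x)"
      by (intro integrable_aff bL)+
    have "\<bar>mom d (aff d \<alpha> v) (L s)\<bar> \<le> (\<integral>x. \<bar>indicator (L s) x * aff d \<alpha> v x\<bar> \<partial>rdm d)"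
      unfolding mom_def by (rule integral_abs_bound)
    also have "\<dots> \<le> (\<integral>x. \<bar>indicator (L S) x * aff d \<alpha> v x\<bar> \<partial>rdm d)"
      using i mono[OF \<open>s \<le> S\<close>] by (intro integral_mono) (auto simp: indicator_def)
    finally show "\<bar>mom d (aff d \<alpha> v) (L s)\<bar> \<le> (\<integral>x. \<bar>indicator (L S) x * aff d \<alpha> v x\<bar> \<partial>rdm d)" .
  qed
  have "seg a 0 = {0}" by (auto simp: seg_def fun_eq_iff)
  then have "L 0 = K" by (simp add: L_def msum_0)
  then show ?thesis
    using jensen_bounded_affine[of "\<lambda>s. mom d (aff d \<alpha> v) (L s)", OF J bd s] by (simp add: L_def)
qed

text \<open>Each segment multiplies by weights 1 - r and r that are affine in r. K is generalized
  because the second summand absorbs a segment of length parameter 1 into the body. The degree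
  obtained this way depends on the number of segments.\<close>

lemma mom_zon_poly:
  assumes "set as \<subseteq> Rd d" "body d K"
  shows "\<exists>p. \<forall>r\<ge>0. mom d (aff d \<alpha> v) (msum K (zon as r)) = poly p r"
  using assms
proof (induction as arbitrary: K)
  case Nil
  then show ?case by (intro exI[of _ "[:mom d (aff d \<alpha> v) K:]"]) (simp add: msum_0)
next
  case (Cons a as)
  then have a: "a \<in> Rd d" "set as \<subseteq> Rd d" by auto
  obtain p where p: "\<And>r. 0 \<le> r \<Longrightarrow> mom d (aff d \<alpha> v) (msum K (zon as r)) = poly p r" using Cons.IH[OF a(2) Cons.prems(2)] by blast
  obtain q where q: "\<And>r. 0 \<le> r \<Longrightarrow> mom d (aff d \<alpha> v) (msum (msum K (seg a 1)) (zon as r)) = poly q r"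
    using Cons.IH[OF a(2) body_msum[OF Cons.prems(2) body_seg[OF a(1)]]] by blast
  have sw: "msum K (msum (seg a s) Z) = msum (msum K Z) (seg a s)" for s Z
    by (simp only: msum_assoc msum_commute[of "seg a s"])
  have "mom d (aff d \<alpha> v) (msum K (zon (a # as) r)) = poly ([:1, -1:] * p + [:0, 1:] * q) r" if "0 \<le> r" for r
  proof -
    have "mom d (aff d \<alpha> v) (msum K (zon (a # as) r)) = mom d (aff d \<alpha> v) (msum (msum K (zon as r)) (seg a r))"
      by (simp only: zon.simps sw)
    also have "\<dots> = (1 - r) * mom d (aff d \<alpha> v) (msum K (zon as r)) + r * mom d (aff d \<alpha> v) (msum (msum K (zon as r)) (seg a 1))"
      by (intro mom_segment_affine body_msum body_zon a Cons.prems that)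
    also have "msum (msum K (zon as r)) (seg a 1) = msum (msum K (seg a 1)) (zon as r)"
      by (simp only: msum_assoc msum_commute[of "seg a 1"])
    finally show ?thesis using p[OF that] q[OF that] by (simp add: algebra_simps)
  qed
  then show ?case by blast
qed

section \<open>The degree of the moment polynomial\<close>

lemma poly_growth_degree:
  fixes p :: "real poly"
  assumes "\<And>r. 0 \<le> r \<Longrightarrow> \<bar>poly p r\<bar> \<le> C * (1 + r) ^ n"
  shows "degree p \<le> n"
proof (rule ccontr)
  assume "\<not> ?thesis"
  then have n: "n < degree p" by simp
  have C: "0 \<le> C" using assms[of 0] by (simp add: order_trans[OF abs_ge_zero])
  have 1: "((\<lambda>x. poly p x / x ^ degree p) \<longlongrightarrow> lead_coeff p) at_top"
    using poly_divide_tendsto_aux[of p] by (rule filterlim_mono) (auto simp: at_top_le_at_infinity)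
  have "((\<lambda>x::real. (C * 2 ^ n) * inverse x) \<longlongrightarrow> (C * 2 ^ n) * 0) at_top"
    by (intro tendsto_mult tendsto_const tendsto_inverse_0_at_top filterlim_ident)
  then have lim: "((\<lambda>x::real. (C * 2 ^ n) * inverse x) \<longlongrightarrow> 0) at_top" by simp
  have "eventually (\<lambda>x. norm (poly p x / x ^ degree p) \<le> (C * 2 ^ n) * inverse x) at_top"
    using eventually_ge_at_top[of 1]
  proof eventually_elim
    case (elim x)
    have "\<bar>poly p x\<bar> \<le> C * (1 + x) ^ n" using assms[of x] elim by simp
    also have "\<dots> \<le> C * (2 * x) ^ n" using elim C by (intro mult_left_mono power_mono) auto
    also have "\<dots> = (C * 2 ^ n) * x ^ n" by (simp add: power_mult_distrib)
    also have "\<dots> \<le> (C * 2 ^ n) * x ^ (degree p - 1)" using elim C n by (intro mult_left_mono power_increasing) auto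
    finally have "\<bar>poly p x\<bar> \<le> (C * 2 ^ n) * x ^ (degree p - 1)" .
    moreover have "x ^ degree p = x ^ (degree p - 1) * x" using n by (metis Suc_diff_1 gr_implies_not0 gr0I power_Suc2)
    ultimately show ?case using elim by (simp add: abs_mult divide_simps)
  qed
  then have "((\<lambda>x. poly p x / x ^ degree p) \<longlongrightarrow> 0) at_top" using lim by (rule Lim_null_comparison)
  with 1 have "lead_coeff p = 0" using tendsto_unique[OF trivial_limit_at_top_linorder] by blast
  then have "p = 0" by simp
  then show False using n by simp
qed

lemma seg_bound: "0 \<le> r \<Longrightarrow> a \<in> Rd d \<Longrightarrow> seg a r \<subseteq> ballR d (r * nrm d a)"
  by (auto simp: seg_def ballR_iff Rd_smul nrm_smul abs_le_iff intro!: mult_right_mono)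

lemma zon_bound: "0 \<le> r \<Longrightarrow> set as \<subseteq> Rd d \<Longrightarrow> zon as r \<subseteq> ballR d (r * (\<Sum>a\<leftarrow>as. nrm d a))"
proof (induction as)
  case Nil then show ?case by (auto simp: ballR_iff Rd_0)
next
  case (Cons a as)
  show ?case
  proof
    fix x assume "x \<in> zon (a # as) r"
    then obtain p q where pq: "p \<in> seg a r" "q \<in> zon as r" "x = p + q" by (auto elim!: msumE)
    have "p \<in> ballR d (r * nrm d a)" "q \<in> ballR d (r * (\<Sum>a\<leftarrow>as. nrm d a))"
      using pq Cons seg_bound[of r a d] by auto
    then show "x \<in> ballR d (r * (\<Sum>a\<leftarrow>a # as. nrm d a))"
      using nrm_triangle[of d p q] by (auto simp: pq(3) ballR_iff Rd_add algebra_simps)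
  qed
qed

text \<open>However many segments there are, the sum lies in a ball of radius proportional to 1 + r.
  The volume then grows with exponent d and the affine function with exponent 1, and growth limits
  the degree to d + 1.\<close>

lemma mom_zon_degree:
  assumes as: "set as \<subseteq> Rd d" and K: "body d K"
  shows "\<exists>p. degree p \<le> Suc d \<and> (\<forall>r\<ge>0. mom d (aff d \<alpha> v) (msum K (zon as r)) = poly p r)"
proof -
  obtain p where p: "\<And>r. 0 \<le> r \<Longrightarrow> mom d (aff d \<alpha> v) (msum K (zon as r)) = poly p r" using mom_zon_poly[OF as K] by blast
  obtain R where R: "0 < R" "K \<subseteq> ballR d R" using body_bounded[OF K] .
  define \<rho> where "\<rho> = R + (\<Sum>a\<leftarrow>as. nrm d a)"
  have sn: "0 \<le> (\<Sum>a\<leftarrow>as. nrm d a)" by (induction as) auto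
  have \<rho>: "0 < \<rho>" using R sn by (simp add: \<rho>_def)
  define V where "V = measure (rdm d) (ballR d 1)"
  have V: "0 \<le> V" by (simp add: V_def)
  have "\<bar>poly p r\<bar> \<le> ((\<bar>\<alpha>\<bar> + \<rho> * nrm d v) * (\<rho> ^ d * V)) * (1 + r) ^ Suc d" if r: "0 \<le> r" for r
  proof -
    let ?A = "msum K (zon as r)" and ?B = "ballR d (\<rho> * (1 + r))"
    have bA: "body d ?A" by (intro body_msum K body_zon as)
    have sub: "?A \<subseteq> ?B"
    proof
      fix x assume "x \<in> ?A"
      then obtain a b where ab: "a \<in> K" "b \<in> zon as r" "x = a + b" by (auto elim!: msumE)
      have "nrm d a \<le> R" "nrm d b \<le> r * (\<Sum>a\<leftarrow>as. nrm d a)" "a \<in> Rd d" "b \<in> Rd d"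
        using ab R zon_bound[OF r as] by (auto simp: ballR_iff)
      moreover have "R + r * (\<Sum>a\<leftarrow>as. nrm d a) \<le> \<rho> * (1 + r)" using R r sn by (simp add: \<rho>_def algebra_simps)
      ultimately show "x \<in> ?B" using nrm_triangle[of d a b] by (auto simp: ab(3) ballR_iff Rd_add)
    qed
    define M where "M = \<bar>\<alpha>\<bar> + \<rho> * (1 + r) * nrm d v"
    have "\<bar>poly p r\<bar> = \<bar>mom d (aff d \<alpha> v) ?A\<bar>" using p[OF r] by simp
    also have "\<dots> \<le> (\<integral>x. \<bar>indicator ?A x * aff d \<alpha> v x\<bar> \<partial>rdm d)"
      unfolding mom_def by (rule integral_abs_bound)
    also have "\<dots> \<le> (\<integral>x. M * indicator ?B x \<partial>rdm d)"
    proof (rule integral_mono)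
      show "integrable (rdm d) (\<lambda>x. \<bar>indicator ?A x * aff d \<alpha> v x\<bar>)" using integrable_aff[OF bA] by (rule integrable_abs)
      show "integrable (rdm d) (\<lambda>x. M * indicator ?B x)"
        using emeasure_ballR_finite by (intro integrable_mult_right integrable_real_indicator) auto
      fix x
      show "\<bar>indicator ?A x * aff d \<alpha> v x\<bar> \<le> M * indicator ?B x"
      proof (cases "x \<in> ?A")
        case True
        then have xB: "x \<in> ?B" using sub by auto
        have "\<bar>ip d x v\<bar> \<le> nrm d x * nrm d v" by (rule ip_le_nrm)
        also have "\<dots> \<le> \<rho> * (1 + r) * nrm d v" using xB by (intro mult_right_mono) (auto simp: ballR_iff)
        finally have "\<bar>aff d \<alpha> v x\<bar> \<le> M" by (auto simp: aff_def M_def)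
        then show ?thesis using True xB by simp
      next
        case False
        have "0 \<le> M" using \<rho> r by (simp add: M_def)
        then show ?thesis using False by (simp add: indicator_def)
      qed
    qed
    also have "\<dots> = M * ((\<rho> * (1 + r)) ^ d * V)"
      using \<rho> r by (simp add: measure_ballR[of "\<rho> * (1 + r)"] V_def)
    also have "\<dots> \<le> ((\<bar>\<alpha>\<bar> + \<rho> * nrm d v) * (1 + r)) * ((\<rho> * (1 + r)) ^ d * V)"
    proof (rule mult_right_mono)
      have "\<bar>\<alpha>\<bar> * 1 \<le> \<bar>\<alpha>\<bar> * (1 + r)" using r by (intro mult_left_mono) auto
      then show "M \<le> (\<bar>\<alpha>\<bar> + \<rho> * nrm d v) * (1 + r)" by (simp add: M_def algebra_simps)
    qed (use \<rho> r V in simp)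
    also have "\<dots> = ((\<bar>\<alpha>\<bar> + \<rho> * nrm d v) * (\<rho> ^ d * V)) * (1 + r) ^ Suc d"
      by (simp only: power_mult_distrib power_Suc mult_ac)
    finally show ?thesis .
  qed
  then have "degree p \<le> Suc d" by (rule poly_growth_degree)
  then show ?thesis using p by blast
qed

text \<open>Rotation invariance of Lebesgue measure on the ball yields $\int_B |\langle x,u\rangle| dx = c |u|$; rounding $x$ to a
  grid turns the integral into a finite sum, i.e. the support function of a zonotope.\<close>

lemma ball_abs_moment:
  assumes d: "0 < d"
  obtains c where "0 < c" "\<And>u. u \<in> Rd d \<Longrightarrow> mom d (\<lambda>x. \<bar>ip d x u\<bar>) (ballR d 1) = c * nrm d u"
proof -
  define H where "H = (\<lambda>u. mom d (\<lambda>x. \<bar>ip d x u\<bar>) (ballR d 1))"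
  have iH: "integrable (rdm d) (\<lambda>x. indicator (ballR d 1) x * \<bar>ip d x u\<bar>)" for u
    by (intro integrable_compact bodyD[OF body_ballR] continuous_on_rabs continuous_on_ip continuous_on_id continuous_on_const)
  have Hs: "H (smul t u) = \<bar>t\<bar> * H u" for t u
  proof -
    have "H (smul t u) = (\<integral>x. \<bar>t\<bar> * (indicator (ballR d 1) x * \<bar>ip d x u\<bar>) \<partial>rdm d)"
      unfolding H_def mom_def by (intro Bochner_Integration.integral_cong) (auto simp: ip_simps abs_mult)
    then show ?thesis by (simp add: H_def mom_def)
  qed
  have Huu: "H u = H u'" if u: "u \<in> Rd d" "nrm d u = 1" "u' \<in> Rd d" "nrm d u' = 1" for u u'
  proof (cases "u = u'")
    case False
    \<comment> \<open>The reflection in the hyperplane orthogonal to u - u' exchanges u and u' and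
      maps the ball to itself.\<close>
    define t where "t = nrm d (u - u')"
    have t: "0 < t"
    proof -
      have "t \<noteq> 0" using False nrm_eq_0[of "u - u'" d] u by (auto simp: t_def Rd_diff)
      then show ?thesis using nrm_nonneg[of d "u - u'"] by (simp add: t_def less_le)
    qed
    define n where "n = smul (1 / t) (u - u')"
    have n: "n \<in> Rd d" "nrm d n = 1" using u t by (auto simp: n_def Rd_smul Rd_diff nrm_smul t_def)
    have uu: "ip d u u = 1" "ip d u' u' = 1" using u nrm_sq[of d u] nrm_sq[of d u'] by auto
    have tt: "t * t = 2 - 2 * ip d u u'"
      using nrm_sq[of d "u - u'"] by (simp add: t_def[symmetric] power2_eq_square ip_simps uu ip_commute[of d u' u])
    let ?\<sigma> = "refl_hp d n 0"
    have inv: "ip d (?\<sigma> x) u' = ip d x u" for x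
    proof -
      have nu: "ip d n u' = - t / 2"
      proof -
        have "ip d n u' = (ip d u u' - 1) / t" using t by (simp add: n_def ip_simps uu field_simps)
        also have "ip d u u' - 1 = - (t * t) / 2" using tt by simp
        finally show ?thesis using t by simp
      qed
      have "ip d x n = (ip d x u - ip d x u') / t" using t by (simp add: n_def ip_simps field_simps)
      moreover have "ip d (?\<sigma> x) u' = ip d x u' - 2 * ip d x n * ip d n u'" by (simp add: refl_hp_def ip_simps)
      ultimately show ?thesis unfolding nu using t by (simp add: field_simps)
    qed
    have ball: "?\<sigma> x \<in> ballR d 1 \<longleftrightarrow> x \<in> ballR d 1" if x: "x \<in> Rd d" for x
    proof -
      have "(nrm d (?\<sigma> x - 0))\<^sup>2 = (nrm d (x - 0))\<^sup>2"
        using refl_hp_dist[OF n, of 0 x 0] by (simp add: ip_simps)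
      then have "nrm d (?\<sigma> x) = nrm d x" by (simp add: power2_eq_iff_nonneg)
      moreover have "?\<sigma> x \<in> Rd d" using x n by (simp add: refl_hp_def Rd_intros)
      ultimately show ?thesis using x by (simp add: ballR_iff)
    qed
    have um: "(\<lambda>x. indicator (ballR d 1) x * \<bar>ip d x u'\<bar>) \<in> borel_measurable borel" by measurable
    have "H u' = (\<integral>x. indicator (ballR d 1) (?\<sigma> x) * \<bar>ip d (?\<sigma> x) u'\<bar> \<partial>rdm d)"
      unfolding H_def mom_def by (rule integral_refl_hp(1)[OF n um, symmetric])
    also have "\<dots> = (\<integral>x. indicator (ballR d 1) x * \<bar>ip d x u\<bar> \<partial>rdm d)"
    proof (rule integral_cong_AE)
      show "AE x in rdm d. indicator (ballR d 1) (?\<sigma> x) * \<bar>ip d (?\<sigma> x) u'\<bar> = indicator (ballR d 1) x * \<bar>ip d x u\<bar>"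
        using AE_rdm_Rd[of d] by eventually_elim (simp add: inv ball indicator_def)
    qed (use measurable_compose[OF refl_hp_measurable um] in auto)
    finally show ?thesis by (simp add: H_def mom_def)
  qed simp
  define e where "e = (\<lambda>i j::nat. if j = i then 1 else 0 :: real)"
  have e: "e i \<in> Rd d" "nrm d (e i) = 1" "ip d x (e i) = x i" if "i < d" for i x
  proof -
    show "e i \<in> Rd d" using that by (auto simp: e_def Rd_def)
    show *: "ip d x (e i) = x i" for x     proof -
      have "ip d x (e i) = (\<Sum>j<d. if j = i then x j else 0)" unfolding ip_def e_def by (intro sum.cong) auto
      then show ?thesis using that by simp
    qed
    show "nrm d (e i) = 1" unfolding nrm_def * by (simp add: e_def)
  qed
  have Hc: "H u = H (e 0) * nrm d u" if u: "u \<in> Rd d" for u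
  proof (cases "nrm d u = 0")
    case True
    then have "u = smul 0 u" using nrm_eq_0[OF u] by (auto simp: fun_eq_iff)
    then have "H u = 0" using Hs[of 0 u] by simp
    then show ?thesis using True by simp
  next
    case False
    then have p: "0 < nrm d u" using nrm_nonneg[of d u] by (simp add: less_le)
    have "u = smul (nrm d u) (smul (1 / nrm d u) u)" using p by (auto simp: fun_eq_iff)
    then have "H u = nrm d u * H (smul (1 / nrm d u) u)" using Hs[of "nrm d u" "smul (1 / nrm d u) u"] p by simp
    also have "H (smul (1 / nrm d u) u) = H (e 0)"
      using u p e[OF d] by (intro Huu) (auto simp: Rd_smul nrm_smul)
    finally show ?thesis by simp
  qed
  have "0 < H (e 0)"
  proof -
    \<comment> \<open>On this shell the absolute coordinates sum to at least 1/2, so the sum of the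
      equal numbers \<open>H (e i)\<close> is positive.\<close>
    let ?D = "ballR d 1 - ballR d (1/2)"
    have sub: "ballR d (1/2) \<subseteq> ballR d 1" by (auto simp: ballR_iff)
    have "measure (rdm d) ?D = measure (rdm d) (ballR d 1) - measure (rdm d) (ballR d (1/2))"
      by (intro measurable_measure_Diff body_fmeasurable body_ballR sub) auto
    also have "\<dots> = (1 - (1/2) ^ d) * measure (rdm d) (ballR d 1)"
      by (simp add: measure_ballR[of "1/2"] algebra_simps)
    also have "\<dots> > 0"
    proof -
      have "(1/2::real) ^ d < 1" using d by (simp add: power_less_one_iff)
      then show ?thesis using measure_ballR_pos[of 1 d] by simp
    qed
    finally have Dp: "0 < measure (rdm d) ?D" .
    have "(1/2) * measure (rdm d) ?D = (\<integral>x. (1/2) * indicator ?D x \<partial>rdm d)" by simp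
    also have "\<dots> \<le> (\<integral>x. (\<Sum>i<d. indicator (ballR d 1) x * \<bar>ip d x (e i)\<bar>) \<partial>rdm d)"
    proof (rule integral_mono)
      show "integrable (rdm d) (\<lambda>x. (1/2) * indicator ?D x :: real)"
        using fmeasurable.Diff[OF body_fmeasurable[OF body_ballR] body_fmeasurable[OF body_ballR], of d 1 "1/2"]
        by (intro integrable_mult_right integrable_real_indicator) (auto simp: fmeasurable_def)
      show "integrable (rdm d) (\<lambda>x. \<Sum>i<d. indicator (ballR d 1) x * \<bar>ip d x (e i)\<bar>)" by (intro Bochner_Integration.integrable_sum iH)
      fix x
      have "nrm d x \<le> (\<Sum>i<d. \<bar>ip d x (e i)\<bar>)" using nrm_le_sum[of d x] e by simp
      then show "(1/2) * indicator ?D x \<le> (\<Sum>i<d. indicator (ballR d 1) x * \<bar>ip d x (e i)\<bar>)"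
        by (auto simp: indicator_def ballR_iff)
    qed
    also have "\<dots> = (\<Sum>i<d. H (e i))" unfolding H_def mom_def by (intro Bochner_Integration.integral_sum iH)
    also have "\<dots> = (\<Sum>i<d. H (e 0))" using e d by (intro sum.cong refl Huu) auto
    finally have "0 < (\<Sum>i<d. H (e 0))" using Dp by linarith
    then show ?thesis using d by (simp add: zero_less_mult_iff)
  qed
  then show thesis using Hc by (intro that[of "H (e 0)"]) (auto simp: H_def)
qed

lemma zonotope_norm_approx:
  assumes d: "0 < d" and \<epsilon>: "0 < \<epsilon>"
  obtains as where "set as \<subseteq> Rd d" "\<And>u. u \<in> Rd d \<Longrightarrow> \<bar>(\<Sum>a\<leftarrow>as. \<bar>ip d a u\<bar>) - nrm d u\<bar> \<le> \<epsilon> * nrm d u"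
proof -
  obtain c where c: "0 < c" "\<And>u. u \<in> Rd d \<Longrightarrow> mom d (\<lambda>x. \<bar>ip d x u\<bar>) (ballR d 1) = c * nrm d u"
    using ball_abs_moment[OF d] by blast
  let ?B = "ballR d 1" and ?V = "measure (rdm d) (ballR d 1)"
  have V: "0 < ?V" by (rule measure_ballR_pos) simp
  \<comment> \<open>Rounding to the grid of mesh 1/m moves a point by at most d/m and the integral
    by at most d V / m times the norm of u; this must not exceed c \<epsilon> times that
    norm.\<close>
  obtain m :: nat where m: "real d * ?V / (c * \<epsilon>) < real m" using reals_Archimedean2 by blast
  have m0: "0 < real m" using m c \<epsilon> V d by (smt (verit) divide_nonneg_pos mult_nonneg_nonneg mult_pos_pos of_nat_0_le_iff)
  define \<rho> where "\<rho> = (\<lambda>x::vec. \<lambda>i. if i < d then of_int \<lfloor>real m * x i\<rfloor> / real m else 0)"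
  have \<rho>R: "\<rho> x \<in> Rd d" for x by (simp add: \<rho>_def Rd_def)
  have \<rho>d: "nrm d (x - \<rho> x) \<le> real d / real m" for x
  proof -
    have "\<bar>(x - \<rho> x) i\<bar> \<le> 1 / real m" if "i < d" for i
    proof -
      have "0 \<le> real m * x i - of_int \<lfloor>real m * x i\<rfloor>" "real m * x i - of_int \<lfloor>real m * x i\<rfloor> \<le> 1" by linarith+
      moreover have "(x - \<rho> x) i = (real m * x i - of_int \<lfloor>real m * x i\<rfloor>) / real m"
        using m0 that by (simp add: \<rho>_def diff_divide_distrib)
      ultimately show ?thesis using m0 by (simp add: divide_right_mono)
    qed
    then have "(\<Sum>i<d. \<bar>(x - \<rho> x) i\<bar>) \<le> (\<Sum>i<d. 1 / real m)" by (intro sum_mono) auto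
    then show ?thesis using nrm_le_sum[of d "x - \<rho> x"] by simp
  qed
  have \<rho>m [measurable]: "\<rho> \<in> borel_measurable borel"
  proof (rule borel_measurable_vecI)
    fix i show "(\<lambda>x. \<rho> x i) \<in> borel_measurable borel" unfolding \<rho>_def by (cases "i < d") (simp_all, measurable)
  qed
  define Y where "Y = \<rho> ` ?B"
  have "finite Y"
  proof -
    have "Y \<subseteq> {f. \<forall>i. (i \<in> {..<d} \<longrightarrow> f i \<in> (\<lambda>z::int. of_int z / real m) ` {- int m - 1..int m + 1}) \<and> (i \<notin> {..<d} \<longrightarrow> f i = 0)}"
    proof
      fix y assume "y \<in> Y"
      then obtain x where x: "x \<in> ?B" "y = \<rho> x" by (auto simp: Y_def)
      have "\<lfloor>real m * x i\<rfloor> \<in> {- int m - 1..int m + 1}" if "i < d" for i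
      proof -
        have "\<bar>x i\<bar> \<le> 1" using coord_le_nrm[OF that, of x] x by (auto simp: ballR_iff)
        then have "\<bar>real m * x i\<bar> \<le> real m * 1" unfolding abs_mult by (intro mult_mono) auto
        then have "real_of_int (- int m) \<le> real m * x i" "real m * x i \<le> real_of_int (int m)" by auto
        then have "- int m \<le> \<lfloor>real m * x i\<rfloor>" "\<lfloor>real m * x i\<rfloor> \<le> int m" by linarith+
        then show ?thesis by simp
      qed
      then show "y \<in> {f. \<forall>i. (i \<in> {..<d} \<longrightarrow> f i \<in> (\<lambda>z::int. of_int z / real m) ` {- int m - 1..int m + 1}) \<and> (i \<notin> {..<d} \<longrightarrow> f i = 0)}"
        by (auto simp: x(2) \<rho>_def)
    qed
    then show ?thesis by (rule finite_subset) (intro finite_set_of_finite_funs, auto)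
  qed
  have vsing: "{a} \<in> sets (borel :: vec measure)" for a by simp
  define cell where "cell = (\<lambda>a. ?B \<inter> \<rho> -` {a})"
  have cellm [measurable]: "cell a \<in> sets borel" for a
    unfolding cell_def using measurable_sets[OF \<rho>m vsing[of a]] by auto
  have cellf: "cell a \<in> fmeasurable (rdm d)" for a
    using fmeasurable_Int_fmeasurable[OF body_fmeasurable[OF body_ballR], of "\<rho> -` {a}" d 1] measurable_sets[OF \<rho>m vsing[of a]] by (auto simp: cell_def)
  \<comment> \<open>Grid points are weighted by the volumes of their cells, and division by c
    normalizes the integral to the norm. The weights can be absorbed into the generators because
    \<open>ip\<close> is homogeneous.\<close>
  define w where "w = (\<lambda>a. measure (rdm d) (cell a) / c)"
  have w: "0 \<le> w a" for a using c by (simp add: w_def)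
  obtain ys where ys: "set ys = Y" "distinct ys" using finite_distinct_list[OF \<open>finite Y\<close>] by blast
  define as where "as = map (\<lambda>a. smul (w a) a) ys"
  show thesis
  proof (rule that[of as])
    show "set as \<subseteq> Rd d" using ys \<rho>R by (auto simp: as_def Y_def Rd_smul)
    fix u assume u: "u \<in> Rd d"
    have "c * (\<Sum>a\<leftarrow>as. \<bar>ip d a u\<bar>) = c * (\<Sum>a\<in>Y. w a * \<bar>ip d a u\<bar>)"
      using ys w by (simp add: as_def o_def sum_list_distinct_conv_sum_set ip_simps abs_mult)
    also have "\<dots> = (\<Sum>a\<in>Y. measure (rdm d) (cell a) * \<bar>ip d a u\<bar>)" using c by (simp add: w_def sum_distrib_left)
    also have "\<dots> = (\<integral>x. (\<Sum>a\<in>Y. indicator (cell a) x * \<bar>ip d a u\<bar>) \<partial>rdm d)"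
      using cellf by (subst Bochner_Integration.integral_sum) (auto simp: fmeasurable_def)
    also have "\<dots> = (\<integral>x. indicator ?B x * \<bar>ip d (\<rho> x) u\<bar> \<partial>rdm d)"
    proof (rule Bochner_Integration.integral_cong[OF refl])
      fix x
      show "(\<Sum>a\<in>Y. indicator (cell a) x * \<bar>ip d a u\<bar>) = indicator ?B x * \<bar>ip d (\<rho> x) u\<bar>"
      proof (cases "x \<in> ?B")
        case True
        have "(\<Sum>a\<in>Y. indicator (cell a) x * \<bar>ip d a u\<bar>) = (\<Sum>a\<in>Y. if a = \<rho> x then \<bar>ip d a u\<bar> else 0)"
          using True by (intro sum.cong) (auto simp: cell_def indicator_def)
        also have "\<dots> = \<bar>ip d (\<rho> x) u\<bar>" using True \<open>finite Y\<close> by (simp add: Y_def)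
        finally show ?thesis using True by simp
      qed (simp add: cell_def)
    qed
    finally have eq: "c * (\<Sum>a\<leftarrow>as. \<bar>ip d a u\<bar>) = (\<integral>x. indicator ?B x * \<bar>ip d (\<rho> x) u\<bar> \<partial>rdm d)" .
    have iu: "integrable (rdm d) (\<lambda>x. indicator ?B x * \<bar>ip d x u\<bar>)"
      by (intro integrable_compact bodyD[OF body_ballR] continuous_on_rabs continuous_on_ip continuous_on_id continuous_on_const)
    have iB: "integrable (rdm d) (\<lambda>x. (real d / real m * nrm d u) * indicator ?B x)"
      using emeasure_ballR_finite by (intro integrable_mult_right integrable_real_indicator) auto
    have pt: "\<bar>indicator ?B x * \<bar>ip d (\<rho> x) u\<bar> - indicator ?B x * \<bar>ip d x u\<bar>\<bar> \<le> (real d / real m * nrm d u) * indicator ?B x" for x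
    proof -
      have "\<bar>\<bar>ip d (\<rho> x) u\<bar> - \<bar>ip d x u\<bar>\<bar> \<le> \<bar>ip d (x - \<rho> x) u\<bar>" by (simp add: ip_simps)
      also have "\<dots> \<le> nrm d (x - \<rho> x) * nrm d u" by (rule ip_le_nrm)
      also have "\<dots> \<le> real d / real m * nrm d u" by (intro mult_right_mono \<rho>d nrm_nonneg)
      finally show ?thesis by (auto simp: indicator_def)
    qed
    have ir: "integrable (rdm d) (\<lambda>x. indicator ?B x * \<bar>ip d (\<rho> x) u\<bar>)"
    proof (rule Bochner_Integration.integrable_bound[OF Bochner_Integration.integrable_add[OF iu iB]])
      show "AE x in rdm d. norm (indicator ?B x * \<bar>ip d (\<rho> x) u\<bar>) \<le> norm (indicator ?B x * \<bar>ip d x u\<bar> + (real d / real m * nrm d u) * indicator ?B x)"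
      proof (rule AE_I2)
        fix x
        have "0 \<le> indicator ?B x * \<bar>ip d (\<rho> x) u\<bar>" by simp
        then show "norm (indicator ?B x * \<bar>ip d (\<rho> x) u\<bar>) \<le> norm (indicator ?B x * \<bar>ip d x u\<bar> + (real d / real m * nrm d u) * indicator ?B x)"
          using pt[of x] unfolding real_norm_def by linarith
      qed
    qed measurable
    have "\<bar>c * (\<Sum>a\<leftarrow>as. \<bar>ip d a u\<bar>) - c * nrm d u\<bar> = \<bar>\<integral>x. indicator ?B x * \<bar>ip d (\<rho> x) u\<bar> - indicator ?B x * \<bar>ip d x u\<bar> \<partial>rdm d\<bar>"
      unfolding eq c(2)[OF u, symmetric] mom_def using ir iu by simp
    also have "\<dots> \<le> (\<integral>x. \<bar>indicator ?B x * \<bar>ip d (\<rho> x) u\<bar> - indicator ?B x * \<bar>ip d x u\<bar>\<bar> \<partial>rdm d)" by (rule integral_abs_bound)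
    also have "\<dots> \<le> (\<integral>x. (real d / real m * nrm d u) * indicator ?B x \<partial>rdm d)"
      using ir iu iB pt by (intro integral_mono) auto
    also have "\<dots> = (real d * ?V / real m) * nrm d u" by simp
    also have "\<dots> \<le> (c * \<epsilon>) * nrm d u"
      using m m0 c \<epsilon> by (intro mult_right_mono) (auto simp: field_simps)
    finally have le: "\<bar>c * (\<Sum>a\<leftarrow>as. \<bar>ip d a u\<bar>) - c * nrm d u\<bar> \<le> (c * \<epsilon>) * nrm d u" .
    have "c * \<bar>(\<Sum>a\<leftarrow>as. \<bar>ip d a u\<bar>) - nrm d u\<bar> \<le> c * (\<epsilon> * nrm d u)"
    proof -
      have "c * \<bar>(\<Sum>a\<leftarrow>as. \<bar>ip d a u\<bar>) - nrm d u\<bar> = \<bar>c * (\<Sum>a\<leftarrow>as. \<bar>ip d a u\<bar>) - c * nrm d u\<bar>"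
        using c(1) unfolding right_diff_distrib[symmetric] abs_mult by simp
      then show ?thesis using le by (simp only: mult.assoc)
    qed
    then show "\<bar>(\<Sum>a\<leftarrow>as. \<bar>ip d a u\<bar>) - nrm d u\<bar> \<le> \<epsilon> * nrm d u" using c by simp
  qed
qed

section \<open>Variation of the curvature path\<close>

lemma ip_lambda_zero [simp]: "ip d (\<lambda>i. 0) u = 0" "ip d u (\<lambda>i. 0) = 0"
  by (simp_all add: ip_def)

text \<open>Banach's indicatrix: the variation is the integral over all levels c of the number of
  steps that cross c, and each crossing produces a root of a polynomial of degree at most D.\<close>

lemma variation_le_roots:
  fixes g :: "real \<Rightarrow> real" and ts :: "real list"
  assumes cont: "continuous_on {0..} g"
    and roots: "\<And>c. \<exists>p. degree p \<le> D \<and> (\<forall>t\<ge>0. g t = c \<longleftrightarrow> poly p t = 0)"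
    and ts: "sorted ts" "\<forall>t\<in>set ts. 0 \<le> t \<and> m \<le> g t \<and> g t \<le> M" and mM: "m \<le> M"
  shows "(\<Sum>j<length ts - 1. \<bar>g (ts ! Suc j) - g (ts ! j)\<bar>) \<le> real D * (M - m)"
proof -
  let ?J = "{..<length ts - 1}"
  \<comment> \<open>Open intervals: a crossing at level c takes place strictly between two
    consecutive nodes, so that different steps give different roots.\<close>
  define I where "I = (\<lambda>j. {min (g (ts ! j)) (g (ts ! Suc j))<..<max (g (ts ! j)) (g (ts ! Suc j))})"
  have mem: "ts ! j \<in> set ts" "ts ! Suc j \<in> set ts" if "j \<in> ?J" for j using that by auto
  have key: "(\<Sum>j\<in>?J. indicator (I j) c) \<le> real D * indicator {m..M} c" for c
  proof (cases "\<exists>j\<in>?J. c \<in> I j")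
    case False
    then show ?thesis by (simp add: indicator_def)
  next
    case True
    then obtain j0 where j0: "j0 \<in> ?J" "c \<in> I j0" by blast
    then have cm: "c \<in> {m..M}"
    proof -
      have "m \<le> g (ts ! j0)" "g (ts ! j0) \<le> M" "m \<le> g (ts ! Suc j0)" "g (ts ! Suc j0) \<le> M"
        using mem[OF j0(1)] ts(2) by auto
      then show ?thesis using j0(2) by (auto simp: I_def min_def max_def split: if_splits)
    qed
    obtain p where p: "degree p \<le> D" "\<And>t. 0 \<le> t \<Longrightarrow> g t = c \<longleftrightarrow> poly p t = 0" using roots[of c] by blast
    \<comment> \<open>The zero polynomial would make g constantly c, contrary to the crossing at
      j0.\<close>
    have "p \<noteq> 0"
    proof
      assume "p = 0"
      then have "g (ts ! j0) = c" "g (ts ! Suc j0) = c" using p(2) mem[OF j0(1)] ts(2) by auto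
      then show False using j0 by (simp add: I_def)
    qed
    let ?S = "{j\<in>?J. c \<in> I j}"
    have ex: "\<exists>x. ts ! j < x \<and> x < ts ! Suc j \<and> poly p x = 0" if j: "j \<in> ?S" for j
    proof -
      have jj: "j \<in> ?J" "c \<in> I j" using j by auto
      have le: "ts ! j \<le> ts ! Suc j" using ts(1) jj(1) by (auto intro: sorted_nth_mono)
      have t0: "0 \<le> ts ! j" "0 \<le> ts ! Suc j" using mem[OF jj(1)] ts(2) by auto
      have ne: "g (ts ! j) \<noteq> c" "g (ts ! Suc j) \<noteq> c" using jj(2) by (auto simp: I_def)
      have "\<exists>x\<ge>ts ! j. x \<le> ts ! Suc j \<and> g x = c"
      proof (cases "g (ts ! j) \<le> g (ts ! Suc j)")
        case True
        then show ?thesis using jj(2) le t0 by (intro IVT' continuous_on_subset[OF cont]) (auto simp: I_def)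
      next
        case False
        then show ?thesis using jj(2) le t0 by (intro IVT2' continuous_on_subset[OF cont]) (auto simp: I_def)
      qed
      then obtain x where x: "ts ! j \<le> x" "x \<le> ts ! Suc j" "g x = c" by blast
      then have "ts ! j < x" "x < ts ! Suc j" using ne by (auto simp: less_le)
      moreover have "poly p x = 0" using p(2)[of x] x t0 by auto
      ultimately show ?thesis by blast
    qed
    define r where "r = (\<lambda>j. SOME x. ts ! j < x \<and> x < ts ! Suc j \<and> poly p x = 0)"
    have r: "ts ! j < r j \<and> r j < ts ! Suc j \<and> poly p (r j) = 0" if "j \<in> ?S" for j
      unfolding r_def using someI_ex[OF ex[OF that]] .
    have lt: "r i < r j" if ij: "i \<in> ?S" "j \<in> ?S" "i < j" for i j
    proof -
      have "ts ! Suc i \<le> ts ! j" using ij ts(1) by (intro sorted_nth_mono) auto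
      then show ?thesis using r[OF ij(1)] r[OF ij(2)] by linarith
    qed
    have inj: "inj_on r ?S"
    proof (rule inj_onI, rule ccontr)
      fix i j assume *: "i \<in> ?S" "j \<in> ?S" "r i = r j" "i \<noteq> j"
      then show False using lt[of i j] lt[of j i] by (cases "i < j") auto
    qed
    have "card ?S = card (r ` ?S)" using inj by (simp add: card_image)
    also have "\<dots> \<le> card {x. poly p x = 0}"
      using r poly_roots_finite[OF \<open>p \<noteq> 0\<close>] by (intro card_mono) auto
    also have "\<dots> \<le> D" using card_poly_roots_bound[OF \<open>p \<noteq> 0\<close>] p(1) by linarith
    finally have "card ?S \<le> D" .
    moreover have "(\<Sum>j\<in>?J. indicator (I j) c) = real (card ?S)"
      by (simp add: indicator_def sum.If_cases Int_def)
    ultimately show ?thesis using cm by simp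
  qed
  have len: "(\<integral>c. indicator (I j) c \<partial>lborel) = \<bar>g (ts ! Suc j) - g (ts ! j)\<bar>" for j
    by (auto simp: I_def min_def max_def)
  have iI: "integrable lborel (indicator (I j) :: real \<Rightarrow> real)" for j
    by (intro integrable_real_indicator) (auto simp: I_def)
  have "(\<Sum>j\<in>?J. \<bar>g (ts ! Suc j) - g (ts ! j)\<bar>) = (\<integral>c. (\<Sum>j\<in>?J. indicator (I j) c) \<partial>lborel)"
    unfolding len[symmetric] by (rule Bochner_Integration.integral_sum[symmetric]) (rule iI)
  also have "\<dots> \<le> (\<integral>c. real D * indicator {m..M} c \<partial>lborel)"
    by (intro integral_mono key Bochner_Integration.integrable_sum iI integrable_mult_right integrable_real_indicator) (use mM in simp_all)
  also have "\<dots> = real D * (M - m)" using mM by simp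
  finally show ?thesis .
qed

text \<open>Together with \<open>zon_attains\<close>: the support function of the zonotope in
  direction u is r times the sum of the |\<open>ip d a u\<close>|.\<close>

lemma zon_norm:
  assumes as: "set as \<subseteq> Rd d" and z: "z \<in> zon as r" and r: "0 \<le> r"
  shows "\<bar>ip d z u\<bar> \<le> r * (\<Sum>a\<leftarrow>as. \<bar>ip d a u\<bar>)"
  using as z
proof (induction as arbitrary: z)
  case Nil then show ?case by (simp add: ip_simps)
next
  case (Cons a as)
  then obtain t y where ty: "- r \<le> t" "t \<le> r" "y \<in> zon as r" "z = smul t a + y" by (auto simp: seg_def elim!: msumE)
  have "\<bar>ip d z u\<bar> \<le> \<bar>t\<bar> * \<bar>ip d a u\<bar> + \<bar>ip d y u\<bar>" by (simp add: ty(4) ip_simps abs_mult[symmetric])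
  also have "\<dots> \<le> r * \<bar>ip d a u\<bar> + r * (\<Sum>a\<leftarrow>as. \<bar>ip d a u\<bar>)"
    using Cons.IH[OF _ ty(3)] Cons.prems ty by (intro add_mono mult_right_mono) auto
  finally show ?case by (simp add: algebra_simps)
qed

lemma zon_attains:
  assumes as: "set as \<subseteq> Rd d" and r: "0 \<le> r"
  obtains z where "z \<in> zon as r" "ip d z u = r * (\<Sum>a\<leftarrow>as. \<bar>ip d a u\<bar>)"
proof -
  have "\<exists>z\<in>zon as r. ip d z u = r * (\<Sum>a\<leftarrow>as. \<bar>ip d a u\<bar>)"
    using as
  proof (induction as)
    case Nil then show ?case by (simp add: ip_simps)
  next
    case (Cons a as)
    then obtain z where z: "z \<in> zon as r" "ip d z u = r * (\<Sum>a\<leftarrow>as. \<bar>ip d a u\<bar>)" by auto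
    have "smul (r * sgn (ip d a u)) a \<in> seg a r"
      unfolding seg_def using r by (intro imageI) (auto simp: sgn_if)
    then have "smul (r * sgn (ip d a u)) a + z \<in> zon (a # as) r" using z by (auto intro: msumI)
    moreover have "ip d (smul (r * sgn (ip d a u)) a + z) u = r * (\<Sum>a\<leftarrow>a # as. \<bar>ip d a u\<bar>)"
    proof -
      have "sgn (ip d a u) * ip d a u = \<bar>ip d a u\<bar>" by (simp add: abs_sgn mult.commute)
      then have "r * sgn (ip d a u) * ip d a u = r * \<bar>ip d a u\<bar>" by (simp only: mult.assoc)
      then show ?thesis by (simp add: ip_simps z(2) distrib_left)
    qed
    ultimately show ?case by blast
  qed
  then show thesis using that by blast
qed

text \<open>The ball is a limit of zonotopes: for a unit vector $u$ the point of the zonotope that attains the support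
  function in direction $u$ is close to $u$, because its norm is not much larger than 1.\<close>

lemma zonotope_ball_approx:
  assumes d: "0 < d" and \<epsilon>: "0 < \<epsilon>" "\<epsilon> \<le> 1"
  obtains as where "set as \<subseteq> Rd d" "\<And>r. 0 \<le> r \<Longrightarrow> zon as r \<subseteq> ballR d (r * (1 + \<epsilon>))"
    "\<And>r. 0 \<le> r \<Longrightarrow> ballR d r \<subseteq> par d (zon as r) (r * sqrt (5 * \<epsilon>))"
proof -
  obtain as where as: "set as \<subseteq> Rd d" "\<And>u. u \<in> Rd d \<Longrightarrow> \<bar>(\<Sum>a\<leftarrow>as. \<bar>ip d a u\<bar>) - nrm d u\<bar> \<le> \<epsilon> * nrm d u"
    using zonotope_norm_approx[OF d \<epsilon>(1)] by blast
  have zR: "zon as r \<subseteq> Rd d" for r using body_zon[OF as(1)] bodyD by blast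
  \<comment> \<open>The support function is evaluated in the direction of z itself.\<close>
  have up: "nrm d z \<le> r * (1 + \<epsilon>)" if z: "z \<in> zon as r" "0 \<le> r" for z r
  proof (cases "nrm d z = 0")
    case False
    then have p: "0 < nrm d z" using nrm_nonneg[of d z] by (simp add: less_le)
    have "nrm d z * nrm d z = ip d z z" using nrm_sq[of d z] by (simp add: power2_eq_square)
    also have "\<dots> \<le> r * (\<Sum>a\<leftarrow>as. \<bar>ip d a z\<bar>)" using zon_norm[OF as(1) z, of z] by simp
    also have "\<dots> \<le> r * ((1 + \<epsilon>) * nrm d z)" using as(2)[of z] zR[of r] z by (intro mult_left_mono) (auto simp: algebra_simps)
    finally have "nrm d z * nrm d z \<le> (r * (1 + \<epsilon>)) * nrm d z" by (simp add: mult.assoc)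
    then show ?thesis using p by (rule mult_right_le_imp_le)
  qed (use z \<epsilon> in simp)
  show thesis
  proof (rule that[OF as(1)])
    fix r :: real assume r: "0 \<le> r"
    show "zon as r \<subseteq> ballR d (r * (1 + \<epsilon>))" using up[of _ r] r zR[of r] by (auto simp: ballR_iff)
    show "ballR d r \<subseteq> par d (zon as r) (r * sqrt (5 * \<epsilon>))"
    proof
      fix b assume b: "b \<in> ballR d r"
      show "b \<in> par d (zon as r) (r * sqrt (5 * \<epsilon>))"
      proof (cases "nrm d b = 0")
        case True
        then have b0: "b = 0" using nrm_eq_0[of b d] b by (simp add: ballR_iff)
        have "0 \<le> r * sqrt (5 * \<epsilon>)" using r \<epsilon> by simp
        from subset_par[OF this] zero_zon[OF r] show ?thesis unfolding b0 by blast
      next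
        case False
        then have p: "0 < nrm d b" using nrm_nonneg[of d b] by (simp add: less_le)
        define s where "s = nrm d b"
        have s: "0 < s" "s \<le> r" using p b by (auto simp: s_def ballR_iff)
        have bR: "b \<in> Rd d" using b by (simp add: ballR_iff)
        obtain z where z: "z \<in> zon as s" "ip d z b = s * (\<Sum>a\<leftarrow>as. \<bar>ip d a b\<bar>)"
          using zon_attains[OF as(1), of s b] s by auto
        have lo: "s * ((1 - \<epsilon>) * s) \<le> ip d z b"
          unfolding z(2) using as(2)[OF bR] s by (intro mult_left_mono) (auto simp: s_def algebra_simps)
        have hi: "nrm d z \<le> s * (1 + \<epsilon>)" using up[OF z(1)] s by simp
        \<comment> \<open>The bound is s^2 (1 - 2 (1 - \<epsilon>) + (1 + \<epsilon>)^2) = s^2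
          (4\<epsilon> + \<epsilon>^2), which explains the 5 under the root.\<close>
        have "(nrm d (b - z))\<^sup>2 = s\<^sup>2 - 2 * ip d z b + (nrm d z)\<^sup>2"
          by (simp add: nrm_sq s_def ip_simps ip_commute[of d b z])
        also have "\<dots> \<le> s\<^sup>2 - 2 * (s * ((1 - \<epsilon>) * s)) + (s * (1 + \<epsilon>))\<^sup>2"
          using lo hi s by (intro add_mono diff_mono power_mono) auto
        also have "\<dots> = s\<^sup>2 * (4 * \<epsilon> + \<epsilon> * \<epsilon>)"
          by (simp only: power2_eq_square) (simp add: algebra_simps)
        also have "\<dots> \<le> s\<^sup>2 * (5 * \<epsilon>)" using \<epsilon> by (intro mult_left_mono) auto
        also have "\<dots> = (s * sqrt (5 * \<epsilon>))\<^sup>2" using \<epsilon> by (simp add: power_mult_distrib)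
        finally have "nrm d (b - z) \<le> s * sqrt (5 * \<epsilon>)" using s \<epsilon> by (rule_tac power2_le_imp_le) auto
        also have "\<dots> \<le> r * sqrt (5 * \<epsilon>)" using s \<epsilon> by (intro mult_right_mono) auto
        finally have n: "nrm d (b - z) \<le> r * sqrt (5 * \<epsilon>)" .
        have "zon as s \<subseteq> zon as r" for as
        proof (induction as)
          case (Cons a as)
          have "seg a s \<subseteq> seg a r" using s by (auto simp: seg_def)
          then show ?case using Cons msum_mono by simp
        qed simp
        then have "z \<in> zon as r" using z by blast
        then show ?thesis using par_iff[OF bR zR] n by blast
      qed
    qed
  qed
qed

section \<open>Centroids along zonotopes and the passage to the ball\<close>

lemma mom_aff_cg:
  assumes A: "body d A" "core d A c \<delta>"
  shows "ip d (cg d A) v = k \<longleftrightarrow> mom d (aff d (- k) v) A = 0"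
  using core_pos[OF A] by (simp add: ip_cg[OF A(1)] mom_aff[OF A(1)] field_simps)

lemma tendsto_ip_cg:
  assumes A: "body d A" "core d A c \<delta>" and \<epsilon>: "(\<epsilon> \<longlongrightarrow> 0) F"
    and ev: "eventually (\<lambda>n. body d (X n) \<and> core d (X n) c \<delta> \<and> 0 \<le> \<epsilon> n \<and> A \<subseteq> par d (X n) (\<epsilon> n) \<and> X n \<subseteq> par d A (\<epsilon> n)) F"
  shows "((\<lambda>n. ip d (cg d (X n)) v) \<longlongrightarrow> ip d (cg d A) v) F"
proof -
  have 1: "((\<lambda>n. mom d (\<lambda>x. ip d x v) (X n)) \<longlongrightarrow> mom d (\<lambda>x. ip d x v) A) F"
    by (rule mom_tendsto[OF A _ \<epsilon> ev]) (intro continuous_on_ip continuous_on_id continuous_on_const)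
  have 2: "((\<lambda>n. mom d (\<lambda>x. 1) (X n)) \<longlongrightarrow> mom d (\<lambda>x. 1) A) F"
    by (rule mom_tendsto[OF A _ \<epsilon> ev]) (intro continuous_on_const)
  have "((\<lambda>n. mom d (\<lambda>x. ip d x v) (X n) / mom d (\<lambda>x. 1) (X n)) \<longlongrightarrow> ip d (cg d A) v) F"
    using tendsto_divide[OF 1 2] core_pos[OF A] bodyD(4)[OF A(1)] by (simp add: ip_cg[OF A(1)] mom_const)
  moreover have "eventually (\<lambda>n. mom d (\<lambda>x. ip d x v) (X n) / mom d (\<lambda>x. 1) (X n) = ip d (cg d (X n)) v) F"
    using ev by eventually_elim (auto simp: ip_cg mom_const dest: bodyD(4))
  ultimately show ?thesis by (rule Lim_transform_eventually)
qed

lemma ip_cg_le: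
  assumes K: "body d K" "core d K c \<delta>" "\<And>x. x \<in> K \<Longrightarrow> ip d x v \<le> M" and v: "v \<in> Rd d" and d: "0 < d" and r: "0 \<le> r"
  shows "ip d (cg d (par d K r)) v \<le> M"
proof (cases "nrm d v = 0")
  case True
  then have "v = 0" using nrm_eq_0[OF v] by simp
  then show ?thesis using K(3)[OF core_center[OF K(2)]] by (simp add: ip_simps)
next
  case False
  then have p: "0 < nrm d v" using nrm_nonneg[of d v] by (simp add: less_le)
  have "ip d (cg d (par d K r)) (smul (1 / nrm d v) v) < M / nrm d v"
    using v p K(3) by (intro cg_strict(1)[OF _ _ K(1,2) _ d r]) (auto simp: Rd_smul nrm_smul ip_simps divide_right_mono)
  then show ?thesis using p by (simp add: ip_simps divide_less_cancel)
qed

lemma continuous_on_zon_cg: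
  assumes as: "set as \<subseteq> Rd d" and K: "body d K" "core d K c \<delta>"
  shows "continuous_on {0..} (\<lambda>r. ip d (cg d (msum K (zon as r))) v)"
proof -
  obtain p where p: "\<And>r. 0 \<le> r \<Longrightarrow> mom d (aff d 0 v) (msum K (zon as r)) = poly p r" using mom_zon_poly[OF as K(1)] by blast
  \<comment> \<open>Two affine functions with the same linear part and constants 0 and 1: their
    moments differ by the volume, so the functional of the centroid is a quotient of
    polynomials.\<close>
  obtain q where q: "\<And>r. 0 \<le> r \<Longrightarrow> mom d (aff d 1 v) (msum K (zon as r)) = poly q r" using mom_zon_poly[OF as K(1)] by blast
  have b: "body d (msum K (zon as r))" for r by (intro body_msum K body_zon as)
  have eq: "ip d (cg d (msum K (zon as r))) v = poly p r / (poly q r - poly p r)" "poly q r - poly p r \<noteq> 0" if "0 \<le> r" for r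
  proof -
    have "mom d (\<lambda>x. ip d x v) (msum K (zon as r)) = poly p r" using p[OF that] by (simp add: mom_aff[OF b])
    moreover have "measure (rdm d) (msum K (zon as r)) = poly q r - poly p r"
      using p[OF that] q[OF that] by (simp add: mom_aff[OF b])
    moreover have "0 < measure (rdm d) (msum K (zon as r))"
      by (rule core_pos[OF b core_mono[OF K(2) subset_msum[OF zero_zon[OF that]]]])
    ultimately show "ip d (cg d (msum K (zon as r))) v = poly p r / (poly q r - poly p r)" "poly q r - poly p r \<noteq> 0"
      by (simp_all add: ip_cg[OF b])
  qed
  have "continuous_on {0..} (\<lambda>r. poly p r / (poly q r - poly p r))"
    using eq(2) by (intro continuous_on_divide continuous_on_diff continuous_on_poly continuous_on_id) auto
  then show ?thesis by (rule continuous_on_eq) (simp add: eq(1))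
qed

lemma variation_zon:
  assumes as: "set as \<subseteq> Rd d" and K: "body d K" "core d K c \<delta>"
    and ts: "sorted ts" "\<forall>t\<in>set ts. 0 \<le> t \<and> m \<le> ip d (cg d (msum K (zon as t))) v \<and> ip d (cg d (msum K (zon as t))) v \<le> M" and mM: "m \<le> M"
  shows "(\<Sum>j<length ts - 1. \<bar>ip d (cg d (msum K (zon as (ts ! Suc j)))) v - ip d (cg d (msum K (zon as (ts ! j)))) v\<bar>) \<le> real (Suc d) * (M - m)"
proof (rule variation_le_roots[where g="\<lambda>t. ip d (cg d (msum K (zon as t))) v", OF continuous_on_zon_cg[OF as K] _ ts mM])
  fix k
  obtain p where p: "degree p \<le> Suc d" "\<And>r. 0 \<le> r \<Longrightarrow> mom d (aff d (- k) v) (msum K (zon as r)) = poly p r"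
    using mom_zon_degree[OF as K(1)] by blast
  have b: "body d (msum K (zon as r))" for r by (intro body_msum K body_zon as)
  show "\<exists>p. degree p \<le> Suc d \<and> (\<forall>t\<ge>0. (ip d (cg d (msum K (zon as t))) v = k) = (poly p t = 0))"
    using p mom_aff_cg[OF b core_mono[OF K(2) subset_msum[OF zero_zon]]] by (intro exI[of _ p]) auto
qed

text \<open>By the Steiner-type formula each linear functional of the curvature path attains every value at most $d+1$
  times, which bounds its variation by $d+1$ times its range.\<close>

theorem variation_curvature_path:
  fixes ts :: "real list"
  assumes K: "body d K" "core d K c \<delta>" "\<And>x. x \<in> K \<Longrightarrow> m \<le> ip d x v \<and> ip d x v \<le> M" and v: "v \<in> Rd d" and d: "0 < d"
    and ts: "sorted ts" "\<forall>t\<in>set ts. 0 \<le> t"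
  shows "(\<Sum>j<length ts - 1. \<bar>ip d (cg d (par d K (ts ! Suc j))) v - ip d (cg d (par d K (ts ! j))) v\<bar>) \<le> real (Suc d) * (M - m)"
proof -
  define \<epsilon> where "\<epsilon> = (\<lambda>n::nat. 1 / real (Suc n))"
  have \<epsilon>: "0 < \<epsilon> n" "\<epsilon> n \<le> 1" for n by (auto simp: \<epsilon>_def)
  have "\<forall>n. \<exists>as. set as \<subseteq> Rd d \<and> (\<forall>r\<ge>0. zon as r \<subseteq> ballR d (r * (1 + \<epsilon> n))) \<and> (\<forall>r\<ge>0. ballR d r \<subseteq> par d (zon as r) (r * sqrt (5 * \<epsilon> n)))"
    using zonotope_ball_approx[OF d \<epsilon>] by metis
  then obtain as where as: "\<And>n. set (as n) \<subseteq> Rd d" "\<And>n r. 0 \<le> r \<Longrightarrow> zon (as n) r \<subseteq> ballR d (r * (1 + \<epsilon> n))"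
    "\<And>n r. 0 \<le> r \<Longrightarrow> ballR d r \<subseteq> par d (zon (as n) r) (r * sqrt (5 * \<epsilon> n))"
    by metis
  define g where "g = (\<lambda>n t. ip d (cg d (msum K (zon (as n) t))) v)"
  define G where "G = (\<lambda>t. ip d (cg d (par d K t)) v)"
  have bp: "body d (par d K t)" "core d (par d K t) c \<delta>" if "0 \<le> t" for t
    using body_par[OF K(1)] core_mono[OF K(2) subset_par[OF that]] by auto
  have lim: "(\<lambda>n. g n t) \<longlonglongrightarrow> G t" if t: "0 \<le> t" for t
    unfolding g_def G_def
  proof (rule tendsto_ip_cg[OF bp[OF t]])
    \<comment> \<open>The two inclusions hold with t \<epsilon> and t sqrt(5 \<epsilon>); the sum
      serves both.\<close>
    let ?e = "\<lambda>n. t * (\<epsilon> n + sqrt (5 * \<epsilon> n))"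
    have "\<epsilon> \<longlonglongrightarrow> 0" unfolding \<epsilon>_def using LIMSEQ_inverse_real_of_nat by (simp add: inverse_eq_divide)
    then have "(\<lambda>n. t * (\<epsilon> n + sqrt (5 * \<epsilon> n))) \<longlonglongrightarrow> t * (0 + sqrt (5 * 0))" by (intro tendsto_intros)
    then show "?e \<longlonglongrightarrow> 0" by simp
    show "eventually (\<lambda>n. body d (msum K (zon (as n) t)) \<and> core d (msum K (zon (as n) t)) c \<delta> \<and> 0 \<le> ?e n \<and>
        par d K t \<subseteq> par d (msum K (zon (as n) t)) (?e n) \<and> msum K (zon (as n) t) \<subseteq> par d (par d K t) (?e n)) sequentially"
    proof (intro always_eventually allI conjI)
      fix n
      show "body d (msum K (zon (as n) t))" by (intro body_msum K body_zon as)
      show "core d (msum K (zon (as n) t)) c \<delta>" by (rule core_mono[OF K(2) subset_msum[OF zero_zon[OF t]]])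
      show "0 \<le> ?e n" using t \<epsilon>[of n] by simp
      have "par d K t \<subseteq> msum K (par d (zon (as n) t) (t * sqrt (5 * \<epsilon> n)))"
        unfolding par_def[of d K] by (intro msum_mono as t) auto
      also have "\<dots> = par d (msum K (zon (as n) t)) (t * sqrt (5 * \<epsilon> n))" by (simp only: par_def msum_assoc)
      also have "\<dots> \<subseteq> par d (msum K (zon (as n) t)) (?e n)" using t \<epsilon>[of n] by (intro par_mono) (auto simp: algebra_simps)
      finally show "par d K t \<subseteq> par d (msum K (zon (as n) t)) (?e n)" .
      have "msum K (zon (as n) t) \<subseteq> par d K (t + t * \<epsilon> n)"
        unfolding par_def using as(2)[OF t, of n] by (intro msum_mono) (auto simp: algebra_simps)
      also have "\<dots> \<subseteq> par d (par d K t) (t * \<epsilon> n)" using t \<epsilon>[of n] by (intro par_par_ge) auto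
      also have "\<dots> \<subseteq> par d (par d K t) (?e n)" using t \<epsilon>[of n] by (intro par_mono) (auto intro!: mult_left_mono)
      finally show "msum K (zon (as n) t) \<subseteq> par d (par d K t) (?e n)" .
    qed
  qed
  have range: "m \<le> G t \<and> G t \<le> M" if t: "0 \<le> t" for t
  proof -
    have "G t \<le> M" unfolding G_def by (rule ip_cg_le[OF K(1,2) _ v d t]) (use K(3) in blast)
    moreover have "ip d (cg d (par d K t)) (- v) \<le> - m"
      by (rule ip_cg_le[OF K(1,2) _ Rd_uminus[OF v] d t]) (use K(3) in \<open>auto simp: ip_simps\<close>)
    ultimately show ?thesis by (simp add: G_def ip_simps)
  qed
  have mM: "m \<le> M" using K(3)[OF core_center[OF K(2)]] by simp
  have tn: "0 \<le> ts ! j" "0 \<le> ts ! Suc j" if "j < length ts - 1" for j using ts(2) that by auto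
  \<comment> \<open>For large n the zonotope path may leave [m, M] at the finitely many nodes by at
    most \<eta>, which enlarges the range by 2 \<eta>.\<close>
  have bound: "(\<Sum>j<length ts - 1. \<bar>G (ts ! Suc j) - G (ts ! j)\<bar>) \<le> real (Suc d) * (M - m + 2 * \<eta>)" if \<eta>: "0 < \<eta>" for \<eta>
  proof -
    have "eventually (\<lambda>n. \<forall>t\<in>set ts. m - \<eta> \<le> g n t \<and> g n t \<le> M + \<eta>) sequentially"
    proof (rule eventually_ball_finite)
      show "\<forall>t\<in>set ts. \<forall>\<^sub>F n in sequentially. m - \<eta> \<le> g n t \<and> g n t \<le> M + \<eta>"
      proof
        fix t assume "t \<in> set ts"
        then have t: "0 \<le> t" using ts(2) by blast
        have "\<forall>\<^sub>F n in sequentially. m - \<eta> < g n t" "\<forall>\<^sub>F n in sequentially. g n t < M + \<eta>"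
          using range[OF t] \<eta> by (intro order_tendstoD[OF lim[OF t]]; simp)+
        then show "\<forall>\<^sub>F n in sequentially. m - \<eta> \<le> g n t \<and> g n t \<le> M + \<eta>" by eventually_elim auto
      qed
    qed simp
    then have ev: "eventually (\<lambda>n. (\<Sum>j<length ts - 1. \<bar>g n (ts ! Suc j) - g n (ts ! j)\<bar>) \<le> real (Suc d) * (M - m + 2 * \<eta>)) sequentially"
    proof eventually_elim
      case (elim n)
      have "(\<Sum>j<length ts - 1. \<bar>g n (ts ! Suc j) - g n (ts ! j)\<bar>) \<le> real (Suc d) * ((M + \<eta>) - (m - \<eta>))"
        unfolding g_def by (rule variation_zon[OF as(1) K(1,2) ts(1)]) (use elim ts(2) mM \<eta> in \<open>auto simp: g_def\<close>)
      then show ?case by (simp add: algebra_simps)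
    qed
    have "(\<lambda>n. \<Sum>j<length ts - 1. \<bar>g n (ts ! Suc j) - g n (ts ! j)\<bar>) \<longlonglongrightarrow> (\<Sum>j<length ts - 1. \<bar>G (ts ! Suc j) - G (ts ! j)\<bar>)"
      by (intro tendsto_sum tendsto_rabs tendsto_diff lim) (use tn in auto)
    then show ?thesis using ev by (rule tendsto_upperbound) simp
  qed
  have "((\<lambda>\<eta>. real (Suc d) * (M - m + 2 * \<eta>)) \<longlongrightarrow> real (Suc d) * (M - m + 2 * 0)) (at_right 0)"
    by (intro tendsto_intros)
  then have "(\<Sum>j<length ts - 1. \<bar>G (ts ! Suc j) - G (ts ! j)\<bar>) \<le> real (Suc d) * (M - m + 2 * 0)"
  proof (rule tendsto_lowerbound)
    show "eventually (\<lambda>\<eta>. (\<Sum>j<length ts - 1. \<bar>G (ts ! Suc j) - G (ts ! j)\<bar>) \<le> real (Suc d) * (M - m + 2 * \<eta>)) (at_right 0)"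
      using eventually_at_right_less[of "0::real"] by eventually_elim (rule bound)
  qed simp
  then show ?thesis by (simp add: G_def)
qed

section \<open>Length of the curvature path\<close>

text \<open>The recursive form of the polygonal length in \<open>plen\<close>, suited to inserting
  points and to concatenating partitions.\<close>

fun pl :: "nat \<Rightarrow> (ereal \<Rightarrow> vec) \<Rightarrow> ereal list \<Rightarrow> real" where
  "pl d \<gamma> (x # y # zs) = nrm d (\<gamma> y - \<gamma> x) + pl d \<gamma> (y # zs)"
| "pl d \<gamma> _ = 0"

lemma pl_sum: "pl d \<gamma> ts = (\<Sum>j<length ts - 1. nrm d (\<gamma> (ts ! Suc j) - \<gamma> (ts ! j)))"
proof (induction d \<gamma> ts rule: pl.induct)
  case (1 d \<gamma> x y zs)
  have len: "length (x # y # zs) - 1 = Suc (length (y # zs) - 1)" by simp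
  show ?case
    unfolding pl.simps 1 len sum.lessThan_Suc_shift by simp
qed auto

lemma plen_pl: "plen d \<gamma> a b = (SUP ts \<in> {ts. sorted ts \<and> set ts \<subseteq> {a..b}}. ereal (pl d \<gamma> ts))"
  unfolding plen_def pl_sum ..

lemma pl_append_mid: "pl d \<gamma> (xs @ [m] @ ys) = pl d \<gamma> (xs @ [m]) + pl d \<gamma> ([m] @ ys)"
proof (induction xs)
  case (Cons x xs)
  then show ?case by (cases xs) auto
qed simp

lemma pl_Cons_ge: "pl d \<gamma> ys \<le> pl d \<gamma> (m # ys)"
  by (cases ys) auto

lemma pl_insert_ge: "pl d \<gamma> (xs @ ys) \<le> pl d \<gamma> (xs @ m # ys)"
proof (induction xs)
  case Nil then show ?case by (simp add: pl_Cons_ge)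
next
  case (Cons x xs)
  show ?case
  proof (cases xs)
    case Nil
    show ?thesis
    proof (cases ys)
      case Nil2: Nil
      then show ?thesis using Nil by simp
    next
      case (Cons y zs)
      have "\<gamma> y - \<gamma> x = (\<gamma> y - \<gamma> m) + (\<gamma> m - \<gamma> x)" by simp
      then have "nrm d (\<gamma> y - \<gamma> x) \<le> nrm d (\<gamma> y - \<gamma> m) + nrm d (\<gamma> m - \<gamma> x)" by (metis nrm_triangle)
      then show ?thesis using Nil Cons by simp
    qed
  next
    case (Cons y zs)
    then show ?thesis using Cons.IH Cons by simp
  qed
qed

lemma pl_append_ge: "pl d \<gamma> xs + pl d \<gamma> ys \<le> pl d \<gamma> (xs @ ys)"
proof (induction xs)
  case Nil then show ?case by simp
next
  case (Cons x xs)
  show ?case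
  proof (cases xs)
    case Nil
    then show ?thesis by (simp add: pl_Cons_ge)
  next
    case (Cons y zs)
    then show ?thesis using Cons.IH by simp
  qed
qed

lemma pl_le_plen: "sorted ts \<Longrightarrow> set ts \<subseteq> {a..b} \<Longrightarrow> ereal (pl d \<gamma> ts) \<le> plen d \<gamma> a b"
  unfolding plen_pl by (rule SUP_upper) simp

lemma plen_leI: "(\<And>ts. sorted ts \<Longrightarrow> set ts \<subseteq> {a..b} \<Longrightarrow> ereal (pl d \<gamma> ts) \<le> B) \<Longrightarrow> plen d \<gamma> a b \<le> B"
  unfolding plen_pl by (rule SUP_least) simp

lemma plen_nonneg: "0 \<le> plen d \<gamma> a b"
  using pl_le_plen[of "[]" a b d \<gamma>] by (simp add: zero_ereal_def)

lemma plen_mono: "a' \<le> a \<Longrightarrow> b \<le> b' \<Longrightarrow> plen d \<gamma> a b \<le> plen d \<gamma> a' b'"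
  by (rule plen_leI, rule pl_le_plen) (auto simp: subset_iff intro: order_trans)

lemma nrm_le_plen: "a \<le> s \<Longrightarrow> s \<le> t \<Longrightarrow> t \<le> b \<Longrightarrow> ereal (nrm d (\<gamma> t - \<gamma> s)) \<le> plen d \<gamma> a b"
  using pl_le_plen[of "[s, t]" a b d \<gamma>] order_trans[of a s t] order_trans[of s t b] by auto

text \<open>Inserting the point b does not shorten a polygon, which gives one inequality;
  concatenating partitions of the two parts gives the other.\<close>

lemma plen_add:
  assumes "a \<le> b" "b \<le> c"
  shows "plen d \<gamma> a c = plen d \<gamma> a b + plen d \<gamma> b c"
proof (rule antisym)
  show "plen d \<gamma> a c \<le> plen d \<gamma> a b + plen d \<gamma> b c"
  proof (rule plen_leI)
    fix ts assume ts: "sorted ts" "set ts \<subseteq> {a..c}"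
    define xs where "xs = takeWhile (\<lambda>t. t \<le> b) ts"
    define ys where "ys = dropWhile (\<lambda>t. t \<le> b) ts"
    have ts_eq: "ts = xs @ ys" by (simp add: xs_def ys_def)
    have so: "sorted xs" "sorted ys" using ts(1) ts_eq by (auto simp: sorted_append)
    have xsb: "\<forall>x\<in>set xs. x \<le> b" by (auto simp: xs_def dest: set_takeWhileD)
    have ysb: "\<forall>y\<in>set ys. b \<le> y"
    proof (cases ys)
      case (Cons y zs)
      then have "\<not> y \<le> b" by (metis ys_def dropWhile_eq_Cons_conv)
      moreover have "\<forall>z\<in>set ys. y \<le> z" using so(2) Cons by auto
      ultimately show ?thesis by (meson linorder_le_cases order_trans)
    qed simp
    have "pl d \<gamma> ts \<le> pl d \<gamma> (xs @ b # ys)" unfolding ts_eq by (rule pl_insert_ge)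
    also have "\<dots> = pl d \<gamma> (xs @ [b]) + pl d \<gamma> (b # ys)" using pl_append_mid[of d \<gamma> xs b ys] by simp
    finally have "ereal (pl d \<gamma> ts) \<le> ereal (pl d \<gamma> (xs @ [b])) + ereal (pl d \<gamma> (b # ys))" by simp
    also have "\<dots> \<le> plen d \<gamma> a b + plen d \<gamma> b c"
      using so xsb ysb ts assms by (intro add_mono pl_le_plen) (auto simp: ts_eq sorted_append)
    finally show "ereal (pl d \<gamma> ts) \<le> plen d \<gamma> a b + plen d \<gamma> b c" .
  qed
  show "plen d \<gamma> a b + plen d \<gamma> b c \<le> plen d \<gamma> a c"
  proof -
    have *: "ereal (pl d \<gamma> xs) + plen d \<gamma> b c \<le> plen d \<gamma> a c" if xs: "sorted xs" "set xs \<subseteq> {a..b}" for xs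
    proof -
      have "ereal (pl d \<gamma> xs) + plen d \<gamma> b c = (SUP ys \<in> {ys. sorted ys \<and> set ys \<subseteq> {b..c}}. ereal (pl d \<gamma> xs) + ereal (pl d \<gamma> ys))"
        unfolding plen_pl by (subst SUP_ereal_add_right) (auto intro!: exI[of _ "[]"])
      also have "\<dots> \<le> plen d \<gamma> a c"
      proof (rule SUP_least)
        fix ys assume "ys \<in> {ys. sorted ys \<and> set ys \<subseteq> {b..c}}"
        then have "ereal (pl d \<gamma> (xs @ ys)) \<le> plen d \<gamma> a c"
          using xs assms by (intro pl_le_plen) (auto simp: sorted_append intro: order_trans, (meson atLeastAtMost_iff order_trans subsetD)+)
        then show "ereal (pl d \<gamma> xs) + ereal (pl d \<gamma> ys) \<le> plen d \<gamma> a c"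
          using pl_append_ge[of d \<gamma> xs ys] by (metis ereal_less_eq(3) order_trans plus_ereal.simps(1))
      qed
      finally show ?thesis .
    qed
    have "plen d \<gamma> a b + plen d \<gamma> b c = (SUP xs \<in> {xs. sorted xs \<and> set xs \<subseteq> {a..b}}. ereal (pl d \<gamma> xs) + plen d \<gamma> b c)"
      unfolding plen_pl[of d \<gamma> a b] using plen_nonneg[of d \<gamma> b c] by (subst SUP_ereal_add_left) (auto intro!: exI[of _ "[]"])
    also have "\<dots> \<le> plen d \<gamma> a c" by (rule SUP_least) (use * in auto)
    finally show ?thesis .
  qed
qed

lemma tendsto_vecI:
  fixes f :: "'a \<Rightarrow> vec"
  assumes "\<And>i. ((\<lambda>x. f x i) \<longlongrightarrow> l i) F" shows "(f \<longlongrightarrow> l) F"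
proof -
  have "limitin (product_topology (\<lambda>i. euclidean) UNIV) f l F"
    unfolding limitin_componentwise using assms by simp
  then show ?thesis by (simp add: euclidean_product_topology)
qed

lemma tendsto_pl_map:
  assumes "\<And>t. t \<in> set ts \<Longrightarrow> ((\<lambda>s. nrm d (\<gamma> (h s t) - \<gamma> t)) \<longlongrightarrow> 0) F"
  shows "((\<lambda>s. pl d \<gamma> (map (h s) ts)) \<longlongrightarrow> pl d \<gamma> ts) F"
proof -
  have "((\<lambda>s. nrm d (\<gamma> (h s v) - \<gamma> (h s u))) \<longlongrightarrow> nrm d (\<gamma> v - \<gamma> u)) F" if u: "u \<in> set ts" "v \<in> set ts" for u v
  proof -
    have "((\<lambda>s. nrm d (\<gamma> (h s v) - \<gamma> v) + nrm d (\<gamma> (h s u) - \<gamma> u)) \<longlongrightarrow> 0 + 0) F"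
      by (intro tendsto_add assms u)
    then have lim: "((\<lambda>s. nrm d (\<gamma> (h s v) - \<gamma> v) + nrm d (\<gamma> (h s u) - \<gamma> u)) \<longlongrightarrow> 0) F" by simp
    have le: "\<bar>nrm d (\<gamma> (h s v) - \<gamma> (h s u)) - nrm d (\<gamma> v - \<gamma> u)\<bar> \<le> nrm d (\<gamma> (h s v) - \<gamma> v) + nrm d (\<gamma> (h s u) - \<gamma> u)" for s
    proof -
      define P Q R S where "P = \<gamma> (h s v)" and "Q = \<gamma> (h s u)" and "R = \<gamma> v" and "S = \<gamma> u"
      have "P - Q = (P - R) + ((R - S) + (S - Q))" by simp
      then have "nrm d (P - Q) \<le> nrm d (P - R) + (nrm d (R - S) + nrm d (S - Q))"
        by (metis nrm_triangle add_left_mono order_trans)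
      moreover have "R - S = (R - P) + ((P - Q) + (Q - S))" by simp
      then have "nrm d (R - S) \<le> nrm d (R - P) + (nrm d (P - Q) + nrm d (Q - S))"
        by (metis nrm_triangle add_left_mono order_trans)
      ultimately show ?thesis
        using nrm_diff_commute[of d P R] nrm_diff_commute[of d Q S] unfolding P_def Q_def R_def S_def by linarith
    qed
    have "((\<lambda>s. nrm d (\<gamma> (h s v) - \<gamma> (h s u)) - nrm d (\<gamma> v - \<gamma> u)) \<longlongrightarrow> 0) F"
      by (rule Lim_null_comparison[OF _ lim]) (use le in simp)
    then show ?thesis by (rule LIM_zero_cancel)
  qed
  then show ?thesis
    unfolding pl_sum by (auto intro!: tendsto_sum)
qed

lemma sorted_map_monotone: "mono f \<Longrightarrow> sorted ts \<Longrightarrow> sorted (map f ts)"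
  by (induction ts) (auto dest: monoD)

section \<open>Cutting a curve at prescribed lengths\<close>

lemma at_left_ereal_nontrivial: "0 < r \<Longrightarrow> at_left (r::ereal) \<noteq> bot"
  by (cases r) (auto simp: at_left_ereal at_left_PInf filtermap_bot_iff)

lemma at_right_ereal_nontrivial: "0 \<le> r \<Longrightarrow> r < \<infinity> \<Longrightarrow> at_right (r::ereal) \<noteq> bot"
  by (cases r) (auto simp: at_right_ereal filtermap_bot_iff)

lemma arclength_attained:
  assumes fin: "plen d \<gamma> 0 \<infinity> < \<infinity>"
    and left: "\<And>r. 0 < r \<Longrightarrow> ((\<lambda>t. nrm d (\<gamma> t - \<gamma> r)) \<longlongrightarrow> 0) (at_left r)"
    and right: "\<And>r. 0 \<le> r \<Longrightarrow> r < \<infinity> \<Longrightarrow> ((\<lambda>t. nrm d (\<gamma> t - \<gamma> r)) \<longlongrightarrow> 0) (at_right r)"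
    and y: "0 \<le> y" "y \<le> plen d \<gamma> 0 \<infinity>"
  shows "plen d \<gamma> 0 (Sup {t. 0 \<le> t \<and> plen d \<gamma> 0 t \<le> y}) = y"
proof -
  let ?V = "\<lambda>t. plen d \<gamma> 0 t"
  define r where "r = Sup {t. 0 \<le> t \<and> ?V t \<le> y}"
  have V0: "?V 0 = 0"
  proof (rule antisym[OF _ plen_nonneg], rule plen_leI)
    fix ts :: "ereal list" assume "set ts \<subseteq> {0..0}"
    then have *: "\<forall>t\<in>set ts. t = 0" by auto
    have "pl d \<gamma> ts = 0" unfolding pl_sum
    proof (rule sum.neutral, rule ballI)
      fix j assume "j \<in> {..<length ts - 1}"
      then have "ts ! j = 0" "ts ! Suc j = 0" using * by auto
      then show "nrm d (\<gamma> (ts ! Suc j) - \<gamma> (ts ! j)) = 0" by simp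
    qed
    then show "ereal (pl d \<gamma> ts) \<le> 0" by (simp add: zero_ereal_def)
  qed
  have r0: "0 \<le> r" unfolding r_def by (rule Sup_upper) (use V0 y in auto)
  have below: "?V t \<le> y" if "t < r" "0 \<le> t" for t
  proof -
    obtain t' where "t < t'" "0 \<le> t'" "?V t' \<le> y" using \<open>t < r\<close> unfolding r_def less_Sup_iff by auto
    have "?V t \<le> ?V t'" by (rule plen_mono) (use \<open>t < t'\<close> in auto)
    then show ?thesis using \<open>?V t' \<le> y\<close> by (rule order_trans)
  qed
  have above: "y < ?V t" if "r < t" for t
  proof (rule ccontr)
    assume "\<not> y < ?V t"
    then have "t \<le> r" unfolding r_def using that r0 by (intro Sup_upper) auto
    then show False using that by simp
  qed
  have le: "?V r \<le> y"
  proof (cases "r = 0")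
    case True then show ?thesis using V0 y by simp
  next
    case False
    then have rp: "0 < r" using r0 by simp
    show ?thesis
    proof (rule plen_leI)
      fix ts assume ts: "sorted ts" "set ts \<subseteq> {0..r}"
      \<comment> \<open>Cutting the nodes off at s < r eventually moves only those equal to r, and
        the new polygon lies over [0,s], where the length is at most y.\<close>
      have lim: "((\<lambda>s. pl d \<gamma> (map (\<lambda>t. min s t) ts)) \<longlongrightarrow> pl d \<gamma> ts) (at_left r)"
      proof (rule tendsto_pl_map)
        fix t assume "t \<in> set ts"
        then have t: "0 \<le> t" "t \<le> r" using ts by auto
        show "((\<lambda>s. nrm d (\<gamma> (min s t) - \<gamma> t)) \<longlongrightarrow> 0) (at_left r)"
        proof (cases "t = r")
          case True
          have "eventually (\<lambda>s. nrm d (\<gamma> s - \<gamma> r) = nrm d (\<gamma> (min s t) - \<gamma> t)) (at_left r)"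
            by (intro eventually_at_leftI[of 0] rp) (use True in \<open>auto simp: min_def\<close>)
          then show ?thesis by (rule Lim_transform_eventually[OF left[OF rp]])
        next
          case False
          then have "t < r" using t by simp
          then have "eventually (\<lambda>s. t < s) (at_left r)" by (intro eventually_at_leftI[of t]) auto
          then have "eventually (\<lambda>s. 0 = nrm d (\<gamma> (min s t) - \<gamma> t)) (at_left r)"
            by eventually_elim (simp add: min_def)
          then show ?thesis by (rule Lim_transform_eventually[OF tendsto_const])
        qed
      qed
      have "eventually (\<lambda>s. s \<in> {0<..<r}) (at_left r)" using rp by (intro eventually_at_leftI[of 0]) auto
      then have ev: "eventually (\<lambda>s. ereal (pl d \<gamma> (map (\<lambda>t. min s t) ts)) \<le> y) (at_left r)"
      proof eventually_elim
        case (elim s)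
        have "sorted (map (\<lambda>t. min s t) ts)" by (rule sorted_map_monotone[OF _ ts(1)]) (auto simp: mono_def min_def)
        moreover have "set (map (\<lambda>t. min s t) ts) \<subseteq> {0..s}" using ts elim by auto
        ultimately have "ereal (pl d \<gamma> (map (\<lambda>t. min s t) ts)) \<le> ?V s" by (rule pl_le_plen)
        also have "\<dots> \<le> y" using elim by (intro below) auto
        finally show ?case .
      qed
      have "((\<lambda>s. ereal (pl d \<gamma> (map (\<lambda>t. min s t) ts))) \<longlongrightarrow> ereal (pl d \<gamma> ts)) (at_left r)"
        using lim by simp
      then show "ereal (pl d \<gamma> ts) \<le> y"
        by (rule tendsto_upperbound[OF _ ev]) (rule at_left_ereal_nontrivial[OF rp])
    qed
  qed
  have ge: "y \<le> ?V r"
  proof (cases "r = \<infinity>")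
    case True then show ?thesis using y by simp
  next
    case False
    then have rf: "r < \<infinity>" by simp
    obtain L where L: "plen d \<gamma> 0 \<infinity> = ereal L" "0 \<le> L" using fin plen_nonneg[of d \<gamma> 0 \<infinity>] by (cases "plen d \<gamma> 0 \<infinity>") auto
    obtain Y where Y: "y = ereal Y" using y L by (cases y) auto
    \<comment> \<open>A lower bound for the initial length is an upper bound for the rest, as the
      two add up to L. Beyond every s > r less than L - Y is left; nodes below s are raised to s
      before s tends to r.\<close>
    have "plen d \<gamma> r \<infinity> \<le> ereal (L - Y)"
    proof (rule plen_leI)
      fix ts assume ts: "sorted ts" "set ts \<subseteq> {r..\<infinity>}"
      have lim: "((\<lambda>s. pl d \<gamma> (map (\<lambda>t. max s t) ts)) \<longlongrightarrow> pl d \<gamma> ts) (at_right r)"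
      proof (rule tendsto_pl_map)
        fix t assume "t \<in> set ts"
        then have t: "r \<le> t" using ts by auto
        show "((\<lambda>s. nrm d (\<gamma> (max s t) - \<gamma> t)) \<longlongrightarrow> 0) (at_right r)"
        proof (cases "t = r")
          case True
          have "eventually (\<lambda>s. nrm d (\<gamma> s - \<gamma> r) = nrm d (\<gamma> (max s t) - \<gamma> t)) (at_right r)"
            by (intro eventually_at_rightI[of _ "\<infinity>"] rf) (use True in \<open>auto simp: max_def\<close>)
          then show ?thesis by (rule Lim_transform_eventually[OF right[OF r0 rf]])
        next
          case False
          then have "r < t" using t by simp
          then have "eventually (\<lambda>s. s < t) (at_right r)" by (intro eventually_at_rightI[of _ t]) auto
          then have "eventually (\<lambda>s. 0 = nrm d (\<gamma> (max s t) - \<gamma> t)) (at_right r)"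
            by eventually_elim (simp add: max_def)
          then show ?thesis by (rule Lim_transform_eventually[OF tendsto_const])
        qed
      qed
      have "eventually (\<lambda>s. s \<in> {r<..<\<infinity>}) (at_right r)" using rf by (intro eventually_at_rightI[of _ "\<infinity>"]) auto
      then have ev: "eventually (\<lambda>s. ereal (pl d \<gamma> (map (\<lambda>t. max s t) ts)) \<le> ereal (L - Y)) (at_right r)"
      proof eventually_elim
        case (elim s)
        have s0: "0 \<le> s" using elim r0 by auto
        have "sorted (map (\<lambda>t. max s t) ts)" by (rule sorted_map_monotone[OF _ ts(1)]) (auto simp: mono_def max_def)
        moreover have "set (map (\<lambda>t. max s t) ts) \<subseteq> {s..\<infinity>}" by auto
        ultimately have 1: "ereal (pl d \<gamma> (map (\<lambda>t. max s t) ts)) \<le> plen d \<gamma> s \<infinity>" by (rule pl_le_plen)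
        have 2: "?V s + plen d \<gamma> s \<infinity> = ereal L" using plen_add[of 0 s \<infinity> d \<gamma>] s0 L by simp
        have 3: "ereal Y < ?V s" using above[of s] elim Y by simp
        show ?case
          using 1 2 3 plen_nonneg[of d \<gamma> s \<infinity>] plen_nonneg[of d \<gamma> 0 s]
          by (cases "?V s"; cases "plen d \<gamma> s \<infinity>") auto
      qed
      have "((\<lambda>s. ereal (pl d \<gamma> (map (\<lambda>t. max s t) ts))) \<longlongrightarrow> ereal (pl d \<gamma> ts)) (at_right r)"
        using lim by simp
      then show "ereal (pl d \<gamma> ts) \<le> ereal (L - Y)"
        by (rule tendsto_upperbound[OF _ ev]) (rule at_right_ereal_nontrivial[OF r0 rf])
    qed
    moreover have "?V r + plen d \<gamma> r \<infinity> = ereal L" using plen_add[of 0 r \<infinity> d \<gamma>] r0 L by simp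
    ultimately show ?thesis
      using Y plen_nonneg[of d \<gamma> r \<infinity>] plen_nonneg[of d \<gamma> 0 r] by (cases "?V r"; cases "plen d \<gamma> r \<infinity>") auto
  qed
  show ?thesis using le ge by (simp add: r_def[symmetric])
qed

text \<open>A continuous curve of finite length can be cut at any prescribed length: the last parameter with arc length at most
  $y$ has arc length exactly $y$, by continuity of the curve from the left (for the initial part) and from the right (for the
  remaining part).\<close>

lemma equal_partition:
  assumes fin: "plen d \<gamma> 0 \<infinity> < \<infinity>"
    and left: "\<And>r. 0 < r \<Longrightarrow> ((\<lambda>t. nrm d (\<gamma> t - \<gamma> r)) \<longlongrightarrow> 0) (at_left r)"
    and right: "\<And>r. 0 \<le> r \<Longrightarrow> r < \<infinity> \<Longrightarrow> ((\<lambda>t. nrm d (\<gamma> t - \<gamma> r)) \<longlongrightarrow> 0) (at_right r)"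
    and k: "0 < k"
  obtains r :: "nat \<Rightarrow> ereal" where "r 0 = 0" "r k = \<infinity>" "\<And>j. j < k \<Longrightarrow> r j \<le> r (Suc j)"
    "\<And>j. j < k \<Longrightarrow> plen d \<gamma> (r j) (r (Suc j)) = plen d \<gamma> 0 \<infinity> / ereal (real k)"
proof -
  obtain L where L: "plen d \<gamma> 0 \<infinity> = ereal L" "0 \<le> L" using fin plen_nonneg[of d \<gamma> 0 \<infinity>] by (cases "plen d \<gamma> 0 \<infinity>") auto
  let ?y = "\<lambda>j::nat. ereal (real j * L / real k)"
  define s where "s = (\<lambda>j. Sup {t. 0 \<le> t \<and> plen d \<gamma> 0 t \<le> ?y j})"
  \<comment> \<open>The ends are set by hand: if the curve rests at its start, the supremum for j =
    0 is positive.\<close>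
  define r where "r = (\<lambda>j. if j = 0 then 0 else if j = k then \<infinity> else s j)"
  have yk: "0 \<le> ?y j \<and> ?y j \<le> plen d \<gamma> 0 \<infinity>" if "j \<le> k" for j
  proof -
    have "real j * L \<le> real k * L" using that L by (intro mult_right_mono) auto
    then show ?thesis using L k by (simp add: field_simps)
  qed
  have V0: "plen d \<gamma> 0 0 = 0"
  proof -
    have "plen d \<gamma> 0 \<infinity> = plen d \<gamma> 0 0 + plen d \<gamma> 0 \<infinity>" by (rule plen_add) auto
    then show ?thesis using L by (cases "plen d \<gamma> 0 0") auto
  qed
  have Vr: "plen d \<gamma> 0 (r j) = ?y j" if "j \<le> k" for j
    using arclength_attained[OF fin left right, of "?y j"] yk[OF that] L V0 k by (auto simp: r_def s_def zero_ereal_def)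
  have rn: "0 \<le> r j" for j
    unfolding r_def s_def by (auto intro!: Sup_upper simp: V0 L)
  have rm: "r j \<le> r (Suc j)" if "j < k" for j
  proof (cases "j = 0 \<or> Suc j = k")
    case True then show ?thesis using rn[of "Suc j"] by (auto simp: r_def)
  next
    case False
    have "?y j \<le> ?y (Suc j)" using L k by (auto intro!: divide_right_mono mult_right_mono)
    then have "s j \<le> s (Suc j)" unfolding s_def by (intro Sup_subset_mono) (auto intro: order_trans)
    then show ?thesis using False that by (auto simp: r_def)
  qed
  show thesis
  proof (rule that[of r])
    show "r 0 = 0" "r k = \<infinity>" using k by (auto simp: r_def)
    fix j assume j: "j < k"
    show "r j \<le> r (Suc j)" by (rule rm[OF j])
    have "plen d \<gamma> 0 (r (Suc j)) = plen d \<gamma> 0 (r j) + plen d \<gamma> (r j) (r (Suc j))"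
      by (rule plen_add[OF rn rm[OF j]])
    then have "?y (Suc j) = ?y j + plen d \<gamma> (r j) (r (Suc j))" using Vr j by simp
    then have "plen d \<gamma> (r j) (r (Suc j)) = ereal (real (Suc j) * L / real k - real j * L / real k)"
      by (cases "plen d \<gamma> (r j) (r (Suc j))") auto
    then show "plen d \<gamma> (r j) (r (Suc j)) = plen d \<gamma> 0 \<infinity> / ereal (real k)"
      using L k by (simp add: field_simps)
  qed
qed

text \<open>A partition within e of the supremal variation leaves at most e for everything beyond
  its last node, which is the Cauchy criterion at infinity.\<close>

lemma bounded_variation_convergent:
  fixes f :: "real \<Rightarrow> real"
  assumes B: "\<And>ts. sorted ts \<Longrightarrow> \<forall>t\<in>set ts. 0 \<le> t \<Longrightarrow> (\<Sum>j<length ts - 1. \<bar>f (ts ! Suc j) - f (ts ! j)\<bar>) \<le> B"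
  shows "\<exists>l. (f \<longlongrightarrow> l) at_top"
proof -
  define v where "v = (\<lambda>ts. \<Sum>j<length ts - 1. \<bar>f (ts ! Suc j) - f (ts ! j)\<bar>)"
  let ?T = "{ts. sorted ts \<and> (\<forall>t\<in>set ts. 0 \<le> t)}"
  have bdd: "bdd_above (v ` ?T)" using B by (intro bdd_aboveI[of _ B]) (auto simp: v_def)
  have cauchy: "\<exists>T\<ge>0. \<forall>s\<ge>T. \<forall>t\<ge>s. \<bar>f t - f s\<bar> \<le> e" if e: "0 < e" for e
  proof -
    have "(SUP ts\<in>?T. v ts) - e < (SUP ts\<in>?T. v ts)" using e by simp
    then obtain ts where ts: "ts \<in> ?T" "(SUP ts\<in>?T. v ts) - e < v ts"
    proof -
      have "[] \<in> ?T" by simp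
      then have ne: "?T \<noteq> {}" by blast
      show ?thesis using \<open>(SUP ts\<in>?T. v ts) - e < (SUP ts\<in>?T. v ts)\<close> less_cSUP_iff[OF ne bdd] that by blast
    qed
    define T where "T = Max (insert 0 (set ts))"
    have T: "0 \<le> T" "\<forall>t\<in>set ts. t \<le> T" by (auto simp: T_def)
    have "\<bar>f t - f s\<bar> \<le> e" if st: "T \<le> s" "s \<le> t" for s t
    proof -
      have "ts @ [s, t] \<in> ?T" using ts T st by (auto simp: sorted_append intro: order_trans)
      then have up: "v (ts @ [s, t]) \<le> (SUP ts\<in>?T. v ts)" by (rule cSUP_upper[OF _ bdd])
      have "v ts + \<bar>f t - f s\<bar> \<le> v (ts @ [s, t])"
      proof -
        let ?n = "length ts"
        have vd: "v us = (\<Sum>j<length us - 1. \<bar>f (us ! Suc j) - f (us ! j)\<bar>)" for us by (simp add: v_def)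
        have len: "length (ts @ [s, t]) - 1 = Suc ?n" by simp
        have "(\<Sum>j<?n. \<bar>f ((ts @ [s, t]) ! Suc j) - f ((ts @ [s, t]) ! j)\<bar>) \<ge> (\<Sum>j<?n - 1. \<bar>f ((ts @ [s, t]) ! Suc j) - f ((ts @ [s, t]) ! j)\<bar>)"
          by (rule sum_mono2) auto
        moreover have "(\<Sum>j<?n - 1. \<bar>f ((ts @ [s, t]) ! Suc j) - f ((ts @ [s, t]) ! j)\<bar>) = v ts"
          unfolding v_def by (intro sum.cong) (auto simp: nth_append)
        moreover have "\<bar>f ((ts @ [s, t]) ! Suc ?n) - f ((ts @ [s, t]) ! ?n)\<bar> = \<bar>f t - f s\<bar>" by (simp add: nth_append)
        ultimately show ?thesis unfolding vd[of "ts @ [s, t]"] len by simp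
      qed
      then show ?thesis using up ts(2) by linarith
    qed
    then show ?thesis using T by blast
  qed
  have "Cauchy (\<lambda>n::nat. f (real n))"
  proof (rule CauchyI')
    fix e :: real assume "0 < e"
    then obtain T where T: "0 \<le> T" "\<And>s t. T \<le> s \<Longrightarrow> s \<le> t \<Longrightarrow> \<bar>f t - f s\<bar> \<le> e / 2" using cauchy[of "e/2"] by auto
    obtain N :: nat where N: "T \<le> real N" using real_arch_simple by blast
    show "\<exists>M. \<forall>m\<ge>M. \<forall>n>m. dist (f (real m)) (f (real n)) < e"
    proof (intro exI allI impI)
      fix m n :: nat assume "N \<le> m" "m < n"
      then have "\<bar>f (real n) - f (real m)\<bar> \<le> e / 2" using N by (intro T(2)) auto
      then show "dist (f (real m)) (f (real n)) < e" using \<open>0 < e\<close> abs_minus_commute[of "f (real m)" "f (real n)"] unfolding dist_real_def by linarith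
    qed
  qed
  then obtain l where l: "(\<lambda>n. f (real n)) \<longlonglongrightarrow> l" using Cauchy_convergent convergent_def by blast
  have "(f \<longlongrightarrow> l) at_top"
  proof (rule tendstoI)
    fix e :: real assume "0 < e"
    then obtain T where T: "0 \<le> T" "\<And>s t. T \<le> s \<Longrightarrow> s \<le> t \<Longrightarrow> \<bar>f t - f s\<bar> \<le> e / 2" using cauchy[of "e/2"] by auto
    have "\<bar>l - f s\<bar> \<le> e / 2" if s: "T \<le> s" for s
    proof -
      have lim: "(\<lambda>n. \<bar>f (real n) - f s\<bar>) \<longlonglongrightarrow> \<bar>l - f s\<bar>" by (intro tendsto_intros l)
      obtain N :: nat where "s \<le> real N" using real_arch_simple by blast
      then have "eventually (\<lambda>n. \<bar>f (real n) - f s\<bar> \<le> e / 2) sequentially"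
        using T(2)[OF s] by (intro eventually_sequentiallyI[of N]) (auto intro: order_trans)
      then show ?thesis by (rule tendsto_upperbound[OF lim]) simp
    qed
    then have "\<forall>s\<ge>T. dist (f s) l < e" using \<open>0 < e\<close> by (force simp: dist_real_def abs_minus_commute)
    then show "eventually (\<lambda>s. dist (f s) l < e) at_top" unfolding eventually_at_top_linorder by blast
  qed
  then show ?thesis ..
qed

section \<open>The curvature path at finite and infinite radius\<close>

lemma rho_real: "0 \<le> r \<Longrightarrow> rho d K (ereal r) = cg d (par d K r)"
  by (simp add: rho_def par_def smul_ballR)

lemma rho_finite: "0 \<le> t \<Longrightarrow> t < \<infinity> \<Longrightarrow> rho d K t = cg d (par d K (real_of_ereal t))"
  by (cases t) (auto simp: rho_real)

definition unitv :: "nat \<Rightarrow> vec" where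
  "unitv i = (\<lambda>j. if j = i then 1 else 0)"

lemma unitv: "i < d \<Longrightarrow> unitv i \<in> Rd d" "i < d \<Longrightarrow> ip d x (unitv i) = x i" "i < d \<Longrightarrow> nrm d (unitv i) = 1"
proof -
  assume i: "i < d"
  show "unitv i \<in> Rd d" using i by (auto simp: unitv_def Rd_def)
  show *: "ip d x (unitv i) = x i" for x
  proof -
    have "ip d x (unitv i) = (\<Sum>j<d. if j = i then x j else 0)" unfolding ip_def unitv_def by (intro sum.cong) auto
    then show ?thesis using i by simp
  qed
  show "nrm d (unitv i) = 1" unfolding nrm_def * by (simp add: unitv_def)
qed

text \<open>\<open>Lim\<close> in \<open>rho\<close> has a meaning only if the limit exists. It does
  because every coordinate of the path has bounded variation.\<close>

lemma rho_Rd: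
  assumes "body d K" "core d K c \<delta>" "0 < d"
  shows "((\<lambda>r. cg d (par d K r)) \<longlongrightarrow> rho d K \<infinity>) at_top" and "0 \<le> t \<Longrightarrow> rho d K t \<in> Rd d"
proof -
  obtain R where R: "0 < R" "K \<subseteq> ballR d R" using body_bounded[OF assms(1)] .
  have "\<exists>l. \<forall>i. ((\<lambda>r. cg d (par d K r) i) \<longlongrightarrow> l i) at_top"
  proof (rule choice[of "\<lambda>i l. ((\<lambda>r. cg d (par d K r) i) \<longlongrightarrow> l) at_top"], rule allI)
    fix i
    show "\<exists>l. ((\<lambda>r. cg d (par d K r) i) \<longlongrightarrow> l) at_top"
    proof (cases "i < d")
      case False
      then show ?thesis by (auto simp: cg_def)
    next
      case True
      have "(\<Sum>j<length ts - 1. \<bar>cg d (par d K (ts ! Suc j)) i - cg d (par d K (ts ! j)) i\<bar>) \<le> real (Suc d) * (R - (- R))"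
        if "sorted ts" "\<forall>t\<in>set ts. 0 \<le> t" for ts
      proof -
        have "- R \<le> ip d x (unitv i) \<and> ip d x (unitv i) \<le> R" if "x \<in> K" for x
          using that R coord_le_nrm[OF True, of x] unitv(2)[OF True, of x] by (auto simp: ballR_iff abs_le_iff)
        from variation_curvature_path[OF assms(1,2) this unitv(1)[OF True] assms(3) that]
        show ?thesis by (simp only: unitv(2)[OF True])
      qed
      then show ?thesis by (rule bounded_variation_convergent)
    qed
  qed
  then obtain l where "\<And>i. ((\<lambda>r. cg d (par d K r) i) \<longlongrightarrow> l i) at_top" by blast
  then have lim: "((\<lambda>r. cg d (par d K r)) \<longlongrightarrow> l) at_top" by (rule tendsto_vecI)
  have "eventually (\<lambda>r. cg d (par d K r) = cg d (msum K (smul r ` ballR d 1))) at_top"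
    using eventually_ge_at_top[of 0] by eventually_elim (simp add: par_def smul_ballR)
  then have "((\<lambda>r. cg d (msum K (smul r ` ballR d 1))) \<longlongrightarrow> l) at_top"
    by (rule Lim_transform_eventually[OF lim])
  then have "rho d K \<infinity> = l" unfolding rho_def by (simp add: tendsto_Lim)
  then show lim: "((\<lambda>r. cg d (par d K r)) \<longlongrightarrow> rho d K \<infinity>) at_top" using lim by simp
  show "rho d K t \<in> Rd d" if "0 \<le> t"
  proof (cases "t = \<infinity>")
    case True
    have "rho d K \<infinity> \<in> Rd d"
      by (rule Lim_in_closed_set[OF closed_Rd _ _ lim]) (auto simp: cg_Rd)
    then show ?thesis using True by simp
  next
    case False then show ?thesis using that by (simp add: rho_finite cg_Rd)
  qed
qed

lemma tendsto_ip:
  fixes f :: "'a \<Rightarrow> vec"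
  assumes "(f \<longlongrightarrow> l) F" shows "((\<lambda>x. ip d (f x) v) \<longlongrightarrow> ip d l v) F"
proof -
  have c: "continuous_on UNIV (\<lambda>x. ip d x v)" by (intro continuous_on_ip continuous_on_id continuous_on_const)
  have "isCont (\<lambda>x. ip d x v) l" using c by (simp add: continuous_on_eq_continuous_at)
  then show ?thesis using assms by (rule isCont_tendsto_compose)
qed

lemma tendsto_nrm_diff:
  fixes f :: "'a \<Rightarrow> vec"
  assumes "\<And>i. i < d \<Longrightarrow> ((\<lambda>x. f x i) \<longlongrightarrow> l i) F" shows "((\<lambda>x. nrm d (f x - l)) \<longlongrightarrow> 0) F"
proof (rule Lim_null_comparison)
  show "eventually (\<lambda>x. norm (nrm d (f x - l)) \<le> (\<Sum>i<d. \<bar>f x i - l i\<bar>)) F"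
    using nrm_le_sum[of d "f x - l" for x] by (intro always_eventually allI) simp
  have "((\<lambda>x. \<Sum>i<d. \<bar>f x i - l i\<bar>) \<longlongrightarrow> (\<Sum>i<d. \<bar>l i - l i\<bar>)) F"
    by (intro tendsto_sum tendsto_rabs tendsto_diff assms tendsto_const) auto
  then show "((\<lambda>x. \<Sum>i<d. \<bar>f x i - l i\<bar>) \<longlongrightarrow> 0) F" by simp
qed

definition row :: "nat \<Rightarrow> (nat \<Rightarrow> nat \<Rightarrow> real) \<Rightarrow> nat \<Rightarrow> vec" where
  "row d A i = (\<lambda>j. if j < d then A i j else 0)"

lemma matapp_row: "i < d \<Longrightarrow> matapp d A x i = ip d x (row d A i)"
  by (simp add: matapp_def ip_def row_def mult.commute)

lemma row_Rd: "row d A i \<in> Rd d"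
  by (simp add: row_def Rd_def)

text \<open>Parallel bodies of radii s and r include each other after fattening by |s - r|. Negative
  s are excluded, since a ball of negative radius is empty.\<close>

lemma cg_par_tendsto:
  assumes K: "body d K" "core d K c \<delta>" and r: "0 \<le> r"
  shows "((\<lambda>s. ip d (cg d (par d K s)) v) \<longlongrightarrow> ip d (cg d (par d K r)) v) (at r within {0..})"
proof (rule tendsto_ip_cg[OF body_par[OF K(1)] core_mono[OF K(2) subset_par[OF r]]])
  have "((\<lambda>s. \<bar>s - r\<bar>) \<longlongrightarrow> \<bar>r - r\<bar>) (at r within {0..})" by (intro tendsto_intros)
  then show "((\<lambda>s. \<bar>s - r\<bar>) \<longlongrightarrow> 0) (at r within {0..})" by simp
  have inc: "par d K s \<subseteq> par d (par d K t) \<bar>s - t\<bar>" if "0 \<le> s" "0 \<le> t" for s t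
  proof -
    have "par d K s \<subseteq> par d K (t + \<bar>s - t\<bar>)" by (rule par_mono) auto
    also have "\<dots> \<subseteq> par d (par d K t) \<bar>s - t\<bar>" by (rule par_par_ge) (use that in auto)
    finally show ?thesis .
  qed
  show "eventually (\<lambda>s. body d (par d K s) \<and> core d (par d K s) c \<delta> \<and> 0 \<le> \<bar>s - r\<bar> \<and>
      par d K r \<subseteq> par d (par d K s) \<bar>s - r\<bar> \<and> par d K s \<subseteq> par d (par d K r) \<bar>s - r\<bar>) (at r within {0..})"
    unfolding eventually_at_filter
  proof (intro always_eventually allI impI conjI)
    fix s :: real assume s: "s \<in> {0..}"
    then have s0: "0 \<le> s" by simp
    show "body d (par d K s)" by (rule body_par[OF K(1)])
    show "core d (par d K s) c \<delta>" by (rule core_mono[OF K(2) subset_par[OF s0]])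
    show "par d K r \<subseteq> par d (par d K s) \<bar>s - r\<bar>" using inc[OF r s0] by (simp add: abs_minus_commute)
    show "par d K s \<subseteq> par d (par d K r) \<bar>s - r\<bar>" by (rule inc[OF s0 r])
  qed simp
qed

lemma path_continuous:
  fixes A :: "nat \<Rightarrow> nat \<Rightarrow> real" and r :: ereal
  assumes K: "body d K" "core d K c \<delta>" "0 < d"
  defines "\<gamma> \<equiv> matapp d A \<circ> rho d K"
  shows "0 < r \<Longrightarrow> ((\<lambda>t. nrm d (\<gamma> t - \<gamma> r)) \<longlongrightarrow> 0) (at_left r)"
    and "0 \<le> r \<Longrightarrow> r < \<infinity> \<Longrightarrow> ((\<lambda>t. nrm d (\<gamma> t - \<gamma> r)) \<longlongrightarrow> 0) (at_right r)"
proof -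
  show "((\<lambda>t. nrm d (\<gamma> t - \<gamma> r)) \<longlongrightarrow> 0) (at_left r)" if r: "0 < r"
  proof (rule tendsto_nrm_diff)
    fix i assume i: "i < d"
    show "((\<lambda>t. \<gamma> t i) \<longlongrightarrow> \<gamma> r i) (at_left r)"
    proof (cases r)
      case (real x)
      have x: "0 < x" using r real by simp
      have "((\<lambda>s. ip d (cg d (par d K s)) (row d A i)) \<longlongrightarrow> ip d (cg d (par d K x)) (row d A i)) (at_left x)"
      proof -
        have "at_left x = at x within {0..<x}"
          using x by (intro at_within_nhd[of _ "{0<..}"]) auto
        also have "\<dots> \<le> at x within {0..}" by (rule at_le) auto
        finally have le: "at_left x \<le> at x within {0..}" .
        show ?thesis by (rule filterlim_mono[OF cg_par_tendsto[OF K(1,2) less_imp_le[OF x]] order_refl le])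
      qed
      moreover have "eventually (\<lambda>s. ip d (cg d (par d K s)) (row d A i) = \<gamma> (ereal s) i) (at_left x)"
        using x by (intro eventually_at_leftI[of 0]) (auto simp: \<gamma>_def matapp_row[OF i] rho_real)
      ultimately have "((\<lambda>s. \<gamma> (ereal s) i) \<longlongrightarrow> \<gamma> r i) (at_left x)"
        using x by (simp add: real \<gamma>_def matapp_row[OF i] rho_real Lim_transform_eventually)
      then show ?thesis by (simp add: real at_left_ereal filterlim_filtermap)
    next
      case PInf
      have "((\<lambda>s. ip d (cg d (par d K s)) (row d A i)) \<longlongrightarrow> ip d (rho d K \<infinity>) (row d A i)) at_top"
        by (rule tendsto_ip[OF rho_Rd(1)[OF K]])
      moreover have "eventually (\<lambda>s. ip d (cg d (par d K s)) (row d A i) = \<gamma> (ereal s) i) at_top"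
        using eventually_ge_at_top[of 0] by eventually_elim (auto simp: \<gamma>_def matapp_row[OF i] rho_real)
      ultimately have "((\<lambda>s. \<gamma> (ereal s) i) \<longlongrightarrow> \<gamma> r i) at_top"
        by (simp add: PInf \<gamma>_def matapp_row[OF i] Lim_transform_eventually)
      then show ?thesis by (simp add: PInf at_left_PInf filterlim_filtermap)
    qed (use r in auto)
  qed
  show "((\<lambda>t. nrm d (\<gamma> t - \<gamma> r)) \<longlongrightarrow> 0) (at_right r)" if r: "0 \<le> r" "r < \<infinity>"
  proof (rule tendsto_nrm_diff)
    fix i assume i: "i < d"
    obtain x where x: "r = ereal x" "0 \<le> x" using r by (cases r) auto
    have le: "at_right x \<le> at x within {0..}" by (rule at_le) (use x in auto)
    have "((\<lambda>s. ip d (cg d (par d K s)) (row d A i)) \<longlongrightarrow> ip d (cg d (par d K x)) (row d A i)) (at_right x)"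
      by (rule filterlim_mono[OF cg_par_tendsto[OF K(1,2) x(2)] order_refl le])
    moreover have "eventually (\<lambda>s. ip d (cg d (par d K s)) (row d A i) = \<gamma> (ereal s) i) (at_right x)"
      using x by (intro eventually_at_rightI[of _ "x + 1"]) (auto simp: \<gamma>_def matapp_row[OF i] rho_real)
    ultimately have "((\<lambda>s. \<gamma> (ereal s) i) \<longlongrightarrow> \<gamma> r i) (at_right x)"
      using x by (simp add: \<gamma>_def matapp_row[OF i] rho_real Lim_transform_eventually)
    then show "((\<lambda>t. \<gamma> t i) \<longlongrightarrow> \<gamma> r i) (at_right r)" by (simp add: x(1) at_right_ereal filterlim_filtermap)
  qed
qed

text \<open>Each of the d coordinates of the image path is a linear functional with range 2d on K,
  hence of variation at most 2d(d+1); the Euclidean length is at most the sum of these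
  variations.\<close>

lemma path_length_bound:
  assumes K: "body d K" "core d K c \<delta>" "0 < d"
    and sub: "matapp d A ` K \<subseteq> (\<lambda>b. q + b) ` ballR d (real d)"
  shows "plen d (matapp d A \<circ> rho d K) 0 \<infinity> \<le> ereal (2 * real d ^ 2 * (real d + 1))"
proof (rule plen_leI)
  fix ts :: "ereal list" assume ts: "sorted ts" "set ts \<subseteq> {0..\<infinity>}"
  define \<gamma> where "\<gamma> = matapp d A \<circ> rho d K"
  have fin: "(\<Sum>j<length us - 1. nrm d (\<gamma> (ereal (us ! Suc j)) - \<gamma> (ereal (us ! j)))) \<le> 2 * real d ^ 2 * (real d + 1)"
    if us: "sorted us" "\<forall>t\<in>set us. 0 \<le> t" for us
  proof -
    have un: "0 \<le> us ! j" "0 \<le> us ! Suc j" if "j < length us - 1" for j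
      by (rule us(2)[rule_format], rule nth_mem, use that in linarith)+
    have one: "(\<Sum>j<length us - 1. \<bar>\<gamma> (ereal (us ! Suc j)) i - \<gamma> (ereal (us ! j)) i\<bar>) \<le> real (Suc d) * (2 * real d)" if i: "i < d" for i
    proof -
      have rg: "q i - real d \<le> ip d x (row d A i) \<and> ip d x (row d A i) \<le> q i + real d" if "x \<in> K" for x
      proof -
        have "matapp d A x \<in> (\<lambda>b. q + b) ` ballR d (real d)" by (rule subsetD[OF sub imageI[OF that]])
        then obtain b where "b \<in> ballR d (real d)" "matapp d A x = q + b" by (rule imageE) (rule that)
        then have "matapp d A x i = q i + b i" "\<bar>b i\<bar> \<le> real d" using coord_le_nrm[OF i, of b] by (auto simp: ballR_iff)
        then show ?thesis unfolding matapp_row[OF i] by auto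
      qed
      have "(\<Sum>j<length us - 1. \<bar>\<gamma> (ereal (us ! Suc j)) i - \<gamma> (ereal (us ! j)) i\<bar>)
        = (\<Sum>j<length us - 1. \<bar>ip d (cg d (par d K (us ! Suc j))) (row d A i) - ip d (cg d (par d K (us ! j))) (row d A i)\<bar>)"
        using un by (intro sum.cong refl) (auto simp: \<gamma>_def matapp_row[OF i] rho_real)
      also have "\<dots> \<le> real (Suc d) * ((q i + real d) - (q i - real d))"
        by (rule variation_curvature_path[OF K(1,2) rg row_Rd K(3) us])
      finally show ?thesis by simp
    qed
    have "(\<Sum>j<length us - 1. nrm d (\<gamma> (ereal (us ! Suc j)) - \<gamma> (ereal (us ! j))))
        \<le> (\<Sum>j<length us - 1. \<Sum>i<d. \<bar>\<gamma> (ereal (us ! Suc j)) i - \<gamma> (ereal (us ! j)) i\<bar>)"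
      using nrm_le_sum[of d "\<gamma> (ereal (us ! Suc j)) - \<gamma> (ereal (us ! j))" for j] by (intro sum_mono) simp
    also have "\<dots> = (\<Sum>i<d. \<Sum>j<length us - 1. \<bar>\<gamma> (ereal (us ! Suc j)) i - \<gamma> (ereal (us ! j)) i\<bar>)" by (rule sum.swap)
    also have "\<dots> \<le> (\<Sum>i<d. real (Suc d) * (2 * real d))" by (intro sum_mono one) auto
    also have "\<dots> = 2 * real d ^ 2 * (real d + 1)" by (simp add: power2_eq_square algebra_simps)
    finally show ?thesis .
  qed
  \<comment> \<open>The variation bound concerns real radii. Nodes at infinity are replaced by a
    large s, and the path is continuous there.\<close>
  define h where "h = (\<lambda>(s::real) t. min (ereal s) t)"
  have lim: "((\<lambda>s. pl d \<gamma> (map (h s) ts)) \<longlongrightarrow> pl d \<gamma> ts) at_top"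
  proof (rule tendsto_pl_map)
    fix t assume "t \<in> set ts"
    then have t: "0 \<le> t" using ts by auto
    show "((\<lambda>s. nrm d (\<gamma> (h s t) - \<gamma> t)) \<longlongrightarrow> 0) at_top"
    proof (cases t)
      case (real x)
      have "eventually (\<lambda>s. 0 = nrm d (\<gamma> (h s t) - \<gamma> t)) at_top"
        using eventually_ge_at_top[of x] by eventually_elim (simp add: h_def real min_def)
      then show ?thesis by (rule Lim_transform_eventually[OF tendsto_const])
    next
      case PInf
      have "((\<lambda>s. nrm d (\<gamma> s - \<gamma> \<infinity>)) \<longlongrightarrow> 0) (at_left \<infinity>)"
        unfolding \<gamma>_def by (rule path_continuous(1)[OF K]) simp
      then have "((\<lambda>s. nrm d (\<gamma> (ereal s) - \<gamma> \<infinity>)) \<longlongrightarrow> 0) at_top" by (simp add: at_left_PInf filterlim_filtermap)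
      then show ?thesis by (simp add: h_def PInf)
    qed (use t in auto)
  qed
  have "eventually (\<lambda>s. pl d \<gamma> (map (h s) ts) \<le> 2 * real d ^ 2 * (real d + 1)) at_top"
    using eventually_ge_at_top[of 0]
  proof eventually_elim
    case (elim s)
    define us where "us = map (\<lambda>t. real_of_ereal (h s t)) ts"
    have hf: "0 \<le> h s t \<and> h s t < \<infinity>" if "t \<in> set ts" for t
      using that ts elim by (auto simp: h_def min_def)
    have er: "ereal (real_of_ereal (h s t)) = h s t" if "t \<in> set ts" for t using hf[OF that] by (cases "h s t") auto
    have so: "sorted (map (h s) ts)" by (rule sorted_map_monotone[OF _ ts(1)]) (auto simp: mono_def h_def min_def)
    have e: "map (h s) ts = map ereal us" using er by (simp add: us_def)
    have "sorted us" using so unfolding e by (simp add: sorted_map)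
    moreover have "\<forall>u\<in>set us. 0 \<le> u" using hf by (auto simp: us_def real_of_ereal_pos)
    ultimately have "(\<Sum>j<length us - 1. nrm d (\<gamma> (ereal (us ! Suc j)) - \<gamma> (ereal (us ! j)))) \<le> 2 * real d ^ 2 * (real d + 1)"
      by (rule fin)
    moreover have "pl d \<gamma> (map ereal us) = (\<Sum>j<length us - 1. nrm d (\<gamma> (ereal (us ! Suc j)) - \<gamma> (ereal (us ! j))))"
      unfolding pl_sum length_map by (intro sum.cong refl) simp
    ultimately show ?case unfolding e by simp
  qed
  then have "pl d \<gamma> ts \<le> 2 * real d ^ 2 * (real d + 1)" by (rule tendsto_upperbound[OF lim]) simp
  then show "ereal (pl d (matapp d A \<circ> rho d K) ts) \<le> ereal (2 * real d ^ 2 * (real d + 1))" by (simp add: \<gamma>_def)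
qed

text \<open>Strictness is what leaves a set with interior after a cut through a path point; at
  infinity it needs the gap that is uniform in the radius.\<close>

lemma rho_strict:
  assumes n: "n \<in> Rd d" "nrm d n = 1" and K: "body d K" "core d K c \<delta>" "\<And>y. y \<in> K \<Longrightarrow> ip d y n \<le> h"
    and d: "0 < d" and t: "0 \<le> t"
  shows "ip d (rho d K t) n < h"
proof (cases "t = \<infinity>")
  case False
  then have "t < \<infinity>" by simp
  show ?thesis
    unfolding rho_finite[OF t \<open>t < \<infinity>\<close>] by (rule cg_strict(1)[OF n K d real_of_ereal_pos[OF t]])
next
  case True
  have "\<exists>\<eta>>0. \<exists>R. \<forall>r\<ge>R. ip d (cg d (par d K r)) n \<le> h - \<eta>"
    by (rule cg_strict(2)[OF n K d])
  then obtain \<eta> R where \<eta>: "0 < \<eta>" and R: "\<forall>r\<ge>R. ip d (cg d (par d K r)) n \<le> h - \<eta>"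
    by (elim exE conjE) (rule that)
  have "ip d (rho d K \<infinity>) n \<le> h - \<eta>"
  proof (rule tendsto_upperbound[OF tendsto_ip[OF rho_Rd(1)[OF K(1,2) d]]])
    show "eventually (\<lambda>r. ip d (cg d (par d K r)) n \<le> h - \<eta>) at_top"
      using eventually_ge_at_top[of R] by eventually_elim (rule R[rule_format])
  qed simp
  then show ?thesis unfolding True using \<eta> by linarith
qed

section \<open>John's theorem\<close>

text \<open>The plane computation behind John's theorem, along the axis e towards the far point
  \<tau> e. The hull of the unit ball and the far point is the union of the balls of radius 1 - l
  around l \<tau> e. The numbers y0 and s2 are the axial coordinate and the squared distance from
  the axis of a point of the ellipsoid with center \<alpha> e and half-axes 1 + \<alpha> along e and
  sqrt b2 across; it still touches the ball at -e.\<close>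

lemma ball_in_dilated_hull:
  fixes t \<tau> \<alpha> b2 s2 :: real
  assumes \<tau>: "1 < \<tau>" and \<alpha>: "0 < \<alpha>" and b2: "b2 = 1 - 2 * \<alpha> / (\<tau> - 1)" "0 \<le> b2"
    and t: "t\<^sup>2 \<le> 1" and s: "0 \<le> s2" "s2 \<le> b2 * (1 - t\<^sup>2)" and y: "y0 = \<alpha> + (1 + \<alpha>) * t" and \<alpha>\<tau>: "\<alpha> \<le> (\<tau> - 1) / 2"
  shows "\<exists>l. 0 \<le> l \<and> l \<le> 1 \<and> (y0 - l * \<tau>)\<^sup>2 + s2 \<le> (1 - l)\<^sup>2"
proof (cases "y0 * \<tau> \<le> 1")
  case True
  have t1: "- 1 \<le> t" "t \<le> 1" using t by (auto simp: abs_square_le_1 abs_le_iff)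
  \<comment> \<open>Up to height 1/\<tau>, where the tangent cone from the far point meets the ball,
    the hull is the ball itself; so l = 0.\<close>
  have "y0\<^sup>2 + b2 * (1 - t\<^sup>2) \<le> 1"
  proof -
    have key: "0 \<le> - \<alpha> - (2 + \<alpha>) * t + 2 * (1 - t) / (\<tau> - 1)"
    proof -
      have "(1 + \<alpha>) * t * \<tau> \<le> 1 - \<alpha> * \<tau>" using True by (simp add: y algebra_simps)
      then have 1: "t * (\<tau> * (1 + \<alpha>)) \<le> 1 - \<alpha> * \<tau>" by (simp add: algebra_simps)
      have 2: "(1 - \<alpha> * \<tau>) * (2 * \<tau> + \<alpha> * (\<tau> - 1)) \<le> (2 - \<alpha> * (\<tau> - 1)) * (\<tau> * (1 + \<alpha>))"
      proof -
        have "(2 - \<alpha> * (\<tau> - 1)) * (\<tau> * (1 + \<alpha>)) - (1 - \<alpha> * \<tau>) * (2 * \<tau> + \<alpha> * (\<tau> - 1)) = \<alpha> * (\<tau> + 1)\<^sup>2"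
          by (simp add: power2_eq_square algebra_simps)
        moreover have "0 \<le> \<alpha> * (\<tau> + 1)\<^sup>2" using \<alpha> by simp
        ultimately show ?thesis by linarith
      qed
      have p: "0 < 2 * \<tau> + \<alpha> * (\<tau> - 1)" using \<tau> \<alpha> by (intro add_pos_pos mult_pos_pos) auto
      have "(t * (2 * \<tau> + \<alpha> * (\<tau> - 1))) * (\<tau> * (1 + \<alpha>)) = (t * (\<tau> * (1 + \<alpha>))) * (2 * \<tau> + \<alpha> * (\<tau> - 1))" by (simp add: mult_ac)
      also have "\<dots> \<le> (1 - \<alpha> * \<tau>) * (2 * \<tau> + \<alpha> * (\<tau> - 1))" using 1 p by (intro mult_right_mono) auto
      also note 2
      finally have "t * (2 * \<tau> + \<alpha> * (\<tau> - 1)) \<le> 2 - \<alpha> * (\<tau> - 1)"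
        using \<tau> \<alpha> by (rule_tac mult_right_le_imp_le[of _ "\<tau> * (1 + \<alpha>)"]) auto
      then have "0 \<le> (- \<alpha> - (2 + \<alpha>) * t) * (\<tau> - 1) + 2 * (1 - t)" by (simp add: algebra_simps)
      then have "0 \<le> ((- \<alpha> - (2 + \<alpha>) * t) * (\<tau> - 1) + 2 * (1 - t)) / (\<tau> - 1)" using \<tau> by simp
      then show ?thesis using \<tau> by (simp add: add_divide_distrib)
    qed
    have "1 - (y0\<^sup>2 + b2 * (1 - t\<^sup>2)) = (1 + t) * \<alpha> * (- \<alpha> - (2 + \<alpha>) * t + 2 * (1 - t) / (\<tau> - 1))"
      using \<tau> unfolding y b2 by (simp add: power2_eq_square field_simps)
    moreover have "0 \<le> (1 + t) * \<alpha> * (- \<alpha> - (2 + \<alpha>) * t + 2 * (1 - t) / (\<tau> - 1))" using key t1 \<alpha> by simp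
    ultimately show ?thesis by linarith
  qed
  then show ?thesis using s by (intro exI[of _ 0]) auto
next
  case False
  \<comment> \<open>Minimizes the difference of the two sides, a quadratic in l with leading
    coefficient \<tau>^2 - 1; \<open>main\<close> is its discriminant condition. The value of b2
    makes the difference in \<open>main\<close> a perfect square: the ellipsoid touches the tangent
    cone.\<close>
  define l where "l = (y0 * \<tau> - 1) / (\<tau>\<^sup>2 - 1)"
  have t1: "- 1 \<le> t" "t \<le> 1" using t by (auto simp: abs_square_le_1 abs_le_iff)
  have tau2: "0 < \<tau>\<^sup>2 - 1" using \<tau> by (simp add: power2_eq_square) (metis less_1_mult)
  have "(1 + \<alpha>) * t \<le> (1 + \<alpha>) * 1" using t1 \<alpha> by (intro mult_left_mono) auto
  then have "y0 \<le> 1 + 2 * \<alpha>" by (simp add: y)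
  then have "y0 \<le> \<tau>" using \<alpha>\<tau> by simp
  then have "y0 * \<tau> \<le> \<tau>\<^sup>2" using \<tau> by (simp add: power2_eq_square)
  then have l: "0 \<le> l" "l \<le> 1" using False tau2 by (auto simp: l_def divide_le_eq)
  have ly: "l * (\<tau>\<^sup>2 - 1) = y0 * \<tau> - 1" using tau2 by (simp add: l_def)
  have main: "(y0\<^sup>2 + b2 * (1 - t\<^sup>2) - 1) * (\<tau>\<^sup>2 - 1) \<le> (y0 * \<tau> - 1)\<^sup>2"
  proof -
    have bb: "b2 * (\<tau> - 1) = \<tau> - 1 - 2 * \<alpha>" using \<tau> by (simp add: b2 field_simps)
    have "b2 * (\<tau>\<^sup>2 - 1) = (b2 * (\<tau> - 1)) * (\<tau> + 1)" by (simp add: power2_eq_square algebra_simps)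
    also have "\<dots> = (\<tau> - 1 - 2 * \<alpha>) * (\<tau> + 1)" by (simp only: bb)
    finally have bb2: "b2 * (\<tau>\<^sup>2 - 1) = (\<tau> - 1 - 2 * \<alpha>) * (\<tau> + 1)" .
    have "(y0 * \<tau> - 1)\<^sup>2 - (y0\<^sup>2 + b2 * (1 - t\<^sup>2) - 1) * (\<tau>\<^sup>2 - 1)
        = (y0 * \<tau> - 1)\<^sup>2 - (y0\<^sup>2 - 1) * (\<tau>\<^sup>2 - 1) - (b2 * (\<tau>\<^sup>2 - 1)) * (1 - t\<^sup>2)" by (simp add: algebra_simps)
    also have "\<dots> = ((\<tau> - \<alpha>) * t - (1 + \<alpha>))\<^sup>2"
      unfolding bb2 y by (simp add: power2_eq_square algebra_simps)
    finally show ?thesis using zero_le_power2[of "(\<tau> - \<alpha>) * t - (1 + \<alpha>)"] by linarith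
  qed
  have "((y0 - l * \<tau>)\<^sup>2 + s2 - (1 - l)\<^sup>2) * (\<tau>\<^sup>2 - 1) \<le> 0"
  proof -
    have "((y0 - l * \<tau>)\<^sup>2 + s2 - (1 - l)\<^sup>2) * (\<tau>\<^sup>2 - 1)
       = (l * (\<tau>\<^sup>2 - 1))\<^sup>2 - 2 * (l * (\<tau>\<^sup>2 - 1)) * (y0 * \<tau> - 1) + (y0\<^sup>2 + s2 - 1) * (\<tau>\<^sup>2 - 1)"
      by (simp add: power2_eq_square algebra_simps)
    also have "\<dots> = (y0\<^sup>2 + s2 - 1) * (\<tau>\<^sup>2 - 1) - (y0 * \<tau> - 1)\<^sup>2"
      unfolding ly by (simp add: power2_eq_square algebra_simps)
    also have "\<dots> \<le> (y0\<^sup>2 + b2 * (1 - t\<^sup>2) - 1) * (\<tau>\<^sup>2 - 1) - (y0 * \<tau> - 1)\<^sup>2"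
      using s tau2 by (intro diff_right_mono mult_right_mono) auto
    also have "\<dots> \<le> 0" using main by simp
    finally show ?thesis .
  qed
  then have "(y0 - l * \<tau>)\<^sup>2 + s2 \<le> (1 - l)\<^sup>2" using tau2 by (simp add: mult_le_0_iff)
  then show ?thesis using l by blast
qed

section \<open>Determinants of matrices given as functions\<close>

definition tmat :: "nat \<Rightarrow> (nat \<Rightarrow> nat \<Rightarrow> real) \<Rightarrow> real mat" where
  "tmat d M = mat d d (\<lambda>(i, j). M i j)"

text \<open>Volumes of ellipsoids up to sign and a constant. Multiplicativity and inverses come from
  the matrix type, continuity in the entries from the expansion over permutations.\<close>

definition mdet :: "nat \<Rightarrow> (nat \<Rightarrow> nat \<Rightarrow> real) \<Rightarrow> real" where
  "mdet d M = Determinant.det (tmat d M)"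

definition mmul :: "nat \<Rightarrow> (nat \<Rightarrow> nat \<Rightarrow> real) \<Rightarrow> (nat \<Rightarrow> nat \<Rightarrow> real) \<Rightarrow> nat \<Rightarrow> nat \<Rightarrow> real" where
  "mmul d M N = (\<lambda>i j. \<Sum>k<d. M i k * N k j)"

lemma tmat_carrier: "tmat d M \<in> carrier_mat d d"
  by (simp add: tmat_def)

lemma tmat_mmul: "tmat d (mmul d M N) = tmat d M * tmat d N"
  by (rule eq_matI) (auto simp: tmat_def mmul_def scalar_prod_def lessThan_atLeast0)

lemma mdet_mmul: "mdet d (mmul d M N) = mdet d M * mdet d N"
  unfolding mdet_def tmat_mmul by (rule Determinant.det_mult[OF tmat_carrier tmat_carrier])

lemma matapp_mmul: "matapp d (mmul d M N) x = matapp d M (matapp d N x)"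
proof (rule ext)
  fix i
  show "matapp d (mmul d M N) x i = matapp d M (matapp d N x) i"
  proof (cases "i < d")
    case True
    have "(\<Sum>j<d. (\<Sum>k<d. M i k * N k j) * x j) = (\<Sum>j<d. \<Sum>k<d. M i k * (N k j * x j))"
      by (simp add: sum_distrib_right mult.assoc)
    also have "\<dots> = (\<Sum>k<d. \<Sum>j<d. M i k * (N k j * x j))" by (rule sum.swap)
    also have "\<dots> = (\<Sum>k<d. M i k * (\<Sum>j<d. N k j * x j))" by (simp add: sum_distrib_left)
    finally show ?thesis using True by (simp add: matapp_def mmul_def)
  qed (simp add: matapp_def)
qed

lemma matapp_Rd: "matapp d A x \<in> Rd d"
  by (simp add: matapp_def Rd_def)

lemma matapp_add: "matapp d A (x + y) = matapp d A x + matapp d A y"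
  and matapp_diff: "matapp d A (x - y) = matapp d A x - matapp d A y"
  and matapp_smul: "matapp d A (smul c x) = smul c (matapp d A x)"
  by (auto simp: matapp_def fun_eq_iff sum.distrib sum_subtractf sum_distrib_left algebra_simps)

lemma mdet_nonzero_inverse:
  assumes "mdet d M \<noteq> 0"
  obtains N where "\<And>x. x \<in> Rd d \<Longrightarrow> matapp d N (matapp d M x) = x" "\<And>x. x \<in> Rd d \<Longrightarrow> matapp d M (matapp d N x) = x"
proof -
  obtain B where B: "B \<in> carrier_mat d d" "B * tmat d M = 1\<^sub>m d" "tmat d M * B = 1\<^sub>m d"
    using det_non_zero_imp_unit[OF tmat_carrier[of d M], where b="()"] assms
    unfolding mdet_def Units_def ring_mat_def by auto
  define N where "N = (\<lambda>i j. B $$ (i, j))"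
  have BN: "tmat d N = B" using B(1) by (intro eq_matI) (auto simp: tmat_def N_def)
  have id: "matapp d P x = x" if "tmat d P = 1\<^sub>m d" "x \<in> Rd d" for P x
  proof (rule ext)
    fix i
    show "matapp d P x i = x i"
    proof (cases "i < d")
      case True
      have "P i j = (if i = j then 1 else 0)" if "j < d" for j
      proof -
        have "tmat d P $$ (i, j) = 1\<^sub>m d $$ (i, j)" using \<open>tmat d P = 1\<^sub>m d\<close> by simp
        then show ?thesis using True that by (simp add: tmat_def)
      qed
      then have "(\<Sum>j<d. P i j * x j) = (\<Sum>j<d. if i = j then x j else 0)" by (intro sum.cong) auto
      then show ?thesis using True by (simp add: matapp_def)
    qed (use that in \<open>simp add: matapp_def Rd_def\<close>)
  qed
  show thesis
  proof (rule that[of N])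
    fix x assume x: "x \<in> Rd d"
    have "tmat d (mmul d N M) = 1\<^sub>m d" "tmat d (mmul d M N) = 1\<^sub>m d" unfolding tmat_mmul BN by (fact B)+
    then show "matapp d N (matapp d M x) = x" "matapp d M (matapp d N x) = x"
      using id[OF _ x] unfolding matapp_mmul[symmetric] by auto
  qed
qed

lemma mdet_diag: "mdet d (\<lambda>i j. if i = j then D i else 0) = (\<Prod>i<d. D i)"
proof -
  have "Determinant.det (tmat d (\<lambda>i j. if i = j then D i else 0)) = prod_list (diag_mat (tmat d (\<lambda>i j. if i = j then D i else 0)))"
    by (rule det_upper_triangular[OF _ tmat_carrier]) (auto simp: upper_triangular_def tmat_def)
  also have "\<dots> = (\<Prod>i<d. D i)"
    by (simp add: diag_mat_def tmat_def prod.distinct_set_conv_list[symmetric] lessThan_atLeast0 cong: map_cong)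
  finally show ?thesis by (simp add: mdet_def)
qed

lemma mdet_sum: "mdet d M = (\<Sum>p | p permutes {0..<d}. signof p * (\<Prod>i = 0..<d. M i (p i)))"
  unfolding mdet_def Determinant.det_def tmat_def
  by (auto intro!: sum.cong prod.cong simp: permutes_in_image)

text \<open>Householder reflections move any unit vector to the first coordinate axis.\<close>

lemma householder:
  assumes e: "e \<in> Rd d" "nrm d e = 1" and d: "0 < d"
  obtains Q where "matapp d Q (unitv 0) = e" "(mdet d Q)\<^sup>2 = 1" "\<And>x. x \<in> Rd d \<Longrightarrow> nrm d (matapp d Q x) = nrm d x"
proof (cases "e = unitv 0")
  case True
  define I where "I = (\<lambda>i j::nat. if i = j then 1 else 0 :: real)"
  have I: "matapp d I x = x" if "x \<in> Rd d" for x
  proof (rule ext)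
    fix i
    have "(\<Sum>j<d. I i j * x j) = (\<Sum>j<d. if i = j then x j else 0)" by (intro sum.cong) (auto simp: I_def)
    then show "matapp d I x i = x i" using that by (auto simp: matapp_def Rd_def)
  qed
  have "mdet d I = 1" unfolding I_def by (subst mdet_diag) simp
  then show ?thesis using I True e by (intro that[of I]) auto
next
  case False
  let ?u = "unitv 0"
  note u = unitv(1)[OF d] unitv(3)[OF d]
  define t where "t = nrm d (?u - e)"
  have "t \<noteq> 0" using False nrm_eq_0[of "?u - e" d] u e by (auto simp: t_def Rd_diff)
  then have t: "0 < t" using nrm_nonneg[of d "?u - e"] by (simp add: t_def less_le)
  define n where "n = smul (1 / t) (?u - e)"
  have n: "n \<in> Rd d" "nrm d n = 1" using u e t by (auto simp: n_def Rd_smul Rd_diff nrm_smul t_def)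
  have uu: "ip d ?u ?u = 1" "ip d e e = 1" using u e nrm_sq[of d ?u] nrm_sq[of d e] by auto
  have tt: "t * t = 2 - 2 * ip d ?u e"
    using nrm_sq[of d "?u - e"] by (simp add: t_def[symmetric] power2_eq_square ip_simps uu ip_commute[of d e ?u])
  define Q where "Q = (\<lambda>i j::nat. (if i = j then 1 else 0) - 2 * n i * n j)"
  have Q: "matapp d Q x = refl_hp d n 0 x" if x: "x \<in> Rd d" for x
  proof (rule ext)
    fix i
    show "matapp d Q x i = refl_hp d n 0 x i"
    proof (cases "i < d")
      case True
      have "(\<Sum>j<d. Q i j * x j) = (\<Sum>j<d. (if i = j then x j else 0) - 2 * n i * (x j * n j))"
        by (intro sum.cong) (auto simp: Q_def algebra_simps)
      also have "\<dots> = x i - 2 * n i * ip d x n" using True by (simp add: sum_subtractf ip_def sum_distrib_left)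
      finally show ?thesis using True by (simp add: matapp_def refl_hp_def)
    next
      case False
      then show ?thesis using x n by (simp add: matapp_def refl_hp_def Rd_def)
    qed
  qed
  have rn: "nrm d (refl_hp d n 0 x) = nrm d x" for x
  proof -
    have "(nrm d (refl_hp d n 0 x - 0))\<^sup>2 = (nrm d (x - 0))\<^sup>2"
      using refl_hp_dist[OF n, of 0 x 0] by (simp add: ip_simps)
    then show ?thesis by (simp add: power2_eq_iff_nonneg)
  qed
  have nn: "ip d n n = 1" using n nrm_sq[of d n] by simp
  show ?thesis
  proof (rule that[of Q])
    have "ip d ?u n = (1 - ip d ?u e) / t" using t by (simp add: n_def ip_simps uu)
    also have "1 - ip d ?u e = t * t / 2" using tt by simp
    finally have un: "2 * ip d ?u n = t" using t by simp
    have "refl_hp d n 0 ?u = e"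
    proof (rule ext)
      fix i
      have "refl_hp d n 0 ?u i = ?u i - (2 * ip d ?u n) * n i" by (simp add: refl_hp_def)
      also have "\<dots> = e i" unfolding un using t by (simp add: n_def)
      finally show "refl_hp d n 0 ?u i = e i" .
    qed
    then show "matapp d Q ?u = e" using Q[OF u(1)] by simp
    show "nrm d (matapp d Q x) = nrm d x" if "x \<in> Rd d" for x using Q[OF that] rn by simp
    \<comment> \<open>A reflection is an involution, so its determinant squares to 1. Ellipsoids are
      compared through squared determinants and the sign does not matter.\<close>
    have "tmat d (mmul d Q Q) = tmat d (\<lambda>i j. if i = j then 1 else 0)"
    proof (rule eq_matI)
      fix i j assume ij: "i < dim_row (tmat d (\<lambda>i j. if i = j then 1 else 0))" "j < dim_col (tmat d (\<lambda>i j. if i = j then 1 else 0))"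
      then have ij: "i < d" "j < d" by (auto simp: tmat_def)
      have "(\<Sum>k<d. Q i k * Q k j) = (\<Sum>k<d. (if i = k then (if k = j then 1 else 0) - 2 * n k * n j else 0) - (if k = j then 2 * n i * n k else 0) + 4 * n i * n j * (n k * n k))"
        by (intro sum.cong) (auto simp: Q_def algebra_simps)
      also have "\<dots> = (if i = j then 1 else 0) - 2 * n i * n j - 2 * n i * n j + 4 * n i * n j * ip d n n"
        using ij by (simp add: sum.distrib sum_subtractf ip_def sum_distrib_left)
      also have "\<dots> = (if i = j then 1 else 0)" by (simp add: nn)
      finally show "tmat d (mmul d Q Q) $$ (i, j) = tmat d (\<lambda>i j. if i = j then 1 else 0) $$ (i, j)"
        using ij by (simp add: tmat_def mmul_def)
    qed (auto simp: tmat_def)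
    then have "mdet d (mmul d Q Q) = mdet d (\<lambda>i j. if i = j then 1 else 0)" by (simp add: mdet_def)
    also have "\<dots> = 1" by (subst mdet_diag) simp
    finally show "(mdet d Q)\<^sup>2 = 1" by (simp add: mdet_mmul power2_eq_square)
  qed
qed

lemma continuous_on_mdet:
  fixes M :: "'a::topological_space \<Rightarrow> nat \<Rightarrow> nat \<Rightarrow> real"
  assumes "\<And>i j. continuous_on S (\<lambda>x. M x i j)"
  shows "continuous_on S (\<lambda>x. mdet d (M x))"
  unfolding mdet_sum by (intro continuous_on_sum continuous_on_mult continuous_on_const continuous_on_prod assms)

text \<open>Affine maps $x \mapsto c + Mx$ are encoded by single functions on pairs of indices, row 0 holding $c$, so
  that Tychonoff's theorem applies.\<close>

definition mpart :: "(nat \<times> nat \<Rightarrow> real) \<Rightarrow> nat \<Rightarrow> nat \<Rightarrow> real" where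
  "mpart f = (\<lambda>i j. f (Suc i, j))"

definition cpart :: "nat \<Rightarrow> (nat \<times> nat \<Rightarrow> real) \<Rightarrow> vec" where
  "cpart d f = (\<lambda>j. if j < d then f (0, j) else 0)"

text \<open>The admissible affine maps form a closed set, one closed condition for each point of the
  ball, inside a compact box. The inner ball of K is a competitor, so the maximum of the squared
  determinant is positive.\<close>

lemma max_ellipsoid:
  assumes K: "body d K" and c: "core d K c \<delta>" and d: "0 < d"
  obtains M m where "m \<in> Rd d" "\<And>b. b \<in> ballR d 1 \<Longrightarrow> m + matapp d M b \<in> K" "mdet d M \<noteq> 0"
    "\<And>M' m'. m' \<in> Rd d \<Longrightarrow> (\<And>b. b \<in> ballR d 1 \<Longrightarrow> m' + matapp d M' b \<in> K) \<Longrightarrow> (mdet d M')\<^sup>2 \<le> (mdet d M)\<^sup>2"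
proof -
  obtain R where R: "0 < R" "K \<subseteq> ballR d R" using body_bounded[OF K] .
  let ?Box = "PiE UNIV (\<lambda>_::nat \<times> nat. {- (2 * R)..2 * R})"
  define good where "good = (\<lambda>f. \<forall>b\<in>ballR d 1. cpart d f + matapp d (mpart f) b \<in> K)"
  define S where "S = ?Box \<inter> {f. good f}"
  have cc: "continuous_on UNIV (\<lambda>f::nat \<times> nat \<Rightarrow> real. f p)" for p
    by (rule continuous_on_product_coordinates)
  have cont: "continuous_on UNIV (\<lambda>f. cpart d f + matapp d (mpart f) b)" for b
  proof (rule continuous_on_vecI)
    fix i
    show "continuous_on UNIV (\<lambda>f. (cpart d f + matapp d (mpart f) b) i)"
      by (cases "i < d") (simp_all add: cpart_def matapp_def mpart_def, intro continuous_on_add continuous_on_sum continuous_on_mult cc continuous_on_const)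
  qed
  have "closed {f. good f}"
  proof -
    have "{f. good f} = (\<Inter>b\<in>ballR d 1. (\<lambda>f. cpart d f + matapp d (mpart f) b) -` K)" by (auto simp: good_def)
    also have "closed \<dots>"
      by (intro closed_INT ballI continuous_closed_vimage bodyD(5)[OF K]) (use cont in \<open>simp add: continuous_on_eq_continuous_at\<close>)
    finally show ?thesis .
  qed
  then have comp: "compact S" unfolding S_def by (intro compact_Int_closed compact_box_fun)
  \<comment> \<open>Entries that do not act on \<open>Rd d\<close> are set to 0, which keeps the
    code in the box without changing the map.\<close>
  define enc where "enc = (\<lambda>(m::vec) (M::nat \<Rightarrow> nat \<Rightarrow> real). \<lambda>(i, j). case i of 0 \<Rightarrow> if j < d then m j else 0 | Suc i' \<Rightarrow> if i' < d \<and> j < d then M i' j else 0)"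
  have enc: "cpart d (enc m M) = m" if "m \<in> Rd d" for m M
    using that by (auto simp: cpart_def enc_def Rd_def fun_eq_iff)
  have encM: "matapp d (mpart (enc m M)) b = matapp d M b" for m M b
    by (auto simp: matapp_def mpart_def enc_def fun_eq_iff)
  have encD: "mdet d (mpart (enc m M)) = mdet d M" for m M
  proof -
    have "tmat d (mpart (enc m M)) = tmat d M" by (rule eq_matI) (auto simp: tmat_def mpart_def enc_def)
    then show ?thesis by (simp add: mdet_def)
  qed
  have encS: "enc m M \<in> S" if m: "m \<in> Rd d" and b: "\<And>b. b \<in> ballR d 1 \<Longrightarrow> m + matapp d M b \<in> K" for m M
  proof -
    have "0 \<in> ballR d 1" by (simp add: ballR_iff Rd_0)
    then have "m + matapp d M 0 \<in> K" by (rule b)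
    moreover have "matapp d M 0 = 0" using matapp_smul[of d M 0 0] by (simp add: matapp_def fun_eq_iff)
    ultimately have mK: "m \<in> K" by simp
    have cb: "\<bar>x i\<bar> \<le> R" if "x \<in> K" "i < d" for x i
      using coord_le_nrm[OF that(2), of x] R that(1) by (auto simp: ballR_iff)
    \<comment> \<open>Column j is the difference of the images of a unit vector and of 0, both in K;
      hence 2 R.\<close>
    have Mb: "\<bar>M i j\<bar> \<le> 2 * R" if ij: "i < d" "j < d" for i j
    proof -
      have "unitv j \<in> ballR d 1" using unitv[OF ij(2)] by (simp add: ballR_iff)
      then have "m + matapp d M (unitv j) \<in> K" by (rule b)
      from cb[OF this ij(1)] have "\<bar>m i + matapp d M (unitv j) i\<bar> \<le> R" by simp
      moreover have "matapp d M (unitv j) i = M i j"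
      proof -
        have "matapp d M (unitv j) i = (\<Sum>k<d. if k = j then M i k else 0)"
        proof -
          have "(\<Sum>k<d. M i k * unitv j k) = (\<Sum>k<d. if k = j then M i k else 0)"
            by (intro sum.cong) (auto simp: unitv_def)
          then show ?thesis using ij by (simp add: matapp_def)
        qed
        then show ?thesis using ij by simp
      qed
      ultimately show ?thesis using cb[OF mK ij(1)] by (simp add: abs_le_iff)
    qed
    have "\<bar>enc m M p\<bar> \<le> 2 * R" for p
      using Mb cb[OF mK] R by (cases p) (auto simp: enc_def split: nat.splits intro: order_trans[of _ R])
    then have "enc m M \<in> ?Box" by (auto simp: abs_le_iff minus_le_iff)
    moreover have "good (enc m M)" using b by (simp add: good_def enc[OF m] encM)
    ultimately show ?thesis by (simp add: S_def)
  qed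
  define I where "I = (\<lambda>i j::nat. if i = j then \<delta> else 0)"
  have \<delta>: "0 < \<delta>" "c \<in> Rd d" using c by (auto simp: core_def)
  have Iapp: "matapp d I b = smul \<delta> b" if "b \<in> Rd d" for b
  proof (rule ext)
    fix i
    have "(\<Sum>j<d. I i j * b j) = (\<Sum>j<d. if i = j then \<delta> * b j else 0)" by (intro sum.cong) (auto simp: I_def)
    then show "matapp d I b i = smul \<delta> b i" using that by (auto simp: matapp_def Rd_def)
  qed
  have Igood: "c + matapp d I b \<in> K" if b: "b \<in> ballR d 1" for b
  proof -
    have "smul \<delta> b \<in> ballR d \<delta>" using b \<delta> by (auto simp: ballR_iff Rd_smul nrm_smul)
    then show ?thesis using c b Iapp[of b] by (auto simp: core_def ballR_iff)
  qed
  have IS: "enc c I \<in> S" by (rule encS[OF \<delta>(2) Igood])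
  have detc: "continuous_on S (\<lambda>f. (mdet d (mpart f))\<^sup>2)"
    by (intro continuous_on_power continuous_on_mdet) (simp add: mpart_def continuous_on_subset[OF cc])
  obtain f where f: "f \<in> S" "\<And>g. g \<in> S \<Longrightarrow> (mdet d (mpart g))\<^sup>2 \<le> (mdet d (mpart f))\<^sup>2"
    using continuous_attains_sup[OF comp _ detc] IS by blast
  have "0 < (mdet d I)\<^sup>2" using \<delta> unfolding I_def by (subst mdet_diag) simp
  also have "\<dots> \<le> (mdet d (mpart f))\<^sup>2" using f(2)[OF IS] by (simp add: encD)
  finally have nz: "mdet d (mpart f) \<noteq> 0" by auto
  show thesis
  proof (rule that[of "cpart d f" "mpart f"])
    show "cpart d f \<in> Rd d" by (simp add: cpart_def Rd_def)
    show "cpart d f + matapp d (mpart f) b \<in> K" if "b \<in> ballR d 1" for b using f(1) that by (simp add: S_def good_def)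
    show "(mdet d M')\<^sup>2 \<le> (mdet d (mpart f))\<^sup>2" if "m' \<in> Rd d" "\<And>b. b \<in> ballR d 1 \<Longrightarrow> m' + matapp d M' b \<in> K" for M' m'
      using f(2)[OF encS[OF that]] by (simp add: encD)
  qed (fact nz)
qed

text \<open>John's theorem: if the image of the body under the map that sends a maximal inscribed ellipsoid to the unit ball
  contained a point at distance $\tau > d$, the hull of this point and the ball would contain a larger ellipsoid, stretched by $1 + \alpha$ in
  the direction of the point and shrunk by the factor $b$ orthogonally to it.\<close>

theorem john_position:
  assumes K: "body d K" and c: "core d K c \<delta>" and d: "0 < d"
  obtains A q where "invertible_d d A" "q \<in> Rd d" "(\<lambda>b. q + b) ` ballR d 1 \<subseteq> matapp d A ` K"
    "matapp d A ` K \<subseteq> (\<lambda>b. q + b) ` ballR d (real d)"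
proof -
  obtain M m where m: "m \<in> Rd d" and MK: "\<And>b. b \<in> ballR d 1 \<Longrightarrow> m + matapp d M b \<in> K" and nz: "mdet d M \<noteq> 0"
    and mx: "\<And>M' m'. m' \<in> Rd d \<Longrightarrow> (\<And>b. b \<in> ballR d 1 \<Longrightarrow> m' + matapp d M' b \<in> K) \<Longrightarrow> (mdet d M')\<^sup>2 \<le> (mdet d M)\<^sup>2"
    using max_ellipsoid[OF K c d] by metis
  obtain A where A: "\<And>x. x \<in> Rd d \<Longrightarrow> matapp d A (matapp d M x) = x" "\<And>x. x \<in> Rd d \<Longrightarrow> matapp d M (matapp d A x) = x"
    using mdet_nonzero_inverse[OF nz] by metis
  have KR: "K \<subseteq> Rd d" using bodyD[OF K] by simp
  define q where "q = matapp d A m"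
  have inv: "invertible_d d A" unfolding invertible_d_def using A by blast
  have in1: "(\<lambda>b. q + b) ` ballR d 1 \<subseteq> matapp d A ` K"
  proof
    fix y assume "y \<in> (\<lambda>b. q + b) ` ballR d 1"
    then obtain b where b: "b \<in> ballR d 1" "y = q + b" by blast
    have "matapp d A (m + matapp d M b) = y" using A(1)[of b] b by (simp add: matapp_add q_def ballR_iff)
    then show "y \<in> matapp d A ` K" using MK[OF b(1)] by blast
  qed
  have in2: "matapp d A ` K \<subseteq> (\<lambda>b. q + b) ` ballR d (real d)"
  proof
    fix y assume "y \<in> matapp d A ` K"
    then obtain k where k: "k \<in> K" "y = matapp d A k" by blast
    define p where "p = y - q"
    have pR: "p \<in> Rd d" by (simp add: p_def k q_def Rd_diff matapp_Rd)
    have kp: "m + matapp d M p = k"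
      using A(2)[of k] A(2)[OF m] k KR by (auto simp: p_def q_def matapp_diff)
    have "nrm d p \<le> real d"
    proof (rule ccontr)
      assume "\<not> nrm d p \<le> real d"
      define \<tau> where "\<tau> = nrm d p"
      have \<tau>: "real d < \<tau>" "1 < \<tau>" using \<open>\<not> nrm d p \<le> real d\<close> d by (auto simp: \<tau>_def)
      define e where "e = smul (1 / \<tau>) p"
      have e: "e \<in> Rd d" "nrm d e = 1" using pR \<tau> by (auto simp: e_def Rd_smul nrm_smul \<tau>_def)
      have pe: "p = smul \<tau> e" using \<tau> by (auto simp: e_def fun_eq_iff)
      obtain Q where Q: "matapp d Q (unitv 0) = e" "(mdet d Q)\<^sup>2 = 1" "\<And>x. x \<in> Rd d \<Longrightarrow> nrm d (matapp d Q x) = nrm d x"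
        using householder[OF e d] by metis
      \<comment> \<open>To first order in \<alpha> the squared determinant gains 2\<alpha> from the
        stretched axis and loses 2\<alpha>/(\<tau> - 1) from each of the d - 1 others. The balance
        2\<alpha>(1 - \<theta>) is positive precisely because \<tau> > d.\<close>
      define \<theta> where "\<theta> = (real d - 1) / (\<tau> - 1)"
      have \<theta>: "0 \<le> \<theta>" "\<theta> < 1" using \<tau> d by (auto simp: \<theta>_def)
      \<comment> \<open>The first bound keeps b2 nonnegative and the ellipsoid short of the far
        point; the second makes the term of second order in the determinant harmless.\<close>
      define \<alpha> where "\<alpha> = min ((\<tau> - 1) / 2) ((1 - \<theta>) / 4)"
      have \<alpha>: "0 < \<alpha>" "\<alpha> \<le> (\<tau> - 1) / 2" "4 * \<alpha> \<le> 1 - \<theta>"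
      proof -
        show "0 < \<alpha>" using \<tau> \<theta> by (auto simp: \<alpha>_def)
        show "\<alpha> \<le> (\<tau> - 1) / 2" unfolding \<alpha>_def by (rule min.cobounded1)
        have "\<alpha> \<le> (1 - \<theta>) / 4" unfolding \<alpha>_def by (rule min.cobounded2)
        then show "4 * \<alpha> \<le> 1 - \<theta>" by simp
      qed
      define b2 where "b2 = 1 - 2 * \<alpha> / (\<tau> - 1)"
      have b2: "0 \<le> b2" using \<alpha> \<tau> by (simp add: b2_def divide_le_eq)
      define D where "D = (\<lambda>i::nat. if i = 0 then 1 + \<alpha> else sqrt b2)"
      define E where "E = (\<lambda>i j. if i = j then D i else 0)"
      have Eapp: "matapp d E x i = (if i < d then D i * x i else 0)" for x i
      proof -
        have "(\<Sum>j<d. E i j * x j) = (\<Sum>j<d. if i = j then D i * x j else 0)" by (intro sum.cong) (auto simp: E_def)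
        then show ?thesis by (simp add: matapp_def)
      qed
      have split0: "ip d x x = (x 0)\<^sup>2 + (\<Sum>i\<in>{1..<d}. (x i)\<^sup>2)" for x
      proof -
        have "{..<d} = insert 0 {1..<d}" using d by auto
        then show ?thesis by (simp add: ip_def power2_eq_square)
      qed
      \<comment> \<open>Stretch along the first axis, turn this axis to e, then apply M. The center
        moves by \<alpha> e, which yields the ellipsoid of
        \<open>ball_in_dilated_hull\<close>.\<close>
      define M' where "M' = mmul d M (mmul d Q E)"
      define m' where "m' = m + matapp d M (smul \<alpha> e)"
      have m'R: "m' \<in> Rd d" by (simp add: m'_def Rd_add m matapp_Rd)
      have "m' + matapp d M' x \<in> K" if x: "x \<in> ballR d 1" for x
      proof -
        have x1: "ip d x x \<le> 1" using x nrm_le_ip[of d x 1] by (auto simp: ballR_iff)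
        define z where "z = smul \<alpha> (unitv 0) + matapp d E x"
        have zR: "z \<in> Rd d" using unitv(1)[OF d] by (simp add: z_def Rd_add Rd_smul matapp_Rd)
        have z0: "z 0 = \<alpha> + (1 + \<alpha>) * x 0" using d by (simp add: z_def Eapp D_def unitv_def)
        have zi: "z i = sqrt b2 * x i" if "i \<in> {1..<d}" for i using that by (simp add: z_def Eapp D_def unitv_def)
        define s2 where "s2 = (\<Sum>i\<in>{1..<d}. (z i)\<^sup>2)"
        have s2: "0 \<le> s2" "s2 \<le> b2 * (1 - (x 0)\<^sup>2)"
        proof -
          show "0 \<le> s2" by (simp add: s2_def sum_nonneg)
          have "s2 = b2 * (\<Sum>i\<in>{1..<d}. (x i)\<^sup>2)"
            unfolding s2_def sum_distrib_left using b2 by (intro sum.cong) (auto simp: zi power_mult_distrib)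
          also have "\<dots> \<le> b2 * (1 - (x 0)\<^sup>2)" using split0[of x] x1 b2 by (intro mult_left_mono) auto
          finally show "s2 \<le> b2 * (1 - (x 0)\<^sup>2)" .
        qed
        have "(x 0)\<^sup>2 \<le> 1" using split0[of x] x1 sum_nonneg[of "{1..<d}" "\<lambda>i. (x i)\<^sup>2"] by simp
        then obtain l where l: "0 \<le> l" "l \<le> 1" "(z 0 - l * \<tau>)\<^sup>2 + s2 \<le> (1 - l)\<^sup>2"
          using ball_in_dilated_hull[OF \<tau>(2) \<alpha>(1) b2_def b2 _ s2 z0 \<alpha>(2)] by blast
        define w where "w = z - smul (l * \<tau>) (unitv 0)"
        have wR: "w \<in> Rd d" using zR unitv(1)[OF d] by (simp add: w_def Rd_diff Rd_smul)
        have "ip d w w = (z 0 - l * \<tau>)\<^sup>2 + s2"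
        proof -
          have "(\<Sum>i\<in>{1..<d}. (w i)\<^sup>2) = s2" unfolding s2_def by (intro sum.cong) (auto simp: w_def unitv_def)
          then show ?thesis using split0[of w] by (simp add: w_def unitv_def)
        qed
        then have wn: "nrm d w \<le> 1 - l" using l by (simp add: nrm_le_ip)
        have zw: "z = smul (l * \<tau>) (unitv 0) + w" by (simp add: w_def)
        define Qw where "Qw = matapp d Q w"
        have Qw: "Qw \<in> Rd d" "nrm d Qw \<le> 1 - l" using wn Q(3)[OF wR] by (simp_all add: Qw_def matapp_Rd)
        have "matapp d Q z = smul (l * \<tau>) e + Qw" unfolding zw by (simp add: matapp_add matapp_smul Q(1) Qw_def)
        moreover have "matapp d Q z = smul \<alpha> e + matapp d (mmul d Q E) x"
          by (simp add: z_def matapp_add matapp_smul Q(1) matapp_mmul)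
        ultimately have eq: "smul \<alpha> e + matapp d (mmul d Q E) x = smul l p + Qw"
          unfolding pe by (auto simp: fun_eq_iff mult.assoc)
        have "m' + matapp d M' x = m + matapp d M (smul \<alpha> e + matapp d (mmul d Q E) x)"
          by (simp add: m'_def M'_def matapp_add matapp_mmul add.assoc)
        also have "\<dots> = m + matapp d M (smul l p + Qw)" by (simp only: eq)
        finally have tot: "m' + matapp d M' x = m + matapp d M (smul l p + Qw)" .
        \<comment> \<open>For l = 1 the ball has shrunk to the far point, whose preimage is k.
          Otherwise rescaling by 1 - l exhibits a convex combination of k and a point of the
          ellipsoid.\<close>
        show ?thesis
        proof (cases "l = 1")
          case True
          have "nrm d Qw = 0" using Qw True nrm_nonneg[of d Qw] by simp
          then have "Qw = 0" using nrm_eq_0[OF Qw(1)] by simp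
          then have "smul l p + Qw = p" using True by (auto simp: fun_eq_iff)
          then show ?thesis unfolding tot using kp k by simp
        next
          case False
          then have l1: "0 < 1 - l" using l by simp
          define v where "v = smul (1 / (1 - l)) Qw"
          have v: "v \<in> ballR d 1" using Qw l1 by (simp add: v_def ballR_iff Rd_smul nrm_smul)
          have "Qw = smul (1 - l) v" using l1 by (auto simp: v_def fun_eq_iff)
          then have "m + matapp d M (smul l p + Qw) = m + (smul l (matapp d M p) + smul (1 - l) (matapp d M v))"
            by (simp only: matapp_add matapp_smul)
          also have "\<dots> = smul (1 - l) (m + matapp d M v) + smul l (m + matapp d M p)"
            by (auto simp: fun_eq_iff algebra_simps)
          also have "\<dots> \<in> K" unfolding kp using cvxD[OF bodyD(3)[OF K] MK[OF v] k(1)] l by simp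
          finally show ?thesis unfolding tot .
        qed
      qed
      then have "(mdet d M')\<^sup>2 \<le> (mdet d M)\<^sup>2" by (rule mx[OF m'R])
      moreover have "(mdet d M')\<^sup>2 = (mdet d M)\<^sup>2 * (mdet d E)\<^sup>2"
        by (simp add: M'_def mdet_mmul power_mult_distrib Q(2))
      moreover have "(mdet d E)\<^sup>2 = (1 + \<alpha>)\<^sup>2 * b2 ^ (d - 1)"
      proof -
        have "mdet d E = (\<Prod>i<d. D i)" unfolding E_def by (rule mdet_diag)
        also have "{..<d} = insert 0 {1..<d}" using d by auto
        also have "(\<Prod>i\<in>insert 0 {1..<d}. D i) = (1 + \<alpha>) * (\<Prod>i\<in>{1..<d}. sqrt b2)" by (simp add: D_def)
        finally have "mdet d E = (1 + \<alpha>) * sqrt b2 ^ (d - 1)" by simp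
        then show ?thesis using b2 by (simp add: power_mult_distrib power_mult[symmetric] mult.commute[of _ 2]) (simp add: power_mult)
      qed
      moreover have "1 < (1 + \<alpha>)\<^sup>2 * b2 ^ (d - 1)"
      proof -
        have "1 + real (d - 1) * (- (2 * \<alpha> / (\<tau> - 1))) \<le> (1 + - (2 * \<alpha> / (\<tau> - 1))) ^ (d - 1)"
          by (rule Bernoulli_inequality) (use \<alpha> \<tau> in \<open>simp add: divide_le_eq\<close>)
        moreover have "real (d - 1) * (- (2 * \<alpha> / (\<tau> - 1))) = - (2 * \<alpha> * \<theta>)" using d by (simp add: \<theta>_def of_nat_diff)
        ultimately have "1 - 2 * \<alpha> * \<theta> \<le> b2 ^ (d - 1)" by (simp add: b2_def)
        then have "(1 + \<alpha>)\<^sup>2 * (1 - 2 * \<alpha> * \<theta>) \<le> (1 + \<alpha>)\<^sup>2 * b2 ^ (d - 1)" by (intro mult_left_mono) auto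
        moreover have "1 < (1 + \<alpha>)\<^sup>2 * (1 - 2 * \<alpha> * \<theta>)"
        proof -
          have a1: "2 * \<alpha> * \<theta> \<le> 2 * \<alpha>" using \<theta> \<alpha> by (simp add: mult_left_le)
          have "2 * \<alpha> \<le> 1 / 2" using \<alpha> \<theta> by linarith
          then have nn: "0 \<le> 1 - 2 * \<alpha> * \<theta>" using a1 by linarith
          have "(1 + 2 * \<alpha>) * (1 - 2 * \<alpha> * \<theta>) \<le> (1 + \<alpha>)\<^sup>2 * (1 - 2 * \<alpha> * \<theta>)"
            using nn by (intro mult_right_mono) (auto simp: power2_eq_square algebra_simps)
          moreover have "(1 + 2 * \<alpha>) * (1 - 2 * \<alpha> * \<theta>) = 1 + 2 * \<alpha> * ((1 - \<theta>) - 2 * \<alpha> * \<theta>)" by (simp add: algebra_simps)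
          moreover have "0 < 2 * \<alpha> * ((1 - \<theta>) - 2 * \<alpha> * \<theta>)"
          proof -
            have "0 < (1 - \<theta>) - 2 * \<alpha> * \<theta>" using a1 \<alpha> by linarith
            then show ?thesis using \<alpha> by simp
          qed
          ultimately show ?thesis by linarith
        qed
        ultimately show ?thesis by linarith
      qed
      ultimately have "(mdet d M)\<^sup>2 * ((1 + \<alpha>)\<^sup>2 * b2 ^ (d - 1)) \<le> (mdet d M)\<^sup>2 * 1" by simp
      moreover have "0 < (mdet d M)\<^sup>2" using nz by simp
      ultimately have "(1 + \<alpha>)\<^sup>2 * b2 ^ (d - 1) \<le> 1" by (simp only: mult_le_cancel_left_pos)
      then show False using \<open>1 < (1 + \<alpha>)\<^sup>2 * b2 ^ (d - 1)\<close> by simp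
    qed
    then have "p \<in> ballR d (real d)" using pR by (simp add: ballR_iff)
    moreover have "y = q + p" by (simp add: p_def)
    ultimately show "y \<in> (\<lambda>b. q + b) ` ballR d (real d)" by blast
  qed
  show thesis by (rule that[OF inv _ in1 in2]) (simp add: q_def matapp_Rd)
qed

section \<open>The discretization of the curvature path\<close>

text \<open>The theorem constrains \<open>disc\<close> only where a discretization exists; this
  makes the constraint effective for every knowledge set that occurs.\<close>

lemma discretization_exists:
  assumes K: "body d K" "core d K c \<delta>" "0 < d" and k: "0 < k"
  shows "\<exists>ps. is_discretization d k K ps"
proof -
  obtain A q where A: "invertible_d d A" "q \<in> Rd d" "(\<lambda>b. q + b) ` ballR d 1 \<subseteq> matapp d A ` K"
    "matapp d A ` K \<subseteq> (\<lambda>b. q + b) ` ballR d (real d)"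
    using john_position[OF K] by metis
  let ?\<gamma> = "matapp d A \<circ> rho d K"
  have "plen d ?\<gamma> 0 \<infinity> < \<infinity>"
    using path_length_bound[OF K A(4)] by (rule order_le_less_trans) simp
  from equal_partition[OF this path_continuous[OF K] k]
  obtain r :: "nat \<Rightarrow> ereal" where r: "r 0 = 0" "r k = \<infinity>" "\<And>j. j < k \<Longrightarrow> r j \<le> r (Suc j)"
    "\<And>j. j < k \<Longrightarrow> plen d ?\<gamma> (r j) (r (Suc j)) = plen d ?\<gamma> 0 \<infinity> / ereal (real k)"
    by blast
  have r0: "0 \<le> r j" if "j \<le> k" for j
    using that
  proof (induction j)
    case (Suc j)
    then show ?case using r(3)[of j] by (auto intro: order_trans)
  qed (simp add: r(1))
  define ps where "ps = map (\<lambda>j. rho d K (r j)) [0..<Suc k]"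
  have len: "length ps = Suc k" by (simp add: ps_def)
  have nth: "ps ! j = rho d K (r j)" if "j \<le> k" for j
    using that unfolding ps_def by (subst nth_map) (auto simp del: upt_Suc)
  have "set ps \<subseteq> Rd d"
    unfolding ps_def using r0 rho_Rd(2)[OF K] by (auto simp del: upt_Suc)
  then have "is_discretization d k K ps"
    unfolding is_discretization_def using len A r nth by (intro conjI exI[of _ A] exI[of _ q] exI[of _ r]) auto
  then show ?thesis ..
qed

lemma covering_index:
  fixes r :: "nat \<Rightarrow> ereal"
  assumes "r 0 = 0" "r k = \<infinity>" "0 < k" "0 \<le> t"
  shows "\<exists>j<k. r j \<le> t \<and> t \<le> r (Suc j)"
proof (rule ccontr)
  assume "\<not> ?thesis"
  then have *: "r j \<le> t \<Longrightarrow> t > r (Suc j)" if "j < k" for j using that by (metis not_le)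
  have "j < k \<Longrightarrow> r (Suc j) < t" for j
  proof (induction j)
    case 0 then show ?case using *[of 0] assms by simp
  next
    case (Suc j)
    then show ?case using *[of "Suc j"] by simp
  qed
  from this[of "k - 1"] show False using assms by simp
qed

text \<open>The listed points are given through their images; injectivity of A on
  \<open>Rd d\<close> identifies them with path points. In the second claim, half the length bound
  of a piece is multiplied by the width of K in direction u, so the estimate no longer refers to
  A.\<close>

lemma discretization_points:
  assumes K: "body d K" "core d K c \<delta>" "0 < d" and k: "0 < k" and D: "is_discretization d k K ps"
  shows "p \<in> set ps \<Longrightarrow> \<exists>t\<ge>0. p = rho d K t"
    and "0 \<le> t \<Longrightarrow> u \<in> Rd d \<Longrightarrow> nrm d u = 1 \<Longrightarrow> (\<And>x y. x \<in> K \<Longrightarrow> y \<in> K \<Longrightarrow> ip d x u - ip d y u \<le> W) \<Longrightarrow>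
      \<exists>p\<in>set ps. \<bar>ip d (rho d K t) u - ip d p u\<bar> \<le> (real d ^ 2 * (real d + 1) / real k) * W"
proof -
  obtain A q r where len: "length ps = Suc k" "set ps \<subseteq> Rd d"
    and A: "invertible_d d A" "q \<in> Rd d" "(\<lambda>b. q + b) ` ballR d 1 \<subseteq> matapp d A ` K"
    "matapp d A ` K \<subseteq> (\<lambda>b. q + b) ` ballR d (real d)"
    and r: "r 0 = 0" "r k = \<infinity>" "\<forall>j<k. r j \<le> r (Suc j)"
    "\<forall>j<k. plen d (matapp d A \<circ> rho d K) (r j) (r (Suc j)) = plen d (matapp d A \<circ> rho d K) 0 \<infinity> / ereal (real k)"
    "\<forall>j\<le>k. matapp d A (ps ! j) = matapp d A (rho d K (r j))"
    using D unfolding is_discretization_def by metis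
  obtain N where N: "\<And>x. x \<in> Rd d \<Longrightarrow> matapp d N (matapp d A x) = x" using A(1) unfolding invertible_d_def by metis
  let ?\<gamma> = "matapp d A \<circ> rho d K"
  have r0: "0 \<le> r j" if "j \<le> k" for j
    using that
  proof (induction j)
    case (Suc j)
    then show ?case using r(3) by (auto intro: order_trans)
  qed (simp add: r(1))
  have psj: "ps ! j = rho d K (r j)" if "j \<le> k" for j
  proof -
    have "ps ! j \<in> Rd d" using len that by (auto intro: nth_mem)
    moreover have "rho d K (r j) \<in> Rd d" by (rule rho_Rd(2)[OF K r0[OF that]])
    ultimately show ?thesis using N r(5) that by metis
  qed
  show "\<exists>t\<ge>0. p = rho d K t" if "p \<in> set ps"
  proof -
    from that have "\<exists>j<length ps. ps ! j = p" by (simp only: in_set_conv_nth)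
    then obtain j where j': "j < length ps" "ps ! j = p" by (elim exE conjE)
    have j: "p = ps ! j" using j'(2) by (rule sym)
    have jk: "j \<le> k" using j'(1) len(1) by linarith
    show ?thesis
      unfolding j psj[OF jk] by (intro exI[of _ "r j"] conjI r0[OF jk] refl)
  qed
  show "\<exists>p\<in>set ps. \<bar>ip d (rho d K t) u - ip d p u\<bar> \<le> (real d ^ 2 * (real d + 1) / real k) * W"
    if t: "0 \<le> t" and u: "u \<in> Rd d" "nrm d u = 1" and W: "\<And>x y. x \<in> K \<Longrightarrow> y \<in> K \<Longrightarrow> ip d x u - ip d y u \<le> W"
  proof -
    obtain j where j: "j < k" "r j \<le> t" "t \<le> r (Suc j)" using covering_index[OF r(1,2) k t] by blast
    have "ereal (nrm d (?\<gamma> t - ?\<gamma> (r j))) \<le> plen d ?\<gamma> (r j) (r (Suc j))"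
      by (rule nrm_le_plen) (use j in auto)
    also have "\<dots> = plen d ?\<gamma> 0 \<infinity> / ereal (real k)" using r(4) j by blast
    also have "\<dots> \<le> ereal (2 * real d ^ 2 * (real d + 1)) / ereal (real k)"
      by (rule ereal_divide_right_mono[OF path_length_bound[OF K A(4)]]) (use k in simp)
    finally have "nrm d (?\<gamma> t - ?\<gamma> (r j)) \<le> 2 * real d ^ 2 * (real d + 1) / real k" using k by simp
    then have nv: "nrm d (matapp d A (rho d K t) - matapp d A (ps ! j)) \<le> 2 * real d ^ 2 * (real d + 1) / real k"
      using psj[of j] j by simp
    let ?x = "rho d K t" and ?p = "ps ! j"
    have pin: "?p \<in> set ps" using j len by simp
    have xR: "?x \<in> Rd d" "?p \<in> Rd d" using rho_Rd(2)[OF K t] pin len by auto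
    define v where "v = matapp d A (?x - ?p)"
    have vR: "v \<in> Rd d" by (simp add: v_def matapp_Rd)
    have v: "nrm d v \<le> 2 * real d ^ 2 * (real d + 1) / real k" using nv by (simp add: v_def matapp_diff)
    have W0: "0 \<le> W" using W[OF core_center[OF K(2)] core_center[OF K(2)]] by simp
    \<comment> \<open>The image of K contains q + b and q - b with b the unit vector along v. Their
      preimages in K differ by 2/|v| times ?x - ?p, and the functional varies by at most W over
      K.\<close>
    have main: "2 * \<bar>ip d (?x - ?p) u\<bar> \<le> nrm d v * W"
    proof (cases "nrm d v = 0")
      case True
      then have "v = 0" using nrm_eq_0[OF vR] by simp
      then have "matapp d N v = 0" by (simp add: matapp_def fun_eq_iff)
      then have "?x - ?p = 0" using N[OF Rd_diff[OF xR]] by (simp add: v_def)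
      then have "ip d (?x - ?p) u = 0" by (simp only: ip_0_left)
      then show ?thesis using True by simp
    next
      case False
      then have vp: "0 < nrm d v" using nrm_nonneg[of d v] by (simp add: less_le)
      define b where "b = smul (1 / nrm d v) v"
      have b: "b \<in> ballR d 1" "- b \<in> ballR d 1" using vR vp by (auto simp: b_def ballR_iff Rd_smul Rd_uminus nrm_smul)
      have "q + b \<in> (\<lambda>b. q + b) ` ballR d 1" "q + - b \<in> (\<lambda>b. q + b) ` ballR d 1" using b by blast+
      then obtain y y' where y: "y \<in> K" "matapp d A y = q + b" "y' \<in> K" "matapp d A y' = q + - b" using A(3) by (metis (no_types, lifting) imageE subsetD)
      have yR: "y \<in> Rd d" "y' \<in> Rd d" using y bodyD(1)[OF K(1)] by auto
      have "matapp d A (y - y') = smul (2 / nrm d v) v" by (auto simp: matapp_diff y b_def fun_eq_iff)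
      also have "\<dots> = matapp d A (smul (2 / nrm d v) (?x - ?p))" by (simp add: v_def matapp_smul)
      finally have "y - y' = smul (2 / nrm d v) (?x - ?p)"
        using N[OF Rd_diff[OF yR]] N[OF Rd_smul[OF Rd_diff[OF xR]]] by metis
      then have "ip d (y - y') u = 2 / nrm d v * ip d (?x - ?p) u" by (simp add: ip_smul_left)
      moreover have "\<bar>ip d (y - y') u\<bar> \<le> W" using W[OF y(1,3)] W[OF y(3,1)] by (auto simp: ip_simps abs_le_iff)
      ultimately have "2 / nrm d v * \<bar>ip d (?x - ?p) u\<bar> \<le> W" using vp by (simp add: abs_mult)
      then show ?thesis using vp by (simp add: field_simps)
    qed
    have "nrm d v * W \<le> (2 * real d ^ 2 * (real d + 1) / real k) * W" using v W0 by (rule mult_right_mono)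
    with main have "\<bar>ip d (?x - ?p) u\<bar> \<le> (real d ^ 2 * (real d + 1) / real k) * W" by simp
    then show ?thesis using pin by (intro bexI[of _ ?p]) (auto simp: ip_diff_left)
  qed
qed

section \<open>Halfspace cuts of the knowledge set\<close>

definition cut :: "nat \<Rightarrow> vec set \<Rightarrow> vec \<Rightarrow> vec \<Rightarrow> vec set" where
  "cut d K p v = K \<inter> {w. 0 \<le> ip d (w - p) v}"

lemma body_cut: "body d K \<Longrightarrow> body d (cut d K p v)"
proof -
  assume K: "body d K"
  have "cut d K p v = K \<inter> {x. ip d x (- v) \<le> - ip d p v}" by (auto simp: cut_def ip_simps)
  then show ?thesis using body_halfspace[OF K] by simp
qed

text \<open>Some y in K lies strictly beyond the hyperplane through p, since p is strictly inside.
  The inner ball, contracted towards y, passes the hyperplane too.\<close>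

lemma core_cut:
  assumes K: "body d K" "core d K c \<delta>" "0 < d" and v: "v \<in> Rd d" "nrm d v = 1" and t: "0 \<le> t" and p: "p = rho d K t"
  shows "\<exists>c' \<delta>'. core d (cut d K p v) c' \<delta>'"
proof -
  have \<delta>: "0 < \<delta>" "c \<in> Rd d" using K by (auto simp: core_def)
  have "\<exists>y\<in>K. ip d p v < ip d y v"
  proof (rule ccontr)
    assume "\<not> ?thesis"
    then have "\<And>y. y \<in> K \<Longrightarrow> ip d y v \<le> ip d p v" by (meson not_le)
    from rho_strict[OF v K(1,2) this K(3) t] show False by (simp add: p)
  qed
  then obtain y where y: "y \<in> K" "ip d p v < ip d y v" by blast
  have yR: "y \<in> Rd d" using y bodyD(1)[OF K(1)] by auto
  define g where "g = ip d y v - ip d p v"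
  \<comment> \<open>Bounds the change of the functional from y to any point of the inner ball; the
    fraction l of the way changes it by at most l M, which stays within the margin g.\<close>
  define M where "M = \<bar>ip d (c - y) v\<bar> + \<delta> + 1"
  have M: "0 < M" "\<bar>ip d (c - y) v\<bar> + \<delta> \<le> M" using \<delta> by (auto simp: M_def)
  define l where "l = min 1 (g / M)"
  have g: "0 < g" using y by (simp add: g_def)
  have l: "0 < l" "l \<le> 1" using g M by (auto simp: l_def)
  have lM: "l * M \<le> g"
  proof -
    have "l \<le> g / M" unfolding l_def by (rule min.cobounded2)
    then show ?thesis using M by (simp add: field_simps)
  qed
  define c' where "c' = smul (1 - l) y + smul l c"
  have "c' + b \<in> cut d K p v" if b: "b \<in> ballR d (l * \<delta>)" for b
  proof -
    define b' where "b' = smul (1 / l) b"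
    have "nrm d b' \<le> \<delta>" using b l by (simp add: b'_def nrm_smul ballR_iff field_simps)
    then have b': "b' \<in> ballR d \<delta>" using b by (simp add: b'_def ballR_iff Rd_smul)
    have bb: "b = smul l b'" using l by (auto simp: b'_def fun_eq_iff)
    have eq: "c' + b = smul (1 - l) y + smul l (c + b')" by (auto simp: c'_def bb fun_eq_iff algebra_simps)
    have "c + b' \<in> K" using K(2) b' by (simp add: core_def)
    then have inK: "c' + b \<in> K" unfolding eq using y l bodyD[OF K(1)] by (intro cvxD) auto
    have bv: "\<bar>ip d b' v\<bar> \<le> \<delta>" using ip_le_nrm[of d b' v] b' v by (simp add: ballR_iff)
    have "ip d (c' + b) v = ip d y v + l * (ip d (c - y) v + ip d b' v)" unfolding eq by (simp add: ip_simps algebra_simps)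
    moreover have "- (l * M) \<le> l * (ip d (c - y) v + ip d b' v)"
    proof -
      have "l * (- M) \<le> l * (ip d (c - y) v + ip d b' v)" using bv M l by (intro mult_left_mono) auto
      then show ?thesis by simp
    qed
    ultimately have "ip d p v \<le> ip d (c' + b) v" using lM by (simp add: g_def)
    then show ?thesis using inK by (simp add: cut_def ip_simps)
  qed
  moreover have "c' \<in> Rd d" using yR \<delta> by (simp add: c'_def Rd_add Rd_smul)
  ultimately have "core d (cut d K p v) c' (l * \<delta>)" using l \<delta> by (simp add: core_def)
  then show ?thesis by blast
qed

lemma knowledge_append: "knowledge d (h @ [(p, v)]) = cut d (knowledge d h) p v"
  by (auto simp: knowledge_def cut_def)

section \<open>The potential\<close>

text \<open>The scale of the $i$-th term of the potential: rounds in which the knowledge set has width about $2^{-i}$ in the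
  chosen direction decrease this term.\<close>

definition scale :: "nat \<Rightarrow> nat \<Rightarrow> real" where
  "scale d i = (1/2) ^ i / (80 * real d)"

text \<open>Division by the volume of the ball makes every term nonnegative. Truncation at n leaves
  widths up to 2 (1/2)^n unpaid.\<close>

definition pot :: "nat \<Rightarrow> nat \<Rightarrow> vec set \<Rightarrow> real" where
  "pot d n K = (\<Sum>i<n. (1/2) ^ i * ln (measure (rdm d) (par d K (scale d i)) / measure (rdm d) (ballR d (scale d i))))"

lemma scale_pos: "0 < d \<Longrightarrow> 0 < scale d i"
  by (simp add: scale_def)

lemma par_measure_mono:
  assumes "body d K" "body d K'" "K' \<subseteq> K"
  shows "measure (rdm d) (par d K' r) \<le> measure (rdm d) (par d K r)"
  by (rule measure_mono_fmeasurable[OF par_mono[OF assms(3) order_refl]])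
    (use bodyD(4)[OF body_par[OF assms(2)]] body_fmeasurable[OF body_par[OF assms(1)]] in auto)

lemma ball_measure_le_par:
  assumes "body d K" "c \<in> K" "0 < r"
  shows "measure (rdm d) (ballR d r) \<le> measure (rdm d) (par d K r)"
proof -
  have cR: "c \<in> Rd d" using assms bodyD(1) by blast
  have "measure (rdm d) (ballR d r) = measure (rdm d) (shift c (ballR d r))"
  proof -
    have "shift c (ballR d r) \<in> sets borel" using bodyD(4)[OF body_shift[OF cR body_ballR]] .
    \<comment> \<open>Translation invariance of volume, read off from \<open>mom_shift\<close> with
      the affine function that is constantly 1.\<close>
    moreover have "mom d (aff d 1 0) (shift c (ballR d r)) = mom d (aff d 1 0) (ballR d r) + ip d c 0 * measure (rdm d) (ballR d r)"
      by (rule mom_shift[OF body_ballR cR])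
    moreover have "mom d (aff d 1 0) A = measure (rdm d) A" if "A \<in> sets borel" for A
    proof -
      have "aff d 1 0 = (\<lambda>_. 1)" by (rule ext) (simp only: aff_def ip_0_right add_0_right)
      then show ?thesis using mom_const[OF that] by (simp only:)
    qed
    ultimately show ?thesis by (simp only: ballR_borel ip_0_right mult_zero_left add_0_right)
  qed
  also have "\<dots> \<le> measure (rdm d) (par d K r)"
  proof (rule measure_mono_fmeasurable)
    show "shift c (ballR d r) \<subseteq> par d K r"
    proof
      fix y assume "y \<in> shift c (ballR d r)"
      then obtain x where x: "x \<in> ballR d r" "y = x + c" by (auto simp: shift_def)
      have "c + x \<in> par d K r" unfolding par_def by (rule msumI[OF assms(2) x(1)])
      then show "y \<in> par d K r" by (simp add: x(2) add.commute)
    qed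
    show "shift c (ballR d r) \<in> sets (rdm d)" using bodyD(4)[OF body_shift[OF cR body_ballR]] by simp
  qed (rule body_fmeasurable[OF body_par[OF assms(1)]])
  finally show ?thesis .
qed

lemma pot_nonneg:
  assumes "body d K" "c \<in> K" "0 < d" shows "0 \<le> pot d n K"
  unfolding pot_def
proof (intro sum_nonneg mult_nonneg_nonneg ln_ge_zero)
  fix i
  show "1 \<le> measure (rdm d) (par d K (scale d i)) / measure (rdm d) (ballR d (scale d i))"
    using ball_measure_le_par[OF assms(1,2) scale_pos[OF assms(3)]] measure_ballR_pos[OF scale_pos[OF assms(3)], of d i] by (simp add: le_divide_eq)
qed simp

lemma pot_term_mono:
  assumes K: "body d K" "core d K c \<delta>" and K': "body d K'" "core d K' c' \<delta>'" "K' \<subseteq> K" and d: "0 < d"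
    and q: "0 < q" "measure (rdm d) (par d K' (scale d i)) \<le> q * measure (rdm d) (par d K (scale d i))"
  shows "ln (measure (rdm d) (par d K' (scale d i)) / measure (rdm d) (ballR d (scale d i)))
    \<le> ln q + ln (measure (rdm d) (par d K (scale d i)) / measure (rdm d) (ballR d (scale d i)))"
proof -
  let ?B = "measure (rdm d) (ballR d (scale d i))"
  have B: "0 < ?B" by (rule measure_ballR_pos[OF scale_pos[OF d]])
  have p: "0 < measure (rdm d) (par d K' (scale d i))" "0 < measure (rdm d) (par d K (scale d i))"
    using par_pos[OF K] par_pos[OF K'(1,2)] scale_pos[OF d, of i] by auto
  have "ln (measure (rdm d) (par d K' (scale d i)) / ?B) \<le> ln (q * (measure (rdm d) (par d K (scale d i)) / ?B))"
    using p B q by (intro ln_mono) (auto simp: divide_right_mono)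
  also have "\<dots> = ln q + ln (measure (rdm d) (par d K (scale d i)) / ?B)" using p B q by (intro ln_mult_pos) auto
  finally show ?thesis .
qed

lemma pot_mono:
  assumes K: "body d K" "core d K c \<delta>" and K': "body d K'" "core d K' c' \<delta>'" "K' \<subseteq> K" and d: "0 < d"
  shows "pot d n K' \<le> pot d n K"
  unfolding pot_def
proof (intro sum_mono mult_left_mono)
  fix i
  show "ln (measure (rdm d) (par d K' (scale d i)) / measure (rdm d) (ballR d (scale d i)))
    \<le> ln (measure (rdm d) (par d K (scale d i)) / measure (rdm d) (ballR d (scale d i)))"
    using pot_term_mono[OF K K' d, of 1 i] par_measure_mono[OF K(1) K'(1,3)] by simp
qed simp

lemma pot_decrease:
  assumes K: "body d K" "core d K c \<delta>" and K': "body d K'" "core d K' c' \<delta>'" "K' \<subseteq> K" and d: "0 < d"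
    and i: "i < n" and drop: "measure (rdm d) (par d K' (scale d i)) \<le> 4 / 5 * measure (rdm d) (par d K (scale d i))"
  shows "pot d n K' \<le> pot d n K - (1/2) ^ i / 5"
proof -
  let ?f = "\<lambda>K i. (1/2::real) ^ i * ln (measure (rdm d) (par d K (scale d i)) / measure (rdm d) (ballR d (scale d i)))"
  have le: "?f K' j \<le> ?f K j" for j
    using pot_term_mono[OF K K' d, of 1 j] par_measure_mono[OF K(1) K'(1,3)] by (intro mult_left_mono) auto
  \<comment> \<open>From ln x <= x - 1; this is the 1/5 in the claim.\<close>
  have "ln (4/5) \<le> - (1/5::real)" using ln_le_minus_one[of "4/5::real"] by simp
  then have "ln (measure (rdm d) (par d K' (scale d i)) / measure (rdm d) (ballR d (scale d i)))
      \<le> - (1/5) + ln (measure (rdm d) (par d K (scale d i)) / measure (rdm d) (ballR d (scale d i)))"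
    using pot_term_mono[OF K K' d, of "4/5" i] drop by linarith
  then have "?f K' i \<le> (1/2) ^ i * (- (1/5) + ln (measure (rdm d) (par d K (scale d i)) / measure (rdm d) (ballR d (scale d i))))"
    by (intro mult_left_mono) auto
  then have fi: "?f K' i \<le> ?f K i - (1/2) ^ i / 5" by (simp add: algebra_simps)
  have "pot d n K' = ?f K' i + (\<Sum>j\<in>{..<n} - {i}. ?f K' j)" unfolding pot_def by (rule sum.remove) (use i in auto)
  also have "\<dots> \<le> (?f K i - (1/2) ^ i / 5) + (\<Sum>j\<in>{..<n} - {i}. ?f K j)" by (intro add_mono fi sum_mono le)
  also have "\<dots> = pot d n K - (1/2) ^ i / 5"
  proof -
    have "pot d n K = ?f K i + (\<Sum>j\<in>{..<n} - {i}. ?f K j)" unfolding pot_def by (rule sum.remove) (use i in auto)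
    then show ?thesis by linarith
  qed
  finally show ?thesis .
qed

text \<open>The fattened cut reaches at most z below the level of p, and p is within \<omega>/(80 d)
  of the centroid. Together the margin is at most \<omega>/(40 d) <= W/(40 d), where W = \<omega> +
  2z is the width of the fattened body: just what \<open>shifted_cut\<close> tolerates, and the
  reason for the 80 in \<open>scale\<close>.\<close>

lemma near_centroid_cut:
  assumes K: "body d K" "core d K c \<delta>" and d: "2 \<le> d" and v: "v \<in> Rd d" "nrm d v = 1"
    and ext: "a \<in> K" "b \<in> K" "\<And>x. x \<in> K \<Longrightarrow> ip d a v \<le> ip d x v \<and> ip d x v \<le> ip d b v"
    and z: "0 < z" "z \<le> \<omega> / (80 * real d)" and \<omega>: "\<omega> = ip d b v - ip d a v"
    and near: "\<bar>ip d (cg d (par d K z)) v - ip d p v\<bar> \<le> \<omega> / (80 * real d)"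
  shows "measure (rdm d) (par d (cut d K p v) z) \<le> 4 / 5 * measure (rdm d) (par d K z)"
proof -
  let ?L = "par d K z"
  have L: "body d ?L" "core d ?L c \<delta>"
    by (rule body_par[OF K(1)], rule core_mono[OF K(2) subset_par[OF less_imp_le[OF z(1)]]])
  have vv: "ip d v v = 1" using v nrm_sq[of d v] by simp
  define m where "m = ip d (cg d ?L) v"
  define W where "W = \<omega> + 2 * z"
  have \<omega>p: "0 < \<omega>"
  proof -
    have "0 < \<omega> / (80 * real d)" using z by linarith
    then show ?thesis using d by (simp add: zero_less_divide_iff)
  qed
  have Wp: "\<omega> \<le> W" "0 < W" using z \<omega>p by (auto simp: W_def)
  have zb: "\<bar>ip d x v\<bar> \<le> z" if "x \<in> ballR d z" for x
    using ip_le_nrm[of d x v] that v by (simp add: ballR_iff)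
  have rng: "ip d a v - z \<le> ip d x v \<and> ip d x v \<le> ip d b v + z" if x: "x \<in> ?L" for x
  proof -
    obtain k y where ky: "k \<in> K" "y \<in> ballR d z" "x = k + y" using x by (auto simp: par_def elim!: msumE)
    then show ?thesis using ext(3)[OF ky(1)] zb[OF ky(2)] by (simp add: ip_simps abs_le_iff)
  qed
  have zv: "smul s v \<in> ballR d z" if "\<bar>s\<bar> = z" for s using v that by (simp add: ballR_iff Rd_smul nrm_smul)
  have "measure (rdm d) (?L \<inter> {x. m - (1 / (40 * real d)) * W \<le> ip d x v}) \<le> 4 / 5 * measure (rdm d) ?L"
  proof (rule shifted_cut[OF L v])
    show "mom d (\<lambda>x. ip d x v) ?L = m * measure (rdm d) ?L"
      using core_pos[OF L] by (simp add: m_def ip_cg[OF L(1)])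
    show "\<bar>ip d x v - ip d y v\<bar> \<le> W" if "x \<in> ?L" "y \<in> ?L" for x y
      using rng[OF that(1)] rng[OF that(2)] by (simp add: W_def \<omega> abs_le_iff)
    show "\<exists>x\<in>?L. \<exists>y\<in>?L. ip d y v - ip d x v = W"
    proof (intro bexI)
      show "ip d (b + smul z v) v - ip d (a + smul (- z) v) v = W" by (simp add: ip_simps vv W_def \<omega>)
      show "b + smul z v \<in> ?L" "a + smul (- z) v \<in> ?L"
        unfolding par_def using ext z by (intro msumI zv; simp)+
    qed
  qed (use d in auto)
  moreover have "measure (rdm d) (par d (cut d K p v) z) \<le> measure (rdm d) (?L \<inter> {x. m - (1 / (40 * real d)) * W \<le> ip d x v})"
  proof (rule measure_mono_fmeasurable)
    show "par d (cut d K p v) z \<subseteq> ?L \<inter> {x. m - (1 / (40 * real d)) * W \<le> ip d x v}"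
    proof
      fix x assume "x \<in> par d (cut d K p v) z"
      then obtain k y where ky: "k \<in> cut d K p v" "y \<in> ballR d z" "x = k + y" by (auto simp: par_def elim!: msumE)
      then have kK: "k \<in> K" "ip d p v \<le> ip d k v" by (auto simp: cut_def ip_simps)
      have "x \<in> ?L" unfolding par_def ky(3) by (rule msumI[OF kK(1) ky(2)])
      have "1 / (40 * real d) * \<omega> \<le> 1 / (40 * real d) * W" using Wp by (intro mult_left_mono) auto
      moreover have "\<omega> / (80 * real d) + \<omega> / (80 * real d) = 1 / (40 * real d) * \<omega>" by simp
      ultimately have "m - 1 / (40 * real d) * W \<le> ip d p v - z" using near z by (simp add: m_def abs_le_iff)
      also have "\<dots> \<le> ip d x v" using kK(2) zb[OF ky(2)] by (simp add: ky(3) ip_simps abs_le_iff)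
      finally show "x \<in> ?L \<inter> {x. m - (1 / (40 * real d)) * W \<le> ip d x v}" using \<open>x \<in> ?L\<close> by simp
    qed
    show "par d (cut d K p v) z \<in> sets (rdm d)" using bodyD(4)[OF body_par[OF body_cut[OF K(1)]]] by simp
    show "?L \<inter> {x. m - (1 / (40 * real d)) * W \<le> ip d x v} \<in> fmeasurable (rdm d)"
      by (rule fmeasurable_Int_fmeasurable[OF body_fmeasurable[OF L(1)]]) simp
  qed
  ultimately show ?thesis by linarith
qed

text \<open>As u is fixed before the query, one point serves both answers: they select opposite
  sides of the same hyperplane, and the estimate applies with u or -u. The width \<omega> in
  direction u bounds the regret of every query, because the path stays between the supporting
  hyperplanes.\<close>

lemma good_round:
  assumes K: "body d K" "core d K c \<delta>" and d: "2 \<le> d" and K1: "K \<subseteq> ballR d 1"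
    and D: "is_discretization d (120 * d ^ 4) K ps" and w: "w \<in> K" and u: "u \<in> Rd d" "nrm d u = 1"
  defines "v \<equiv> \<lambda>p. if ip d (w - p) u \<ge> 0 then u else - u"
  obtains \<omega> where "0 \<le> \<omega>" "\<And>p. p \<in> set ps \<Longrightarrow> ip d (w - p) (v p) \<le> \<omega>"
    "\<And>p. p \<in> set ps \<Longrightarrow> w \<in> cut d K p (v p) \<and> (\<exists>c' \<delta>'. core d (cut d K p (v p)) c' \<delta>')"
    "\<And>n. \<omega> \<le> 2 * (1/2) ^ n \<or> (\<exists>p\<in>set ps. pot d n (cut d K p (v p)) \<le> pot d n K - \<omega> / 10)"
proof -
  have d0: "0 < d" and k0: "0 < 120 * d ^ 4" using d by auto
  obtain a b where a: "a \<in> K" "\<And>x. x \<in> K \<Longrightarrow> ip d a u \<le> ip d x u"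
    and b: "b \<in> K" "\<And>x. x \<in> K \<Longrightarrow> ip d x u \<le> ip d b u" and ab: "ip d a u + 2 * \<delta> \<le> ip d b u"
    using body_ip_extrema[OF K u] by metis
  define \<omega> where "\<omega> = ip d b u - ip d a u"
  have \<delta>: "0 < \<delta>" using K by (simp add: core_def)
  have \<omega>0: "0 < \<omega>" using ab \<delta> by (simp add: \<omega>_def)
  have ip1: "\<bar>ip d x u\<bar> \<le> 1" if "x \<in> K" for x
    using ip_le_nrm[of d x u] that K1 u by (auto simp: ballR_iff)
  have \<omega>2: "\<omega> \<le> 2" using ip1[OF a(1)] ip1[OF b(1)] by (simp add: \<omega>_def abs_le_iff)
  have range: "ip d a u \<le> ip d p u \<and> ip d p u \<le> ip d b u" if p: "p \<in> set ps" for p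
  proof -
    obtain t where t: "0 \<le> t" "p = rho d K t" using discretization_points(1)[OF K d0 k0 D p] by blast
    have "ip d p u < ip d b u" unfolding t(2) by (rule rho_strict[OF u K b(2) d0 t(1)])
    moreover have "ip d p (- u) < - ip d a u"
      unfolding t(2) by (rule rho_strict[OF _ _ K _ d0 t(1)]) (use u a(2) in \<open>auto simp: ip_simps Rd_uminus\<close>)
    ultimately show ?thesis by (simp add: ip_simps)
  qed
  have vu: "v p \<in> Rd d" "nrm d (v p) = 1" for p using u by (auto simp: v_def Rd_uminus)
  have pos: "0 \<le> ip d (w - p) (v p)" for p by (auto simp: v_def ip_minus_right)
  show thesis
  proof (rule that[of \<omega>])
    show "0 \<le> \<omega>" using \<omega>0 by simp
    show "ip d (w - p) (v p) \<le> \<omega>" if "p \<in> set ps" for p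
      using range[OF that] a(2)[OF w] b(2)[OF w] by (auto simp: v_def ip_simps \<omega>_def)
    show "w \<in> cut d K p (v p) \<and> (\<exists>c' \<delta>'. core d (cut d K p (v p)) c' \<delta>')" if p: "p \<in> set ps" for p
    proof
      show "w \<in> cut d K p (v p)" using w pos by (simp add: cut_def)
      obtain t where t: "0 \<le> t" "p = rho d K t" using discretization_points(1)[OF K d0 k0 D p] by blast
      show "\<exists>c' \<delta>'. core d (cut d K p (v p)) c' \<delta>'" by (rule core_cut[OF K d0 vu t])
    qed
    show "\<omega> \<le> 2 * (1/2) ^ n \<or> (\<exists>p\<in>set ps. pot d n (cut d K p (v p)) \<le> pot d n K - \<omega> / 10)" for n
    proof (cases "\<omega> \<le> 2 * (1/2) ^ n")
      case False
      have ex: "(1/2) ^ n < \<omega>" using False zero_le_power[of "1/2::real" n] by linarith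
      \<comment> \<open>The least i gives 2^(-i) < \<omega> <= 2 * 2^(-i), so that the drop 2^(-i)/5
        of the potential is at least \<omega>/10. For i = 0 the upper bound is \<omega> <= 2, the
        diameter of the unit ball.\<close>
      define i where "i = (LEAST i. (1/2::real) ^ i < \<omega>)"
      have i: "(1/2) ^ i < \<omega>" unfolding i_def using ex by (rule LeastI)
      have in_: "i < n"
      proof (cases n)
        case 0 then show ?thesis using False \<omega>2 by simp
      next
        case (Suc m)
        then have "(1/2) ^ m < \<omega>" using False by simp
        then have "i \<le> m" unfolding i_def by (rule Least_le)
        then show ?thesis using Suc by simp
      qed
      have \<omega>i: "\<omega> \<le> 2 * (1/2) ^ i"
      proof (cases i)
        case 0 then show ?thesis using \<omega>2 by simp
      next
        case (Suc j)
        then have "\<not> (1/2) ^ j < \<omega>" using not_less_Least[of j "\<lambda>i. (1/2::real) ^ i < \<omega>"] by (simp add: i_def[symmetric])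
        then show ?thesis using Suc by simp
      qed
      let ?z = "scale d i"
      have z: "0 < ?z" "?z \<le> \<omega> / (80 * real d)"
        using scale_pos[OF d0] i d0 by (auto simp: scale_def intro!: divide_right_mono)
      have W: "ip d x u - ip d y u \<le> \<omega>" if "x \<in> K" "y \<in> K" for x y
        using a(2)[OF that(2)] b(2)[OF that(1)] by (simp add: \<omega>_def)
      have "0 \<le> ereal ?z" using z by simp
      from discretization_points(2)[OF K d0 k0 D this u W]
      obtain p where p: "p \<in> set ps" "\<bar>ip d (rho d K (ereal ?z)) u - ip d p u\<bar> \<le> (real d ^ 2 * (real d + 1) / real (120 * d ^ 4)) * \<omega>"
        by blast
      \<comment> \<open>Half the length bound of a piece must not exceed 1/(80 d); as 80 (d + 1) <=
        120 d for d >= 2, the constant 120 suffices.\<close>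
      have co: "real d ^ 2 * (real d + 1) / real (120 * d ^ 4) \<le> 1 / (80 * real d)"
      proof -
        have "real d ^ 2 * (real d + 1) * (80 * real d) = real d ^ 3 * (80 * (real d + 1))" by (simp add: power2_eq_square power3_eq_cube)
        also have "\<dots> \<le> real d ^ 3 * (120 * real d)" using d by (intro mult_left_mono) auto
        also have "\<dots> = real (120 * d ^ 4)" by (simp add: power3_eq_cube power4_eq_xxxx)
        finally show ?thesis using d0 by (simp add: divide_le_eq le_divide_eq mult.commute)
      qed
      have near: "\<bar>ip d (cg d (par d K ?z)) u - ip d p u\<bar> \<le> \<omega> / (80 * real d)"
      proof -
        have "(real d ^ 2 * (real d + 1) / real (120 * d ^ 4)) * \<omega> \<le> 1 / (80 * real d) * \<omega>"
          using co \<omega>0 by (intro mult_right_mono) auto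
        then show ?thesis using p(2) z(1) by (simp add: rho_real)
      qed
      have drop: "measure (rdm d) (par d (cut d K p (v p)) ?z) \<le> 4 / 5 * measure (rdm d) (par d K ?z)"
      proof (cases "ip d (w - p) u \<ge> 0")
        case True
        then have vp: "v p = u" by (simp add: v_def)
        show ?thesis unfolding vp
          by (rule near_centroid_cut[OF K d u a(1) b(1) _ z \<omega>_def near]) (use a(2) b(2) in blast)
      next
        case False
        then have vp: "v p = - u" by (simp add: v_def)
        have near': "\<bar>ip d (cg d (par d K ?z)) (- u) - ip d p (- u)\<bar> \<le> \<omega> / (80 * real d)"
          using near by (simp add: ip_minus_right abs_minus_commute)
        show ?thesis unfolding vp
          by (rule near_centroid_cut[OF K d _ _ b(1) a(1) _ z _ near'])
            (use u a(2) b(2) in \<open>auto simp: ip_minus_right Rd_uminus \<omega>_def\<close>)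
      qed
      obtain t where t: "0 \<le> t" "p = rho d K t" using discretization_points(1)[OF K d0 k0 D p(1)] by blast
      obtain c' \<delta>' where core': "core d (cut d K p (v p)) c' \<delta>'" using core_cut[OF K d0 vu t] by blast
      have "pot d n (cut d K p (v p)) \<le> pot d n K - (1/2) ^ i / 5"
        by (rule pot_decrease[OF K body_cut[OF K(1)] core' _ d0 in_ drop]) (auto simp: cut_def)
      then have "pot d n (cut d K p (v p)) \<le> pot d n K - \<omega> / 10" using \<omega>i by linarith
      then show ?thesis using p(1) by blast
    qed simp
  qed
qed

text \<open>Summed over the possible queries, the regret is at most card S times \<omega>, whereas a
  single query is known to lower the potential, by \<omega>/10. The factor 10(k+1) balances the two.
  Rounds of width below the smallest scale are charged to the additive term.\<close>

lemma regret_bound: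
  assumes d: "2 \<le> d"
    and disc: "\<forall>K. (\<exists>ps. is_discretization d (120 * d ^ 4) K ps) \<longrightarrow> is_discretization d (120 * d ^ 4) K (disc K)"
    and orc: "\<forall>h. orc h \<in> Rd d \<and> nrm d (orc h) = 1"
    and K: "body d (knowledge d h)" "core d (knowledge d h) c \<delta>" and w: "w \<in> knowledge d h"
  shows "exp_regret d disc orc w n h \<le> 10 * real (Suc (120 * d ^ 4)) * pot d N (knowledge d h) + real n * (2 * (1/2) ^ N)"
  using K w
proof (induction n arbitrary: h c \<delta>)
  case 0
  have "0 \<le> pot d N (knowledge d h)" by (rule pot_nonneg[OF 0(1,3)]) (use d in simp)
  then show ?case by simp
next
  case (Suc n)
  have d0: "0 < d" using d by simp
  let ?k = "120 * d ^ 4" and ?K = "knowledge d h" and ?u = "orc h"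
  let ?C = "10 * real (Suc ?k)" and ?\<epsilon> = "2 * (1/2::real) ^ N"
  define S where "S = set (disc ?K)"
  have D: "is_discretization d ?k ?K (disc ?K)"
    using disc discretization_exists[OF Suc.prems(1,2) d0, of ?k] d0 by auto
  then have len: "length (disc ?K) = Suc ?k" by (simp add: is_discretization_def)
  \<comment> \<open>Points of the discretization may coincide, so S can have fewer than k + 1
    elements; the upper bound on its size is what the balance uses.\<close>
  have S: "finite S" "0 < card S" "card S \<le> Suc ?k"
    using len card_length[of "disc ?K"] by (auto simp: S_def card_gt_0_iff)
  define v where "v = (\<lambda>p. if ip d (w - p) ?u \<ge> 0 then ?u else - ?u)"
  have K1: "?K \<subseteq> ballR d 1" by (simp add: knowledge_def)
  obtain \<omega> where \<omega>: "0 \<le> \<omega>" "\<And>p. p \<in> S \<Longrightarrow> ip d (w - p) (v p) \<le> \<omega>"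
    "\<And>p. p \<in> S \<Longrightarrow> w \<in> cut d ?K p (v p) \<and> (\<exists>c' \<delta>'. core d (cut d ?K p (v p)) c' \<delta>')"
    "\<And>n. \<omega> \<le> 2 * (1/2) ^ n \<or> (\<exists>p\<in>S. pot d n (cut d ?K p (v p)) \<le> pot d n ?K - \<omega> / 10)"
    using good_round[OF Suc.prems(1,2) d K1 D Suc.prems(3), of ?u] orc unfolding v_def S_def by metis
  let ?P = "\<lambda>p. pot d N (cut d ?K p (v p))"
  have rec: "exp_regret d disc orc w n (h @ [(p, v p)]) \<le> ?C * ?P p + real n * ?\<epsilon>" if p: "p \<in> S" for p
  proof -
    obtain c' \<delta>' where c': "core d (cut d ?K p (v p)) c' \<delta>'" using \<omega>(3)[OF p] by blast
    have "body d (knowledge d (h @ [(p, v p)]))" "core d (knowledge d (h @ [(p, v p)])) c' \<delta>'" "w \<in> knowledge d (h @ [(p, v p)])"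
      unfolding knowledge_append using body_cut[OF Suc.prems(1)] c' \<omega>(3)[OF p] by auto
    from Suc.IH[OF this] show ?thesis unfolding knowledge_append .
  qed
  have mono: "?P p \<le> pot d N ?K" if p: "p \<in> S" for p
  proof -
    obtain c' \<delta>' where c': "core d (cut d ?K p (v p)) c' \<delta>'" using \<omega>(3)[OF p] by blast
    show ?thesis by (rule pot_mono[OF Suc.prems(1,2) body_cut[OF Suc.prems(1)] c' _ d0]) (auto simp: cut_def)
  qed
  have C: "0 \<le> ?C" by simp
  have "(\<Sum>p\<in>S. ip d (w - p) (v p) + exp_regret d disc orc w n (h @ [(p, v p)]))
      \<le> (\<Sum>p\<in>S. \<omega> + (?C * ?P p + real n * ?\<epsilon>))"
    by (intro sum_mono add_mono \<omega>(2) rec)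
  also have "\<dots> = real (card S) * \<omega> + ?C * (\<Sum>p\<in>S. ?P p) + real (card S) * (real n * ?\<epsilon>)"
    by (simp only: sum.distrib sum_constant sum_distrib_left[symmetric])
  also have "\<dots> \<le> real (card S) * (?C * pot d N ?K + real (Suc n) * ?\<epsilon>)"
  proof (cases "\<omega> \<le> ?\<epsilon>")
    case True
    have "(\<Sum>p\<in>S. ?P p) \<le> real (card S) * pot d N ?K" by (rule sum_bounded_above) (rule mono)
    then have "?C * (\<Sum>p\<in>S. ?P p) \<le> ?C * (real (card S) * pot d N ?K)" using C by (rule mult_left_mono)
    moreover have "real (card S) * \<omega> \<le> real (card S) * ?\<epsilon>" using True by (intro mult_left_mono) auto
    ultimately show ?thesis by (simp add: algebra_simps)
  next
    case False
    then obtain p where p: "p \<in> S" "?P p \<le> pot d N ?K - \<omega> / 10" using \<omega>(4)[of N] by blast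
    have "(\<Sum>p\<in>S. ?P p) = ?P p + (\<Sum>p\<in>S - {p}. ?P p)" by (rule sum.remove[OF S(1) p(1)])
    also have "(\<Sum>p\<in>S - {p}. ?P p) \<le> real (card (S - {p})) * pot d N ?K" by (rule sum_bounded_above) (use mono in auto)
    also have "real (card (S - {p})) = real (card S) - 1" using S p by (simp add: of_nat_diff)
    finally have "(\<Sum>p\<in>S. ?P p) \<le> real (card S) * pot d N ?K - \<omega> / 10" using p(2) by (simp add: algebra_simps)
    then have "?C * (\<Sum>p\<in>S. ?P p) \<le> ?C * (real (card S) * pot d N ?K - \<omega> / 10)" using C by (rule mult_left_mono)
    also have "\<dots> = ?C * (real (card S) * pot d N ?K) - real (Suc ?k) * \<omega>" by (simp add: right_diff_distrib)
    finally have 1: "?C * (\<Sum>p\<in>S. ?P p) \<le> ?C * (real (card S) * pot d N ?K) - real (Suc ?k) * \<omega>" .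
    have "real (card S) \<le> real (Suc ?k)" using S(3) by (simp only: of_nat_le_iff)
    then have 2: "real (card S) * \<omega> \<le> real (Suc ?k) * \<omega>" using \<omega>(1) by (rule mult_right_mono)
    have 3: "real (card S) * (real n * ?\<epsilon>) \<le> real (card S) * (real (Suc n) * ?\<epsilon>)" by (intro mult_left_mono mult_right_mono) auto
    have 4: "real (card S) * (?C * pot d N ?K + real (Suc n) * ?\<epsilon>) = ?C * (real (card S) * pot d N ?K) + real (card S) * (real (Suc n) * ?\<epsilon>)"
      by (simp only: distrib_left mult.left_commute)
    show ?thesis unfolding 4 using 1 2 3 by linarith
  qed
  finally have sum: "(\<Sum>p\<in>S. ip d (w - p) (v p) + exp_regret d disc orc w n (h @ [(p, v p)]))
      \<le> real (card S) * (?C * pot d N ?K + real (Suc n) * ?\<epsilon>)" .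
  have "exp_regret d disc orc w (Suc n) h = (\<Sum>p\<in>S. ip d (w - p) (v p) + exp_regret d disc orc w n (h @ [(p, v p)])) / real (card S)"
    unfolding exp_regret.simps S_def v_def Let_def ..
  also have "\<dots> \<le> real (card S) * (?C * pot d N ?K + real (Suc n) * ?\<epsilon>) / real (card S)"
    by (rule divide_right_mono[OF sum]) simp
  also have "\<dots> = ?C * pot d N ?K + real (Suc n) * ?\<epsilon>"
  proof -
    have "real (card S) \<noteq> 0" using S(2) by simp
    then show ?thesis by (rule nonzero_mult_div_cancel_left)
  qed
  finally show ?case .
qed

lemma pot_ball:
  assumes d: "2 \<le> d"
  shows "pot d n (ballR d 1) \<le> 18 * (real d * ln (real d))"
proof -
  have d0: "0 < d" using d by simp
  have lnd: "0 < ln (real d)" using d by simp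
  have tm: "ln (measure (rdm d) (par d (ballR d 1) (scale d i)) / measure (rdm d) (ballR d (scale d i))) \<le> real d * ((8 + real i) * ln (real d))" for i
  proof -
    let ?z = "scale d i"
    have z: "0 < ?z" by (rule scale_pos[OF d0])
    have V: "0 < measure (rdm d) (ballR d 1)" by (rule measure_ballR_pos) simp
    have c: "core d (ballR d 1) 0 1" by (auto simp: core_def Rd_0)
    have pp: "0 < measure (rdm d) (par d (ballR d 1) ?z)" by (rule par_pos[OF body_ballR c]) (use z in simp)
    have "par d (ballR d 1) ?z \<subseteq> ballR d (1 + ?z)"
    proof
      fix x assume "x \<in> par d (ballR d 1) ?z"
      then obtain a b where "a \<in> ballR d 1" "b \<in> ballR d ?z" "x = a + b" by (auto simp: par_def elim!: msumE)
      then show "x \<in> ballR d (1 + ?z)" using nrm_triangle[of d a b] by (auto simp: ballR_iff Rd_add)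
    qed
    then have "measure (rdm d) (par d (ballR d 1) ?z) \<le> measure (rdm d) (ballR d (1 + ?z))"
      by (rule measure_mono_fmeasurable) (use bodyD(4)[OF body_par[OF body_ballR]] body_fmeasurable[OF body_ballR] in auto)
    also have "\<dots> = (1 + ?z) ^ d * measure (rdm d) (ballR d 1)" using z by (intro measure_ballR) simp
    finally have "measure (rdm d) (par d (ballR d 1) ?z) / measure (rdm d) (ballR d ?z) \<le> ((1 + ?z) ^ d * measure (rdm d) (ballR d 1)) / (?z ^ d * measure (rdm d) (ballR d 1))"
      unfolding measure_ballR[OF z] using z V by (intro divide_right_mono) auto
    also have "\<dots> = ((1 + ?z) / ?z) ^ d" using V by (simp add: power_divide)
    also have "\<dots> \<le> (real d ^ (8 + i)) ^ d"
    proof (rule power_mono)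
      \<comment> \<open>Since d >= 2, the numerical constant and the power of 2 are absorbed into a
        power of d, and the logarithm becomes a multiple of ln d.\<close>
      have "(1 + ?z) / ?z = 1 + 80 * real d * 2 ^ i" using d0 by (simp add: scale_def field_simps power_divide)
      also have "\<dots> \<le> 128 * real d * 2 ^ i"
      proof -
        have "1 * 1 \<le> real d * 2 ^ i" using d by (intro mult_mono) auto
        then show ?thesis by simp
      qed
      also have "\<dots> = real d * 2 ^ (7 + i)" by (simp add: power_add)
      also have "\<dots> \<le> real d * real d ^ (7 + i)" using d by (intro mult_left_mono power_mono) auto
      also have "\<dots> = real d ^ (8 + i)" by (simp add: power_add eval_nat_numeral)
      finally show "(1 + ?z) / ?z \<le> real d ^ (8 + i)" .
    qed (use z in simp)
    finally have "ln (measure (rdm d) (par d (ballR d 1) ?z) / measure (rdm d) (ballR d ?z)) \<le> ln ((real d ^ (8 + i)) ^ d)"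
      using pp measure_ballR_pos[OF z, of d] by (intro ln_mono) auto
    also have "\<dots> = real d * ((8 + real i) * ln (real d))" using d0 by (simp add: ln_realpow)
    finally show ?thesis .
  qed
  \<comment> \<open>8 times the geometric sum 2, plus the sum 2 of i 2^(-i), gives the bound 18 for
    every n.\<close>
  have geo: "(\<Sum>i<n. (1/2::real) ^ i * (8 + real i)) = 18 - (9 + real n) * 2 * (1/2) ^ n"
  proof (induction n)
    case (Suc n)
    have "18 - (9 + x) * 2 * h + h * (8 + x) = 18 - (9 + (x + 1)) * 2 * (1/2 * h)" for x h :: real
      by (simp add: algebra_simps)
    then show ?case by (simp only: sum.lessThan_Suc Suc of_nat_Suc power_Suc add.commute[of 1])
  qed simp
  have "pot d n (ballR d 1) \<le> (\<Sum>i<n. (1/2) ^ i * (real d * ((8 + real i) * ln (real d))))"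
    unfolding pot_def by (intro sum_mono mult_left_mono tm) auto
  also have "\<dots> = (real d * ln (real d)) * (\<Sum>i<n. (1/2) ^ i * (8 + real i))"
    by (simp add: sum_distrib_left mult_ac)
  also have "\<dots> \<le> (real d * ln (real d)) * 18"
    unfolding geo using lnd by (intro mult_left_mono) auto
  finally show ?thesis by (simp add: mult_ac)
qed

theorem theorem5p3:
  shows "\<exists>(k :: nat \<Rightarrow> nat) (c1::real) (c2::real) (C::real).
     0 < c1 \<and> 0 < c2 \<and>
     (\<forall>d\<ge>2. c1 * real d ^ 4 \<le> real (k d) \<and> real (k d) \<le> c2 * real d ^ 4) \<and>
     (\<forall>d\<ge>2. \<forall>(disc :: vec set \<Rightarrow> vec list) (orc :: (vec \<times> vec) list \<Rightarrow> vec) w T.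
        (\<forall>K. (\<exists>ps. is_discretization d (k d) K ps) \<longrightarrow> is_discretization d (k d) K (disc K)) \<longrightarrow>
        (\<forall>h. orc h \<in> Rd d \<and> nrm d (orc h) = 1) \<longrightarrow>
        w \<in> ballR d 1 \<longrightarrow>
        exp_regret d disc orc w T [] \<le> C * real d ^ 5 * (ln (real d))\<^sup>2)"
proof (rule exI[of _ "\<lambda>d. 120 * d ^ 4"], rule exI[of _ "120::real"], rule exI[of _ "120::real"],
    rule exI[of _ "43568::real"], intro conjI allI impI)
  fix d :: nat and disc :: "vec set \<Rightarrow> vec list" and orc :: "(vec \<times> vec) list \<Rightarrow> vec" and w T
  assume d: "2 \<le> d"
    and disc: "\<forall>K. (\<exists>ps. is_discretization d (120 * d ^ 4) K ps) \<longrightarrow> is_discretization d (120 * d ^ 4) K (disc K)"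
    and orc: "\<forall>h. orc h \<in> Rd d \<and> nrm d (orc h) = 1" and w: "w \<in> ballR d 1"
  have kn: "knowledge d [] = ballR d 1" by (simp add: knowledge_def)
  have c: "core d (ballR d 1) 0 1" by (auto simp: core_def Rd_0)
  let ?k = "120 * d ^ 4" and ?L = "ln (real d)"
  \<comment> \<open>As many scales as rounds: the unpaid remainder 2 T / 2^T is then bounded by
    2.\<close>
  have "exp_regret d disc orc w T [] \<le> 10 * real (Suc ?k) * pot d T (ballR d 1) + real T * (2 * (1/2) ^ T)"
    using regret_bound[OF d disc orc, of "[]" 0 1 w T T] body_ballR c w unfolding kn by blast
  also have "real T * (2 * (1/2) ^ T) \<le> 2"
  proof -
    have "real T < 2 ^ T" by (rule of_nat_less_two_power)
    then show ?thesis by (simp add: power_divide divide_le_eq)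
  qed
  also have "10 * real (Suc ?k) * pot d T (ballR d 1) \<le> (10 * (121 * real d ^ 4)) * (18 * (real d * ?L))"
  proof (rule mult_mono)
    have "1 \<le> real d ^ 4" using d by (intro one_le_power) simp
    then show "10 * real (Suc ?k) \<le> 10 * (121 * real d ^ 4)" by simp
    show "0 \<le> pot d T (ballR d 1)" by (rule pot_nonneg[OF body_ballR w]) (use d in simp)
  qed (use pot_ball[OF d] in auto)
  finally have "exp_regret d disc orc w T [] \<le> 10 * (121 * real d ^ 4) * (18 * (real d * ?L)) + 2" by simp
  moreover have "real d ^ 5 = real d ^ 4 * real d" by (simp add: eval_nat_numeral)
  ultimately have le: "exp_regret d disc orc w T [] \<le> 21780 * (real d ^ 5 * ?L) + 2" by (simp only: mult_ac)
  have "ln 2 \<le> ?L" using d by simp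
  then have L: "1/2 \<le> ?L" using ln2_ge_two_thirds by linarith
  have d5: "1 \<le> real d ^ 5" using d by (intro one_le_power) simp
  \<comment> \<open>One logarithm suffices up to the constant 2; since ln d >= 1/2, both it and the
    2 are bounded by multiples of the claimed expression, and 43568 = 2 * 21780 + 4 * 2.\<close>
  have "?L * 1 \<le> ?L * (2 * ?L)" using L by (intro mult_left_mono) auto
  then have "real d ^ 5 * ?L \<le> real d ^ 5 * (2 * ?L\<^sup>2)" by (intro mult_left_mono) (auto simp: power2_eq_square)
  moreover have "1 * (1/4) \<le> real d ^ 5 * ?L\<^sup>2"
  proof (rule mult_mono[OF d5])
    have "(1/2)\<^sup>2 \<le> ?L\<^sup>2" using L by (intro power_mono) auto
    then show "1/4 \<le> ?L\<^sup>2" by (simp add: power2_eq_square)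
  qed auto
  ultimately show "exp_regret d disc orc w T [] \<le> 43568 * real d ^ 5 * ?L\<^sup>2" using le by simp
qed auto

end
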